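(* The problem PMClass is decidable. That is, there is an algorithm which, given as input a finite alphabet $A$, a morphism $\varphi : A^* \to A^*$ (given by the finite list of words $\varphi(x)$, $x \in A$) and a letter $a \in A$ such that $\varphi$ iterated on $a$ converges to a right-infinite word $\alpha = \varphi^\infty(a)$, always terminates and outputs the complexity class of $\alpha$, i.e. the one among the five classes $$\Theta(1),\quad \Theta(n),\quad \Theta(n\log\log n),\quad \Theta(n \log n),\quad \Theta(n^2)$$ to which the factor complexity function $P_\alpha$ belongs.
   Context: $A^*$ is the free monoid of finite words over the finite alphabet $A$ (with empty word $\varepsilon$); a morphism $\varphi : A^*\to A^*$ is a monoid morphism (it may erase letters, i.e. $\varphi(x)=\varepsilon$ is allowed for some letters $x$). Right-infinite words are indexed by $\mathbb{N}=\{0,1,2,\dots\}$. If $\varphi(a)$ begins with $a$ and $|\varphi^k(a)| \to \infty$, each word $\varphi^k(a)$ is a prefix of $\varphi^{k+1}(a)$, and $\varphi^\infty(a)$ denotes the right-infinite word having all $\varphi^k(a)$ as prefixes; it is a fixed point of $\varphi$ and is called a pure morphic sequence. The factor complexity of a sequence $\alpha$ is the function $P_\alpha:\mathbb{N}\to\mathbb{N}$ where $P_\alpha(n)$ is the number of distinct words of length $n$ occurring as factors (blocks of consecutive letters) of $\alpha$. $P_\alpha \in \Theta(f)$ means that there are constants $0<c\le C$ with $c f(n)\le P_\alpha(n)\le C f(n)$ for all large $n$. It is a known theorem of Pansiot (1984) that for every pure morphic sequence $\alpha$, $P_\alpha$ belongs to exactly one of the five classes listed. *)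

theory Defs
  imports
    Complex_Main
    "HOL-Library.Landau_Symbols"
    "HOL-Library.Nat_Bijection"
    "HOL-Library.Omega_Words_Fun"
begin

section \<open>Pure morphic sequences\<close>

text \<open>
  A morphism of the free monoid is given by the images of the letters. Images may be empty.
  Right-infinite words are functions on \<^typ>\<open>nat\<close>, as in the theory of omega-words.
\<close>

definition extend :: "('a \<Rightarrow> 'a list) \<Rightarrow> 'a list \<Rightarrow> 'a list" where
  "extend \<phi> w = concat (map \<phi> w)"

definition iterate :: "('a \<Rightarrow> 'a list) \<Rightarrow> 'a \<Rightarrow> nat \<Rightarrow> 'a list" where
  "iterate \<phi> a k = (extend \<phi> ^^ k) [a]"

definition converges_on :: "('a \<Rightarrow> 'a list) \<Rightarrow> 'a \<Rightarrow> bool" where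
  "converges_on \<phi> a \<longleftrightarrow>
     (\<exists>u. \<phi> a = a # u) \<and> filterlim (\<lambda>k. length (iterate \<phi> a k)) at_top sequentially"

definition limit_word :: "('a \<Rightarrow> 'a list) \<Rightarrow> 'a \<Rightarrow> 'a word" where
  "limit_word \<phi> a =
     (THE \<alpha>. \<forall>k. prefix (length (iterate \<phi> a k)) \<alpha> = iterate \<phi> a k)"

lemma extend_append: "extend \<phi> (u @ v) = extend \<phi> u @ extend \<phi> v"
  by (simp add: extend_def)

lemma iterate_Suc: "iterate \<phi> a (Suc k) = extend \<phi> (iterate \<phi> a k)"
  by (simp add: iterate_def)

lemma iterate_prefix_Suc:
  assumes "\<phi> a = a # u"
  shows "\<exists>v. iterate \<phi> a (Suc k) = iterate \<phi> a k @ v"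
proof (induction k)
  case 0
  show ?case using assms by (simp add: iterate_def extend_def)
next
  case (Suc k)
  then show ?case by (metis iterate_Suc extend_append)
qed

lemma iterate_prefix:
  assumes "\<phi> a = a # u" and "k \<le> l"
  shows "\<exists>v. iterate \<phi> a l = iterate \<phi> a k @ v"
  using assms(2)
proof (induction l rule: dec_induct)
  case base
  show ?case by simp
next
  case (step n)
  then show ?case using iterate_prefix_Suc[where \<phi> = \<phi> and a = a and u = u and k = n, OF assms(1)] by force
qed

text \<open>The description defining \<^const>\<open>limit_word\<close> determines exactly one word.\<close>

lemma ex1_limit_word:
  assumes "converges_on \<phi> a"
  shows "\<exists>!\<alpha>. \<forall>k. prefix (length (iterate \<phi> a k)) \<alpha> = iterate \<phi> a k"
proof -
  let ?w = "iterate \<phi> a"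
  obtain u where u: "\<phi> a = a # u"
    using assms by (auto simp: converges_on_def)
  have "\<exists>k. n < length (?w k)" for n
  proof -
    have "eventually (\<lambda>k. Suc n \<le> length (?w k)) sequentially"
      using assms by (auto simp: converges_on_def filterlim_at_top)
    then show ?thesis by (auto simp: eventually_sequentially Suc_le_eq)
  qed
  then obtain K where K: "\<And>n. n < length (?w (K n))" by metis
  have agree: "?w k ! n = ?w l ! n" if "n < length (?w k)" "n < length (?w l)" for k l n
    using that iterate_prefix[where \<phi> = \<phi> and a = a and u = u and k = k and l = l, OF u]
      iterate_prefix[where \<phi> = \<phi> and a = a and u = u and k = l and l = k, OF u]
    by (metis nat_le_linear nth_append)
  show ?thesis
  proof (rule ex1I[of _ "\<lambda>n. ?w (K n) ! n"])
    show "\<forall>k. prefix (length (?w k)) (\<lambda>n. ?w (K n) ! n) = ?w k"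
      by (auto intro!: nth_equalityI agree K)
  next
    fix \<beta> assume b: "\<forall>k. prefix (length (?w k)) \<beta> = ?w k"
    show "\<beta> = (\<lambda>n. ?w (K n) ! n)"
    proof
      fix n
      have "prefix (length (?w (K n))) \<beta> ! n = \<beta> n"
        using K[of n] by simp
      then show "\<beta> n = ?w (K n) ! n" using b by metis
    qed
  qed
qed

lemma prefix_limit_word:
  assumes "converges_on \<phi> a"
  shows "prefix (length (iterate \<phi> a k)) (limit_word \<phi> a) = iterate \<phi> a k"
  using theI'[OF ex1_limit_word[OF assms]] by (simp add: limit_word_def)


section \<open>Factor complexity and the five classes\<close>

definition factors :: "'a word \<Rightarrow> nat \<Rightarrow> 'a list set" where
  "factors \<alpha> n = {\<alpha> [i \<rightarrow> i + n] | i. True}"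

text \<open>
  The set of factors is finite whenever only finitely many letters occur in the word, so the
  cardinality is then the true one.
\<close>

definition factor_complexity :: "'a word \<Rightarrow> nat \<Rightarrow> nat" where
  "factor_complexity \<alpha> n = card (factors \<alpha> n)"

datatype growth = Const | Linear | Linear_loglog | Linear_log | Quadratic

primrec growth_fun :: "growth \<Rightarrow> nat \<Rightarrow> real" where
  "growth_fun Const n = 1"
| "growth_fun Linear n = real n"
| "growth_fun Linear_loglog n = real n * ln (ln (real n))"
| "growth_fun Linear_log n = real n * ln (real n)"
| "growth_fun Quadratic n = (real n)\<^sup>2"

definition has_growth :: "'a word \<Rightarrow> growth \<Rightarrow> bool" where
  "has_growth \<alpha> c \<longleftrightarrow> (\<lambda>n. real (factor_complexity \<alpha> n)) \<in> \<Theta>(growth_fun c)"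


section \<open>Partial recursive functions\<close>

text \<open>
  Algorithms are codes of partial recursive functions in the sense of Kleene, with
  \<open>evaluates f xs y\<close> meaning that the computation of \<open>f\<close> on the arguments \<open>xs\<close> halts
  with result \<open>y\<close>.
\<close>

datatype recf =
    Zero
  | Succ
  | Proj nat
  | Comp recf "recf list"
  | PrimRec recf recf
  | Minimize recf

inductive evaluates :: "recf \<Rightarrow> nat list \<Rightarrow> nat \<Rightarrow> bool" where
  zero: "evaluates Zero xs 0"
| succ: "evaluates Succ [x] (Suc x)"
| proj: "i < length xs \<Longrightarrow> evaluates (Proj i) xs (xs ! i)"
| comp: "list_all2 (\<lambda>g y. evaluates g xs y) gs ys \<Longrightarrow> evaluates f ys z \<Longrightarrow>
    evaluates (Comp f gs) xs z"
| primrec_0: "evaluates f xs y \<Longrightarrow> evaluates (PrimRec f g) (0 # xs) y"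
| primrec_Suc: "evaluates (PrimRec f g) (n # xs) y \<Longrightarrow> evaluates g (n # y # xs) z \<Longrightarrow>
    evaluates (PrimRec f g) (Suc n # xs) z"
| minimize: "evaluates f (n # xs) 0 \<Longrightarrow> (\<And>m. m < n \<Longrightarrow> \<exists>y. evaluates f (m # xs) (Suc y)) \<Longrightarrow>
    evaluates (Minimize f) xs n"
monos list_all2_mono

inductive_cases evaluates_ZeroE: "evaluates Zero xs z"
inductive_cases evaluates_SuccE: "evaluates Succ xs z"
inductive_cases evaluates_ProjE: "evaluates (Proj i) xs z"
inductive_cases evaluates_CompE: "evaluates (Comp f gs) xs z"
inductive_cases evaluates_PrimRec_0E: "evaluates (PrimRec f g) (0 # xs) z"
inductive_cases evaluates_PrimRec_SucE: "evaluates (PrimRec f g) (Suc n # xs) z"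
inductive_cases evaluates_MinimizeE: "evaluates (Minimize f) xs z"

lemma evaluates_unique:
  assumes "evaluates f xs y" and "evaluates f xs z"
  shows "y = z"
  using assms
proof (induction arbitrary: z rule: evaluates.induct)
  case (zero xs)
  then show ?case by (rule evaluates_ZeroE) simp
next
  case (succ x)
  then show ?case by (rule evaluates_SuccE) simp
next
  case (proj i xs)
  from proj.prems show ?case by (rule evaluates_ProjE) simp
next
  case (comp xs gs ys f y)
  from comp.prems obtain ys' where
    ys': "list_all2 (\<lambda>g. evaluates g xs) gs ys'" and z: "evaluates f ys' z"
    by (rule evaluates_CompE)
  have "ys = ys'"
    using comp.IH(1) ys' by (auto simp: list_all2_conv_all_nth intro!: nth_equalityI)
  then show ?case using comp.IH(2) z by blast
next
  case (primrec_0 f xs y g)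
  from primrec_0.prems have "evaluates f xs z" by (rule evaluates_PrimRec_0E)
  then show ?case by (rule primrec_0.IH)
next
  case (primrec_Suc f g n xs y z')
  from primrec_Suc.prems obtain y' where
    "evaluates (PrimRec f g) (n # xs) y'" "evaluates g (n # y' # xs) z"
    by (rule evaluates_PrimRec_SucE)
  then show ?case using primrec_Suc.IH by blast
next
  case (minimize f n xs)
  from minimize.prems have z: "evaluates f (z # xs) 0"
    and below: "\<And>m. m < z \<Longrightarrow> \<exists>y. evaluates f (m # xs) (Suc y)"
    by (rule evaluates_MinimizeE, blast)+
  have "\<not> n < z"
  proof
    assume "n < z"
    then obtain y where "evaluates f (n # xs) (Suc y)" using below by blast
    then have "0 = Suc y" by (rule minimize.IH(1))
    then show False by simp
  qed
  moreover have "\<not> z < n"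
  proof
    assume "z < n"
    then obtain y where "\<And>v. evaluates f (z # xs) v \<Longrightarrow> Suc y = v"
      using minimize.IH(2) by blast
    then have "Suc y = 0" using z by blast
    then show False by simp
  qed
  ultimately show ?case by simp
qed


section \<open>The problem PMClass\<close>

text \<open>
  An instance consists of the table of a morphism on the alphabet \<open>{0, \<dots>, m - 1}\<close>, where \<open>m\<close>
  is the length of the table and the word at position \<open>x\<close> is the image of the letter \<open>x\<close>,
  and of a start letter.
\<close>

type_synonym instance_data = "nat list list \<times> nat"

definition morphism_of :: "nat list list \<Rightarrow> nat \<Rightarrow> nat list" where
  "morphism_of ws x = ws ! x"

definition PMClass_instance :: "instance_data \<Rightarrow> bool" where
  "PMClass_instance = (\<lambda>(ws, a).
     (\<forall>w \<in> set ws. set w \<subseteq> {..<length ws}) \<and> a < length ws \<and>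
     converges_on (morphism_of ws) a)"

definition PMClass_word :: "instance_data \<Rightarrow> nat word" where
  "PMClass_word = (\<lambda>(ws, a). limit_word (morphism_of ws) a)"

definition encode_instance :: "instance_data \<Rightarrow> nat" where
  "encode_instance = (\<lambda>(ws, a). prod_encode (list_encode (map list_encode ws), a))"

primrec encode_growth :: "growth \<Rightarrow> nat" where
  "encode_growth Const = 0"
| "encode_growth Linear = 1"
| "encode_growth Linear_loglog = 2"
| "encode_growth Linear_log = 3"
| "encode_growth Quadratic = 4"

end

theory Submission
 imports Defs "HOL-Real_Asymp.Real_Asymp"
begin

text \<open>
 Passing to a power of the morphism, we may assume that bounded letters (those with bounded iterated images)
 are stable and that the first and the last growing letter of each image reproduce themselves. As in Pansiot's
 theorem, an aperiodic word has complexity \<open>n\<^sup>2\<close> if bounded words accumulate next to a growing letter. Otherwise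
 the number of iterations \<open>p\<close> at which a block \<open>f\<^sup>p(b) f\<^sup>p(m) f\<^sup>p(c)\<close> is relevant for factors of length \<open>n\<close>
 decides: \<open>\<bar>f\<^sup>p(b)\<bar>\<close> has order \<open>p\<^sup>d r\<^sup>p\<close>, and this number is bounded, of order \<open>log log n\<close> or of order \<open>log n\<close>
 according to whether all growing letters have equal \<open>d\<close> and \<open>r\<close>, only equal \<open>r\<close>, or different \<open>r\<close>.

 Instead of computing with the algebraic numbers \<open>r\<close>, we give a finite certificate for each of the five cases:
 it is checkable by integer arithmetic, proves its class, and exists whenever the class is attained. As the
 classes exclude each other, an exhaustive search for a certificate of any class decides the problem.
\<close>

text \<open>A search can only find finite witnesses, and two of the facts needed have none at first
  sight. That two growth rates agree cannot be seen from finitely many lengths. The witness is an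
  exchange relation: a positive integer matrix \<open>X\<close> that intertwines two blocks of the
  incidence matrix forces equal rates. It exists because products of entries of real eigenvectors
  satisfy the relation, the common eigenvalue cancels, and a linear system with integer coefficients
  and a positive real solution has a positive integer one. That the word is not ultimately periodic
  is witnessed by two positions whose continuations visibly differ; this is conclusive because, even
  for an erasing morphism, iterates that ever identify two infinite words do so after as many steps
  as there are letters. The polynomial exponents are never computed: it is enough to know whether
  all of them vanish, and a positive rank in a certificate forces a positive exponent.\<close>

abbreviation eventually_nat :: "(nat => bool) => bool" (binder "EV " 10) where
 "eventually_nat P \<equiv> eventually P sequentially"

section \<open>Computable functions and semidecidable predicates\<close>

text \<open>Codes are bijective, so that a search through all numbers is a search through all values
  of the type and \<open>dec\<close> never meets an invalid code.\<close>

class enc =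
 fixes enc :: "'a => nat"
 assumes bij_enc: "bij enc"

lemma enc_eq_iff [simp]: "enc x = enc y \<longleftrightarrow> x = y"
 using bij_enc by (metis bij_pointE)

definition dec :: "nat => 'a :: enc" where
 "dec = inv enc"

lemma dec_enc [simp]: "dec (enc x) = x"
 unfolding dec_def using bij_enc by (metis bij_is_inj inv_f_f)

lemma enc_dec [simp]: "enc (dec n :: 'a :: enc) = n"
 unfolding dec_def using bij_enc by (metis bij_is_surj surj_f_inv_f)

instantiation nat :: enc
begin
definition enc_nat :: "nat => nat" where "enc_nat n = n"
instance by standard (simp add: enc_nat_def [abs_def] bij_id[unfolded id_def])
end

instantiation prod :: (enc, enc) enc
begin
definition enc_prod :: "'a \<times> 'b => nat" where
 "enc_prod z = prod_encode (map_prod enc enc z)"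
instance
proof
 have "enc = prod_encode \<circ> map_prod enc (enc :: 'b => nat)"
  by (auto simp: enc_prod_def fun_eq_iff)
 moreover have "bij (map_prod enc (enc :: 'b => nat) :: 'a \<times> 'b => _)"
  using bij_enc[where 'a = 'a] bij_enc[where 'a = 'b]
  unfolding bij_def by (simp add: prod.inj_map map_prod_surj)
 ultimately show "bij (enc :: 'a \<times> 'b => nat)"
  using bij_comp bij_prod_encode by metis
qed
end

instantiation list :: (enc) enc
begin
definition enc_list :: "'a list => nat" where
 "enc_list xs = list_encode (map enc xs)"
instance
proof
 have eq: "enc = list_encode \<circ> map (enc :: 'a => nat)"
  by (auto simp: enc_list_def fun_eq_iff)
 have "bij (map (enc :: 'a => nat))"
 proof (rule bijI)
  show "inj (map (enc :: 'a => nat))" using bij_enc[where 'a = 'a] by (simp add: bij_is_inj)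
  show "surj (map (enc :: 'a => nat))"
   by (rule surjI[of _ "map dec"]) (simp add: comp_def)
 qed
 thus "bij (enc :: 'a list => nat)" unfolding eq by (rule bij_comp[OF _ bij_list_encode])
qed
end

lemma enc_nat [simp]: "enc (n :: nat) = n"
 by (simp add: enc_nat_def)

lemma enc_Pair [simp]: "enc (x, y) = prod_encode (enc x, enc y)"
 by (simp add: enc_prod_def)

lemma enc_Nil [simp]: "enc [] = 0"
 by (simp add: enc_list_def)

lemma enc_Cons [simp]: "enc (x # xs) = Suc (prod_encode (enc x, enc xs))"
 by (simp add: enc_list_def)

definition computable :: "('a :: enc => 'b :: enc) => bool" where
 "computable f \<longleftrightarrow> (EX r. ALL x. evaluates r [enc x] (enc (f x)))"

definition computable2 :: "('a :: enc => 'b :: enc => 'c :: enc) => bool" where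
 "computable2 f \<longleftrightarrow> (EX r. ALL x y. evaluates r [enc x, enc y] (enc (f x y)))"

section \<open>Codes for arithmetic and for the pairing function\<close>

lemma evaluates_proj:
 "i < length xs ==> y = xs ! i ==> evaluates (Proj i) xs y"
 using evaluates.proj by blast

lemma evaluates_comp1:
 "evaluates g xs y ==> evaluates f [y] z ==> evaluates (Comp f [g]) xs z"
 by (rule evaluates.comp[where ys = "[y]"]) auto

lemma evaluates_comp2:
 "evaluates g xs y ==> evaluates h xs y' ==> evaluates f [y, y'] z ==>
  evaluates (Comp f [g, h]) xs z"
 by (rule evaluates.comp[where ys = "[y, y']"]) auto

lemma computable_id: "computable (%x. x)"
 unfolding computable_def by (auto intro!: exI[of _ "Proj 0"] evaluates_proj)

lemma computable_o:
 assumes "computable f" "computable g"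
 shows "computable (%x. f (g x))"
proof -
 from assms obtain r s where "!!x. evaluates r [enc x] (enc (f x))" "!!x. evaluates s [enc x] (enc (g x))"
  by (auto simp: computable_def)
 thus ?thesis
  unfolding computable_def by (intro exI[of _ "Comp r [s]"]) (blast intro: evaluates_comp1)
qed

lemma computable2_o:
 assumes "computable2 h" "computable f" "computable g"
 shows "computable (%x. h (f x) (g x))"
proof -
 from assms obtain t r s where "!!x y. evaluates t [enc x, enc y] (enc (h x y))"
  "!!x. evaluates r [enc x] (enc (f x))" "!!x. evaluates s [enc x] (enc (g x))"
  by (auto simp: computable_def computable2_def)
 thus ?thesis
  unfolding computable_def by (intro exI[of _ "Comp t [r, s]"]) (blast intro: evaluates_comp2)
qed

fun recf_const :: "nat => recf" where
 "recf_const 0 = Zero"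
| "recf_const (Suc n) = Comp Succ [recf_const n]"

lemma evaluates_recf_const: "evaluates (recf_const n) xs n"
 by (induction n) (auto intro: evaluates.zero evaluates_comp1 evaluates.succ)

lemma computable_const: "computable (%x. c)"
 unfolding computable_def using evaluates_recf_const by blast

lemma computable_Suc: "computable f ==> computable (%x. Suc (f x))"
 by (rule computable_o[where f = Suc])
   (auto simp: computable_def intro!: exI[of _ Succ] evaluates.succ)

lemma evaluates_primrec:
 assumes "evaluates f xs (F 0)" and "!!k. evaluates g (k # F k # xs) (F (Suc k))"
 shows "evaluates (PrimRec f g) (n # xs) (F n)"
 by (induction n) (use assms in \<open>auto intro: evaluates.primrec_0 evaluates.primrec_Suc\<close>)

lemma computable2_primrec:
 fixes F :: "nat => 'a :: enc => nat"
 assumes "computable (F 0)" and "!!k x. F (Suc k) x = h k (F k x) x"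
  and "!!k y x. evaluates r [k, y, enc x] (h k y x)"
 shows "computable2 F"
proof -
 from assms(1) obtain s where s: "!!x. evaluates s [enc x] (F 0 x)" by (auto simp: computable_def)
 have "evaluates (PrimRec s r) (n # [enc x]) (F n x)" for n x
  using evaluates_primrec[of s "[enc x]" "%n. F n x" r] s assms(2,3) by simp
 thus ?thesis unfolding computable2_def by auto
qed

lemma computable2_swap: "computable2 f ==> computable2 (%x y. f y x)"
 unfolding computable2_def
 by (elim exE, rule_tac x = "Comp r [Proj 1, Proj 0]" in exI) (auto intro!: evaluates_comp2 evaluates_proj)

lemma computable2_plus: "computable2 ((+) :: nat => nat => nat)"
 by (rule computable2_primrec[where h = "%k y x. Suc y" and r = "Comp Succ [Proj 1]"])
   (auto simp: computable_id plus_nat.add_0[abs_def] intro!: evaluates_comp1 evaluates_proj evaluates.succ)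

lemma computable_pred: "computable (%x :: nat. x - 1)"
proof -
 have "computable2 (%(n :: nat) (x :: nat). n - 1)"
  by (rule computable2_primrec[where F = "%n (x :: nat). n - 1" and h = "%k y x. k" and r = "Proj 0"])
    (auto simp: computable_const intro!: evaluates_proj)
 from computable2_o[OF this computable_id computable_id] show ?thesis .
qed

lemma computable2_minus: "computable2 ((-) :: nat => nat => nat)"
proof -
 from computable_pred obtain p where p: "!!x. evaluates p [x] (x - 1)" by (auto simp: computable_def)
 have "computable2 (%n x :: nat. x - n)"
  by (rule computable2_primrec[where h = "%k y x. y - 1" and r = "Comp p [Proj 1]"])
    (use p in \<open>auto simp: computable_id intro!: evaluates_comp1 evaluates_proj\<close>)
 thus ?thesis by (rule computable2_swap)
qed

lemma computable2_times: "computable2 ((*) :: nat => nat => nat)"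
proof -
 from computable2_plus obtain p where p: "!!x y :: nat. evaluates p [x, y] (x + y)"
  by (auto simp: computable2_def)
 show ?thesis
  by (rule computable2_primrec[where h = "%k y x. x + y" and r = "Comp p [Proj 2, Proj 1]"])
    (use p in \<open>auto simp: computable_const times_nat.mult_0[abs_def] intro!: evaluates_comp2 evaluates_proj\<close>)
qed

lemma computable_nat_arith:
 assumes "computable f" "computable g"
 shows computable_plus: "computable (%x. f x + g x :: nat)"
  and computable_minus: "computable (%x. f x - g x :: nat)"
  and computable_times: "computable (%x. f x * g x :: nat)"
 using computable2_o[OF computable2_plus assms] computable2_o[OF computable2_minus assms]
  computable2_o[OF computable2_times assms] by auto

lemma computable_triangle: "computable triangle"
proof -
 from computable2_plus obtain p where p: "!!x y :: nat. evaluates p [x, y] (x + y)"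
  by (auto simp: computable2_def)
 have "computable2 (%n x :: nat. triangle n)"
  by (rule computable2_primrec[where h = "%k y x. y + Suc k" and r = "Comp p [Proj 1, Comp Succ [Proj 0]]"])
    (use p in \<open>auto simp: computable_const intro!: evaluates_comp1 evaluates_comp2 evaluates_proj evaluates.succ
    simp del: add_Suc_right\<close>)
 from computable2_o[OF this computable_id computable_id] show ?thesis .
qed

lemma computable2_Pair: "computable2 Pair"
proof -
 from computable2_plus computable_triangle obtain p t
  where p: "!!x y :: nat. evaluates p [x, y] (x + y)" and t: "!!x. evaluates t [x] (triangle x)"
  by (auto simp: computable_def computable2_def)
 have "evaluates (Comp p [Comp t [p], Proj 0]) [x, y] (prod_encode (x, y))" for x y
  unfolding prod_encode_def by (auto intro!: evaluates_comp1 evaluates_comp2 evaluates_proj p t)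
 thus ?thesis unfolding computable2_def by auto
qed

lemma computable_Pair:
 "computable f ==> computable g ==> computable (%x. (f x, g x))"
 using computable2_o[OF computable2_Pair] by blast

text \<open>The assumed zero keeps the minimization total. The rule serves to invert the pairing
  function.\<close>

lemma computable_Least_aux:
 fixes h :: "nat => 'a :: enc => nat"
 assumes "computable2 h" and "!!x. EX n. h n x = 0"
 shows "computable (%x. LEAST n. h n x = 0)"
proof -
 from assms(1) obtain r where r: "!!n x. evaluates r [n, enc x] (h n x)"
  by (auto simp: computable2_def)
 have "evaluates (Minimize r) [enc x] (LEAST n. h n x = 0)" for x
 proof (rule evaluates.minimize)
  have "h (LEAST n. h n x = 0) x = 0" using assms(2) by (rule LeastI_ex)
  thus "evaluates r [LEAST n. h n x = 0, enc x] 0" using r by metis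
 next
  fix m assume "m < (LEAST n. h n x = 0)"
  hence "h m x ~= 0" using not_less_Least by blast
  thus "EX y. evaluates r [m, enc x] (Suc y)" using r[of m x] by (metis not0_implies_Suc)
 qed
 thus ?thesis unfolding computable_def by auto
qed

lemma computable2_pair_iff:
 fixes h :: "'a :: enc => 'b :: enc => 'c :: enc"
 assumes fs: "computable (fst :: 'a \<times> 'b => 'a)" "computable (snd :: 'a \<times> 'b => 'b)"
 shows "computable2 h \<longleftrightarrow> computable (%z. h (fst z) (snd z))"
proof
 assume "computable2 h"
 from computable2_o[OF this fs] show "computable (%z. h (fst z) (snd z))" .
next
 assume "computable (%z. h (fst z) (snd z))"
 then obtain r where r: "!!z. evaluates r [enc z] (enc (h (fst z) (snd z)))"
  unfolding computable_def by blast
 from computable2_Pair obtain p where p: "!!x :: 'a. !!y :: 'b. evaluates p [enc x, enc y] (enc (x, y))"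
  unfolding computable2_def by blast
 have "evaluates (Comp r [p]) [enc x, enc y] (enc (h x y))" for x y
  using evaluates_comp1[OF p r[of "(x, y)"]] by simp
 thus "computable2 h" unfolding computable2_def by blast
qed

text \<open>The pair \<open>(m, n)\<close> has the code \<open>triangle (m + n) + m\<close>, so
  \<open>m + n\<close> is the least \<open>s\<close> for which \<open>triangle (Suc s)\<close>
  exceeds \<open>z\<close>. Truncated subtraction expresses this inequality by a zero.\<close>

definition tri_root :: "nat => nat" where
 "tri_root z = (LEAST s. Suc z - triangle (Suc s) = 0)"

lemma triangle_mono: "m <= n ==> triangle m <= triangle n"
 by (induction n rule: dec_induct) auto

lemma tri_root_prod_encode: "tri_root (prod_encode (m, n)) = m + n"
 unfolding tri_root_def prod_encode_def
proof (rule Least_equality)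
 show "Suc (case (m, n) of (m, n) => triangle (m + n) + m) - triangle (Suc (m + n)) = 0" by simp
next
 fix s assume *: "Suc (case (m, n) of (m, n) => triangle (m + n) + m) - triangle (Suc s) = 0"
 show "m + n <= s"
 proof (rule ccontr)
  assume "~ m + n <= s"
  hence "triangle (Suc s) <= triangle (m + n)" by (intro triangle_mono) simp
  with * show False by simp
 qed
qed

lemma computable_tri_root: "computable tri_root"
proof -
 have 1: "computable2 (%(s :: nat) (z :: nat). Suc z - triangle (Suc s))"
 proof -
  from computable2_minus computable_triangle obtain p t
   where p: "!!x y :: nat. evaluates p [x, y] (x - y)" and t: "!!x. evaluates t [x] (triangle x)"
   by (auto simp: computable_def computable2_def)
  have "evaluates (Comp p [Comp Succ [Proj 1], Comp t [Comp Succ [Proj 0]]]) [s, z] (Suc z - triangle (Suc s))" for s z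
   by (rule evaluates_comp2[OF evaluates_comp1[OF _ evaluates.succ]
      evaluates_comp1[OF evaluates_comp1[OF _ evaluates.succ] t] p]) (auto intro!: evaluates_proj)
  thus ?thesis unfolding computable2_def by auto
 qed
 have 2: "EX s. Suc z - triangle (Suc s) = 0" for z
  by (rule exI[of _ z]) (induction z, auto)
 show ?thesis
  using computable_Least_aux[OF 1 2] unfolding tri_root_def .
qed

lemma computable_fst_snd_aux:
 "computable (fst :: 'a :: enc \<times> 'b :: enc => 'a)" "computable (snd :: 'a \<times> 'b => 'b)"
proof -
 \<comment> \<open>The excess of the code over the triangular number is the first component; what
   then remains of the root is the second.\<close>
 let ?m = "%z. z - triangle (tri_root z)"
 have m: "computable ?m"
  by (rule computable_minus[OF computable_id computable_o[OF computable_triangle computable_tri_root]])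
 hence n: "computable (%z. tri_root z - ?m z)"
  by (rule computable_minus[OF computable_tri_root])
 have "?m (enc p) = enc (fst p)" "tri_root (enc p) - ?m (enc p) = enc (snd p)" for p :: "'a \<times> 'b"
 proof -
  obtain x y where p: "p = (x, y)" by (cases p)
  show "?m (enc p) = enc (fst p)" "tri_root (enc p) - ?m (enc p) = enc (snd p)"
   unfolding p enc_Pair tri_root_prod_encode by (simp_all add: prod_encode_def)
 qed
 with m n show "computable (fst :: 'a :: enc \<times> 'b :: enc => 'a)" "computable (snd :: 'a \<times> 'b => 'b)"
  unfolding computable_def enc_nat by metis+
qed

lemma computable_fst: "computable f ==> computable (%x. fst (f x))"
 and computable_snd: "computable f ==> computable (%x. snd (f x))"
 using computable_o[OF computable_fst_snd_aux(1)] computable_o[OF computable_fst_snd_aux(2)] by blast+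

lemmas computable2_iff = computable2_pair_iff[OF computable_fst_snd_aux]

text \<open>A term with free variables is treated as a function of one environment; below a binder
  the environment is paired with the bound variable. This rule and the next substitute computable
  arguments into such terms.\<close>

lemma computable_arg:
 assumes "computable (%z. H (fst z) (snd z))" "computable f" "computable g"
 shows "computable (%z. H (f z) (g z))"
 using computable_o[OF assms(1) computable_Pair[OF assms(2,3)]] by simp

lemma computable_arg3:
 assumes "computable (%z. H (fst z) (fst (snd z)) (snd (snd z)))" "computable f" "computable g" "computable h"
 shows "computable (%z. H (f z) (g z) (h z))"
 using computable_o[OF assms(1) computable_Pair[OF assms(2) computable_Pair[OF assms(3,4)]]] by simp

text \<open>The source of recursion on structured data: conditionals, iteration and folds are all
  reduced to \<open>rec_nat\<close> with a parameter \<open>e\<close> and values in an arbitrary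
  coded type.\<close>

lemma computable_rec_nat:
 fixes A :: "'a :: enc => 'b :: enc"
 assumes A: "computable A" and H: "computable (%z. H (fst z) (fst (snd z)) (snd (snd z)))"
  and N: "computable N"
 shows "computable (%e. rec_nat (A e) (%k y. H e k y) (N e))"
proof -
 let ?F = "%n e. rec_nat (A e) (%k y. H e k y) n"
 from H obtain h where h: "!!e k y. evaluates h [enc (e, k, y)] (enc (H e k y))"
  unfolding computable_def by (metis fst_conv snd_conv)
 from A obtain s where s: "!!x. evaluates s [enc x] (enc (A x))" unfolding computable_def by blast
 from computable2_Pair obtain p where p: "!!x :: 'a. !!y :: nat \<times> 'b. evaluates p [enc x, enc y] (enc (x, y))"
  unfolding computable2_def by blast
 from computable2_Pair obtain q where q: "!!x :: nat. !!y :: 'b. evaluates q [enc x, enc y] (enc (x, y))"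
  unfolding computable2_def by blast
 let ?r = "Comp h [Comp p [Proj 2, Comp q [Proj 0, Proj 1]]]"
 have r: "evaluates ?r (k # enc y # [enc x]) (enc (H x k y))" for k y x
 proof (rule evaluates_comp1[OF evaluates_comp2[OF _ evaluates_comp2 p] h])
  show "evaluates (Proj 2) [k, enc y, enc x] (enc x)" by (rule evaluates_proj) auto
  show "evaluates (Proj 0) [k, enc y, enc x] k" by (rule evaluates_proj) auto
  show "evaluates (Proj 1) [k, enc y, enc x] (enc y)" by (rule evaluates_proj) auto
  show "evaluates q [k, enc y] (enc (k, y))" using q[of k y] by simp
 qed
 have "evaluates (PrimRec s ?r) (n # [enc x]) (enc (?F n x))" for n x
  by (rule evaluates_primrec[where F = "%n. enc (?F n x)"]) (use s r in simp_all)
 hence "computable2 ?F" unfolding computable2_def by auto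
 from computable2_o[OF this N computable_id] show ?thesis .
qed

section \<open>Decidable predicates and closure rules\<close>

definition decidable :: "('a :: enc => bool) => bool" where
 "decidable P \<longleftrightarrow> computable (%x. of_bool (P x) :: nat)"

named_theorems comp_intros

lemmas [comp_intros] = computable_id computable_const computable_Suc computable_plus computable_minus
 computable_times computable_Pair computable_fst computable_snd

lemma computable_If [comp_intros]:
 assumes "decidable P" "computable f" "computable g"
 shows "computable (%x. if P x then f x else g x)"
proof -
 \<comment> \<open>A conditional is a recursion of length 1 or 0.\<close>
 have "computable (%x. rec_nat (g x) (%k y. f x) (of_bool (P x)))"
  by (rule computable_rec_nat) (use assms computable_o in \<open>auto simp: decidable_def intro!: comp_intros\<close>)
 moreover have "rec_nat (g x) (%k y. f x) (of_bool (P x)) = (if P x then f x else g x)" for x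
  by (auto simp: of_bool_def)
 ultimately show ?thesis by simp
qed

lemma computable_rec_nat' [comp_intros]:
 assumes "computable A" "computable (%z. H (fst z) (fst (snd z)) (snd (snd z)))" "computable N"
 shows "computable (%e. rec_nat (A e) (H e) (N e))"
 using computable_rec_nat[OF assms] .

lemma computable_funpow [comp_intros]:
 fixes H :: "'a :: enc => 'b :: enc => 'b"
 assumes "computable A" "computable (%z. H (fst z) (snd z))" "computable N"
 shows "computable (%e. (H e ^^ N e) (A e :: 'b :: enc))"
proof -
 have "computable (%z. H (fst z) (snd (snd z)))"
  by (intro computable_arg[OF assms(2)] comp_intros)
 hence "computable (%e. rec_nat (A e) (%k y. H e y) (N e))"
  by (intro computable_rec_nat[where H = "%e k y. H e y"] assms)
 moreover have "rec_nat (A e) (%k y. H e y) n = (H e ^^ n) (A e)" for e n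
  by (induction n) auto
 ultimately show ?thesis by simp
qed

lemma decidable_True [comp_intros]: "decidable (%x. True)"
 and decidable_False [comp_intros]: "decidable (%x. False)"
 unfolding decidable_def by (simp_all add: comp_intros)

lemma decidable_conj [comp_intros]:
 assumes "decidable P" "decidable Q" shows "decidable (%x. P x & Q x)"
 using assms computable_times unfolding decidable_def of_bool_conj by blast

lemma decidable_not [comp_intros]:
 assumes "decidable P" shows "decidable (%x. ~ P x)"
proof -
 have "computable (%x. 1 - of_bool (P x) :: nat)"
  using assms unfolding decidable_def by (intro comp_intros)
 moreover have "1 - of_bool b = (of_bool (~ b) :: nat)" for b by simp
 ultimately show ?thesis unfolding decidable_def by simp
qed

lemma decidable_disj [comp_intros]:
 assumes "decidable P" "decidable Q" shows "decidable (%x. P x | Q x)"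
proof -
 have "decidable (%x. ~ (~ P x & ~ Q x))" using assms by (intro comp_intros)
 thus ?thesis by simp
qed

lemma decidable_imp [comp_intros]:
 assumes "decidable P" "decidable Q" shows "decidable (%x. P x --> Q x)"
proof -
 have "decidable (%x. ~ P x | Q x)" using assms by (intro comp_intros)
 thus ?thesis by (simp only: imp_conv_disj)
qed

lemma decidable_o: "decidable P ==> computable f ==> decidable (%x. P (f x))"
 unfolding decidable_def by (rule computable_o)

lemma computable_enc: "computable f ==> computable (%x. enc (f x))"
 unfolding computable_def by simp

lemma decidable_zero:
 assumes "computable f" shows "decidable (%x. f x = (0 :: nat))"
proof -
 have "computable (%x. 1 - f x :: nat)" using assms by (intro comp_intros)
 moreover have "1 - f x = of_bool (f x = 0)" for x by auto
 ultimately show ?thesis unfolding decidable_def by simp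
qed

lemma decidable_le [comp_intros]:
 assumes "computable f" "computable g" shows "decidable (%x. f x <= (g x :: nat))"
proof -
 have "decidable (%x. f x - g x = 0)" using assms by (intro decidable_zero comp_intros)
 thus ?thesis by simp
qed

lemma decidable_less [comp_intros]:
 assumes "computable f" "computable g" shows "decidable (%x. f x < (g x :: nat))"
proof -
 have "decidable (%x. ~ g x <= f x)" using assms by (intro comp_intros)
 thus ?thesis by (simp add: not_le)
qed

lemma decidable_eq [comp_intros]:
 assumes "computable f" "computable g" shows "decidable (%x. f x = g x)"
proof -
 have "decidable (%x. enc (f x) <= enc (g x) & enc (g x) <= enc (f x))"
  using assms by (intro comp_intros computable_enc)
 moreover have "enc (f x) <= enc (g x) & enc (g x) <= enc (f x) \<longleftrightarrow> f x = g x" for x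
  using enc_eq_iff by (metis le_antisym order_refl)
 ultimately show ?thesis by simp
qed

lemma computable_Cons [comp_intros]:
 assumes "computable f" "computable g" shows "computable (%x. f x # g x)"
proof -
 have "computable (%x. Suc (enc (f x, g x)))"
  using assms by (intro computable_Suc computable_enc computable_Pair)
 thus ?thesis unfolding computable_def by simp
qed

text \<open>The code of a nonempty list is the successor of the code of the pair of head and tail,
  so the predecessor is decoded as that pair. The value at the empty list is arbitrary and guarded
  by a case distinction.\<close>

definition uncons :: "'a :: enc list => 'a \<times> 'a list" where
 "uncons xs = dec (enc xs - 1)"

lemma uncons_Cons [simp]: "uncons (x # xs) = (x, xs)"
proof -
 have "enc (x # xs) - 1 = enc (x, xs)" by simp
 thus ?thesis unfolding uncons_def by (metis dec_enc)
qed

lemma computable_uncons: "computable f ==> computable (%x. uncons (f x))"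
proof -
 assume "computable f"
 hence "computable (%x. enc (f x) - 1)" by (intro comp_intros computable_enc)
 thus ?thesis unfolding computable_def uncons_def by simp
qed

lemma computable_case_list [comp_intros]:
 assumes "computable L" "computable A" "computable (%z. C (fst z) (fst (snd z)) (snd (snd z)))"
 shows "computable (%e. case L e of [] => A e | x # xs => C e x xs)"
proof -
 have "computable (%e. if L e = [] then A e else C e (fst (uncons (L e))) (snd (uncons (L e))))"
 proof (intro comp_intros assms)
  show "computable (%x. C x (fst (uncons (L x))) (snd (uncons (L x))))"
   by (intro computable_arg3[OF assms(3)] comp_intros computable_uncons assms)
 qed
 also have "(%e. if L e = [] then A e else C e (fst (uncons (L e))) (snd (uncons (L e)))) =
   (%e. case L e of [] => A e | x # xs => C e x xs)"
  by (auto simp: fun_eq_iff split: list.splits)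
 finally show ?thesis .
qed

lemma length_le_enc: "length xs <= enc xs"
proof (induction xs)
 case (Cons x xs)
 thus ?case using le_prod_encode_2[of "enc xs" "enc x"] by simp
qed simp

lemma computable_fold [comp_intros]:
 fixes H :: "'a :: enc => 'b :: enc => 'c :: enc => 'c"
 assumes "computable (%z. H (fst z) (fst (snd z)) (snd (snd z)))" "computable L" "computable A"
 shows "computable (%e. fold (H e) (L e) (A e))"
proof -
 \<comment> \<open>The fold is run as an iteration on the pair of remaining list and accumulator.
   The code of a list bounds its length, and surplus rounds leave the pair as it is.\<close>
 let ?step = "%e s. case fst s of [] => s | x # xs => (xs, H e x (snd s))"
 have step: "computable (%z. ?step (fst z) (snd z))"
 proof (intro comp_intros)
  show "computable (%z. H (fst (fst z)) (fst (snd z)) (snd (snd (fst z))))"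
   by (intro computable_arg3[OF assms(1)] comp_intros)
 qed
 have iter: "length xs <= n ==> (?step e ^^ n) (xs, s) = ([], fold (H e) xs s)" for e n xs s
 proof (induction n arbitrary: xs s)
  case (Suc n)
  show ?case
  proof (cases xs)
   case Nil
   thus ?thesis using Suc.IH[of "[]" s] by (simp add: funpow_Suc_right del: funpow.simps)
  next
   case (Cons y ys)
   thus ?thesis using Suc by (simp add: funpow_Suc_right del: funpow.simps)
  qed
 qed simp
 have "computable (%e. snd ((?step e ^^ enc (L e)) (L e, A e)))"
  using assms(2,3) step by (intro comp_intros(8,9) computable_funpow computable_Pair computable_enc)
 thus ?thesis by (simp only: iter[OF length_le_enc] snd_conv)
qed

lemma computable_rev [comp_intros]: "computable f ==> computable (%x. rev (f x))"
 using computable_fold[where H = "%e. Cons" and L = f and A = "%_. []"]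
 by (simp add: fold_Cons_rev comp_intros)

lemma computable_foldr [comp_intros]:
 assumes "computable (%z. H (fst z) (fst (snd z)) (snd (snd z)))" "computable L" "computable A"
 shows "computable (%e. foldr (H e) (L e) (A e))"
 unfolding foldr_conv_fold by (intro comp_intros assms)

lemma computable_append [comp_intros]:
 assumes "computable f" "computable g" shows "computable (%x. f x @ g x)"
proof -
 have "computable (%e. foldr (%x s. x # s) (f e) (g e))" by (intro comp_intros assms)
 moreover have "foldr (%x s. x # s) xs ys = xs @ ys" for xs ys :: "'b list" by (induction xs) auto
 ultimately show ?thesis by simp
qed

lemma computable_map [comp_intros]:
 assumes "computable (%z. H (fst z) (snd z))" "computable L"
 shows "computable (%e. map (H e) (L e))"
proof -
 have "computable (%e. foldr (%x s. H e x # s) (L e) [])"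
  by (intro comp_intros assms computable_arg[OF assms(1)])
 moreover have "foldr (%x s. H e x # s) xs [] = map (H e) xs" for e xs by (induction xs) auto
 ultimately show ?thesis by simp
qed

lemma decidable_arg:
 assumes "decidable (%z. H (fst z) (snd z))" "computable f" "computable g"
 shows "decidable (%z. H (f z) (g z))"
 using decidable_o[OF assms(1) computable_Pair[OF assms(2,3)]] by simp

lemma computable_filter [comp_intros]:
 assumes "decidable (%z. H (fst z) (snd z))" "computable L"
 shows "computable (%e. filter (H e) (L e))"
proof -
 have "computable (%e. foldr (%x s. if H e x then x # s else s) (L e) [])"
  by (intro comp_intros assms decidable_arg[OF assms(1)])
 moreover have "foldr (%x s. if H e x then x # s else s) xs [] = filter (H e) xs" for e xs
  by (induction xs) auto
 ultimately show ?thesis by simp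
qed

lemma computable_length [comp_intros]:
 assumes "computable L" shows "computable (%e. length (L e))"
proof -
 have "computable (%e. foldr (%x s. Suc s) (L e) 0)" by (intro comp_intros assms)
 moreover have "foldr (%x s. Suc s) xs 0 = length xs" for xs :: "'b list" by (induction xs) auto
 ultimately show ?thesis by simp
qed

lemma computable_concat [comp_intros]:
 assumes "computable L" shows "computable (%e. concat (L e))"
 unfolding concat_conv_foldr by (intro comp_intros assms)

lemma computable_sum_list [comp_intros]:
 assumes "computable L" shows "computable (%e. sum_list (L e) :: nat)"
proof -
 have "computable (%e. foldr (%x s. x + s) (L e) 0 :: nat)" by (intro comp_intros assms)
 thus ?thesis by (simp add: sum_list.eq_foldr)
qed

lemma computable_upt [comp_intros]:
 assumes "computable N" shows "computable (%e. [0..<N e])"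
proof -
 have "computable (%e. rec_nat [] (%k y. y @ [k]) (N e))" by (intro comp_intros assms)
 moreover have "rec_nat [] (%k y. y @ [k]) n = [0..<n]" for n by (induction n) auto
 ultimately show ?thesis by simp
qed

lemma computable_replicate [comp_intros]:
 assumes "computable N" "computable f" shows "computable (%e. replicate (N e) (f e))"
proof -
 have "computable (%e. map (%k. f e) [0..<N e])"
  by (intro comp_intros assms computable_o[OF assms(2)])
 thus ?thesis by (simp add: map_replicate_const)
qed

lemma computable_tl [comp_intros]:
 assumes "computable L" shows "computable (%e. tl (L e))"
proof -
 have "computable (%e. case L e of [] => [] | x # xs => xs)" by (intro comp_intros assms)
 thus ?thesis by (simp add: tl_def cong: list.case_cong)
qed

lemma computable_drop [comp_intros]:
 assumes "computable N" "computable L" shows "computable (%e. drop (N e) (L e))"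
proof -
 have "computable (%e. (tl ^^ N e) (L e))" by (intro comp_intros assms)
 moreover have "(tl ^^ n) xs = drop n xs" for n and xs :: "'b list"
  by (induction n arbitrary: xs) (simp_all add: drop_Suc funpow_Suc_right del: funpow.simps)
 ultimately show ?thesis by simp
qed

lemma computable_take [comp_intros]:
 assumes "computable N" "computable L" shows "computable (%e. take (N e) (L e))"
proof -
 have "computable (%e. rev (drop (length (L e) - N e) (rev (L e))))" by (intro comp_intros assms)
 moreover have "rev (drop (length xs - n) (rev xs)) = take n xs" for n and xs :: "'b list"
  by (cases "n <= length xs") (simp_all add: rev_take[symmetric] rev_drop)
 ultimately show ?thesis by simp
qed

text \<open>Indexing with a default: the value of \<open>xs ! i\<close> beyond the end of the list
  is unspecified, so that nothing could be shown about its computability.\<close>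

definition lookup :: "'a => 'a list => nat => 'a" where
 "lookup d xs i = (if i < length xs then xs ! i else d)"

lemma computable_lookup [comp_intros]:
 assumes "computable d" "computable L" "computable N"
 shows "computable (%e. lookup (d e) (L e) (N e))"
proof -
 have "computable (%e. case drop (N e) (L e) of [] => d e | x # xs => x)" by (intro comp_intros assms)
 moreover have "(case drop n xs of [] => y | x # xs => x) = lookup y xs n" for n y and xs :: "'b list"
  by (auto simp: lookup_def split: list.splits) (metis Cons_nth_drop_Suc list.inject)
 ultimately show ?thesis by simp
qed

lemma decidable_ball [comp_intros]:
 assumes "decidable (%z. H (fst z) (snd z))" "computable L"
 shows "decidable (%e. ALL x:set (L e). H e x)"
proof -
 have "decidable (%e. filter (%x. ~ H e x) (L e) = [])"
  by (intro comp_intros assms)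
 thus ?thesis by (simp add: filter_empty_conv)
qed

lemma decidable_bex [comp_intros]:
 assumes "decidable (%z. H (fst z) (snd z))" "computable L"
 shows "decidable (%e. EX x:set (L e). H e x)"
proof -
 have "decidable (%e. ~ (ALL x:set (L e). ~ H e x))" by (intro comp_intros assms)
 thus ?thesis by simp
qed

lemma decidable_member [comp_intros]:
 assumes "computable f" "computable L"
 shows "decidable (%e. f e : set (L e))"
proof -
 have "decidable (%e. EX x:set (L e). f e = x)"
  by (intro comp_intros assms computable_o[OF assms(1)])
 thus ?thesis by simp
qed

text \<open>Stages are numbers here; \<open>semidecI\<close> admits witnesses of any coded type.
  Closure under unbounded existential quantifiers comes at the price of negation, which is why all
  certificates below are phrased positively.\<close>

definition semidec :: "('a :: enc => bool) => bool" where
 "semidec P \<longleftrightarrow> (EX D :: 'a => nat => bool. decidable (%z. D (fst z) (snd z)) & (ALL x. P x \<longleftrightarrow> (EX n. D x n)))"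

named_theorems semidec_intros

lemma computable_dec: "computable (dec :: nat => 'b :: enc)"
 unfolding computable_def
proof (intro exI[of _ "Proj 0"] allI)
 fix n show "evaluates (Proj 0) [enc n] (enc (dec n :: 'b))" by (rule evaluates_proj) simp_all
qed

lemma semidecI:
 fixes D :: "'a :: enc => 'b :: enc => bool"
 assumes "decidable (%z. D (fst z) (snd z))" "!!x. P x \<longleftrightarrow> (EX t. D x t)"
 shows "semidec P"
 unfolding semidec_def
proof (intro exI[of _ "%x n. D x (dec n)"] conjI allI)
 have "computable (%z :: 'a \<times> nat. dec (snd z) :: 'b)"
  by (rule computable_o[OF computable_dec]) (intro comp_intros)
 thus "decidable (%z. D (fst z) (dec (snd z)))"
  by (intro decidable_arg[OF assms(1)] comp_intros)
 show "P x \<longleftrightarrow> (EX n. D x (dec n))" for x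
  using assms(2) by (metis dec_enc)
qed

lemma semidec_decidable: "decidable P ==> semidec P"
 by (rule semidecI[where D = "%x (n :: nat). P x"]) (auto intro!: decidable_o[of P] comp_intros)

lemma semidec_ex [semidec_intros]:
 fixes P :: "'a :: enc => 'b :: enc => bool"
 assumes "semidec (%z. P (fst z) (snd z))"
 shows "semidec (%x. EX t. P x t)"
proof -
 from assms obtain D where D: "decidable (%z. D (fst z) (snd z))" "!!z n. P (fst z) (snd z) \<longleftrightarrow> (EX n :: nat. D z n)"
  unfolding semidec_def by blast
 have P: "P x t \<longleftrightarrow> (EX n. D (x, t) n)" for x t using D(2)[of "(x, t)"] by simp
 show ?thesis
  by (rule semidecI[where D = "%x q. D (x, fst q) (snd q)"]) (auto simp: P intro!: decidable_arg[OF D(1)] comp_intros)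
qed

lemma semidec_conj [semidec_intros]:
 assumes "semidec P" "semidec Q" shows "semidec (%x. P x & Q x)"
proof -
 from assms obtain D E where D: "decidable (%z. D (fst z) (snd z))" "!!x. P x \<longleftrightarrow> (EX n :: nat. D x n)"
  and E: "decidable (%z. E (fst z) (snd z))" "!!x. Q x \<longleftrightarrow> (EX n :: nat. E x n)"
  unfolding semidec_def by blast
 show ?thesis
  by (rule semidecI[where D = "%x q. D x (fst q) & E x (snd q)"])
    (auto simp: D(2) E(2) intro!: decidable_arg[OF D(1)] decidable_arg[OF E(1)] comp_intros)
qed

lemma semidec_disj [semidec_intros]:
 assumes "semidec P" "semidec Q" shows "semidec (%x. P x | Q x)"
proof -
 from assms obtain D E where D: "decidable (%z. D (fst z) (snd z))" "!!x. P x \<longleftrightarrow> (EX n :: nat. D x n)"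
  and E: "decidable (%z. E (fst z) (snd z))" "!!x. Q x \<longleftrightarrow> (EX n :: nat. E x n)"
  unfolding semidec_def by blast
 show ?thesis
  by (rule semidecI[where D = "%x q. D x q | E x q"])
    (auto simp: D(2) E(2) intro!: decidable_arg[OF D(1)] decidable_arg[OF E(1)] comp_intros)
qed

text \<open>Finitely many witnesses lie below a common bound \<open>T\<close>, so one stage serves
  all elements of the list.\<close>

lemma semidec_ball [semidec_intros]:
 fixes P :: "'a :: enc => 'b :: enc => bool"
 assumes "semidec (%z. P (fst z) (snd z))" "computable L"
 shows "semidec (%e. ALL x:set (L e). P e x)"
proof -
 from assms obtain D where D: "decidable (%z. D (fst z) (snd z))" "!!z n. P (fst z) (snd z) \<longleftrightarrow> (EX n :: nat. D z n)"
  unfolding semidec_def by blast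
 have P: "P x t \<longleftrightarrow> (EX n. D (x, t) n)" for x t using D(2)[of "(x, t)"] by simp
 show ?thesis
 proof (rule semidecI[where D = "%e T. ALL x:set (L e). EX n:set [0..<T]. D (e, x) n"])
  show "decidable (%z. ALL x:set (L (fst z)). EX n:set [0..<snd z]. D (fst z, x) n)"
   by (intro comp_intros decidable_arg[OF D(1)] computable_o[OF assms(2)])
  show "(ALL x:set (L e). P e x) \<longleftrightarrow> (EX T. ALL x:set (L e). EX n:set [0..<T]. D (e, x) n)" for e
  proof
   assume "ALL x:set (L e). P e x"
   then obtain N where N: "!!x. x : set (L e) ==> D (e, x) (N x)" unfolding P by metis
   have "N x < Suc (Max (N ` set (L e)))" if "x : set (L e)" for x
    using that by (simp add: le_imp_less_Suc)
   thus "EX T. ALL x:set (L e). EX n:set [0..<T]. D (e, x) n"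
    using N by (intro exI[of _ "Suc (Max (N ` set (L e)))"]) (metis atLeastLessThan_iff le0 set_upt)
  qed (auto simp: P)
 qed
qed

lemma semidec_bex [semidec_intros]:
 fixes P :: "'a :: enc => 'b :: enc => bool"
 assumes "semidec (%z. P (fst z) (snd z))" "computable L"
 shows "semidec (%e. EX x:set (L e). P e x)"
proof -
 have "semidec (%e. EX x. x : set (L e) & P e x)"
  by (intro semidec_intros assms semidec_decidable comp_intros computable_o[OF assms(2)])
 thus ?thesis by (simp add: Bex_def)
qed

text \<open>The witnesses of all five predicates are searched for in parallel.\<close>

lemma computable_select:
 fixes P :: "nat => 'a :: enc => bool"
 assumes "!!i. i < N ==> semidec (P i)"
 shows "EX r. ALL x. (EX i<N. P i x) --> (EX i<N. P i x & evaluates r [enc x] i)"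
proof -
 have "EX D :: nat => 'a => nat => bool. ALL i<N. decidable (%z. D i (fst z) (snd z)) & (ALL x. P i x \<longleftrightarrow> (EX n. D i x n))"
  using assms unfolding semidec_def by metis
 then obtain D :: "nat => 'a => nat => bool" where D: "!!i. i < N ==> decidable (%z. D i (fst z) (snd z))"
  "!!i x. i < N ==> P i x \<longleftrightarrow> (EX n. D i x n)" by auto
 define E where "E = (%x (q :: nat \<times> nat). EX i<N. fst q = i & D i x (snd q))"
 have decE: "decidable (%z. E (fst z) (snd z))"
 proof -
  \<comment> \<open>The procedures \<open>D i\<close> for different \<open>i\<close> are unrelated,
    so \<open>E\<close> is decidable only as a finite disjunction, built up by induction on its
    length.\<close>
  have "n <= N ==> decidable (%z :: 'a \<times> nat \<times> nat. EX i<n. fst (snd z) = i & D i (fst z) (snd (snd z)))" for n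
  proof (induction n)
   case 0
   thus ?case by (simp add: comp_intros)
  next
   case (Suc n)
   have "decidable (%z :: 'a \<times> nat \<times> nat. (EX i<n. fst (snd z) = i & D i (fst z) (snd (snd z))) |
     fst (snd z) = n & D n (fst z) (snd (snd z)))"
    using Suc by (intro comp_intros decidable_arg[OF D(1)]) auto
   thus ?case by (simp add: less_Suc_eq ex_disj_distrib conj_disj_distribR disj_commute)
  qed
  thus ?thesis unfolding E_def by simp
 qed
 hence "decidable (%z :: 'a \<times> nat. E (fst z) (dec (snd z)))"
  by (intro decidable_arg[OF decE] computable_o[OF computable_dec] comp_intros)
 hence "computable (%z :: 'a \<times> nat. 1 - of_bool (E (fst z) (dec (snd z))) :: nat)"
  unfolding decidable_def by (rule computable_minus[OF computable_const, where g = "%z. of_bool (E (fst z) (dec (snd z)))"])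
 hence "computable2 (%(x :: 'a) n. 1 - of_bool (E x (dec n)) :: nat)" unfolding computable2_iff .
 hence "computable2 (%n (x :: 'a). 1 - of_bool (E x (dec n)) :: nat)" by (rule computable2_swap)
 then obtain h where h: "!!n x. evaluates h [n, enc x] (1 - of_bool (E x (dec n)))"
  unfolding computable2_def by auto
 obtain g where g: "!!n. evaluates g [n] (fst (dec n :: nat \<times> nat))"
 proof -
  have "computable (%n. fst (dec n :: nat \<times> nat))"
   by (rule computable_fst[OF computable_dec])
  thus thesis using that unfolding computable_def by auto
 qed
 show ?thesis
 proof (intro exI[of _ "Comp g [Minimize h]"] allI impI)
  fix x assume "EX i<N. P i x"
  then obtain i n where in': "i < N" "D i x n" using D(2) by auto
  have ex: "EX n. E x (dec n)"
   by (rule exI[of _ "enc (i, n)"]) (use in' in \<open>auto simp: E_def simp del: enc_Pair\<close>)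
  let ?n = "LEAST n. E x (dec n)"
  have E: "E x (dec ?n)" using ex by (rule LeastI_ex)
  have "evaluates (Minimize h) [enc x] ?n"
  proof (rule evaluates.minimize)
   show "evaluates h [?n, enc x] 0" using h[of ?n x] E by simp
   show "EX y. evaluates h [m, enc x] (Suc y)" if "m < ?n" for m
    using h[of m x] not_less_Least[OF that] by auto
  qed
  hence "evaluates (Comp g [Minimize h]) [enc x] (fst (dec ?n :: nat \<times> nat))"
   using g by (rule evaluates_comp1)
  thus "EX i<N. P i x & evaluates (Comp g [Minimize h]) [enc x] i"
   using E D(2) unfolding E_def by blast
 qed
qed

section \<open>Iterating morphisms\<close>

abbreviation it :: "('a => 'a list) => nat => 'a list => 'a list" where
 "it f n \<equiv> extend f ^^ n"

definition mpow :: "('a => 'a list) => nat => 'a => 'a list" where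
 "mpow f k b = it f k [b]"

text \<open>The conjugate of \<open>f\<close> under reversal. It turns every statement on prefixes
  of images into one on suffixes.\<close>

definition mir :: "('a => 'a list) => 'a => 'a list" where
 "mir f b = rev (f b)"

lemma extend_Nil [simp]: "extend f [] = []"
 and extend_Cons [simp]: "extend f (b # w) = f b @ extend f w"
 by (simp_all add: extend_def)

lemma it_append: "it f n (u @ v) = it f n u @ it f n v"
 by (induction n) (simp_all add: extend_append)

lemma it_Nil [simp]: "it f n [] = []"
 by (induction n) simp_all

lemma it_Cons: "it f n (b # w) = it f n [b] @ it f n w"
 using it_append[of n f "[b]" w] by simp

lemma it_add: "it f (m + n) w = it f m (it f n w)"
 by (simp add: funpow_add)

lemma it_Suc: "it f (Suc n) w = it f n (extend f w)"
 by (simp add: funpow_swap1)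

lemma it_Suc_letter: "it f (Suc n) [b] = it f n (f b)"
 by (simp only: it_Suc extend_Cons extend_Nil append_Nil2)

lemma it_concat: "it f n w = concat (map (%b. it f n [b]) w)"
proof (induction w)
 case (Cons b w)
 thus ?case using it_Cons[of n f b w] by simp
qed simp

lemma set_extend: "set (extend f w) = (UN b:set w. set (f b))"
 by (simp add: extend_def)

lemma set_it: "set (it f n w) = (UN b:set w. set (it f n [b]))"
 by (subst it_concat) simp

lemma length_it: "length (it f n w) = sum_list (map (%b. length (it f n [b])) w)"
 by (subst it_concat) (simp add: length_concat comp_def)

lemma it_closed:
 assumes "!!b. b : S ==> set (f b) <= S" "set w <= S"
 shows "set (it f n w) <= S"
 by (induction n) (use assms in \<open>auto simp: set_extend\<close>)

lemma it_persist:
 assumes "!!c. P c ==> EX d:set (f c). P d" "EX c:set w. P c"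
 shows "EX c:set (it f n w). P c"
proof (induction n)
 case (Suc n)
 then obtain c where "c : set (it f n w)" "P c" by blast
 with assms(1)[of c] show ?case by (auto simp: set_extend)
qed (use assms(2) in simp)

lemma extend_mpow: "extend (mpow f k) w = it f k w"
 by (subst it_concat) (simp add: extend_def mpow_def[abs_def])

lemma it_mpow: "it (mpow f k) n w = it f (k * n) w"
proof (induction n)
 case (Suc n)
 have "it (mpow f k) (Suc n) w = extend (mpow f k) (it (mpow f k) n w)" by simp
 also have "... = it f k (it f (k * n) w)" unfolding Suc extend_mpow ..
 also have "... = it f (k * Suc n) w" by (simp add: it_add[symmetric])
 finally show ?case .
qed simp

lemma it_mir: "it (mir f) n (rev w) = rev (it f n w)"
proof (induction n)
 case (Suc n)
 have "extend (mir f) (rev v) = rev (extend f v)" for v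
  by (induction v) (simp_all add: extend_append mir_def)
 with Suc show ?case by simp
qed simp

lemma it_mir_letter: "it (mir f) n [b] = rev (it f n [b])"
 using it_mir[of n f "[b]"] by simp

lemma it_cong:
 assumes "!!b. b : S ==> f b = g b" "!!b. b : S ==> set (f b) <= S" "set w <= S"
 shows "it f n w = it g n w"
proof (induction n)
 case (Suc n)
 have "set (it f n w) <= S" using it_closed assms(2,3) by metis
 hence "extend f (it f n w) = extend g (it f n w)"
  using assms(1) unfolding extend_def by (metis map_cong subset_code(1))
 with Suc show ?case by simp
qed simp

lemma length_it_subset: "b : set w ==> length (it f n [b]) <= length (it f n w)"
 unfolding length_it[of n f w] by (rule member_le_sum_list) auto

lemma length_it_le: "(!!b. b : set w ==> length (it f n [b]) <= K) ==> length (it f n w) <= length w * K"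
proof (induction w)
 case (Cons b w)
 thus ?case by (subst it_Cons) (simp add: add_mono)
qed simp

lemma it_idem_on:
 assumes "!!b. b : set w ==> extend f (f b) = f b"
 shows "it f (Suc n) w = extend f w"
proof (induction n)
 case (Suc n)
 have "extend f (extend f v) = extend f v" if "set v <= set w" for v
  using that assms by (induction v) (auto simp: extend_append)
 hence "extend f (extend f w) = extend f w" by simp
 with Suc show ?case by simp
qed simp

section \<open>Growing and bounded letters\<close>

definition growing :: "('a => 'a list) => 'a => bool" where
 "growing f b \<longleftrightarrow> (ALL N. EX n. N <= length (it f n [b]))"

lemma not_growing_bound: "~ growing f b ==> EX K. ALL n. length (it f n [b]) <= K"
 unfolding growing_def by (meson nat_le_linear)

lemma not_growing_word_bound:
 assumes "!!b. b : set w ==> ~ growing f b"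
 shows "EX K. ALL n. length (it f n w) <= K"
proof -
 obtain K where K: "!!b n. b : set w ==> length (it f n [b]) <= K b"
  using not_growing_bound[OF assms] by metis
 have "length (it f n [b]) <= Max (K ` set w)" if "b : set w" for b n
  using K[OF that, of n] that by (meson Max_ge finite_imageI finite_set imageI le_trans)
 hence "length (it f n w) <= length w * Max (K ` set w)" for n by (rule length_it_le)
 thus ?thesis by blast
qed

lemma growing_child:
 assumes "growing f b" shows "EX c:set (f b). growing f c"
proof (rule ccontr)
 assume "~ ?thesis"
 then obtain K where K: "!!n. length (it f n (f b)) <= K" using not_growing_word_bound by metis
 have "length (it f n [b]) <= Suc K" for n
  using K[of "n - 1"] it_Suc_letter[of "n - 1" f b] by (cases n) auto
 with assms show False unfolding growing_def by (meson Suc_n_not_le_n le_trans)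
qed

lemma growing_if_child: "c : set (it f n [b]) ==> growing f c ==> growing f b"
 unfolding growing_def
proof
 fix N assume *: "c : set (it f n [b])" "ALL N. EX n. N <= length (it f n [c])"
 then obtain m where "N <= length (it f m [c])" by auto
 also have "... <= length (it f (m + n) [b])" unfolding it_add using *(1) by (rule length_it_subset)
 finally show "EX n. N <= length (it f n [b])" by blast
qed

lemma growing_descendant: "growing f b ==> EX c:set (it f n [b]). growing f c"
 by (rule it_persist) (auto intro: growing_child)

lemma growing_mir: "growing (mir f) = growing f"
 unfolding growing_def fun_eq_iff it_mir_letter by simp

text \<open>One number \<open>e\<close> serves both as start and as period, as for the idempotent
  power of an element of a finite semigroup: any common multiple of the periods that exceeds all
  preperiods will do.\<close>

lemma eventually_periodic_common:
 fixes g :: "'s => nat => 'b"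
 assumes "finite S" and "!!s. s : S ==> EX i p. p >= 1 & (ALL n>=i. g s (n + p) = g s n)"
 shows "EX e>=1. ALL s:S. ALL n>=e. g s (n + e) = g s n"
 using assms
proof (induction S rule: finite_induct)
 case (insert s S)
 have "EX e>=1. ALL s:S. ALL n>=e. g s (n + e) = g s n"
  by (rule insert.IH) (rule insert.prems, rule insertI2)
 then obtain e where e: "e >= 1" "!!s n. s : S ==> n >= e ==> g s (n + e) = g s n" by blast
 from insert.prems[OF insertI1] obtain i p where p: "p >= 1" "!!n. n >= i ==> g s (n + p) = g s n" by blast
 have mult: "h (n + k * q) = h n" if "!!n. n >= j ==> h (n + q) = h n" "n >= j" for h :: "nat => 'b" and n k q j
 proof (induction k)
  case (Suc k)
  have "h (n + Suc k * q) = h ((n + k * q) + q)" by (simp add: algebra_simps)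
  also have "... = h (n + k * q)" using that by simp
  finally show ?case using Suc by simp
 qed simp
 \<comment> \<open>A multiple of both periods; the factor \<open>Suc i\<close> lifts it above the
   new preperiod.\<close>
 let ?e = "e * p * Suc i"
 have ge: "?e >= e" "?e >= i" "?e >= 1"
 proof -
  have "e * 1 * 1 <= ?e" "1 * 1 * i <= ?e" using e(1) p(1) by (intro mult_le_mono; simp)+
  thus "?e >= e" "?e >= i" "?e >= 1" using e(1) by auto
 qed
 have "g t (n + ?e) = g t n" if "t : insert s S" "n >= ?e" for t n
 proof (cases "t : S")
  case True
  thus ?thesis using mult[of e "g t" e n "p * Suc i"] e(2) that ge by (simp add: algebra_simps)
 next
  case False
  hence "t = s" using that by simp
  thus ?thesis using mult[of i "g s" p n "e * Suc i"] p(2) that ge by (simp add: algebra_simps)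
 qed
 with ge show ?case by blast
qed auto

lemma eventually_periodic_orbit:
 fixes g :: "nat => 'b"
 assumes "finite (range g)" and "!!n. g (Suc n) = T (g n)"
 shows "EX i p. p >= 1 & (ALL n>=i. g (n + p) = g n)"
proof -
 have "~ inj g" using assms(1) finite_imageD infinite_UNIV_nat by blast
 then obtain i j where ij: "i < j" "g i = g j" unfolding inj_def by (metis nat_neq_iff)
 have "g (n + (j - i)) = g n" if "n >= i" for n
  using that
 proof (induction n rule: dec_induct)
  case base thus ?case using ij by simp
 next
  case (step n) thus ?case using assms(2) by simp
 qed
 thus ?thesis using ij by (intro exI[of _ i] exI[of _ "j - i"]) auto
qed

locale morphism =
 fixes f :: "'a => 'a list" and R :: "'a set"
 assumes finite_R: "finite R" and closed: "b : R ==> set (f b) <= R"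
begin

lemma it_in_R: "set w <= R ==> set (it f n w) <= R"
 using closed by (rule it_closed)

lemma it_letter_in_R: "b : R ==> set (it f n [b]) <= R"
 using it_in_R[of "[b]" n] by simp

lemma fast_descendant:
 assumes "!!d. d : R - S ==> EX c:set (f d). c ~: S" "d : R - S"
 shows "EX c:set (it f n [d]). c ~: S"
proof -
 have "EX c:set (it f n [d]). c : R - S"
 proof (rule it_persist)
  show "EX e:set (f c). e : R - S" if "c : R - S" for c using assms(1)[OF that] closed[of c] that by blast
 qed (use assms(2) in simp)
 thus ?thesis by blast
qed

lemma width: obtains W where "W >= 1" "!!b. b : R ==> length (f b) <= W"
proof (rule that[of "Suc (Max ((length \<circ> f) ` R))"])
 show "length (f b) <= Suc (Max ((length \<circ> f) ` R))" if "b : R" for b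
  using that finite_R by (metis Max_ge comp_apply finite_imageI image_eqI le_SucI)
qed simp

lemma length_it_add_le:
 assumes "!!b. b : R ==> length (f b) <= W" "set w <= R"
 shows "length (it f (m + n) w) <= W ^ m * length (it f n w)"
proof (induction m)
 case (Suc m)
 let ?v = "it f (m + n) w"
 have "length (it f 1 ?v) <= length ?v * W"
  using assms it_in_R[OF assms(2), of "m + n"] by (intro length_it_le) (simp add: subset_iff)
 also have "... <= W ^ m * length (it f n w) * W" using Suc by (rule mult_le_mono1)
 finally show ?case by (simp add: algebra_simps)
qed simp

text \<open>Between consecutive multiples of \<open>k\<close> the length grows at most by the factor
  \<open>W ^ k\<close>, so boundedness along the multiples is boundedness.\<close>

lemma growing_mpow:
 assumes "k >= 1" "b : R" shows "growing (mpow f k) b = growing f b"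
proof
 assume "growing (mpow f k) b" thus "growing f b"
  unfolding growing_def it_mpow by blast
next
 assume g: "growing f b"
 obtain W where W: "W >= 1" "!!b. b : R ==> length (f b) <= W" by (rule width) blast
 show "growing (mpow f k) b"
 proof (rule ccontr)
  assume "~ growing (mpow f k) b"
  from not_growing_bound[OF this] obtain K where K: "!!n. length (it f (k * n) [b]) <= K"
   unfolding it_mpow by blast
  have "length (it f n [b]) <= W ^ k * K" for n
  proof -
   have "length (it f (n mod k + k * (n div k)) [b]) <= W ^ (n mod k) * length (it f (k * (n div k)) [b])"
    using W(2) assms(2) by (intro length_it_add_le) auto
   also have "... <= W ^ k * K"
    using W(1) assms(1) K by (intro mult_le_mono power_increasing) (auto intro: less_imp_le)
   finally show ?thesis by simp
  qed
  thus False using g unfolding growing_def by (meson Suc_n_not_le_n le_trans)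
 qed
qed

lemma not_growing_finite_orbit:
 assumes "set w <= R" "!!b. b : set w ==> ~ growing f b"
 shows "finite (range (%n. it f n w))"
proof -
 obtain K where K: "!!n. length (it f n w) <= K" using not_growing_word_bound assms(2) by metis
 have "range (%n. it f n w) <= {v. set v <= R & length v <= K}"
  using K it_in_R[OF assms(1)] by auto
 thus ?thesis using finite_lists_length_le[OF finite_R] finite_subset by blast
qed

lemma morphism_mpow: "morphism (mpow f k) R"
 using finite_R it_letter_in_R by unfold_locales (auto simp: mpow_def)

lemma morphism_mir: "morphism (mir f) R"
 using finite_R closed by unfold_locales (auto simp: mir_def)

end

text \<open>Images of bounded letters contain only bounded letters. Hence the first growing letter
  of an image depends on nothing but the first growing letter of the word, and its sequence is the
  orbit of a map on a finite set.\<close>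

lemma first_growing:
 assumes "EX c:set w. growing f c"
 shows "filter (growing f) w ~= []" and
  "hd (filter (growing f) (extend f w)) = hd (filter (growing f) (f (hd (filter (growing f) w))))"
proof -
 from assms obtain y c v where w: "w = y @ c # v" "growing f c" "ALL b:set y. ~ growing f b"
  using split_list_first_prop[OF assms] by blast
 have y: "filter (growing f) y = []" using w(3) by (simp add: filter_empty_conv)
 have "filter (growing f) (extend f y) = []"
  using w(3) growing_if_child[where f = f and n = 1] by (auto simp: filter_empty_conv set_extend)
 moreover have "filter (growing f) (f c) ~= []"
  using growing_child[OF w(2)] by (auto simp: filter_empty_conv)
 ultimately show "filter (growing f) w ~= []"
  "hd (filter (growing f) (extend f w)) = hd (filter (growing f) (f (hd (filter (growing f) w))))"
  using w(1,2) y by (simp_all add: extend_append)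
qed

text \<open>The normal form reached by a suitable power: bounded letters are stable after one step, and
 the first growing letter of the image of a growing letter reproduces itself.\<close>

definition normal :: "('a => 'a list) => 'a set => 'a set => bool" where
 "normal f G B \<longleftrightarrow> (ALL c:G. EX y0 c1 w0 y w. f c = y0 @ c1 # w0 & f c1 = y @ c1 # w &
   c1 : G & set y0 <= B & set y <= B)"

section \<open>Passing to a power in normal form\<close>

context morphism
begin

abbreviation "G \<equiv> {b : R. growing f b}"
abbreviation "B \<equiv> {b : R. ~ growing f b}"

lemma first_growing_orbit:
 assumes "c : G"
 shows "EX i p. p >= 1 & (ALL n>=i. hd (filter (growing f) (it f (n + p) [c])) = hd (filter (growing f) (it f n [c])))"
proof (rule eventually_periodic_orbit[where T = "%b. hd (filter (growing f) (f b))"])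
 have *: "EX d:set (it f n [c]). growing f d" for n using assms growing_descendant by auto
 have "hd (filter (growing f) (it f n [c])) : R" for n
 proof -
  have "hd (filter (growing f) (it f n [c])) : set (filter (growing f) (it f n [c]))"
   using first_growing(1)[OF *] by (rule hd_in_set)
  thus ?thesis using it_letter_in_R[of c n] assms by auto
 qed
 thus "finite (range (%n. hd (filter (growing f) (it f n [c]))))"
  using finite_R by (meson finite_subset image_subsetI)
 show "hd (filter (growing f) (it f (Suc n) [c])) =
   hd (filter (growing f) (f (hd (filter (growing f) (it f n [c])))))" for n
  using first_growing(2)[OF *] by simp
qed

lemma normal_power_aux:
 assumes "e >= 1" "!!c n. c : G ==> n >= e ==>
   hd (filter (growing f) (it f (n + e) [c])) = hd (filter (growing f) (it f n [c]))"
 shows "normal (mpow f e) G B"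
 unfolding normal_def
proof
 fix c assume c: "c : G"
 have split: "EX y c1 w. it f e [b] = y @ c1 # w & c1 : G & set y <= B & c1 = hd (filter (growing f) (it f e [b]))"
  if "b : G" for b
 proof -
  from that growing_descendant have "EX d:set (it f e [b]). growing f d" by auto
  from split_list_first_prop[OF this] obtain y d w
   where d: "it f e [b] = y @ d # w" "growing f d" "ALL z:set y. ~ growing f z" by blast
  moreover have "filter (growing f) y = []" using d(3) by (simp add: filter_empty_conv)
  ultimately show ?thesis using it_letter_in_R[of b e] that
   by (intro exI[of _ y] exI[of _ d] exI[of _ w]) auto
 qed
 from split[OF c] obtain y0 c1 w0 where c1: "it f e [c] = y0 @ c1 # w0" "c1 : G" "set y0 <= B"
  "c1 = hd (filter (growing f) (it f e [c]))" by blast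
 from split[OF c1(2)] obtain y c2 w where c2: "it f e [c1] = y @ c2 # w" "c2 : G" "set y <= B"
  "c2 = hd (filter (growing f) (it f e [c1]))" by blast
 have first_iter: "hd (filter (growing f) (it f n w)) = hd (filter (growing f) (it f n [hd (filter (growing f) w)]))"
  if "EX c:set w. growing f c" for n w
 proof -
  from split_list_first_prop[OF that] obtain y d v
   where w: "w = y @ d # v" "growing f d" "ALL z:set y. ~ growing f z" by blast
  have "filter (growing f) (it f n y) = []"
   using w(3) growing_if_child[where f = f and n = n] set_it[of n f y] by (fastforce simp: filter_empty_conv)
  moreover have "filter (growing f) y = []" using w(3) by (simp add: filter_empty_conv)
  moreover have "filter (growing f) (it f n [d]) ~= []"
   using growing_descendant[OF w(2), of n] by (auto simp: filter_empty_conv)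
  ultimately show ?thesis using w(1,2)
   by (simp add: it_append it_Cons[of n f d v])
 qed
 \<comment> \<open>\<open>c1\<close> and \<open>c2\<close> are the first growing letters after
   \<open>e\<close> and \<open>2e\<close> iterations on \<open>c\<close>. They agree because
   \<open>e\<close> is at once a start and a period of that sequence.\<close>
 have "c2 = hd (filter (growing f) (it f e (it f e [c])))"
  using c2(4) c1(4) c first_iter[OF growing_descendant, of c e e] by simp
 also have "... = c1" using assms(2)[OF c, of e] c1(4) by (simp add: it_add)
 finally show "EX y0 c1 w0 y w. mpow f e c = y0 @ c1 # w0 & mpow f e c1 = y @ c1 # w &
   c1 : G & set y0 <= B & set y <= B"
  unfolding mpow_def using c1 c2 by blast
qed

lemma idem_power_aux:
 assumes "e >= 1" "!!b n. b : B ==> n >= e ==> it f (n + e) [b] = it f n [b]" "b : B"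
 shows "extend (mpow f e) (mpow f e b) = mpow f e b"
 using assms(2)[OF assms(3), of e] by (simp add: extend_mpow mpow_def it_add[symmetric])

end

lemma (in morphism) normal_power:
 obtains e where "e >= 1" "!!b. b : B ==> extend (mpow f e) (mpow f e b) = mpow f e b"
  "normal (mpow f e) G B" "normal (mir (mpow f e)) G B"
proof -
 interpret m: morphism "mir f" R by (rule morphism_mir)
 \<comment> \<open>Bundling the orbit of a bounded letter with the first and last growing letters of
   a growing one yields a single exponent for all requirements. Components that make no sense for a
   letter are kept constant.\<close>
 define g where "g s n = (if s : B then it f n [s] else [],
   if s : G then hd (filter (growing f) (it f n [s])) else undefined,
   if s : G then hd (filter (growing f) (it (mir f) n [s])) else undefined)" for s n
 have gB: "g s n = (it f n [s], undefined, undefined)" if "s : B" for s n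
  using that by (simp add: g_def)
 have gG: "g s n = ([], hd (filter (growing f) (it f n [s])), hd (filter (growing f) (it (mir f) n [s])))"
  if "s : G" for s n
  using that by (simp add: g_def)
 have per: "EX i p. p >= 1 & (ALL n>=i. g s (n + p) = g s n)" if s: "s : R" for s
 proof (cases "s : B")
  case True
  hence "EX i p. p >= 1 & (ALL n>=i. it f (n + p) [s] = it f n [s])"
   by (intro eventually_periodic_orbit[where T = "extend f"] not_growing_finite_orbit) auto
  then obtain i p where ip: "p >= 1" "!!n. n >= i ==> it f (n + p) [s] = it f n [s]" by blast
  have "g s (n + p) = g s n" if "n >= i" for n unfolding gB[OF True] using ip(2)[OF that] by simp
  with ip(1) show ?thesis by blast
 next
  case False
  hence sG: "s : G" using s by auto
  obtain i p where i: "p >= 1" "!!n. n >= i ==> hd (filter (growing f) (it f (n + p) [s])) = hd (filter (growing f) (it f n [s]))"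
   using first_growing_orbit[OF sG] by blast
  obtain j q where j: "q >= 1" "!!n. n >= j ==> hd (filter (growing f) (it (mir f) (n + q) [s])) = hd (filter (growing f) (it (mir f) n [s]))"
   using m.first_growing_orbit[of s] sG unfolding growing_mir by blast
  have m1: "hd (filter (growing f) (it f (n + k * p) [s])) = hd (filter (growing f) (it f n [s]))" if "n >= i" for n k
  proof (induction k)
   case (Suc k)
   thus ?case using i(2)[of "n + k * p"] that by (simp add: algebra_simps)
  qed simp
  have m2: "hd (filter (growing f) (it (mir f) (n + k * q) [s])) = hd (filter (growing f) (it (mir f) n [s]))" if "n >= j" for n k
  proof (induction k)
   case (Suc k)
   thus ?case using j(2)[of "n + k * q"] that by (simp add: algebra_simps)
  qed simp
  have "g s (n + p * q) = g s n" if "n >= max i j" for n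
   unfolding gG[OF sG] using m1[where k = q and n = n] m2[where k = p and n = n] that by (simp add: mult.commute)
  thus ?thesis using i(1) j(1) by (intro exI[of _ "max i j"] exI[of _ "p * q"]) auto
 qed
 from eventually_periodic_common[where g = g, OF finite_R per]
 obtain e where e: "e >= 1" "!!s n. s : R ==> n >= e ==> g s (n + e) = g s n" by blast
 have eB: "it f (n + e) [b] = it f n [b]" if "b : B" "n >= e" for b n
  using e(2)[of b n] that unfolding gB[OF that(1)] by simp
 have eG: "hd (filter (growing f) (it f (n + e) [c])) = hd (filter (growing f) (it f n [c]))"
  "hd (filter (growing f) (it (mir f) (n + e) [c])) = hd (filter (growing f) (it (mir f) n [c]))"
  if "c : G" "n >= e" for c n
  using e(2)[of c n] that unfolding gG[OF that(1)] by simp_all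
 have mm: "mpow (mir f) e = mir (mpow f e)"
  by (rule ext) (simp add: mpow_def mir_def it_mir_letter)
 show thesis
 proof (rule that[OF e(1)])
  show "extend (mpow f e) (mpow f e b) = mpow f e b" if "b : B" for b
   using idem_power_aux[OF e(1) eB] that by blast
  show "normal (mpow f e) G B" using normal_power_aux[OF e(1) eG(1)] by blast
  show "normal (mir (mpow f e)) G B"
   using m.normal_power_aux[OF e(1)] eG(2) unfolding growing_mir mm by blast
 qed
qed

section \<open>Pure morphic words\<close>

text \<open>\<open>R\<close> consists of exactly the letters that occur in \<open>x\<close>. Letters
  without an occurrence could have any growth, with no influence on the complexity.\<close>

locale pure_morphic = morphism f R for f :: "'a => 'a list" and R +
 fixes a :: 'a and x :: "'a word"
 assumes a_in_R: "a : R" and prolongable: "EX u. f a = a # u"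
  and word: "prefix (length (it f n [a])) x = it f n [a]"
  and unbounded: "EX n. N <= length (it f n [a])"
  and reachable: "b : R ==> EX n. b : set (it f n [a])"
begin

lemma growing_a: "growing f a"
 using unbounded by (simp add: growing_def)

lemma a_in_G: "a : G"
 using growing_a a_in_R by simp

definition pre :: "'a list => bool" where
 "pre w \<longleftrightarrow> prefix (length w) x = w"

definition fac :: "'a list => bool" where
 "fac w \<longleftrightarrow> (EX u. pre (u @ w))"

lemma pre_iter: "pre (it f n [a])"
 using word by (simp add: pre_def)

lemma pre_appendD: "pre (u @ v) ==> pre u"
proof -
 assume "pre (u @ v)"
 hence "take (length u) (prefix (length u + length v) x) = u" by (simp add: pre_def)
 thus ?thesis by (simp add: pre_def min_def)
qed

lemma pre_comparable: "pre u ==> pre v ==> length u <= length v ==> EX w. v = u @ w"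
proof -
 assume *: "pre u" "pre v" "length u <= length v"
 have "take (length u) v = take (length u) (prefix (length v) x)" using *(2) unfolding pre_def by (rule arg_cong[OF sym])
 also have "... = u" using *(1,3) by (simp add: pre_def min_def)
 finally show ?thesis by (metis append_take_drop_id)
qed

lemma pre_subsequence: "pre (prefix n x)"
 by (simp add: pre_def)

lemma pre_imp_iter: "pre w ==> EX n v. it f n [a] = w @ v"
 using unbounded[of "length w"] pre_comparable pre_iter by blast

lemma pre_it: "pre w ==> pre (it f p w)"
proof -
 assume "pre w"
 then obtain n v where "it f n [a] = w @ v" using pre_imp_iter by blast
 hence "it f (p + n) [a] = it f p w @ it f p v" by (simp add: it_add it_append)
 thus ?thesis using pre_iter pre_appendD by metis
qed

lemma fac_it: "fac w ==> fac (it f p w)"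
 unfolding fac_def using pre_it by (metis it_append)

lemma fac_appendD: "fac (u @ v @ w) ==> fac v"
 unfolding fac_def by (metis append.assoc pre_appendD)

lemma fac_iff: "fac w \<longleftrightarrow> (EX n u v. it f n [a] = u @ w @ v)"
proof
 assume "fac w"
 thus "EX n u v. it f n [a] = u @ w @ v" unfolding fac_def using pre_imp_iter by (metis append.assoc)
next
 assume "EX n u v. it f n [a] = u @ w @ v"
 thus "fac w" unfolding fac_def using pre_iter pre_appendD by (metis append.assoc)
qed

lemma fac_R: "fac w ==> set w <= R"
 using it_letter_in_R[OF a_in_R] by (auto simp: fac_iff) (metis Un_iff set_append subsetD)

lemma factors_eq: "factors x n = {w. fac w & length w = n}"
proof (intro set_eqI iffI)
 fix w assume "w : factors x n"
 then obtain i where w: "w = x [i \<rightarrow> i + n]" by (auto simp: factors_def)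
 hence "prefix (i + n) x = prefix i x @ w" by (simp add: subsequence_append)
 hence "fac w" unfolding fac_def using pre_subsequence by metis
 with w show "w : {w. fac w & length w = n}" by simp
next
 fix w assume "w : {w. fac w & length w = n}"
 then obtain u where u: "pre (u @ w)" "length w = n" by (auto simp: fac_def)
 hence "prefix (length u + n) x = u @ w" by (simp add: pre_def)
 moreover have "prefix (length u + n) x = prefix (length u) x @ x [length u \<rightarrow> length u + n]"
  by (rule subsequence_append)
 ultimately have "w = x [length u \<rightarrow> length u + n]" by (metis append_eq_append_conv subsequence_length u(2) add_diff_cancel_left')
 thus "w : factors x n" by (auto simp: factors_def)
qed

lemma finite_factors: "finite (factors x n)"
proof (rule finite_subset)
 show "factors x n <= {w. set w <= R & length w = n}" unfolding factors_eq using fac_R by auto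
qed (rule finite_lists_length_eq[OF finite_R])

lemma range_x: "x i : R"
 using fac_R[of "[x i]"] pre_subsequence[of "Suc i"] by (auto simp: fac_def)

text \<open>A power has the same fixed point \<open>x\<close> and the same alphabet, so a
  certificate for any power speaks about the original word.\<close>

lemma pure_morphic_mpow:
 assumes k: "k >= 1" shows "pure_morphic (mpow f k) R a x"
proof -
 interpret k: morphism "mpow f k" R by (rule morphism_mpow)
 show ?thesis
 proof
  show "a : R" by (rule a_in_R)
  obtain v where v: "it f k [a] = [a] @ v"
   using pre_comparable[of "[a]" "it f k [a]"] pre_iter[of k] pre_iter[of 0] growing_descendant[OF growing_a, of k]
   by (cases "it f k [a]") auto
  thus "EX u. mpow f k a = a # u" by (simp add: mpow_def)
  show "prefix (length (it (mpow f k) n [a])) x = it (mpow f k) n [a]" for n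
   unfolding it_mpow by (rule word)
  show "EX n. N <= length (it (mpow f k) n [a])" for N
   using growing_mpow[OF k a_in_R] growing_a unfolding growing_def by blast
  show "EX n. b : set (it (mpow f k) n [a])" if b: "b : R" for b
  proof -
   obtain n where n: "b : set (it f n [a])" using reachable[OF b] by blast
   have "n <= k * n" using k by simp
   have mono: "set (it f m [a]) <= set (it f (m + j) [a])" for m j
   proof (induction j)
    case (Suc j)
    obtain u where "f a = a # u" using prolongable by blast
    hence "it f (Suc (m + j)) [a] = it f (m + j) [a] @ it f (m + j) u"
     by (metis it_Cons it_Suc_letter)
    with Suc show ?case by auto
   qed simp
   show ?thesis unfolding it_mpow using mono[of n "k * n - n"] n \<open>n <= k * n\<close> by auto
  qed
 qed
qed

end

lemma pure_morphic_limit_word: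
 assumes "converges_on f a" "finite R" "!!b. b : R ==> set (f b) <= R" "a : R"
 shows "pure_morphic f {b. EX n. b : set (it f n [a])} a (limit_word f a)"
proof
 have "{b. EX n. b : set (it f n [a])} <= R" using it_closed[of R f "[a]"] assms(3,4) by auto
 thus "finite {b. EX n. b : set (it f n [a])}" using assms(2) finite_subset by blast
 show "set (f b) <= {b. EX n. b : set (it f n [a])}" if b: "b : {b. EX n. b : set (it f n [a])}" for b
 proof
  fix c assume "c : set (f b)"
  moreover obtain n where "b : set (it f n [a])" using b by auto
  ultimately have "c : set (it f (Suc n) [a])" by (auto simp: set_extend)
  thus "c : {b. EX n. b : set (it f n [a])}" by blast
 qed
 show "a : {b. EX n. b : set (it f n [a])}" by (auto intro: exI[of _ 0])
 show "EX u. f a = a # u" using assms(1) by (simp add: converges_on_def)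
 show "prefix (length (it f n [a])) (limit_word f a) = it f n [a]" for n
  using prefix_limit_word[OF assms(1), of n] by (simp add: iterate_def)
 show "EX n. N <= length (it f n [a])" for N
 proof -
  have "eventually (%k. N <= length (iterate f a k)) sequentially"
   using assms(1) by (auto simp: converges_on_def filterlim_at_top)
  thus ?thesis by (auto simp: eventually_sequentially iterate_def)
 qed
qed auto

section \<open>Ultimately periodic words\<close>

definition uper :: "'a word => bool" where
 "uper x \<longleftrightarrow> (EX N q. q >= 1 & (ALL i>=N. x (i + q) = x i))"

lemma uper_bounded:
 assumes "uper x" shows "EX K. ALL n. card (factors x n) <= K"
proof -
 obtain N q where q: "q >= 1" "!!i. i >= N ==> x (i + q) = x i" using assms by (auto simp: uper_def)
 have "EX j<N + q. x [i \<rightarrow> i + n] = x [j \<rightarrow> j + n]" for i n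
 proof (induction i rule: less_induct)
  case (less i)
  show ?case
  proof (cases "i < N + q")
   case False
   have "x (i + k) = x (i - q + k)" for k
    using q(2)[of "i - q + k"] False by (simp add: algebra_simps)
   hence "x [i \<rightarrow> i + n] = x [i - q \<rightarrow> i - q + n]"
    by (intro nth_equalityI) auto
   moreover have "i - q < i" using False q(1) by linarith
   ultimately show ?thesis using less[of "i - q"] by auto
  qed auto
 qed
 hence "factors x n <= (%j. x [j \<rightarrow> j + n]) ` {..<N + q}" for n
  unfolding factors_def by blast
 hence "card (factors x n) <= card ((%j. x [j \<rightarrow> j + n]) ` {..<N + q})" for n
  by (intro card_mono) auto
 moreover have "card ((%j. x [j \<rightarrow> j + n]) ` {..<N + q}) <= N + q" for n
  using card_image_le[of "{..<N + q}"] by simp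
 ultimately have "card (factors x n) <= N + q" for n by (rule order_trans)
 thus ?thesis by blast
qed

text \<open>The theorem of Morse and Hedlund: if the number of factors does not increase from
  \<open>n\<close> to \<open>n + 1\<close>, every factor of length \<open>n\<close> has a single
  right extension, and two occurrences of one factor continue alike for ever.\<close>

lemma not_uper_card_factors:
 fixes x :: "'a word"
 assumes "~ uper x" and fin: "!!n. finite (factors x n)"
 shows "Suc n <= card (factors x n)"
proof (induction n)
 case 0
 have "factors x 0 = {[]}" by (auto simp: factors_def)
 thus ?case by simp
next
 case (Suc n)
 have surj: "take n ` factors x (Suc n) = factors x n"
 proof (intro set_eqI iffI)
  fix w assume "w : factors x n"
  then obtain i where "w = x [i \<rightarrow> i + n]" by (auto simp: factors_def)
  hence "w = take n (x [i \<rightarrow> i + Suc n])" by simp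
  thus "w : take n ` factors x (Suc n)" unfolding factors_def by blast
 next
  fix w assume "w : take n ` factors x (Suc n)"
  then obtain i where "w = take n (x [i \<rightarrow> i + Suc n])" by (auto simp: factors_def)
  hence "w = x [i \<rightarrow> i + n]" by simp
  thus "w : factors x n" unfolding factors_def by blast
 qed
 have "card (factors x n) < card (factors x (Suc n))"
 proof (rule ccontr)
  assume "~ ?thesis"
  moreover have "card (factors x n) <= card (factors x (Suc n))"
   using card_image_le[OF fin, of "take n" "Suc n"] surj by simp
  ultimately have "card (take n ` factors x (Suc n)) = card (factors x (Suc n))" using surj by simp
  hence inj: "inj_on (take n) (factors x (Suc n))" using fin by (simp add: eq_card_imp_inj_on)
  have ext: "x [i \<rightarrow> i + Suc n] = x [j \<rightarrow> j + Suc n]" if "x [i \<rightarrow> i + n] = x [j \<rightarrow> j + n]" for i j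
  proof (rule inj_onD[OF inj])
   show "take n (x [i \<rightarrow> i + Suc n]) = take n (x [j \<rightarrow> j + Suc n])" using that by simp
  qed (auto simp: factors_def)
  have "finite (range (%i. x [i \<rightarrow> i + n]))" using fin[of n] by (simp add: factors_def full_SetCompr_eq)
  hence "~ inj (%i. x [i \<rightarrow> i + n])" using finite_imageD infinite_UNIV_nat by blast
  then obtain i j where ij: "i < j" "x [i \<rightarrow> i + n] = x [j \<rightarrow> j + n]"
   unfolding inj_def by (metis nat_neq_iff)
  have all: "x [i + k \<rightarrow> i + k + n] = x [j + k \<rightarrow> j + k + n]" for k
  proof (induction k)
   case (Suc k)
   have "drop 1 (x [i + k \<rightarrow> i + k + Suc n]) = drop 1 (x [j + k \<rightarrow> j + k + Suc n])" using ext[OF Suc] by simp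
   thus ?case by (simp del: subseq_to_Suc)
  qed (use ij in simp)
  have "x (i + k + n) = x (j + k + n)" for k
   using arg_cong[OF ext[OF all[of k]], of "%w. w ! n"] by (simp del: subseq_to_Suc)
  note shift = this
  have "x (m + (j - i)) = x m" if "m >= i + n" for m
  proof -
   have "m = i + (m - i - n) + n" "m + (j - i) = j + (m - i - n) + n" using that ij(1) by auto
   thus ?thesis using shift[of "m - i - n"] by metis
  qed
  hence "uper x" using ij(1) unfolding uper_def by (intro exI[of _ "i + n"] exI[of _ "j - i"]) auto
  with assms(1) show False by simp
 qed
 with Suc show ?case by simp
qed

section \<open>Kernels of iterated morphisms on infinite words\<close>

text \<open>Prefix comparability: the words have no mismatch at a common position.\<close>

definition pc :: "'a list => 'a list => bool" where
 "pc u v \<longleftrightarrow> (EX z. u = v @ z | v = u @ z)"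

lemma pc_Nil [simp]: "pc [] v" "pc u []"
 by (auto simp: pc_def)

lemma pc_Cons [simp]: "pc (c # u) (d # v) \<longleftrightarrow> c = d & pc u v"
 by (auto simp: pc_def)

lemma pc_iff_take: "pc u v \<longleftrightarrow> take (length v) u = take (length u) v"
 by (auto simp: pc_def) (metis append_take_drop_id linear take_all)

lemma pc_take: "pc u v ==> N <= length u ==> N <= length v ==> take N u = take N v"
 by (auto simp: pc_def)

lemma pc_extend: "pc u v ==> pc (extend f u) (extend f v)"
 by (auto simp: pc_def extend_append)

lemma not_pc_split:
 "~ pc u v ==> EX p c d u' v'. u = p @ c # u' & v = p @ d # v' & c ~= d"
proof (induction u arbitrary: v)
 case (Cons c u)
 then obtain d v' where v: "v = d # v'" by (cases v) auto
 show ?case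
 proof (cases "c = d")
  case True
  with Cons v obtain p c' d' u1 v1 where "u = p @ c' # u1" "v' = p @ d' # v1" "c' ~= d'" by force
  thus ?thesis using v True by (metis append_Cons)
 next
  case False
  thus ?thesis using v by (metis append_Nil)
 qed
qed auto

text \<open>A finitary substitute for two infinite words that begin with \<open>c\<close> and
  \<open>c'\<close> and have the same image.\<close>

definition agree :: "('a => 'a list) => 'a set => 'a => 'a => bool" where
 "agree f S c c' \<longleftrightarrow> (ALL N. EX u v. set u <= S & set v <= S & N <= length (extend f (c # u)) &
   N <= length (extend f (c' # v)) & take N (extend f (c # u)) = take N (extend f (c' # v)))"

text \<open>On \<open>S\<close> the morphism factors through an alphabet with one letter less. Such
  morphisms are called simplifiable, the others elementary.\<close>

definition factorable :: "('a => 'a list) => 'a set => bool" where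
 "factorable f S \<longleftrightarrow> (EX b:S. EX g h. (ALL c:S. f c = extend h (g c) & set (g c) <= S - {b}) &
   (ALL c:S - {b}. set (h c) <= S))"

lemma agree_sym: "agree f S c c' ==> agree f S c' c"
 unfolding agree_def by metis

text \<open>A compactness argument: a choice that depends on \<open>N\<close> is made uniform, since
  a property that holds for large \<open>N\<close> holds for all smaller ones.\<close>

lemma finite_antimono_choice:
 assumes "finite S" "!!N :: nat. EX e:S. P N e" "!!N M e. N <= M ==> P M e ==> P N e"
 shows "EX e:S. ALL N. P N e"
proof (rule ccontr)
 assume "~ ?thesis"
 then obtain N where N: "!!e. e : S ==> ~ P (N e) e" by metis
 obtain e where e: "e : S" "P (Max (N ` S)) e" using assms(2) by blast
 hence "N e <= Max (N ` S)" using assms(1) by simp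
 with e assms(3) N show False by blast
qed

text \<open>The defect effect: when \<open>f c\<close> is a prefix of \<open>f c'\<close>, cutting it off makes \<open>f\<close> shorter without
 destroying the coincidence, until some letter is erased.\<close>

lemma defect:
 assumes "finite S" "!!c. c : S ==> set (f c) <= S" "c : S" "c' : S" "c ~= c'" "agree f S c c'"
 shows "factorable f S"
 using assms(2-)
proof (induction "SUM c:S. length (f c)" arbitrary: f c c' rule: less_induct)
 case less
 have goal: "factorable f S" if le: "length (f c) <= length (f c')" and c: "c : S" "c' : S" "c ~= c'"
  and ag: "agree f S c c'" for c c'
 proof -
  obtain z where z: "f c' = f c @ z"
  proof -
   obtain u v where "take (length (f c')) (extend f (c # u)) = take (length (f c')) (extend f (c' # v))"
    using ag unfolding agree_def by blast
   hence "f c' = f c @ take (length (f c') - length (f c)) (extend f u)" using le by simp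
   thus thesis by (rule that)
  qed
  show ?thesis
  proof (cases "f c = []")
   case True
   \<comment> \<open>A letter that is erased anyway can be deleted beforehand, so \<open>f\<close>
     factors through the letters other than \<open>c\<close>.\<close>
   show ?thesis unfolding factorable_def
   proof (rule bexI[OF _ c(1)], rule exI[of _ "%d. if d = c then [] else [d]"], rule exI[of _ f],
     intro conjI ballI)
    fix d assume "d : S"
    thus "f d = extend f (if d = c then [] else [d])" "set (if d = c then [] else [d]) <= S - {c}"
     using True by auto
   qed (use less.prems(1) in blast)
  next
   case False
   \<comment> \<open>\<open>ta\<close> replaces \<open>c'\<close> by \<open>c c'\<close>, and
     \<open>f'\<close> sends \<open>c'\<close> to the rest of its image. Then \<open>f\<close> is
     \<open>ta\<close> followed by \<open>f'\<close>, while the total length of the images drops by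
     the length of \<open>f c\<close>.\<close>
   define f' where "f' = f(c' := z)"
   define ta where "ta d = (if d = c' then [c, c'] else [d])" for d
   have comp: "extend f' (ta d) = f d" for d using c z by (simp add: f'_def ta_def)
   have comp': "extend f' (extend ta w) = extend f w" for w
    by (induction w) (simp_all add: extend_append comp)
   have taS: "set w <= S ==> set (extend ta w) <= S" for w
    using c by (auto simp: set_extend ta_def split: if_splits)
   have closed': "set (f' d) <= S" if "d : S" for d
    using less.prems(1)[OF that] less.prems(1)[OF c(2)] z by (auto simp: f'_def)
   have smaller: "(SUM d:S. length (f' d)) < (SUM d:S. length (f d))"
    by (rule sum_strict_mono_ex1[OF assms(1)]) (use z False c in \<open>auto simp: f'_def\<close>)
   define P where "P N e \<longleftrightarrow> (EX u v. set u <= S & set v <= S & N <= length (extend f' (e # u)) &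
     N <= length (extend f' (c' # v)) & take N (extend f' (e # u)) = take N (extend f' (c' # v)))" for N e
   have "EX e:S - {c'}. P N e" for N
   proof -
    \<comment> \<open>The common prefix \<open>f c\<close> is cut off, and one more letter ensures
      that \<open>u\<close> is not empty.\<close>
    let ?N = "Suc N + length (f c)"
    obtain u v where uv: "set u <= S" "set v <= S" "?N <= length (extend f (c # u))"
     "?N <= length (extend f (c' # v))" "take ?N (extend f (c # u)) = take ?N (extend f (c' # v))"
     using ag unfolding agree_def by blast
    have len: "Suc N <= length (extend f u)" "Suc N <= length (z @ extend f v)" using uv(3,4) z by auto
    have tk: "take (Suc N) (extend f u) = take (Suc N) (z @ extend f v)" using uv(5) z by simp
    from len(1) obtain d u1 where u: "u = d # u1" by (cases u) auto
    \<comment> \<open>\<open>ta\<close> maps no word to one beginning with \<open>c'\<close>, so the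
      new pair \<open>e\<close>, \<open>c'\<close> again consists of different letters.\<close>
    define e where "e = (if d = c' then c else d)"
    obtain u' where u': "extend ta u = e # u'" using u by (cases "d = c'") (simp_all add: ta_def e_def)
    have "extend f' (e # u') = extend f u" using u' comp' by metis
    moreover have "extend f' (c' # extend ta v) = z @ extend f v" using comp'[of v] by (simp add: f'_def)
    moreover have "e : S - {c'}" using u uv(1) c by (auto simp: e_def)
    moreover have "set u' <= S" "set (extend ta v) <= S" using taS[OF uv(1)] taS[OF uv(2)] u' by auto
    moreover have "take N (extend f u) = take N (z @ extend f v)"
     using tk by (metis Suc_n_not_le_n linear min.absorb1 take_take)
    ultimately show ?thesis unfolding P_def using len by (metis Suc_leD)
   qed
   moreover have "P N e" if "N <= M" "P M e" for N M e
   proof -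
    from that(2) obtain u v where uv: "set u <= S" "set v <= S" "M <= length (extend f' (e # u))"
     "M <= length (extend f' (c' # v))" "take M (extend f' (e # u)) = take M (extend f' (c' # v))"
     unfolding P_def by blast
    have "take N (extend f' (e # u)) = take N (extend f' (c' # v))"
     using arg_cong[OF uv(5), of "take N"] that(1) unfolding take_take by (simp only: min_absorb1)
    thus ?thesis unfolding P_def using uv that(1) le_trans by blast
   qed
   ultimately obtain e where e: "e : S - {c'}" "ALL N. P N e"
    using finite_antimono_choice[of "S - {c'}" P] assms(1) by blast
   hence "agree f' S e c'" unfolding agree_def P_def by blast
   with less.hyps[OF smaller closed', of e c'] e(1) c(2) have "factorable f' S" by blast
   then obtain b g h where b: "b : S" "!!d. d : S ==> f' d = extend h (g d)"
    "!!d. d : S ==> set (g d) <= S - {b}" "!!d. d : S - {b} ==> set (h d) <= S"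
    unfolding factorable_def by blast
   have ext: "extend f' w = extend h (extend g w)" if "set w <= S" for w
    using that b(2) by (induction w) (auto simp: extend_append)
   show ?thesis unfolding factorable_def
   proof (rule bexI[OF _ b(1)], rule exI[of _ "%d. extend g (ta d)"], rule exI[of _ h],
     intro conjI ballI)
    fix d assume "d : S"
    hence "set (ta d) <= S" using c by (auto simp: ta_def)
    thus "f d = extend h (extend g (ta d))" "set (extend g (ta d)) <= S - {b}"
     using ext[of "ta d"] comp[of d] b(3) by (simp, fastforce simp: set_extend)
   qed (use b(4) in blast)
  qed
 qed
 show ?case
 proof (cases "length (f c) <= length (f c')")
  case True thus ?thesis using goal less.prems by blast
 next
  case False
  thus ?thesis using goal[of c' c] less.prems agree_sym by (metis linear)
 qed
qed

text \<open>A chain of words stands for its limit, which may be a finite word; \<open>aeq\<close> says that the limits agree.\<close>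

definition chain :: "(nat => 'a list) => bool" where
 "chain W \<longleftrightarrow> (ALL k l. k <= l --> (EX z. W l = W k @ z))"

definition aeq :: "(nat => 'a list) => (nat => 'a list) => bool" where
 "aeq W W' \<longleftrightarrow> (ALL k l. pc (W k) (W' l))"

definition unbd :: "(nat => 'a list) => bool" where
 "unbd W \<longleftrightarrow> (ALL N. EX k. N <= length (W k))"

lemma chain_extend: "chain W ==> chain (%k. extend f (W k))"
 unfolding chain_def by (metis extend_append)

lemma aeq_extend: "aeq W W' ==> aeq (%k. extend f (W k)) (%k. extend f (W' k))"
 unfolding aeq_def using pc_extend by blast

lemma aeq_it: "aeq W W' ==> aeq (%k. it f n (W k)) (%k. it f n (W' k))"
 by (induction n) (use aeq_extend in auto)

text \<open>An elementary morphism is injective on infinite words: at the first mismatch of two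
  words with the same image stand two different letters that agree, which the defect effect
  excludes.\<close>

lemma aeq_extendD:
 assumes S: "finite S" "!!c. c : S ==> set (f c) <= S" "~ factorable f S"
  and W: "chain W" "!!k. set (W k) <= S" "unbd (%k. extend f (W k))"
  and W': "chain W'" "!!k. set (W' k) <= S" "unbd (%k. extend f (W' k))"
  and eq: "aeq (%k. extend f (W k)) (%k. extend f (W' k))"
 shows "aeq W W'"
proof (rule ccontr)
 assume "~ aeq W W'"
 then obtain k l where "~ pc (W k) (W' l)" by (auto simp: aeq_def)
 then obtain p c d u v where p: "W k = p @ c # u" "W' l = p @ d # v" "c ~= d" using not_pc_split by blast
 have cont: "EX z. N <= length (extend f (V k @ z)) & (EX k'. V k' = V k @ z)"
  if V: "chain V" "unbd (%k. extend f (V k))" for V :: "nat => 'a list" and N k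
 proof -
  obtain k1 where k1: "N <= length (extend f (V k1))" using V(2) by (auto simp: unbd_def)
  obtain z where z: "V (max k k1) = V k @ z" using V(1) unfolding chain_def by (metis max.cobounded1)
  obtain y where "V (max k k1) = V k1 @ y" using V(1) unfolding chain_def by (metis max.cobounded2)
  hence "N <= length (extend f (V (max k k1)))" using k1 by (simp add: extend_append)
  thus ?thesis using z by metis
 qed
 have "agree f S c d"
  unfolding agree_def
 proof
  fix N
  let ?N = "N + length (extend f p)"
  obtain z k' where z: "?N <= length (extend f (W k @ z))" "W k' = W k @ z" using cont[OF W(1,3)] by blast
  obtain y l' where y: "?N <= length (extend f (W' l @ y))" "W' l' = W' l @ y" using cont[OF W'(1,3)] by blast
  have "take ?N (extend f (W k')) = take ?N (extend f (W' l'))"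
   using pc_take[of "extend f (W k')" "extend f (W' l')" ?N] eq z y unfolding aeq_def by metis
  hence "take N (extend f (c # u @ z)) = take N (extend f (d # v @ y))"
   using z y p by (simp add: extend_append)
  moreover have "N <= length (extend f (c # u @ z))" "N <= length (extend f (d # v @ y))"
   using z(1) y(1) p by (simp_all add: extend_append)
  moreover have "set (u @ z) <= S" "set (v @ y) <= S" using W(2)[of k'] W'(2)[of l'] z(2) y(2) p by auto
  ultimately show "EX u v. set u <= S & set v <= S & N <= length (extend f (c # u)) &
   N <= length (extend f (d # v)) & take N (extend f (c # u)) = take N (extend f (d # v))" by blast
 qed
 moreover have "c : S" "d : S" using W(2)[of k] W'(2)[of l] p by auto
 ultimately have "factorable f S" using S(2) p(3) by (intro defect[OF S(1)])
 with S(3) show False by contradiction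
qed

lemma unbd_extendD: "unbd (%k. extend f (V k)) ==> finite S ==> (!!k. set (V k) <= S) ==> unbd V"
proof -
 assume u: "unbd (%k. extend f (V k))" and S: "finite S" "!!k. set (V k) <= S"
 let ?K = "Suc (Max ((length \<circ> f) ` S))"
 have "length (f b) <= ?K" if "b : S" for b
  using that S(1) by (metis Max_ge comp_apply finite_imageI image_eqI le_SucI)
 hence le: "length (extend f (V k)) <= length (V k) * ?K" for k
  using length_it_le[of "V k" 1 f ?K] S(2)[of k] by auto
 show "unbd V"
  unfolding unbd_def
 proof
  fix N
  obtain k where "N * ?K <= length (extend f (V k))" using u unfolding unbd_def by blast
  hence "N * ?K <= length (V k) * ?K" using le order_trans by blast
  hence "N <= length (V k)" by (simp only: mult_le_cancel2)
  thus "EX k. N <= length (V k)" ..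
 qed
qed

text \<open>If \<open>f\<close> is elementary on \<open>S\<close>, all iterations can be cancelled.
  Otherwise \<open>f\<close> factors through a smaller alphabet, and exchanging the two factors
  gives a morphism there at the cost of one iteration. Hence \<open>card S\<close> iterations
  identify whatever is identified at all.\<close>

lemma kernel_stabilizes:
 assumes "finite S" "!!c. c : S ==> set (f c) <= S"
  and "chain W" "!!k. set (W k) <= S" "!!n. unbd (%k. it f n (W k))"
  and "chain W'" "!!k. set (W' k) <= S" "!!n. unbd (%k. it f n (W' k))"
  and "aeq (%k. it f n (W k)) (%k. it f n (W' k))" "card S <= m"
 shows "aeq (%k. it f m (W k)) (%k. it f m (W' k))"
 using assms
proof (induction "card S" arbitrary: S f W W' m rule: less_induct)
 case less
 note fin = less.prems(1) and cl = less.prems(2) and W = less.prems(3-5) and W' = less.prems(6-8)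
 show ?case
 proof (cases "factorable f S")
  case True
  then obtain b g h where b: "b : S" "!!d. d : S ==> f d = extend h (g d)"
   "!!d. d : S ==> set (g d) <= S - {b}" "!!d. d : S - {b} ==> set (h d) <= S"
   unfolding factorable_def by blast
  \<comment> \<open>With \<open>f\<close> being \<open>g\<close> followed by \<open>h\<close>, the
    power \<open>Suc n\<close> of \<open>f\<close> is \<open>g\<close>, then the \<open>n\<close>-th
    power of \<open>F\<close>, then \<open>h\<close>.\<close>
  define F where "F c = extend g (h c)" for c
  have ext: "extend f w = extend h (extend g w)" if "set w <= S" for w
   using that b(2) by (induction w) (auto simp: extend_append)
  have F: "extend F v = extend g (extend h v)" for v
   by (induction v) (auto simp: extend_append F_def)
  have inS: "set (it f n w) <= S" if "set w <= S" for w n using it_closed[of S f w n] cl that by blast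
  have conj: "extend g (it f n w) = it F n (extend g w)" if "set w <= S" for w n
  proof (induction n)
   case (Suc n)
   show ?case using ext[OF inS[OF that]] Suc by (simp add: F)
  qed simp
  have conj': "it f (Suc n) w = extend h (it F n (extend g w))" if "set w <= S" for w n
   using ext[OF inS[OF that]] conj[OF that] by simp
  have gS: "set (extend g w) <= S - {b}" if "set w <= S" for w
   using that b(3) by (auto simp: set_extend)
  have Fcl: "set (F d) <= S - {b}" if "d : S - {b}" for d
   unfolding F_def using gS b(4)[OF that] by blast
  have unb: "unbd (%k. it F n (extend g (V k)))" if "!!k. set (V k) <= S" "!!n. unbd (%k. it f n (V k))" for V n
  proof (rule unbd_extendD)
   show "unbd (%k. extend h (it F n (extend g (V k))))" using that(2)[of "Suc n"] conj'[OF that(1)] by simp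
   show "set (it F n (extend g (V k))) <= S" for k
    using it_closed[of "S - {b}" F "extend g (V k)" n] Fcl gS[OF that(1)] by blast
  qed (rule fin)
  obtain m' where m': "m = Suc m'" using b(1) fin less.prems(10) by (cases m) auto
  have "aeq (%k. it F m' (extend g (W k))) (%k. it F m' (extend g (W' k)))"
  proof (rule less.hyps[of "S - {b}" F "%k. extend g (W k)" "%k. extend g (W' k)" m'])
   show "card (S - {b}) < card S" using b(1) fin by (meson card_Diff1_less)
   show "aeq (%k. it F n (extend g (W k))) (%k. it F n (extend g (W' k)))"
    using aeq_extend[OF less.prems(9), of g] conj W(2) W'(2) by simp
   show "card (S - {b}) <= m'" using b(1) fin less.prems(10) m' by simp
  qed (use fin Fcl chain_extend W W' gS unb in auto)
  from aeq_extend[OF this, of h] show ?thesis using conj' W(2) W'(2) m' by simp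
 next
  case False
  have "aeq W W'" if "aeq (%k. it f n (W k)) (%k. it f n (W' k))" for n
   using that
  proof (induction n)
   case (Suc n)
   have ch: "chain V ==> chain (%k. it f n (V k))" for V n
    by (induction n) (use chain_extend in auto)
   have inS: "set (it f n w) <= S" if "set w <= S" for w n using it_closed[of S f w n] cl that by blast
   have "aeq (%k. it f n (W k)) (%k. it f n (W' k))"
    by (rule aeq_extendD[OF fin cl False])
     (use ch[OF W(1)] ch[OF W'(1)] inS W(2) W'(2) W(3)[of "Suc n"] W'(3)[of "Suc n"] Suc.prems in auto)
   thus ?case by (rule Suc.IH)
  qed simp
  with less.prems(9) show ?thesis by (intro aeq_it) blast
 qed
qed

section \<open>Deciding ultimate periodicity of pure morphic words\<close>

text \<open>In an ultimately periodic word the images under \<open>f\<^sup>m\<close> of the tails at two occurrences of a growing letter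
 eventually agree, as they share a prefix longer than the period, and \<open>m = \<bar>R\<bar>\<close> iterations suffice for that.
 Conversely, an agreement of the images for all occurrences makes the word ultimately periodic.\<close>

definition mismatch :: "('a => 'a list) => 'a => nat => 'a set => nat => nat => nat => bool" where
 "mismatch f a m E n i j \<longleftrightarrow> (let w = it f n [a] in 1 <= i & i < j & (EX b:E. take 1 (drop i w) = [b] & take 1 (drop j w) = [b]) &
   ~ pc (it f m (drop i w)) (it f m (drop j w)))"

lemma take_1_drop: "take (Suc 0) (drop i w) = [b] \<longleftrightarrow> i < length w & w ! i = b"
 by (cases "i < length w") (auto simp: Cons_nth_drop_Suc[symmetric])

text \<open>Powers of \<open>v\<close> are mapped to powers of \<open>v\<close>, so all further
  prefixes in steps of \<open>ka\<close> consist of the same initial word followed by a power of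
  \<open>v\<close>.\<close>

definition const_cert :: "('a => 'a list) => 'a => nat => nat => 'a list => nat => nat => bool" where
 "const_cert f a n ka v k l \<longleftrightarrow> v ~= [] & 1 <= ka & it f (n + ka) [a] = it f n [a] @ concat (replicate k v) &
   it f ka v = concat (replicate l v)"

context pure_morphic
begin

lemma it_a_mono: "m <= n ==> EX v. it f n [a] = it f m [a] @ v"
proof -
 assume "m <= n"
 obtain u where u: "it f (n - m) [a] = [a] @ u"
  using pre_comparable[of "[a]" "it f (n - m) [a]"] pre_iter[of "n - m"] pre_iter[of 0]
   growing_descendant[OF growing_a, of "n - m"] by (cases "it f (n - m) [a]") auto
 have "it f n [a] = it f m (it f (n - m) [a])" using \<open>m <= n\<close> by (simp add: it_add[symmetric])
 also have "... = it f m [a] @ it f m u" unfolding u by (rule it_append)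
 finally show ?thesis by blast
qed

lemma length_it_a_mono: "m <= n ==> length (it f m [a]) <= length (it f n [a])"
 using it_a_mono by fastforce

lemma unbounded_from: "EX n>=m. N <= length (it f n [a])"
proof -
 obtain n where "N <= length (it f n [a])" using unbounded by blast
 hence "N <= length (it f (max m n) [a])" using length_it_a_mono[of n "max m n"] by simp
 thus ?thesis by (intro exI[of _ "max m n"]) simp
qed

lemma pre_nth: "pre w ==> i < length w ==> w ! i = x i"
 unfolding pre_def by (metis add_0 minus_nat.diff_0 subsequence_nth)

lemma prefix_Suc_shift: "prefix (i + k) x = prefix i x @ x [i \<rightarrow> i + k]"
 by (rule subsequence_append)

lemma it_shift_unbd: "unbd (%k. it f n (x [i \<rightarrow> i + k]))"
 unfolding unbd_def
proof
 fix N
 let ?P = "it f n (prefix i x)"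
 obtain r where r: "N + length ?P <= length (it f r [a])" "n <= r" using unbounded_from by blast
 define m where "m = r - n"
 let ?K = "length (it f m [a])"
 have *: "it f n (prefix ?K x) = it f r [a]" unfolding word using r(2) by (simp add: m_def it_add[symmetric])
 have "length (it f r [a]) <= length (it f n (prefix (i + ?K) x))"
 proof -
  have "prefix (i + ?K) x = prefix (?K + i) x" by (simp add: add.commute)
  also have "... = prefix ?K x @ x [?K \<rightarrow> ?K + i]" by (rule subsequence_append)
  finally have "it f n (prefix (i + ?K) x) = it f n (prefix ?K x) @ it f n (x [?K \<rightarrow> ?K + i])"
   by (simp only: it_append)
  thus ?thesis unfolding * by simp
 qed
 also have "... = length ?P + length (it f n (x [i \<rightarrow> i + ?K]))"
  by (simp only: prefix_Suc_shift it_append length_append)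
 finally show "EX k. N <= length (it f n (x [i \<rightarrow> i + k]))" using r(1) by (intro exI[of _ ?K]) linarith
qed

lemma it_shift_nth:
 assumes "t < length (it f n (x [i \<rightarrow> i + k]))"
 shows "it f n (x [i \<rightarrow> i + k]) ! t = x (length (it f n (prefix i x)) + t)"
proof -
 have "pre (it f n (prefix i x) @ it f n (x [i \<rightarrow> i + k]))"
  using pre_it[OF pre_subsequence[of "i + k"]] by (simp only: prefix_Suc_shift it_append)
 from pre_nth[OF this, of "length (it f n (prefix i x)) + t"] assms show ?thesis by simp
qed

lemma growing_from: "growing f b ==> b : R ==> EX n>=m. N <= length (it f n [b])"
proof (rule ccontr)
 assume g: "growing f b" "b : R" and no: "~ (EX n>=m. N <= length (it f n [b]))"
 have "length (it f n [b]) <= max N (Max ((%n. length (it f n [b])) ` {..m}))" for n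
 proof (cases "n <= m")
  case True
  hence "length (it f n [b]) <= Max ((%n. length (it f n [b])) ` {..m})" by (intro Max_ge) auto
  thus ?thesis by simp
 next
  case False
  thus ?thesis using no by (meson le_cases max.coboundedI1)
 qed
 thus False using g(1) unfolding growing_def by (meson Suc_n_not_le_n le_trans)
qed

lemma chain_shift: "chain (%k. x [i \<rightarrow> i + k])"
 unfolding chain_def
proof (intro allI impI)
 fix k l :: nat assume "k <= l"
 hence "take k (x [i \<rightarrow> i + l]) = x [i \<rightarrow> i + k]" by (simp add: min_def)
 thus "EX z. x [i \<rightarrow> i + l] = x [i \<rightarrow> i + k] @ z" by (metis append_take_drop_id)
qed

lemma set_shift: "set (x [i \<rightarrow> i + k]) <= R"
 using range_x by auto

lemma aeq_if_uper:
 assumes "uper x" "1 <= i" "1 <= j" "x i = x j" "growing f (x i)" "card R <= m"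
 shows "aeq (%k. it f m (x [i \<rightarrow> i + k])) (%k. it f m (x [j \<rightarrow> j + k]))"
proof -
 obtain N q where q: "q >= 1" "!!i. i >= N ==> x (i + q) = x i" using assms(1) by (auto simp: uper_def)
 obtain n1 where n1: "N <= length (it f n1 [a])" using unbounded by blast
 obtain n where n: "n >= n1" "q <= length (it f n [x i])" using growing_from[OF assms(5) range_x] by blast
 \<comment> \<open>Because \<open>i\<close> is at least 1, the prefix contains the initial
   \<open>a\<close>, whose image alone reaches beyond the preperiod.\<close>
 have start: "N <= length (it f n (prefix i x))" if i: "1 <= i" for i
 proof -
  have "prefix 1 x = [a]" using pre_iter[of 0] by (simp add: pre_def)
  hence "prefix i x = [a] @ x [1 \<rightarrow> 1 + (i - 1)]" using subsequence_append[where i = 1 and j = "i - 1" and w = x] i by simp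
  hence "length (it f n [a]) <= length (it f n (prefix i x))" by (simp only: it_append length_append le_add1)
  thus ?thesis using n1 length_it_a_mono[OF n(1)] by linarith
 qed
 let ?I = "length (it f n (prefix i x))" and ?J = "length (it f n (prefix j x))"
 \<comment> \<open>Both tails begin with the image of the same letter, which is at least one period
   long; from there on the period propagates the agreement.\<close>
 have eq: "x (?I + t) = x (?J + t)" for t
 proof (induction t rule: less_induct)
  case (less t)
  show ?case
  proof (cases "t < q")
   case True
   have t: "t < length (it f n [x i])" using True n(2) by simp
   have "it f n [x i] ! t = x (?I + t)" using it_shift_nth[of t n i 1] t by simp
   moreover have "it f n [x j] ! t = x (?J + t)" using it_shift_nth[of t n j 1] t assms(4) by simp
   ultimately show ?thesis using assms(4) by metis
  next
   case False
   hence t: "t = (t - q) + q" by simp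
   have "x (?I + (t - q) + q) = x (?I + (t - q))" using q(2) start[OF assms(2)] by simp
   moreover have "x (?J + (t - q) + q) = x (?J + (t - q))" using q(2) start[OF assms(3)] by simp
   moreover have "x (?I + (t - q)) = x (?J + (t - q))" using less[of "t - q"] False q(1) by simp
   ultimately show ?thesis using t by (metis add.assoc)
  qed
 qed
 have "aeq (%k. it f n (x [i \<rightarrow> i + k])) (%k. it f n (x [j \<rightarrow> j + k]))"
  unfolding aeq_def pc_iff_take
 proof (intro allI nth_equalityI)
  fix k l t assume "t < length (take (length (it f n (x [j \<rightarrow> j + l]))) (it f n (x [i \<rightarrow> i + k])))"
  thus "take (length (it f n (x [j \<rightarrow> j + l]))) (it f n (x [i \<rightarrow> i + k])) ! t =
    take (length (it f n (x [i \<rightarrow> i + k]))) (it f n (x [j \<rightarrow> j + l])) ! t"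
   using eq[of t] it_shift_nth[of t n i k] it_shift_nth[of t n j l] by simp
 qed simp
 \<comment> \<open>The number \<open>n\<close> of iterations above depends on the unknown period; it
   is traded for the fixed number \<open>m\<close>.\<close>
 from kernel_stabilizes[OF finite_R closed chain_shift set_shift it_shift_unbd chain_shift set_shift it_shift_unbd
   this assms(6)]
 show ?thesis by simp
qed

lemma drop_iter: "i <= length (it f n [a]) ==> drop i (it f n [a]) = x [i \<rightarrow> i + (length (it f n [a]) - i)]"
 using word[of n] by (metis add_0 le_add_diff_inverse subsequence_drop)

lemma mismatch_not_uper:
 assumes "mismatch f a m E n i j" "card R <= m" "!!b. b : E ==> growing f b"
 shows "~ uper x"
proof
 assume u: "uper x"
 let ?w = "it f n [a]"
 have ij: "1 <= i" "i < j" "j < length ?w" "?w ! i = ?w ! j" "growing f (?w ! i)"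
  "~ pc (it f m (drop i ?w)) (it f m (drop j ?w))" using assms(1,3) by (auto simp: mismatch_def Let_def take_1_drop)
 have "x i = ?w ! i" "x j = ?w ! j" using pre_nth[OF pre_iter] ij by auto
 hence "aeq (%k. it f m (x [i \<rightarrow> i + k])) (%k. it f m (x [j \<rightarrow> j + k]))"
  using u ij assms(2) by (intro aeq_if_uper) auto
 hence "pc (it f m (x [i \<rightarrow> i + (length ?w - i)])) (it f m (x [j \<rightarrow> j + (length ?w - j)]))"
  unfolding aeq_def by blast
 moreover have "drop i ?w = x [i \<rightarrow> i + (length ?w - i)]" "drop j ?w = x [j \<rightarrow> j + (length ?w - j)]"
  by (rule drop_iter, use ij in linarith)+
 ultimately have "pc (it f m (drop i ?w)) (it f m (drop j ?w))" by (simp only:)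
 with ij show False by simp
qed

text \<open>By the pigeonhole principle some letter of \<open>E\<close> stands at two positions.
  Without a mismatch the images of the two tails agree, and the distance of their starting points is
  a period.\<close>

lemma not_uper_mismatch:
 assumes "~ uper x" and inf: "infinite {i. x i : E}" and E: "!!b. b : E ==> growing f b"
 shows "EX n i j. mismatch f a m E n i j"
proof -
 have "infinite ({i. x i : E} - {0})" using inf by simp
 moreover have "finite (x ` ({i. x i : E} - {0}))" using finite_R range_x by (meson finite_subset image_subsetI)
 ultimately have "~ inj_on x ({i. x i : E} - {0})" using finite_imageD by blast
 then obtain i' j' where ij': "x i' : E" "1 <= i'" "1 <= j'" "i' ~= j'" "x i' = x j'"
  unfolding inj_on_def by (auto simp: Suc_le_eq)
 obtain i j where ij: "x i : E" "1 <= i" "i < j" "x i = x j"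
  using that[of i' j'] that[of j' i'] ij' by (metis nat_neq_iff)
 show ?thesis
 proof (rule ccontr)
  assume no: "\<nexists>n i j. mismatch f a m E n i j"
  let ?I = "length (it f m (prefix i x))" and ?J = "length (it f m (prefix j x))"
  have eq: "x (?I + t) = x (?J + t)" for t
  proof -
   obtain k where k: "Suc t <= length (it f m (x [j \<rightarrow> j + k]))" using it_shift_unbd unfolding unbd_def by blast
   obtain k' where k': "Suc t <= length (it f m (x [i \<rightarrow> i + k']))" using it_shift_unbd unfolding unbd_def by blast
   obtain n where n: "i + j + k + k' + 1 <= length (it f n [a])" using unbounded by blast
   let ?w = "it f n [a]"
   have "~ mismatch f a m E n i j" using no by blast
   hence "pc (it f m (drop i ?w)) (it f m (drop j ?w))"
    using ij n pre_nth[OF pre_iter, of i n] pre_nth[OF pre_iter, of j n] by (simp add: mismatch_def Let_def take_1_drop)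
   moreover have long: "t < length (it f m (drop l ?w))" if lh: "Suc t <= length (it f m (x [l \<rightarrow> l + h]))"
    "l + h <= length ?w" for l h
   proof -
    have "h <= length ?w - l" "l <= length ?w" using lh(2) by auto
    then obtain z where z: "x [l \<rightarrow> l + (length ?w - l)] = x [l \<rightarrow> l + h] @ z"
     using chain_shift[of l] unfolding chain_def by blast
    have "drop l ?w = x [l \<rightarrow> l + h] @ z" using drop_iter[OF \<open>l <= length ?w\<close>] z by simp
    thus ?thesis using lh(1) by (simp add: it_append)
   qed
   moreover have t: "t < length (it f m (drop i ?w))" "t < length (it f m (drop j ?w))"
    using long[OF k'] long[OF k] n by auto
   ultimately have "it f m (drop i ?w) ! t = it f m (drop j ?w) ! t"
    using pc_take[of "it f m (drop i ?w)" "it f m (drop j ?w)" "Suc t"] by (metis Suc_leI lessI nth_take)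
   thus ?thesis
    using it_shift_nth[of t m i "length ?w - i"] it_shift_nth[of t m j "length ?w - j"] drop_iter[of i n] drop_iter[of j n] t n ij
    by simp
  qed
  \<comment> \<open>The factor between the two positions contains a growing letter, so its image is
    not empty and the period is positive.\<close>
  have "?I < ?J"
  proof -
   have "x i : x ` {i..<i + (j - i)}" by (rule imageI) (use ij in simp)
   hence "x i : set (x [i \<rightarrow> i + (j - i)])" by simp
   moreover have "it f m [x i] ~= []" using growing_descendant[OF E[OF ij(1)], of m] by auto
   ultimately have "it f m (x [i \<rightarrow> i + (j - i)]) ~= []"
    using length_it_subset[of "x i" "x [i \<rightarrow> i + (j - i)]" m f] by auto
   moreover have "prefix j x = prefix i x @ x [i \<rightarrow> i + (j - i)]" using prefix_Suc_shift[of i "j - i"] ij by simp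
   ultimately show ?thesis by (simp add: it_append)
  qed
  have "x (n + (?J - ?I)) = x n" if "n >= ?I" for n
  proof -
   have "?I + (n - ?I) = n" "?J + (n - ?I) = n + (?J - ?I)" using that \<open>?I < ?J\<close> by auto
   thus ?thesis using eq[of "n - ?I"] by metis
  qed
  hence "uper x" using \<open>?I < ?J\<close> unfolding uper_def by (intro exI[of _ ?I] exI[of _ "?J - ?I"]) auto
  with assms(1) show False by simp
 qed
qed

lemma periodic_if_pre_powers:
 assumes "!!t. pre (w @ concat (replicate t v))" "length w <= i"
 shows "x (i + length v) = x i"
proof (cases "v = []")
 case False
 define C where "C = concat (replicate (Suc i) v)"
 have "i * 1 < Suc i * length v" using False by (intro mult_less_le_imp_less) (auto simp: Suc_le_eq)
 hence len: "i < length C" by (simp add: C_def length_concat sum_list_replicate)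
 have "(v @ C) ! (i - length w + length v) = C ! (i - length w)" by (metis add.commute nth_append_length_plus)
 moreover have "(C @ v) ! (i - length w) = C ! (i - length w)" using len by (simp add: nth_append less_imp_diff_less)
 moreover have "C @ v = v @ C"
 proof -
  have "concat (replicate (Suc i) v @ [v]) = concat (v # replicate (Suc i) v)" by (simp only: replicate_append_same)
  thus ?thesis by (simp add: C_def)
 qed
 moreover have "pre (w @ v @ C)" using assms(1)[of "Suc (Suc i)"] by (simp add: C_def)
 ultimately show ?thesis
  using pre_nth[of "w @ v @ C" "i + length v"] pre_nth[of "w @ v @ C" i] assms(2) len by (simp add: nth_append)
qed simp

lemma it_replicate: "it f n (concat (replicate t v)) = concat (replicate t (it f n v))"
 by (induction t) (simp_all add: it_append)

lemma concat_replicate_mult: "concat (replicate t (concat (replicate l v))) = concat (replicate (t * l) v)"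
 by (induction t) (simp_all add: replicate_add)

lemma const_cert_uper:
 assumes "const_cert f a n ka v k l" shows "uper x"
proof -
 have c: "v ~= []" "1 <= ka" "it f (n + ka) [a] = it f n [a] @ concat (replicate k v)" "it f ka v = concat (replicate l v)"
  using assms by (auto simp: const_cert_def)
 have pow: "EX t. it f (n + j * ka) [a] = it f n [a] @ concat (replicate t v)" for j
 proof (induction j)
  case (Suc j)
  then obtain t where t: "it f (n + j * ka) [a] = it f n [a] @ concat (replicate t v)" by blast
  have "it f (n + Suc j * ka) [a] = it f ka (it f (n + j * ka) [a])" unfolding it_add[symmetric] by (simp add: add_ac)
  also have "... = it f (n + ka) [a] @ concat (replicate (t * l) v)"
   unfolding t it_append it_replicate c(4) concat_replicate_mult it_add[symmetric] by (simp add: add.commute)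
  also have "... = it f n [a] @ concat (replicate (k + t * l) v)" unfolding c(3) by (simp add: replicate_add)
  finally show ?case by blast
 qed (auto intro: exI[of _ 0])
 have "pre (it f n [a] @ concat (replicate t v))" for t
 proof -
  obtain j where j: "length (it f n [a]) + t * length v <= length (it f j [a])" using unbounded by blast
  have "j * 1 <= n + j * ka" using c(2) by (intro trans_le_add2 mult_le_mono2)
  hence "length (it f j [a]) <= length (it f (n + j * ka) [a])" by (intro length_it_a_mono) simp
  moreover obtain t' where t': "it f (n + j * ka) [a] = it f n [a] @ concat (replicate t' v)" using pow by blast
  moreover from t' have "length (it f (n + j * ka) [a]) = length (it f n [a]) + t' * length v"
   by (simp add: length_concat sum_list_replicate)
  ultimately have "t * length v <= t' * length v" using j by linarith
  hence "t <= t'" using c(1) by simp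
  then obtain s where "t' = t + s" using le_Suc_ex by blast
  thus ?thesis using pre_iter[of "n + j * ka"] pre_appendD[of "it f n [a] @ concat (replicate t v)" "concat (replicate s v)"]
   unfolding t' by (simp add: replicate_add)
 qed
 hence "x (i + length v) = x i" if "length (it f n [a]) <= i" for i using periodic_if_pre_powers that by blast
 thus ?thesis unfolding uper_def using c(1) by (intro exI[of _ "length (it f n [a])"] exI[of _ "length v"]) (simp add: Suc_le_eq)
qed

text \<open>Both the growth of \<open>f\<^sup>n(a)\<close> and the lengths of the images of a period are multiples of the least period
 \<open>q\<close> if \<open>n\<close> and \<open>ka\<close> are chosen such that \<open>\<bar>f\<^sup>n(a)\<bar>\<close> and \<open>\<bar>f\<^bsup>n+ka\<^esup>(a)\<bar>\<close> agree modulo \<open>q\<close>.\<close>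

lemma uper_const_cert:
 assumes "uper x" shows "EX n ka v k l. const_cert f a n ka v k l"
proof -
 \<comment> \<open>The least eventual period is taken, since it divides every other one.\<close>
 define Q where "Q p \<longleftrightarrow> 1 <= p & (EX N. ALL i>=N. x (i + p) = x i)" for p
 define q where "q = (LEAST p. Q p)"
 have "EX p. Q p" using assms by (auto simp: uper_def Q_def)
 hence "Q q" unfolding q_def by (rule LeastI_ex)
 then obtain N where q: "1 <= q" "!!i. i >= N ==> x (i + q) = x i" by (auto simp: Q_def)
 have shift: "x (i + t * q) = x i" if "N <= i" for i t
 proof (induction t)
  case (Suc t)
  thus ?case using q(2)[of "i + t * q"] that by (simp add: algebra_simps)
 qed simp
 have dvd: "q dvd p" if p: "!!i. M <= i ==> x (i + p) = x i" for p M
 proof (rule ccontr)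
  assume "~ q dvd p"
  hence "1 <= p mod q" by (simp add: dvd_eq_mod_eq_0)
  moreover have "x (i + p mod q) = x i" if "max M N <= i" for i
  proof -
   have "x (i + p mod q) = x (i + p mod q + p div q * q)" by (rule shift[symmetric]) (use that in simp)
   also have "... = x i" using p[of i] that by (simp add: add.assoc)
   finally show ?thesis .
  qed
  ultimately have "Q (p mod q)" unfolding Q_def by blast
  hence "q <= p mod q" unfolding q_def by (rule Least_le)
  moreover have "p mod q < q" using q(1) by simp
  ultimately show False by simp
 qed
 obtain n0 where n0: "N <= length (it f n0 [a])" using unbounded by blast
 \<comment> \<open>Two iterates have lengths congruent modulo \<open>q\<close> by the pigeonhole
   principle, so the gap between them is filled by whole periods.\<close>
 have "finite (range (%n. length (it f (n0 + n) [a]) mod q))"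
  by (rule finite_subset[of _ "{..<q}"]) (use q(1) in auto)
 hence "~ inj (%n. length (it f (n0 + n) [a]) mod q)" using finite_imageD infinite_UNIV_nat by blast
 then obtain n1 n2 where n12: "n1 < n2" "length (it f (n0 + n1) [a]) mod q = length (it f (n0 + n2) [a]) mod q"
  unfolding inj_def by (metis nat_neq_iff)
 define n ka where "n = n0 + n1" and "ka = n2 - n1"
 define i where "i = length (it f n [a])"
 have i: "N <= i" using n0 length_it_a_mono[of n0 n] by (simp add: i_def n_def)
 have ka: "1 <= ka" "n0 + n2 = n + ka" using n12(1) by (simp_all add: ka_def n_def)
 define v where "v = x [i \<rightarrow> i + q]"
 have v: "x [j \<rightarrow> j + t * q] = concat (replicate t v)" if j: "j = i + s * q" for s t j
 proof (induction t)
  case (Suc t)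
  have vj: "x [j + t * q \<rightarrow> j + t * q + q] = v"
  proof (rule nth_equalityI)
   fix r assume "r < length (x [j + t * q \<rightarrow> j + t * q + q])"
   thus "x [j + t * q \<rightarrow> j + t * q + q] ! r = v ! r"
    using shift[of "i + r" "s + t"] i by (simp add: v_def j algebra_simps)
  qed (simp add: v_def)
  have "take (t * q) (x [j \<rightarrow> j + (t * q + q)]) @ drop (t * q) (x [j \<rightarrow> j + (t * q + q)]) = x [j \<rightarrow> j + t * q] @ v"
   unfolding subsequence_take subsequence_drop vj[symmetric] by (simp add: min_def add.assoc)
  hence "x [j \<rightarrow> j + (t * q + q)] = x [j \<rightarrow> j + t * q] @ v" unfolding append_take_drop_id .
  also have "... = concat (replicate t v @ [v])" using Suc by simp
  finally show ?case by (simp only: replicate_append_same replicate_Suc mult_Suc add.commute)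
 qed simp
 have len_v: "length v = q" by (simp add: v_def)
 have pre_u: "pre (it f n [a] @ concat (replicate t v))" for t
  using pre_subsequence[of "i + t * q"] v[of i 0 t] pre_iter[of n]
  by (simp add: prefix_Suc_shift i_def pre_def length_concat sum_list_replicate len_v)
 have "i <= length (it f (n + ka) [a])" unfolding i_def by (rule length_it_a_mono) simp
 moreover have "length (it f (n + ka) [a]) mod q = i mod q" using n12(2) unfolding ka(2) by (simp add: i_def n_def)
 ultimately have "q dvd length (it f (n + ka) [a]) - i" by (rule mod_eq_dvd_iff_nat[THEN iffD1])
 then obtain k where k: "length (it f (n + ka) [a]) = i + k * q"
 proof -
  obtain k where "length (it f (n + ka) [a]) - i = q * k" using \<open>q dvd length (it f (n + ka) [a]) - i\<close> by (rule dvdE)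
  hence "length (it f (n + ka) [a]) = i + k * q" using \<open>i <= length (it f (n + ka) [a])\<close> by (simp add: mult.commute)
  thus thesis by (rule that)
 qed
 have ext: "it f (n + ka) [a] = it f n [a] @ concat (replicate k v)"
  using pre_iter[of "n + ka"] pre_iter[of n] v[of i 0 k] unfolding pre_def k by (simp add: prefix_Suc_shift i_def)
 have pre_v: "pre (it f (n + ka) [a] @ concat (replicate t (it f ka v)))" for t
  using pre_it[OF pre_u[of t], of ka] by (simp add: it_append it_replicate it_add[symmetric] add.commute)
 have "q dvd length (it f ka v)" using periodic_if_pre_powers[OF pre_v] by (rule dvd)
 then obtain l where l: "length (it f ka v) = l * q" by (metis dvdE mult.commute)
 have "it f ka v = concat (replicate l v)"
 proof -
  have "prefix (i + k * q + l * q) x = it f (n + ka) [a] @ it f ka v" using pre_v[of 1] unfolding pre_def by (simp add: k l)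
  moreover have "prefix (i + k * q) x = it f (n + ka) [a]" using pre_iter[of "n + ka"] unfolding pre_def k .
  ultimately show ?thesis using prefix_Suc_shift[of "i + k * q" "l * q"] v[of "i + k * q" k l] by simp
 qed
 moreover have "v ~= []" using q(1) by (simp add: v_def)
 ultimately show ?thesis unfolding const_cert_def using ext ka(1) by blast
qed

end

section \<open>Positive eigenvectors of irreducible matrices\<close>

text \<open>Bolzano and Weierstrass for finitely many coordinates, by repeated thinning.\<close>

lemma finite_bounded_subsequence:
 fixes v :: "nat => 'i => real"
 assumes "finite K" "!!n i. i : K ==> \<bar>v n i\<bar> <= C"
 shows "EX r l. strict_mono r & (ALL i:K. (%n. v (r n) i) \<longlonglongrightarrow> l i)"
 using assms
proof (induction K rule: finite_induct)
 case empty
 show ?case using strict_mono_id by auto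
next
 case (insert i K)
 have "EX r l. strict_mono r & (ALL i:K. (%n. v (r n) i) \<longlonglongrightarrow> l i)"
  by (rule insert.IH) (use insert.prems in blast)
 then obtain r l where r: "strict_mono r" "!!i. i : K ==> (%n. v (r n) i) \<longlonglongrightarrow> l i" by blast
 obtain s :: "nat => nat" where s: "strict_mono s" "monoseq (%n. v (r (s n)) i)"
  using seq_monosub[of "%n. v (r n) i"] by blast
 have "Bseq (%n. v (r (s n)) i)" by (rule BseqI'[where K = C]) (use insert.prems in auto)
 then obtain y where y: "(%n. v (r (s n)) i) \<longlonglongrightarrow> y"
  using Bseq_monoseq_convergent[OF _ s(2)] by (auto simp: convergent_def)
 have "(%n. v ((r \<circ> s) n) j) \<longlonglongrightarrow> (l(i := y)) j" if "j : insert i K" for j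
 proof (cases "j = i")
  case False
  hence "((%n. v (r n) j) \<circ> s) \<longlonglongrightarrow> l j" using r(2) s(1) that by (intro LIMSEQ_subseq_LIMSEQ) auto
  thus ?thesis using False by (simp add: comp_def)
 qed (use y in \<open>simp add: comp_def\<close>)
 thus ?case using strict_mono_o[OF r(1) s(1)] by blast
qed

lemma trancl_leaves:
 assumes "(i, j) : E\<^sup>+" "i ~: P" "j : P"
 shows "EX i' j'. (i', j') : E & i' ~: P & j' : P"
 using assms by (induction rule: trancl_induct) auto

text \<open>Collatz--Wielandt: the least \<open>rate\<close> with \<open>M v <= rate v\<close> for some positive \<open>v\<close> is an eigenvalue; otherwise
 lowering \<open>v\<close> at the strict places makes all places strict, and \<open>rate\<close> could be lowered.\<close>

lemma perron:
 fixes M :: "'i => 'i => real"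
 assumes K: "finite K" "K ~= {}" and nn: "!!i j. 0 <= M i j"
  and irr: "!!i j. i : K ==> j : K ==> (i, j) : {(i, j). i : K & j : K & 0 < M i j}\<^sup>+"
 shows "EX rate u. 0 < rate & (ALL i:K. 0 < u i) & (ALL i:K. (SUM j:K. M i j * u j) = rate * u i)"
proof -
 let ?E = "{(i, j). i : K & j : K & 0 < M i j}"
 define A where "A v i = (SUM j:K. M i j * v j)" for v i
 define sub where "sub ga v \<longleftrightarrow> (ALL i:K. 0 <= v i) & (SUM i:K. v i) = 1 & (ALL i:K. A v i <= ga * v i)" for ga v
 define T where "T = {ga. 0 <= ga & (EX v. sub ga v)}"
 have cK: "0 < card K" using K by (simp add: card_gt_0_iff)
 have "(SUM i:K. SUM j:K. M i j) : T"
 proof -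
  have "A (%i. 1 / card K) i <= (SUM i:K. SUM j:K. M i j) * (1 / card K)" if "i : K" for i
  proof -
   have "(SUM j:K. M i j) <= (SUM i:K. SUM j:K. M i j)"
    using that K(1) nn by (intro member_le_sum) (auto intro: sum_nonneg)
   hence "(SUM j:K. M i j) * (1 / card K) <= (SUM i:K. SUM j:K. M i j) * (1 / card K)"
    by (intro mult_right_mono) auto
   thus ?thesis unfolding A_def by (simp only: sum_distrib_right)
  qed
  hence "sub (SUM i:K. SUM j:K. M i j) (%i. 1 / card K)" using cK by (simp add: sub_def)
  thus ?thesis unfolding T_def using nn by (auto intro!: sum_nonneg)
 qed
 hence T: "T ~= {}" "bdd_below T" by (auto simp: T_def intro: bdd_belowI)
 define rate where "rate = Inf T"
 have rate_le: "rate <= ga" if "ga : T" for ga unfolding rate_def using that T(2) by (rule cInf_lower)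
 have "EX g v. sub g v & g < rate + 1 / Suc n & rate <= g" for n
 proof -
  have "EX g:T. g < rate + 1 / Suc n" using T unfolding rate_def by (intro cInf_lessD) auto
  thus ?thesis using rate_le by (auto simp: T_def)
 qed
 then obtain g v where gv: "!!n. sub (g n) (v n)" "!!n. g n < rate + 1 / Suc n" "!!n. rate <= g n" by metis
 have "\<bar>v n i\<bar> <= 1" if "i : K" for n i
  using gv(1)[of n] member_le_sum[of i K "v n"] that K(1) by (auto simp: sub_def)
 then obtain r l where r: "strict_mono r" "!!i. i : K ==> (%n. v (r n) i) \<longlonglongrightarrow> l i"
  using finite_bounded_subsequence[OF K(1)] by metis
 have "(%n. rate + 1 / Suc n) \<longlonglongrightarrow> rate" by real_asymp
 hence "g \<longlonglongrightarrow> rate"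
  by (rule tendsto_sandwich[rotated 2, OF tendsto_const]) (use gv(2,3) in \<open>auto intro!: always_eventually less_imp_le\<close>)
 hence gr: "(%n. g (r n)) \<longlonglongrightarrow> rate" using LIMSEQ_subseq_LIMSEQ[OF _ r(1)] by (simp add: comp_def)
 have l: "sub rate l"
  unfolding sub_def
 proof (intro conjI ballI)
  show "0 <= l i" if "i : K" for i
   using r(2)[OF that] gv(1) that by (intro LIMSEQ_le_const[OF r(2)[OF that]]) (auto simp: sub_def)
  have "(%n. SUM i:K. v (r n) i) \<longlonglongrightarrow> (SUM i:K. l i)" by (intro tendsto_sum r(2))
  moreover have "(SUM i:K. v (r n) i) = 1" for n using gv(1) by (simp add: sub_def)
  ultimately show "(SUM i:K. l i) = 1" by (simp add: LIMSEQ_const_iff)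
  show "A l i <= rate * l i" if "i : K" for i
  proof (rule LIMSEQ_le)
   show "(%n. A (v (r n)) i) \<longlonglongrightarrow> A l i" unfolding A_def by (intro tendsto_sum tendsto_mult tendsto_const r(2))
   show "(%n. g (r n) * v (r n) i) \<longlonglongrightarrow> rate * l i" by (intro tendsto_mult gr r(2) that)
   show "EX N. ALL n>=N. A (v (r n)) i <= g (r n) * v (r n) i" using gv(1) that by (auto simp: sub_def)
  qed
 qed
 \<comment> \<open>If some coordinate vanished, irreducibility would give a positive entry leading
   from a vanishing coordinate to a positive one, against the inequality at the former.\<close>
 have pos: "0 < w i" if w: "sub rate w" and i: "i : K" for w i
 proof (rule ccontr)
  let ?P = "{i : K. 0 < w i}"
  assume "~ 0 < w i"
  hence "i ~: ?P" by simp
  have "?P ~= {}"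
  proof
   assume "?P = {}"
   hence "w i = 0" if "i : K" for i using w that by (force simp: sub_def)
   hence "(SUM i:K. w i) = 0" by simp
   with w show False by (simp add: sub_def)
  qed
  then obtain j where "j : ?P" by blast
  with trancl_leaves[OF irr[OF i] \<open>i ~: ?P\<close>, of j] obtain i' j' where
   ij: "i' : K" "j' : K" "0 < M i' j'" "i' ~: ?P" "j' : ?P" by auto
  have "0 < M i' j' * w j'" using ij by simp
  also have "... <= A w i'" unfolding A_def
   using ij(2) K(1) nn w by (intro member_le_sum[of j' K "%j. M i' j * w j"]) (auto simp: sub_def)
  also have "... <= rate * w i'" using w ij(1) by (simp add: sub_def)
  also have "w i' = 0" using ij(1,4) w by (force simp: sub_def)
  finally show False by simp
 qed
 have rate: "0 < rate"
 proof -
  obtain i where i: "i : K" using K(2) by blast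
  from irr[OF i i] obtain j where j: "j : K" "0 < M i j" by (auto elim: tranclE dest: tranclD)
  have "0 < M i j * l j" using j pos[OF l] by simp
  also have "... <= A l i" unfolding A_def
   using j(1) K(1) nn l by (intro member_le_sum[of j K "%j. M i j * l j"]) (auto simp: sub_def)
  also have "... <= rate * l i" using l i by (simp add: sub_def)
  finally show ?thesis using pos[OF l i] by (simp add: zero_less_mult_iff)
 qed
 define strict where "strict w = {i : K. A w i < rate * w i}" for w
 define pv where "pv w \<longleftrightarrow> (ALL i:K. 0 < w i) & (ALL i:K. A w i <= rate * w i)" for w
 \<comment> \<open>If all inequalities were strict, the largest quotient \<open>A w i / w i\<close>
   would be an element of \<open>T\<close> below its infimum.\<close>
 have not_all: "strict w ~= K" if w: "pv w" for w
 proof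
  assume s: "strict w = K"
  define S where "S = (SUM i:K. w i)"
  define ga where "ga = Max ((%i. A w i / w i) ` K)"
  have S: "0 < S" unfolding S_def using w K by (intro sum_pos) (auto simp: pv_def)
  have le: "A w i / w i <= ga" if "i : K" for i unfolding ga_def using that K(1) by simp
  have "ga : (%i. A w i / w i) ` K" unfolding ga_def using K by (intro Max_in) auto
  then obtain i where i: "i : K" "ga = A w i / w i" by blast
  have "A w i < rate * w i" using s i(1) unfolding strict_def by blast
  hence "ga < rate" unfolding i(2) using w i(1) by (simp add: pv_def pos_divide_less_eq)
  have A0: "0 <= A w i" unfolding A_def using nn w by (intro sum_nonneg) (auto simp: pv_def less_imp_le)
  have "0 <= ga" using i A0 w by (auto simp: pv_def less_imp_le)
  have "A (%i. w i / S) i = A w i / S" for i by (simp add: A_def sum_divide_distrib)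
  moreover have "A w i <= ga * w i" if "i : K" for i using le[OF that] w that by (auto simp: pv_def divide_simps)
  moreover have "(SUM i:K. w i / S) = 1" using S by (simp add: S_def flip: sum_divide_distrib)
  ultimately have "sub ga (%i. w i / S)"
   using S w by (auto simp: sub_def pv_def less_imp_le divide_right_mono)
  hence "ga : T" using \<open>0 <= ga\<close> by (auto simp: T_def)
  with rate_le \<open>ga < rate\<close> show False by force
 qed
 have larger: "EX w'. pv w' & card (strict w) < card (strict w')" if w: "pv w" and ne: "strict w ~= {}" for w
 proof -
  have sK: "strict w <= K" by (auto simp: strict_def)
  hence fin: "finite (strict w)" using K(1) finite_subset by blast
  obtain i0 where i0: "i0 : K" "i0 ~: strict w" using not_all[OF w] sK by blast
  obtain j0 where j0: "j0 : strict w" using ne by blast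
  from trancl_leaves[OF irr[OF i0(1)] i0(2) j0] sK j0 obtain i1 j1 where
   e: "i1 : K" "j1 : K" "0 < M i1 j1" "i1 ~: strict w" "j1 : strict w" by auto
  \<comment> \<open>Half of the least slack leaves the strict places strict and positive. Lowering
    the coordinate \<open>j1\<close> makes the inequality at \<open>i1\<close> strict as
    well.\<close>
  define ep where "ep = Min ((%i. (w i - A w i / rate) / 2) ` strict w)"
  have eps_pos: "0 < ep" unfolding ep_def using fin ne rate
   by (subst Min_gr_iff) (auto simp: strict_def divide_simps mult.commute)
  have eps_le: "ep <= (w i - A w i / rate) / 2" if "i : strict w" for i
   unfolding ep_def using that fin by (intro Min_le) auto
  define w' where "w' i = (if i : strict w then w i - ep else w i)" for i
  have w'_le: "w' i <= w i" for i using eps_pos by (simp add: w'_def)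
  have A_mono: "A w' i <= A w i" for i unfolding A_def using nn w'_le by (intro sum_mono mult_left_mono) auto
  have A0: "0 <= A w i" for i unfolding A_def using nn w by (intro sum_nonneg) (auto simp: pv_def less_imp_le)
  have st: "A w' i < rate * w' i" "0 < w' i" if i: "i : strict w" for i
  proof -
   have "A w i < rate * w i" using i by (simp add: strict_def)
   hence "A w i / rate < w i" using rate by (simp add: divide_simps mult.commute)
   hence *: "A w i / rate < w' i" using eps_le[OF i] i unfolding w'_def by (simp add: field_simps)
   hence "A w i < rate * w' i" using rate by (simp add: divide_simps mult.commute)
   thus "A w' i < rate * w' i" using A_mono[of i] by linarith
   have "0 <= A w i / rate" using A0 rate by simp
   thus "0 < w' i" using * by linarith
  qed
  have i1: "A w' i1 < rate * w' i1"
  proof -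
   have "A w' i1 < A w i1" unfolding A_def
   proof (rule sum_strict_mono_ex1[OF K(1)])
    show "ALL j:K. M i1 j * w' j <= M i1 j * w j" using nn w'_le by (auto intro: mult_left_mono)
    show "EX j:K. M i1 j * w' j < M i1 j * w j" using e eps_pos by (intro bexI[of _ j1]) (auto simp: w'_def)
   qed
   also have "... <= rate * w i1" using w e(1) by (simp add: pv_def)
   finally show ?thesis using e(4) by (simp add: w'_def)
  qed
  have "pv w'"
   unfolding pv_def
  proof (intro conjI ballI)
   fix i assume i: "i : K"
   show "0 < w' i" using st(2)[of i] w i by (cases "i : strict w") (auto simp: pv_def w'_def)
   show "A w' i <= rate * w' i"
   proof (cases "i : strict w")
    case True thus ?thesis using st(1) by (simp add: less_imp_le)
   next
    case False
    thus ?thesis using A_mono[of i] w i by (auto simp: pv_def w'_def intro: order_trans)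
   qed
  qed
  moreover have "strict w \<subset> strict w'"
   using st(1) i1 e sK by (auto simp: strict_def)
  moreover have "finite (strict w')" using K(1) by (simp add: strict_def)
  ultimately show ?thesis using psubset_card_mono by blast
 qed
 have none: "strict w = {}" if "pv w" for w
  using that
 proof (induction "card K - card (strict w)" arbitrary: w rule: less_induct)
  case less
  show ?case
  proof (rule ccontr)
   assume "strict w ~= {}"
   then obtain w' where w': "pv w'" "card (strict w) < card (strict w')" using larger less.prems by blast
   have "card (strict w') <= card K" using K(1) by (intro card_mono) (auto simp: strict_def)
   hence "strict w' = {}" using less.hyps[of w'] w' by auto
   with w'(2) show False by simp
  qed
 qed
 have "pv l" using l pos[OF l] by (auto simp: pv_def sub_def)
 with none have "ALL i:K. A l i = rate * l i" by (force simp: strict_def pv_def)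
 with rate pos[OF l] show ?thesis unfolding A_def by blast
qed

section \<open>Growth of letters\<close>

definition grows :: "(nat => real) => nat => real => bool" where
 "grows L deg rate \<longleftrightarrow> 0 < rate & (EX c C. 0 < c & 0 < C &
   (EV n. c * (real n ^ deg * rate ^ n) <= L n & L n <= C * (real n ^ deg * rate ^ n)))"

text \<open>This class is closed under sums, exponential factors and partial sums, which is what
  solving the length recursion requires. The zero alternative is there for sums over no
  letters.\<close>

definition tame :: "(nat => real) => bool" where
 "tame L \<longleftrightarrow> (EV n. L n = 0) | (EX deg rate. grows L deg rate)"

lemma poly_exp_le:
 assumes "0 < rate" "rate < rate' | rate = rate' & deg <= deg'"
 shows "EX C>0. EV n. real n ^ deg * rate ^ n <= C * (real n ^ deg' * rate' ^ n)"
proof (cases "rate < rate'")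
 case True
 define rk where "rk = rate / rate'"
 have rk: "0 < rk" "rk < 1" using True assms(1) by (auto simp: rk_def)
 have "(%n. real n ^ deg * rk ^ n) \<longlonglongrightarrow> 0" using rk by real_asymp
 hence "(%n. real n ^ deg * rate ^ n / rate' ^ n) \<longlonglongrightarrow> 0" by (simp add: rk_def power_divide)
 hence "EV n. real n ^ deg * rate ^ n / rate' ^ n < 1" by (rule order_tendstoD) simp
 hence "EV n. real n ^ deg * rate ^ n <= 1 * (real n ^ deg' * rate' ^ n)"
  using eventually_ge_at_top[of 1]
 proof eventually_elim
  case (elim n)
  have "real n ^ deg * rate ^ n <= 1 * rate' ^ n" using elim(1) True assms(1) by (simp add: divide_simps)
  also have "1 * rate' ^ n <= real n ^ deg' * rate' ^ n" using elim(2) True assms(1) by (intro mult_right_mono) auto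
  finally show ?case by simp
 qed
 thus ?thesis using zero_less_one by blast
next
 case False
 hence eq: "rate = rate'" "deg <= deg'" using assms(2) by auto
 have "EV n. real n ^ deg * rate ^ n <= 1 * (real n ^ deg' * rate' ^ n)"
  using eventually_ge_at_top[of 1]
 proof eventually_elim
  case (elim n)
  thus ?case using eq assms(1) by (simp add: power_increasing)
 qed
 thus ?thesis using zero_less_one by blast
qed

lemma grows_sandwich:
 assumes "grows U deg rate" "0 < c" "0 < C" "EV n. c * U n <= L n & L n <= C * U n"
 shows "grows L deg rate"
proof -
 from assms(1) obtain d D where d: "0 < rate" "0 < d" "0 < D"
  and ev: "EV n. d * (real n ^ deg * rate ^ n) <= U n & U n <= D * (real n ^ deg * rate ^ n)"
  unfolding grows_def by blast
 from ev assms(4) have "EV n. (c * d) * (real n ^ deg * rate ^ n) <= L n & L n <= (C * D) * (real n ^ deg * rate ^ n)"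
 proof eventually_elim
  case (elim n)
  have "c * (d * (real n ^ deg * rate ^ n)) <= c * U n" "C * U n <= C * (D * (real n ^ deg * rate ^ n))"
   using elim assms(2,3) by (auto intro!: mult_left_mono)
  with elim show ?case by (simp add: mult.assoc)
 qed
 thus ?thesis unfolding grows_def using d assms(2,3) by (meson mult_pos_pos)
qed

lemma tame_sandwich:
 assumes "tame U" "0 < c" "0 < C" "EV n. c * U n <= L n & L n <= C * U n"
 shows "tame L"
 using assms(1) unfolding tame_def
proof
 assume "EV n. U n = 0"
 with assms(4) have "EV n. L n = 0" by eventually_elim auto
 thus "(EV n. L n = 0) | (EX deg rate. grows L deg rate)" ..
qed (use grows_sandwich[OF _ assms(2-4)] in blast)

lemma tame_cmult: "tame L ==> 0 < c ==> tame (%n. c * L n)"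
 by (rule tame_sandwich[where U = L and c = c and C = c]) auto

lemma tame_zero: "tame (%n. 0)"
 by (simp add: tame_def)

lemma grows_nonneg: "grows L deg rate ==> EV n. 0 <= L n"
 unfolding grows_def by (auto elim!: eventually_mono intro: order_trans[rotated])

lemma grows_dominated_add:
 assumes "grows L deg rate" "grows L' deg' rate'" "rate' < rate | rate' = rate & deg' <= deg"
 shows "grows (%n. L n + L' n) deg rate"
proof -
 from assms(1) obtain d D where d: "0 < rate" "0 < d" "0 < D"
  and ev: "EV n. d * (real n ^ deg * rate ^ n) <= L n & L n <= D * (real n ^ deg * rate ^ n)"
  unfolding grows_def by blast
 from assms(2) obtain d' D' where d': "0 < rate'" "0 < d'" "0 < D'"
  and ev': "EV n. d' * (real n ^ deg' * rate' ^ n) <= L' n & L' n <= D' * (real n ^ deg' * rate' ^ n)"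
  unfolding grows_def by blast
 from poly_exp_le[OF d'(1) assms(3)] obtain C where C: "C > 0"
  and le: "EV n. real n ^ deg' * rate' ^ n <= C * (real n ^ deg * rate ^ n)" by blast
 have "EV n. d * (real n ^ deg * rate ^ n) <= L n + L' n &
   L n + L' n <= (D + D' * C) * (real n ^ deg * rate ^ n)"
  using ev ev' le grows_nonneg[OF assms(2)]
 proof eventually_elim
  case (elim n)
  have "D' * (real n ^ deg' * rate' ^ n) <= D' * (C * (real n ^ deg * rate ^ n))" using elim d' by (intro mult_left_mono) auto
  with elim show ?case by (simp add: algebra_simps)
 qed
 moreover have "0 < D + D' * C" using d d' C by (simp add: add_pos_pos)
 ultimately show ?thesis unfolding grows_def using d by blast
qed

lemma tame_add:
 assumes "tame L" "tame L'" shows "tame (%n. L n + L' n)"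
proof -
 have zero: "tame (%n. A n + Z n)" if "tame A" "EV n. Z n = 0" for A Z :: "nat => real"
  using that(1) unfolding tame_def
 proof
  assume "EV n. A n = 0"
  with that(2) have "EV n. A n + Z n = 0" by eventually_elim simp
  thus "(EV n. A n + Z n = 0) | (EX deg rate. grows (%n. A n + Z n) deg rate)" ..
 next
  assume "EX deg rate. grows A deg rate"
  then obtain deg rate where "grows A deg rate" by blast
  moreover have "EV n. 1 * A n <= A n + Z n & A n + Z n <= 1 * A n"
   using that(2) by eventually_elim simp
  ultimately have "grows (%n. A n + Z n) deg rate"
   by (rule grows_sandwich[OF _ zero_less_one zero_less_one])
  thus "(EV n. A n + Z n = 0) | (EX deg rate. grows (%n. A n + Z n) deg rate)" by blast
 qed
 show ?thesis
 proof (cases "(EV n. L n = 0) | (EV n. L' n = 0)")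
  case True
  thus ?thesis
  proof
   assume "EV n. L n = 0"
   from zero[OF assms(2) this] show ?thesis by (simp add: add.commute)
  qed (rule zero[OF assms(1)])
 next
  case False
  then obtain deg rate deg' rate' where g: "grows L deg rate" "grows L' deg' rate'" using assms unfolding tame_def by blast
  consider "rate' < rate | rate' = rate & deg' <= deg" | "rate < rate' | rate = rate' & deg <= deg'" by linarith
  thus ?thesis
  proof cases
   case 1 thus ?thesis using grows_dominated_add[OF g] unfolding tame_def by blast
  next
   case 2
   hence "grows (%n. L' n + L n) deg' rate'" by (rule grows_dominated_add[OF g(2,1)])
   thus ?thesis unfolding tame_def by (auto simp: add.commute)
  qed
 qed
qed

lemma tame_sum: "finite S ==> (!!s. s : S ==> tame (L s)) ==> tame (%n. SUM s:S. L s n)"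
 by (induction S rule: finite_induct) (auto simp: tame_zero intro: tame_add)

lemma tame_sum_list: "(!!s. s : set w ==> tame (L s)) ==> tame (%n. sum_list (map (%s. L s n) w))"
 by (induction w) (auto simp: tame_zero intro: tame_add)

lemma grows_exp_mult:
 assumes "grows L deg rate" "0 < ga" shows "grows (%n. L n * ga ^ n) deg (rate * ga)"
proof -
 from assms(1) obtain d D where d: "0 < rate" "0 < d" "0 < D"
  and ev: "EV n. d * (real n ^ deg * rate ^ n) <= L n & L n <= D * (real n ^ deg * rate ^ n)"
  unfolding grows_def by blast
 from ev have "EV n. d * (real n ^ deg * (rate * ga) ^ n) <= L n * ga ^ n &
   L n * ga ^ n <= D * (real n ^ deg * (rate * ga) ^ n)"
 proof eventually_elim
  case (elim n)
  have "d * (real n ^ deg * rate ^ n) * ga ^ n <= L n * ga ^ n" "L n * ga ^ n <= D * (real n ^ deg * rate ^ n) * ga ^ n"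
   using elim assms(2) by (auto intro!: mult_right_mono)
  thus ?case by (simp add: power_mult_distrib mult.assoc)
 qed
 thus ?thesis unfolding grows_def using d assms(2) by (meson mult_pos_pos)
qed

lemma tame_exp_mult: "tame L ==> 0 < ga ==> tame (%n. L n * ga ^ n)"
 unfolding tame_def
proof (elim disjE exE)
 assume "EV n. L n = 0"
 hence "EV n. L n * ga ^ n = 0" by eventually_elim simp
 thus "(EV n. L n * ga ^ n = 0) | (EX deg rate. grows (%n. L n * ga ^ n) deg rate)" ..
qed (use grows_exp_mult in blast)

lemma grows_Suc:
 assumes "grows (%n. L (Suc n)) deg rate" shows "grows L deg rate"
proof -
 from assms obtain d D where d: "0 < rate" "0 < d" "0 < D"
  and ev: "EV n. d * (real n ^ deg * rate ^ n) <= L (Suc n) & L (Suc n) <= D * (real n ^ deg * rate ^ n)"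
  unfolding grows_def by blast
 have "EV n. (d / (2 ^ deg * rate)) * (real (Suc n) ^ deg * rate ^ Suc n) <= L (Suc n) &
   L (Suc n) <= (D / rate) * (real (Suc n) ^ deg * rate ^ Suc n)"
  using ev eventually_ge_at_top[of 1]
 proof eventually_elim
  case (elim n)
  have "real (Suc n) ^ deg <= (2 * real n) ^ deg" using elim(2) by (intro power_mono) auto
  hence "(d / (2 ^ deg * rate)) * (real (Suc n) ^ deg * rate ^ Suc n) <= (d / (2 ^ deg * rate)) * ((2 * real n) ^ deg * rate ^ Suc n)"
   using d by (intro mult_left_mono mult_right_mono) auto
  also have "... = d * (real n ^ deg * rate ^ n)" using d by (simp add: power_mult_distrib)
  finally have 1: "(d / (2 ^ deg * rate)) * (real (Suc n) ^ deg * rate ^ Suc n) <= L (Suc n)" using elim by linarith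
  have "real n ^ deg <= real (Suc n) ^ deg" by (intro power_mono) auto
  hence "D * (real n ^ deg * rate ^ n) <= D * (real (Suc n) ^ deg * rate ^ n)"
   using d by (intro mult_left_mono mult_right_mono) auto
  also have "... = (D / rate) * (real (Suc n) ^ deg * rate ^ Suc n)" using d by simp
  finally show ?case using 1 elim by linarith
 qed
 hence "EV n. (d / (2 ^ deg * rate)) * (real n ^ deg * rate ^ n) <= L n & L n <= (D / rate) * (real n ^ deg * rate ^ n)"
  by (rule eventually_sequentially_Suc[THEN iffD1])
 moreover have "0 < d / (2 ^ deg * rate)" "0 < D / rate" using d by auto
 ultimately show ?thesis unfolding grows_def using d(1) by blast
qed

lemma tame_Suc: "tame (%n. L (Suc n)) ==> tame L"
 unfolding tame_def using grows_Suc eventually_sequentially_Suc[of "%n. L n = 0"] by blast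

lemma eventually_split_sum:
 fixes a :: "nat => real"
 shows "N <= n ==> (SUM k<n. a k) = (SUM k<N. a k) + (SUM k:{N..<n}. a k)"
 by (metis atLeast0LessThan le0 sum.atLeastLessThan_concat)

text \<open>Summation preserves the order for rates above 1, raises the degree by one for rate 1 and
  stays bounded for rates below 1. The positive constant \<open>U\<close> keeps the bounded case
  away from zero.\<close>

lemma tame_partial_sums:
 assumes a: "tame a" "!!n. 0 <= a n" and U: "0 < U"
 shows "tame (%n. U + (SUM k<n. a k))"
proof -
 let ?S = "%n. U + (SUM k<n. a k)"
 have bounded: "tame ?S" if bnd: "!!n. ?S n <= C" for C
 proof -
  have "U <= C" using bnd[of 0] by simp
  have "grows ?S 0 1"
   unfolding grows_def using U \<open>U <= C\<close> bnd a(2)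
   by (intro conjI exI[of _ U] exI[of _ C]) (auto intro!: always_eventually sum_nonneg)
  thus ?thesis unfolding tame_def by blast
 qed
 show ?thesis
 proof (cases "EV n. a n = 0")
  case True
  then obtain N where N: "!!n. n >= N ==> a n = 0" by (auto simp: eventually_sequentially)
  have "?S n <= U + (SUM k<N. a k)" for n
  proof (cases "n <= N")
   case True
   hence "(SUM k<n. a k) <= (SUM k<N. a k)" using a(2) by (intro sum_mono2) auto
   thus ?thesis by simp
  next
   case False
   thus ?thesis using N eventually_split_sum[of N n a] by simp
  qed
  thus ?thesis by (rule bounded)
 next
  case False
  then obtain deg rk where "grows a deg rk" using a(1) unfolding tame_def by blast
  then obtain d D where d: "0 < rk" "0 < d" "0 < D"
   and ev: "EV n. d * (real n ^ deg * rk ^ n) <= a n & a n <= D * (real n ^ deg * rk ^ n)"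
   unfolding grows_def by blast
  then obtain N where N: "!!n. n >= N ==> d * (real n ^ deg * rk ^ n) <= a n"
   "!!n. n >= N ==> a n <= D * (real n ^ deg * rk ^ n)" by (auto simp: eventually_sequentially)
  define K0 where "K0 = U + (SUM k<N. a k)"
  have K0: "0 < K0" unfolding K0_def using U a(2) by (simp add: add_pos_nonneg sum_nonneg)
  have split: "?S n = K0 + (SUM k:{N..<n}. a k)" if "n >= N" for n
   using eventually_split_sum[OF that, of a] by (simp add: K0_def)
  consider "rk < 1" | "rk = 1" | "1 < rk" by linarith
  thus ?thesis
  proof cases
   case 1
   \<comment> \<open>A rate strictly between \<open>rk\<close> and 1 absorbs the polynomial and
     leaves a convergent geometric series.\<close>
   define si where "si = (1 + rk) / 2"
   have si: "rk < si" "si < 1" "0 < si" using 1 d by (auto simp: si_def)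
   obtain C M where C: "C > 0" "!!n. n >= M ==> real n ^ deg * rk ^ n <= C * (real n ^ 0 * si ^ n)"
    using poly_exp_le[of rk si deg 0] d(1) si(1) by (auto simp: eventually_sequentially)
   let ?M = "max M N"
   have "?S n <= U + (SUM k<?M. a k) + D * C / (1 - si)" for n
   proof (cases "n <= ?M")
    case True
    hence "(SUM k<n. a k) <= (SUM k<?M. a k)" using a(2) by (intro sum_mono2) auto
    moreover have "0 <= D * C / (1 - si)" using d C si by simp
    ultimately show ?thesis by linarith
   next
    case False
    have "a k <= D * C * si ^ k" if "k >= ?M" for k
    proof -
     have "a k <= D * (real k ^ deg * rk ^ k)" using N that by simp
     also have "... <= D * (C * (real k ^ 0 * si ^ k))" using C(2)[of k] that d by (intro mult_left_mono) auto
     finally show ?thesis by simp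
    qed
    hence "(SUM k:{?M..<n}. a k) <= (SUM k:{?M..<n}. D * C * si ^ k)" by (intro sum_mono) auto
    also have "... <= (SUM k<n. D * C * si ^ k)" using d C si by (intro sum_mono2) auto
    also have "... = D * C * ((1 - si ^ n) / (1 - si))" using si sum_gp_strict[of si n] by (simp flip: sum_distrib_left)
    also have "... <= D * C * (1 / (1 - si))" using d C si by (intro mult_left_mono divide_right_mono) auto
    finally have le: "(SUM k:{?M..<n}. a k) <= D * C / (1 - si)" by simp
    have "?M <= n" using False by linarith
    from eventually_split_sum[OF this, of a] le show ?thesis by linarith
   qed
   thus ?thesis by (rule bounded)
  next
   case 2
   have "grows ?S (Suc deg) 1"
    unfolding grows_def
   proof (intro conjI)
    \<comment> \<open>The lower constant comes from the upper half of the summands: at least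
      \<open>n / 2\<close> of them, each with index at least \<open>n / 3\<close>.\<close>
    have "EV n. (d / (2 * 3 ^ deg)) * (real n ^ Suc deg * 1 ^ n) <= ?S n & ?S n <= (K0 + D) * (real n ^ Suc deg * 1 ^ n)"
     using eventually_ge_at_top[of "2 * N + 2"]
    proof eventually_elim
     case (elim n)
     have "(SUM k:{N..<n}. a k) <= (SUM k:{N..<n}. D * real n ^ deg)"
     proof (rule sum_mono)
      fix k assume k: "k : {N..<n}"
      have "a k <= D * real k ^ deg" using N(2)[of k] k 2 by simp
      also have "... <= D * real n ^ deg" using k d by (intro mult_left_mono power_mono) auto
      finally show "a k <= D * real n ^ deg" .
     qed
     also have "... = real (n - N) * (D * real n ^ deg)" by simp
     also have "... <= real n * (D * real n ^ deg)" using d by (intro mult_right_mono) auto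
     finally have 1: "(SUM k:{N..<n}. a k) <= D * real n ^ Suc deg" by (simp add: algebra_simps)
     have "K0 * 1 <= K0 * real n ^ Suc deg" using elim K0 by (intro mult_left_mono one_le_power) auto
     with 1 have up: "?S n <= (K0 + D) * real n ^ Suc deg" using split[of n] elim by (simp add: algebra_simps)
     have "(d / (2 * 3 ^ deg)) * real n ^ Suc deg = (real n / 2) * (d * (real n / 3) ^ deg)"
      by (simp add: power_divide)
     also have "... <= real (n - n div 2) * (d * (real n / 3) ^ deg)"
      using d by (intro mult_right_mono) auto
     also have "... = (SUM k:{n div 2..<n}. d * (real n / 3) ^ deg)" by simp
     also have "... <= (SUM k:{n div 2..<n}. a k)"
     proof (rule sum_mono)
      fix k assume k: "k : {n div 2..<n}"
      have "n <= 3 * (n div 2)" using elim by presburger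
      hence "real n / 3 <= real (n div 2)" by linarith
      hence "real n / 3 <= real k" using k by auto
      hence "d * (real n / 3) ^ deg <= d * real k ^ deg" using d by (intro mult_left_mono power_mono) auto
      also have "... <= a k" using N(1)[of k] k elim 2 by auto
      finally show "d * (real n / 3) ^ deg <= a k" .
     qed
     also have "... <= (SUM k<n. a k)" using a(2) by (intro sum_mono2) auto
     finally show ?case using up U by simp
    qed
    thus "EX c C. 0 < c & 0 < C & (EV n. c * (real n ^ Suc deg * 1 ^ n) <= ?S n &
      ?S n <= C * (real n ^ Suc deg * 1 ^ n))"
     by (intro exI[of _ "d / (2 * 3 ^ deg)"] exI[of _ "K0 + D"]) (use d K0 in auto)
   qed simp
   thus ?thesis unfolding tame_def by blast
  next
   case 3
   \<comment> \<open>The lower bound uses only the last summand, at the index \<open>n - 1\<close>: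
     this costs one factor \<open>rk\<close> and at most a factor 2 in the base of the
     polynomial.\<close>
   define c C where "c = d / (2 ^ deg * rk)" and "C = K0 + D / (rk - 1)"
   have "EV n. c * (real n ^ deg * rk ^ n) <= ?S n & ?S n <= C * (real n ^ deg * rk ^ n)"
    using eventually_ge_at_top[of "N + 2"]
   proof eventually_elim
    case (elim n)
    have "(SUM k:{N..<n}. a k) <= (SUM k:{N..<n}. D * real n ^ deg * rk ^ k)"
    proof (rule sum_mono)
     fix k assume k: "k : {N..<n}"
     have "a k <= D * (real k ^ deg * rk ^ k)" using N(2)[of k] k by simp
     also have "... <= D * (real n ^ deg * rk ^ k)" using k d by (intro mult_left_mono mult_right_mono power_mono) auto
     finally show "a k <= D * real n ^ deg * rk ^ k" by simp
    qed
    also have "... <= (SUM k<n. D * real n ^ deg * rk ^ k)" using d by (intro sum_mono2) auto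
    also have "... = D * real n ^ deg * ((rk ^ n - 1) / (rk - 1))"
     using 3 sum_gp_strict[of rk n] by (simp flip: sum_distrib_left) (simp add: divide_simps algebra_simps)
    also have "... <= D * real n ^ deg * (rk ^ n / (rk - 1))" using d 3 by (intro mult_left_mono divide_right_mono) auto
    finally have 1: "(SUM k:{N..<n}. a k) <= D / (rk - 1) * (real n ^ deg * rk ^ n)" by simp
    have "1 <= real n ^ deg * rk ^ n"
     using mult_mono[of 1 "real n ^ deg" 1 "rk ^ n"] elim 3 by (auto intro: one_le_power)
    hence "K0 * 1 <= K0 * (real n ^ deg * rk ^ n)" using K0 by (intro mult_left_mono) auto
    with 1 have up: "?S n <= C * (real n ^ deg * rk ^ n)" using split[of n] elim by (simp add: C_def algebra_simps)
    obtain m where m: "n = Suc m" using elim by (cases n) auto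
    have "real n ^ deg <= (2 * real m) ^ deg" using elim m by (intro power_mono) auto
    hence "c * (real n ^ deg * rk ^ n) <= c * ((2 * real m) ^ deg * rk ^ n)"
     unfolding c_def using d by (intro mult_left_mono mult_right_mono) auto
    also have "... = d * (real m ^ deg * rk ^ m)" using d m by (simp add: c_def power_mult_distrib)
    also have "... <= a m" using N(1)[of m] elim m by simp
    also have "... <= (SUM k<n. a k)" using a(2) m by (intro member_le_sum) auto
    finally show ?case using up U by simp
   qed
   moreover have "0 < c" "0 < C" using d K0 3 by (auto simp: c_def C_def add_pos_pos)
   ultimately have "grows ?S deg rk" unfolding grows_def using d(1) by blast
   thus ?thesis unfolding tame_def by blast
  qed
 qed
qed

text \<open>Variation of constants: after division by \<open>rate ^ n\<close> the recurrence becomes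
  a partial sum.\<close>

lemma tame_recurrence:
 assumes "!!n. U (Suc n) = rate * U n + h n" "0 < rate" "0 < U 0" "tame h" "!!n. 0 <= h n"
 shows "tame U"
proof -
 let ?a = "%n. (1 / rate) * (h n * (1 / rate) ^ n)"
 have "tame ?a" using assms by (intro tame_cmult tame_exp_mult) auto
 hence "tame (%n. U 0 + (SUM k<n. ?a k))" using assms by (intro tame_partial_sums) auto
 hence "tame (%n. (U 0 + (SUM k<n. ?a k)) * rate ^ n)" using assms(2) by (intro tame_exp_mult)
 moreover have "(U 0 + (SUM k<n. ?a k)) * rate ^ n = U n" for n
 proof (induction n)
  case (Suc n)
  have "(U 0 + (SUM k<Suc n. ?a k)) * rate ^ Suc n = rate * ((U 0 + (SUM k<n. ?a k)) * rate ^ n) + ?a n * rate ^ Suc n"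
   by (simp add: algebra_simps)
  also have "?a n * rate ^ Suc n = h n" using assms(2) by (simp add: power_divide)
  finally show ?case using Suc assms(1) by simp
 qed simp
 ultimately show ?thesis by simp
qed

context morphism
begin

text \<open>Induction on the number of letters reachable from \<open>b\<close>. If \<open>b\<close>
  does not recur, its length is a sum of lengths already treated. Otherwise the lengths in the
  strong component \<open>K\<close> of \<open>b\<close> are added with the weights of a Perron
  eigenvector. The sum satisfies a scalar recurrence whose inhomogeneous part stems from earlier
  letters, so that periodicity of the component causes no oscillation in the orders.\<close>

theorem tame_length:
 assumes "b : R" shows "tame (%n. real (length (it f n [b])))"
 using assms
proof (induction "card {c. EX n. c : set (it f n [b])}" arbitrary: b rule: less_induct)
 case less
 define reach where "reach b = {c. EX n. c : set (it f n [b])}" for b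
 define L where "L b n = real (length (it f n [b]))" for b n
 have refl: "c : reach c" for c unfolding reach_def by (auto intro: exI[of _ 0])
 have reach_R: "reach c <= R" if "c : R" for c unfolding reach_def using it_letter_in_R[OF that] by blast
 have trans: "reach d <= reach c" if dc: "d : reach c" for c d
 proof
  fix e assume "e : reach d"
  then obtain m n where mn: "e : set (it f m [d])" "d : set (it f n [c])" using dc by (auto simp: reach_def)
  hence "e : set (it f (m + n) [c])" unfolding it_add set_it[of m f "it f n [c]"] by blast
  thus "e : reach c" by (auto simp: reach_def)
 qed
 have child: "c : reach d" if "c : set (f d)" for c d
  unfolding reach_def using that by (auto intro!: exI[of _ 1])
 have IH: "tame (L c)" if "c : reach b" "b ~: reach c" for c
 proof -
  have "reach c \<subset> reach b" using trans[OF that(1)] that(2) refl by blast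
  moreover have "finite (reach b)" using reach_R[OF less.prems] finite_R finite_subset by blast
  ultimately have "card (reach c) < card (reach b)" by (rule psubset_card_mono[rotated])
  thus ?thesis using less.hyps[of c] that(1) reach_R[OF less.prems]
   unfolding reach_def[symmetric] L_def by blast
 qed
 have L_Suc: "L d (Suc n) = sum_list (map (%c. L c n) (f d))" for d n
 proof -
  have "real (length (it f n w)) = sum_list (map (%c. L c n) w)" for w
  proof (induction w)
   case (Cons c w)
   thus ?case using it_Cons[of n f c w] by (simp add: L_def)
  qed simp
  from this[of "f d"] show ?thesis by (simp only: L_def it_Suc_letter)
 qed
 show ?case
 proof (cases "EX c:set (f b). b : reach c")
  case False
  have "tame (%n. sum_list (map (%c. L c n) (f b)))"
   using False child IH by (intro tame_sum_list) blast
  hence "tame (%n. L b (Suc n))" unfolding L_Suc .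
  thus ?thesis unfolding L_def[symmetric] by (rule tame_Suc)
 next
  case True
  then obtain c0 where c0: "c0 : set (f b)" "b : reach c0" by blast
  define K where "K = {e : reach b. b : reach e}"
  have KR: "K <= R" using reach_R[OF less.prems] by (auto simp: K_def)
  have finK: "finite K" using KR finite_R finite_subset by blast
  have bK: "b : K" using refl by (simp add: K_def)
  define M where "M e d = real (count_list (f d) e)" for e d
  let ?E = "{(i, j). i : K & j : K & 0 < M i j}"
  have M_pos: "0 < M e d \<longleftrightarrow> e : set (f d)" for e d
   using count_list_0_iff[of "f d" e] by (auto simp: M_def)
  have path: "(e, d) : ?E\<^sup>*" if "e : set (it f n [d])" "d : K" "e : K" for e d n
   using that(1,3)
  proof (induction n arbitrary: e)
   case (Suc n)
   then obtain e' where e': "e' : set (it f n [d])" "e : set (f e')" by (auto simp: set_extend)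
   have "e' : reach d" using e'(1) by (auto simp: reach_def)
   moreover have "b : reach e'" using trans[OF child[OF e'(2)]] Suc.prems(2) by (auto simp: K_def)
   ultimately have "e' : K" using trans[of d b] that(2) by (auto simp: K_def)
   thus ?case using Suc.IH[OF e'(1)] e'(2) Suc.prems(2) M_pos by (auto intro: converse_rtrancl_into_rtrancl)
  qed simp
  have path': "(e, d) : ?E\<^sup>*" if "e : reach d" "d : K" "e : K" for e d
   using path that by (auto simp: reach_def)
  have irr: "(i, j) : ?E\<^sup>+" if "i : K" "j : K" for i j
  proof -
   have c0K: "c0 : K" using c0 child[of c0 b] by (auto simp: K_def)
   have "i : reach c0" using that(1) trans[OF c0(2)] by (auto simp: K_def)
   hence "(i, c0) : ?E\<^sup>*" using path' c0K that(1) by blast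
   moreover have "(c0, b) : ?E" using c0K bK c0(1) M_pos by auto
   moreover have "(b, j) : ?E\<^sup>*" using path'[of b j] bK that(2) by (auto simp: K_def)
   ultimately show ?thesis by (meson rtrancl_into_trancl1 trancl_rtrancl_trancl)
  qed
  have "K ~= {}" "0 <= M i j" for i j using bK by (auto simp: M_def)
  from perron[OF finK this irr]
  obtain rate u where u: "0 < rate" "!!i. i : K ==> 0 < u i" "!!i. i : K ==> (SUM j:K. M i j * u j) = rate * u i"
   by blast
  define h where "h n = (SUM d:K. u d * sum_list (map (%c. L c n) (filter (%c. c ~: K) (f d))))" for n
  \<comment> \<open>As \<open>M e d\<close> counts the letter \<open>e\<close> in
    \<open>f d\<close>, \<open>u\<close> is an eigenvector on the side of the images; this makes the
    part of the recurrence inside \<open>K\<close> collapse to multiplication by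
    \<open>rate\<close>.\<close>
  define U where "U n = (SUM d:K. u d * L d n)" for n
  have split: "sum_list (map g w) = (SUM e:K. real (count_list w e) * g e) + sum_list (map g (filter (%c. c ~: K) w))"
   for g :: "'a => real" and w
  proof (induction w)
   case (Cons c w)
   have "(SUM e:K. real (count_list (c # w) e) * g e) =
     (SUM e:K. real (count_list w e) * g e) + (SUM e:K. if e = c then g e else 0)"
    unfolding sum.distrib[symmetric] by (intro sum.cong) (auto simp: algebra_simps)
   also have "(SUM e:K. if e = c then g e else 0) = (if c : K then g c else 0)" using finK by (simp add: sum.delta)
   finally show ?case using Cons by simp
  qed simp
  have rec: "U (Suc n) = rate * U n + h n" for n
  proof -
   have "U (Suc n) = (SUM d:K. u d * (SUM e:K. M e d * L e n)) + h n"
    unfolding U_def h_def L_Suc by (subst split) (simp add: M_def distrib_left sum.distrib)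
   also have "(SUM d:K. u d * (SUM e:K. M e d * L e n)) = (SUM e:K. (SUM d:K. M e d * u d) * L e n)"
    unfolding sum_distrib_left sum_distrib_right by (subst sum.swap) (simp add: algebra_simps)
   also have "... = rate * U n" unfolding U_def sum_distrib_left by (intro sum.cong) (simp_all add: u(3) mult.assoc)
   finally show ?thesis .
  qed
  have U0: "0 < U 0" unfolding U_def using finK bK u(2) by (intro sum_pos) (auto simp: L_def)
  have tame_h: "tame h"
   unfolding h_def
  proof (intro tame_sum tame_cmult tame_sum_list finK u(2))
   fix d c assume "d : K" "c : set (filter (%c. c ~: K) (f d))"
   hence "c : reach b" "c ~: K" using trans[of d b] child[of c d] by (auto simp: K_def)
   thus "tame (L c)" by (intro IH) (auto simp: K_def)
  qed
  have h_nonneg: "0 <= h n" for n unfolding h_def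
   using u(2) by (intro sum_nonneg mult_nonneg_nonneg sum_list_nonneg) (auto simp: L_def less_imp_le)
  note tameU = tame_recurrence[OF rec u(1) U0 tame_h h_nonneg]
  obtain W where W: "W >= 1" "!!b. b : R ==> length (f b) <= W" by (rule width) blast
  \<comment> \<open>Every letter of the component occurs in a fixed iterate of \<open>b\<close>, so
    its length is at most a constant times that of \<open>b\<close>, and \<open>U\<close> and
    \<open>L b\<close> have the same order.\<close>
  obtain r where r: "!!e. e : K ==> e : set (it f (r e) [b])" unfolding K_def reach_def by atomize_elim (rule choice, auto)
  have le: "L e n <= real (W ^ r e) * L b n" if "e : K" for e n
  proof -
   have "length (it f n [e]) <= length (it f (n + r e) [b])"
    unfolding it_add by (rule length_it_subset[OF r[OF that]])
   also have "... <= W ^ r e * length (it f n [b])"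
    using length_it_add_le[OF W(2), of "[b]" "r e" n] less.prems by (simp add: add.commute)
   finally show ?thesis unfolding L_def by (metis of_nat_le_iff of_nat_mult)
  qed
  define C where "C = (SUM e:K. u e * real (W ^ r e))"
  have C: "0 < C" unfolding C_def using finK bK u(2) W(1) by (intro sum_pos) auto
  have up: "U n <= C * L b n" for n
   unfolding U_def C_def sum_distrib_right
   using le u(2) by (intro sum_mono) (simp add: mult.assoc mult_left_mono less_imp_le)
  have low: "u b * L b n <= U n" for n
   unfolding U_def using finK bK u(2) by (intro member_le_sum[of b K "%d. u d * L d n"]) (auto simp: L_def less_imp_le)
  have "(1 / C) * U n <= L b n & L b n <= (1 / u b) * U n" for n
   using up[of n] low[of n] C u(2)[OF bK] by (simp add: divide_simps mult.commute)
  hence "EV n. (1 / C) * U n <= L b n & L b n <= (1 / u b) * U n"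
   by (intro always_eventually allI)
  from tame_sandwich[OF tameU _ _ this] C u(2)[OF bK] have "tame (L b)" by simp
  thus ?thesis unfolding L_def .
 qed
qed

end

section \<open>Upper bounds\<close>

lemma prefix_of_concat:
 assumes "t ~= []" "concat (map g bs) = t @ z"
 shows "EX mid c v t' z'. bs = mid @ c # v & t = concat (map g mid) @ t' & t' ~= [] & g c = t' @ z'"
 using assms
proof (induction bs arbitrary: t)
 case (Cons b bs)
 from Cons.prems(2) have "g b @ concat (map g bs) = t @ z" by simp
 then obtain us where "g b = t @ us | t = g b @ us & concat (map g bs) = us @ z"
  by (auto simp: append_eq_append_conv2)
 then consider z' where "g b = t @ z'" | t1 where "t = g b @ t1" "t1 ~= []" "concat (map g bs) = t1 @ z"
  by (cases "us = []") auto
 thus ?case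
 proof cases
  case 1
  thus ?thesis using Cons.prems(1)
   by (rule_tac exI[of _ "[]"], rule_tac exI[of _ b], rule_tac exI[of _ bs]) auto
 next
  case 2
  from Cons.IH[OF 2(2,3)] obtain mid c v t' z' where
   "bs = mid @ c # v" "t1 = concat (map g mid) @ t'" "t' ~= []" "g c = t' @ z'" by blast
  thus ?thesis using 2(1) by (intro exI[of _ "b # mid"]) auto
 qed
qed simp

text \<open>A factor that fits into no single block crosses a boundary: it starts inside one block,
  covers those of \<open>mid\<close> and ends inside another.\<close>

lemma infix_of_concat:
 assumes "w ~= []" "concat (map g bs) = y @ w @ z" "!!b y z. b : set bs ==> g b ~= y @ w @ z"
 shows "EX u b mid c v s t y' z'. bs = u @ b # mid @ c # v & w = s @ concat (map g mid) @ t &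
  s ~= [] & t ~= [] & g b = y' @ s & g c = t @ z'"
 using assms(2,3)
proof (induction bs arbitrary: y)
 case (Cons b bs)
 from Cons.prems(1) have "g b @ concat (map g bs) = y @ w @ z" by simp
 then obtain us where "y = g b @ us & concat (map g bs) = us @ w @ z |
   g b = y @ us & us @ concat (map g bs) = w @ z"
  by (auto simp: append_eq_append_conv2)
 then consider y' where "y = g b @ y'" "concat (map g bs) = y' @ w @ z"
  | y' where "g b = y @ y'" "y' ~= []" "y' @ concat (map g bs) = w @ z"
 proof (cases "us = []")
  case True
  thus thesis using \<open>_ | _\<close> that(1)[of "[]"] by auto
 next
  case False
  thus thesis using \<open>_ | _\<close> that(1)[of us] that(2)[of us] by blast
 qed
 thus ?case
 proof cases
  case 1
  have "g d ~= y @ w @ z" if "d : set bs" for d y z using Cons.prems(2)[of d] that by simp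
  from Cons.IH[OF 1(2) this] obtain u b' mid c v s t y' z' where
   "bs = u @ b' # mid @ c # v" "w = s @ concat (map g mid) @ t" "s ~= []" "t ~= []" "g b' = y' @ s" "g c = t @ z'"
   by blast
  moreover from this(1) have "b # bs = (b # u) @ b' # mid @ c # v" by simp
  ultimately show ?thesis by blast
 next
  case 2
  from 2(3) obtain us where "y' = w @ us | w = y' @ us & concat (map g bs) = us @ z"
   by (auto simp: append_eq_append_conv2)
  then consider z' where "y' = w @ z'" | t where "w = y' @ t" "t ~= []" "concat (map g bs) = t @ z"
   by (cases "us = []") auto
  thus ?thesis
  proof cases
   case 1
   thus ?thesis using Cons.prems(2)[of b y z'] \<open>g b = y @ y'\<close> by simp
  next
   case t: 2
   from prefix_of_concat[OF t(2,3)] obtain mid c v t' z' where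
    "bs = mid @ c # v" "t = concat (map g mid) @ t'" "t' ~= []" "g c = t' @ z'" by blast
   moreover from this(1) have "b # bs = [] @ b # mid @ c # v" by simp
   moreover have "w = y' @ concat (map g mid) @ t'" using t(1) calculation(2) by simp
   ultimately show ?thesis using 2(1,2) by blast
  qed
 qed
qed (use assms(1) in simp)

lemma it_self_reproducing:
 assumes "f c = y @ c # w"
 shows "it f p [c] = concat (map (%i. it f i y) (rev [0..<p])) @ c # concat (map (%i. it f i w) [0..<p])"
proof (induction p)
 case (Suc p)
 have "it f (Suc p) [c] = it f p y @ it f p [c] @ it f p w"
  unfolding it_Suc_letter assms by (metis it_append it_Cons)
 thus ?case using Suc by simp
qed simp

context morphism
begin

text \<open>After \<open>D n\<close> iterations the first \<open>n\<close> letters of the images of a letter no longer change. Where a bounded word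
 accumulates in front of the letter, this takes \<open>n\<close> iterations, which causes quadratic complexity.\<close>

definition D_ok :: "(nat => nat) => bool" where
 "D_ok D \<longleftrightarrow> (ALL c:G. ALL y w. f c = y @ c # w --> set y <= B -->
   extend f y ~= [] & (ALL n. n <= D n) |
   extend f y = [] & (ALL n. ALL p>=D n. n <= length (concat (map (%i. it f i w) [0..<p]))))"

text \<open>By \<open>normal\<close>, the image of \<open>c\<close> begins with a bounded word
  followed by a letter \<open>c1\<close> that reproduces itself. Either copies of a nonempty bounded
  word pile up before \<open>c1\<close>, or the material behind \<open>c1\<close> grows; in both
  cases the prefix freezes once it is long enough.\<close>

lemma stable_prefix:
 assumes idem: "!!b. b : B ==> extend f (f b) = f b" and nf: "normal f G B" and D: "D_ok D"
  and c: "c : R" and p: "D n + 2 <= p"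
 shows "take n (it f (Suc p) [c]) = take n (it f p [c])" and "c : G ==> n <= length (it f p [c])"
proof -
 have idem': "it f p y = extend f y" if "set y <= B" "1 <= p" for y p
  using it_idem_on[of y f "p - 1"] that idem by auto
 have self: "n <= length (it f q [c1]) & take n (it f (Suc q) [c1]) = take n (it f q [c1])"
  if c1: "c1 : G" "f c1 = y @ c1 # w" "set y <= B" and q: "D n + 1 <= q" for c1 y w q
 proof -
  let ?Y = "%q. concat (map (%i. it f i y) (rev [0..<q]))" and ?V = "%q. concat (map (%i. it f i w) [0..<q])"
  \<comment> \<open>All iterates of \<open>y\<close> from the first on coincide; only the innermost
    factor is \<open>y\<close> itself.\<close>
  have Y: "?Y (Suc q) = concat (replicate q (extend f y)) @ y" for q
  proof (induction q)
   case (Suc q)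
   have "?Y (Suc (Suc q)) = it f (Suc q) y @ ?Y (Suc q)" by simp
   thus ?case using Suc idem'[OF c1(3), of "Suc q"] by simp
  qed simp
  obtain r where r: "q = Suc r" "D n <= r" using q by (cases q) auto
  have it: "it f (Suc q) [c1] = concat (replicate q (extend f y)) @ y @ c1 # ?V (Suc q)" for q
   using it_self_reproducing[where f = f, OF c1(2), of "Suc q"] Y[of q] by simp
  consider "extend f y ~= []" "n <= D n" | "extend f y = []" "n <= length (?V q)"
   using D c1 q unfolding D_ok_def by (meson add_leD1)
  thus ?thesis
  proof cases
   case 1
   let ?Z = "concat (replicate r (extend f y))"
   have "r * 1 <= r * length (extend f y)" using 1(1) by (intro mult_le_mono) (auto simp: Suc_le_eq)
   hence "r <= length ?Z" by (simp add: length_concat sum_list_replicate)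
   hence n: "n <= length ?Z" using 1(2) r by simp
   have "concat (replicate q (extend f y)) = ?Z @ extend f y"
    using r replicate_append_same[of r "extend f y"] by (metis concat_append concat.simps append_Nil2 replicate_Suc)
   hence "it f (Suc q) [c1] = ?Z @ extend f y @ y @ c1 # ?V (Suc q)" using it[of q] by simp
   moreover have "it f q [c1] = ?Z @ y @ c1 # ?V q" using it[of r] r by simp
   ultimately show ?thesis using n by simp
  next
   case 2
   define A where "A = y @ c1 # ?V q"
   have "it f (Suc q) [c1] = A @ it f q w" "it f q [c1] = A"
    using it[of q] it[of r] 2(1) r by (simp_all add: A_def)
   moreover have "n <= length A" using 2(2) by (simp add: A_def)
   ultimately show ?thesis by simp
  qed
 qed
 \<comment> \<open>Of the two additional iterations one leads from \<open>c\<close> to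
   \<open>c1\<close>, the other accounts for the innermost factor \<open>y\<close>.\<close>
 obtain q where q: "p = Suc q" "D n + 1 <= q" using p by (cases p) auto
 show "take n (it f (Suc p) [c]) = take n (it f p [c])"
 proof (cases "c : G")
  case True
  then obtain y0 c1 w0 y w where n: "f c = y0 @ c1 # w0" "f c1 = y @ c1 # w" "c1 : G" "set y0 <= B" "set y <= B"
   using nf unfolding normal_def by blast
  have it: "it f (Suc p) [c] = extend f y0 @ it f p [c1] @ it f p w0" if "1 <= p" for p
   unfolding it_Suc_letter n(1) it_append it_Cons[of p f c1 w0] idem'[OF n(4) that] by simp
  have s: "n <= length (it f q [c1])" "take n (it f (Suc q) [c1]) = take n (it f q [c1])"
   using self[OF n(3,2,5) q(2)] by auto
  have "n <= length (it f (Suc q) [c1])" using self[OF n(3,2,5), of "Suc q"] q by auto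
  have tk: "take n (E @ A @ z) = take n E @ take (n - length E) (take n A)" if "n <= length A" for E A z
   using that by (simp add: min_def)
  have "take n (extend f y0 @ it f (Suc q) [c1] @ z) = take n (extend f y0 @ it f q [c1] @ z')" for z z'
   unfolding tk[OF s(1)] tk[OF \<open>n <= length (it f (Suc q) [c1])\<close>] s(2) ..
  thus ?thesis using it[of p] it[of q] q by simp
 next
  case False
  hence "c : B" using c by simp
  hence "it f (Suc p) [c] = extend f [c]" "it f p [c] = extend f [c]"
   using q by (intro idem'; simp)+
  hence "it f (Suc p) [c] = it f p [c]" by simp
  thus ?thesis by simp
 qed
 show "n <= length (it f p [c])" if cG: "c : G"
 proof -
  obtain y0 c1 w0 y w where n: "f c = y0 @ c1 # w0" "f c1 = y @ c1 # w" "c1 : G" "set y <= B"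
   using nf cG unfolding normal_def by blast
  have "n <= length (it f q [c1])" using self[OF n(3,2,4) q(2)] by auto
  also have "... <= length (it f p [c])" unfolding q it_Suc_letter using n(1) by (intro length_it_subset) simp
  finally show ?thesis .
 qed
qed

lemma stable_prefix_all:
 assumes "!!b. b : B ==> extend f (f b) = f b" "normal f G B" "D_ok D" "c : R" "D n + 2 <= p"
 shows "take n (it f p [c]) = take n (it f (D n + 2) [c])"
 using assms(5) by (induction p rule: dec_induct) (use stable_prefix(1)[OF assms(1-4)] in auto)

end

locale normalized = pure_morphic +
 assumes idem: "b : B ==> extend f (f b) = f b"
  and nf: "normal f G B" and nf_mir: "normal (mir f) G B"
begin

lemma idem_word: "set y <= B ==> 1 <= p ==> it f p y = extend f y"
 using it_idem_on[of y f "p - 1"] idem by auto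

lemma idem_mir: "b : B ==> extend (mir f) (mir f b) = mir f b"
 using idem[of b] it_mir[of 1 f "f b"] by (simp add: mir_def)

sublocale mirror: morphism "mir f" R
 by (rule morphism_mir)

lemma mirror_G: "mirror.G = G" "mirror.B = B"
 by (simp_all add: growing_mir)

text \<open>The factors of length \<open>n\<close> that cover the \<open>p\<close>-th image of
  \<open>mid\<close> and reach into those of the neighbours \<open>b\<close> and
  \<open>c\<close>.\<close>

definition cross :: "'a \<times> 'a list \<times> 'a => nat => nat => 'a list set" where
 "cross ta p n = (case ta of (b, mid, c) => {w. length w = n & (EX s t y z. w = s @ it f p mid @ t &
   s ~= [] & t ~= [] & it f p [b] = y @ s & it f p [c] = t @ z)})"

text \<open>Such a factor is determined by the length of its part \<open>s\<close> in the image of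
  \<open>b\<close>, which lies strictly between 0 and \<open>n\<close>.\<close>

lemma card_cross: "finite (cross ta p n)" "card (cross ta p n) <= n"
proof -
 obtain b mid c where ta: "ta = (b, mid, c)" by (cases ta)
 define h where "h k = drop (length (it f p [b]) - k) (it f p [b]) @ it f p mid @
   take (n - k - length (it f p mid)) (it f p [c])" for k
 have sub: "cross ta p n <= h ` {..<n}"
 proof
  fix w assume "w : cross ta p n"
  then obtain s t y z where w: "length w = n" "w = s @ it f p mid @ t" "s ~= []" "t ~= []"
   "it f p [b] = y @ s" "it f p [c] = t @ z" unfolding cross_def ta by auto
  hence "w = h (length s)" unfolding h_def by simp
  moreover have "length s < n" using w by (cases t) auto
  ultimately show "w : h ` {..<n}" by blast
 qed
 thus "finite (cross ta p n)" using finite_surj by blast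
 have "card (cross ta p n) <= card (h ` {..<n})" using sub by (intro card_mono) auto
 also have "... <= n" using card_image_le[of "{..<n}" h] by simp
 finally show "card (cross ta p n) <= n" .
qed

definition triples :: "('a \<times> 'a list \<times> 'a) set" where
 "triples = {(b, mid, c). EX d:R. EX u v. f d = u @ b # mid @ c # v}"

lemma finite_triples: "finite triples"
proof -
 obtain W where W: "W >= 1" "!!b. b : R ==> length (f b) <= W" by (rule width) blast
 have "triples <= R \<times> {mid. set mid <= R & length mid <= W} \<times> R"
 proof
  fix ta assume "ta : triples"
  then obtain b mid c d u v where *: "ta = (b, mid, c)" "d : R" "f d = u @ b # mid @ c # v"
   unfolding triples_def by auto
  thus "ta : R \<times> {mid. set mid <= R & length mid <= W} \<times> R"
   using closed[OF *(2)] W(2)[OF *(2)] by auto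
 qed
 thus ?thesis using finite_lists_length_le[OF finite_R] finite_R by (meson finite_SigmaI finite_subset)
qed

lemma triples_R: "(b, mid, c) : triples ==> b : R & set mid <= R & c : R"
 unfolding triples_def using closed by fastforce

text \<open>At the least level at which \<open>w\<close> fits into the image of one letter, it fits
  into no image one level below and therefore crosses a boundary there. The bound on the image of
  \<open>d\<close> excludes levels at which all images are too short.\<close>

lemma factor_crosses:
 assumes "fac w" "2 <= length w"
 shows "EX p. EX d:R. length w <= length (it f (Suc p) [d]) & (EX ta:triples. w : cross ta p (length w))"
proof -
 define P where "P p \<longleftrightarrow> (EX b:R. EX y z. it f p [b] = y @ w @ z)" for p
 have "EX p. P p" using assms(1) a_in_R unfolding P_def fac_iff by blast
 hence least: "P (LEAST p. P p)" "!!q. q < (LEAST p. P p) ==> ~ P q"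
  by (auto intro: LeastI_ex dest: not_less_Least)
 have "~ P 0"
 proof
  assume "P 0"
  then obtain b y z where "[b] = y @ w @ z" unfolding P_def by auto
  hence "length [b] = length y + length w + length z" by (metis length_append add.assoc)
  with assms(2) show False by simp
 qed
 then obtain p where p: "(LEAST p. P p) = Suc p" using least(1) by (cases "LEAST p. P p") auto
 then obtain d y z where d: "d : R" "it f (Suc p) [d] = y @ w @ z" using least(1) unfolding P_def by auto
 have np: "it f p [b] ~= y @ w @ z" if "b : set (f d)" for b y z
 proof
  assume "it f p [b] = y @ w @ z"
  hence "P p" unfolding P_def using that closed[OF d(1)] by blast
  with least(2)[of p] p show False by simp
 qed
 have w: "w ~= []" using assms(2) by auto
 have "concat (map (%b. it f p [b]) (f d)) = y @ w @ z"
  using d(2) unfolding it_Suc_letter by (subst (asm) it_concat)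
 from infix_of_concat[OF w this np] obtain u b mid c v s t y' z' where
  sp: "f d = u @ b # mid @ c # v" "w = s @ concat (map (%b. it f p [b]) mid) @ t" "s ~= []" "t ~= []"
  "it f p [b] = y' @ s" "it f p [c] = t @ z'" by blast
 have "(b, mid, c) : triples" unfolding triples_def using d(1) sp(1) by blast
 moreover have "w : cross (b, mid, c) p (length w)"
  using sp(2-) unfolding cross_def prod.case mem_Collect_eq it_concat[of p f mid] by blast
 ultimately show ?thesis using d by (intro exI[of _ p] bexI[of _ d]) auto
qed

text \<open>From level \<open>D n + 2\<close> on, the relevant suffix and prefix are frozen. So is
  the image of \<open>mid\<close>: if it contained a growing letter, it would alone be as long as
  the whole factor.\<close>

lemma cross_stable:
 assumes D: "D_ok D" "mirror.D_ok D" and ta: "ta : triples" and p: "D n + 2 <= p"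
 shows "cross ta p n <= cross ta (D n + 2) n"
proof
 fix w assume w: "w : cross ta p n"
 obtain b mid c where t: "ta = (b, mid, c)" by (cases ta)
 let ?q = "D n + 2"
 from w obtain s t y z where w: "length w = n" "w = s @ it f p mid @ t" "s ~= []" "t ~= []"
   "it f p [b] = y @ s" "it f p [c] = t @ z" unfolding cross_def t by auto
 have R: "b : R" "set mid <= R" "c : R" using triples_R ta t by auto
 have tk: "take n (it f p [c]) = take n (it f ?q [c])"
  by (rule stable_prefix_all[OF idem nf D(1) R(3) p])
 have "t = take (length t) (take n (it f p [c]))" using w(1,2,6) by simp
 also have "... = take (length t) (it f ?q [c])" unfolding tk using w(1,2) by simp
 finally have "t = take (length t) (it f ?q [c])" .
 then obtain z' where z': "it f ?q [c] = t @ z'" by (metis append_take_drop_id)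
 have "take n (it (mir f) p [b]) = take n (it (mir f) ?q [b])"
  using mirror.stable_prefix_all[of D b n p] idem_mir nf_mir D(2) R(1) p unfolding mirror_G by blast
 hence tk: "take n (rev (it f p [b])) = take n (rev (it f ?q [b]))" unfolding it_mir_letter .
 have "rev s = take (length s) (take n (rev (it f p [b])))" using w(1,2,5) by simp
 also have "... = take (length s) (rev (it f ?q [b]))" unfolding tk using w(1,2) by simp
 finally have "rev s = take (length s) (rev (it f ?q [b]))" .
 then obtain y' where "rev (it f ?q [b]) = rev s @ y'" by (metis append_take_drop_id)
 hence y': "it f ?q [b] = rev y' @ s" by (metis rev_append rev_rev_ident)
 have "it f p mid = it f ?q mid"
 proof (cases "set mid <= B")
  case True
  thus ?thesis using idem_word[OF True, of p] idem_word[OF True, of ?q] p by simp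
 next
  case False
  then obtain d where d: "d : set mid" "d : G" using R(2) by blast
  have "n <= length (it f p [d])" using stable_prefix(2)[OF idem nf D(1) _ p] d R(2) by blast
  also have "... <= length (it f p mid)" by (rule length_it_subset[OF d(1)])
  finally have "n < length w" using w(2,3,4) by (cases s) auto
  with w(1) show ?thesis by simp
 qed
 with w y' z' show "w : cross ta ?q n" unfolding cross_def t by auto
qed

text \<open>All levels from \<open>D n + 2\<close> on count as one by stability. Below, only levels
  with an image of length at least \<open>n\<close> one step later matter, and each contributes at
  most \<open>n\<close> factors per triple.\<close>

lemma upper_bound:
 assumes D: "D_ok D" "mirror.D_ok D"
 shows "EX C. ALL n>=2. card (factors x n) <=
  C * n * Suc (card {p. p < D n + 2 & (EX d:R. n <= length (it f (Suc p) [d]))})"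
proof (intro exI[of _ "card triples"] allI impI)
 fix n :: nat assume n: "2 <= n"
 let ?P = "{p. p < D n + 2 & (EX d:R. n <= length (it f (Suc p) [d]))}"
 let ?Q = "insert (D n + 2) ?P"
 have fin: "finite ?P" by (rule finite_subset[of _ "{..<D n + 2}"]) auto
 have "factors x n <= (UN ta:triples. UN p:?Q. cross ta p n)"
 proof
  fix w assume "w : factors x n"
  hence "fac w" "length w = n" unfolding factors_eq by auto
  with factor_crosses[of w] n obtain p d ta where *: "d : R" "n <= length (it f (Suc p) [d])" "ta : triples"
   "w : cross ta p n" by auto
  show "w : (UN ta:triples. UN p:?Q. cross ta p n)"
  proof (cases "p < D n + 2")
   case True with * show ?thesis by auto
  next
   case False
   hence "w : cross ta (D n + 2) n" using cross_stable[OF D *(3), of n p] *(4) by auto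
   with *(3) show ?thesis by blast
  qed
 qed
 hence "card (factors x n) <= card (UN ta:triples. UN p:?Q. cross ta p n)"
  using finite_triples fin card_cross by (intro card_mono) auto
 also have "... <= (SUM ta:triples. card (UN p:?Q. cross ta p n))" using finite_triples by (rule card_UN_le)
 also have "... <= (SUM ta:triples. n * Suc (card ?P))"
 proof (rule sum_mono)
  fix ta
  have "card (UN p:?Q. cross ta p n) <= (SUM p:?Q. card (cross ta p n))" using fin by (intro card_UN_le) auto
  also have "... <= (SUM p:?Q. n)" by (intro sum_mono card_cross)
  also have "... <= n * Suc (card ?P)" using fin by (simp add: card_insert_if)
  finally show "card (UN p:?Q. cross ta p n) <= n * Suc (card ?P)" .
 qed
 finally show "card (factors x n) <= card triples * n * Suc (card ?P)" by (simp only: sum_constant of_nat_id mult.assoc)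
qed

end

text \<open>If the bounded word before \<open>c\<close> vanishes, the word behind \<open>c\<close>
  does not, because \<open>c\<close> would be bounded otherwise. So at least one letter is gained in
  every iteration, and \<open>n\<close> iterations always suffice.\<close>

lemma (in morphism) D_ok_id:
 assumes idem: "!!b. b : B ==> extend f (f b) = f b"
 shows "D_ok (%n. n)"
 unfolding D_ok_def
proof (intro ballI allI impI)
 fix c y w assume c: "c : G" "f c = y @ c # w" "set y <= B"
 let ?V = "%p. concat (map (%i. it f i w) [0..<p])"
 have wR: "set w <= R" using closed[of c] c by auto
 have idem': "it f p y = extend f y" if "set y <= B" "1 <= p" for y p
  using it_idem_on[of y f "p - 1"] that idem by auto
 have "n <= length (?V p)" if y: "extend f y = []" and p: "n <= p" for n p
 proof -
  have w: "extend f w ~= []"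
  proof
   assume w: "extend f w = []"
   have "it f q [c] = y @ c # w" if "1 <= q" for q
    using that
   proof (induction q rule: dec_induct)
    case base show ?case using c(2) by simp
   next
    case (step q)
    thus ?case using c(2) y w by (simp add: extend_append)
   qed
   hence "length (it f q [c]) <= Suc (length (y @ c # w))" for q by (cases "q = 0") (auto simp: not_less_eq_eq)
   moreover have "growing f c" using c(1) by simp
   ultimately show False unfolding growing_def by (meson Suc_n_not_le_n le_trans)
  qed
  have ne: "it f i w ~= []" for i
  proof (cases "set w <= B")
   case True
   show ?thesis
   proof (cases "i = 0")
    case False
    thus ?thesis using idem'[OF True, of i] w by simp
   qed (use w in auto)
  next
   case False
   then obtain d where d: "d : set w" "growing f d" using wR by blast
   thus ?thesis using growing_descendant[OF d(2), of i] length_it_subset[OF d(1), of i f] by auto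
  qed
  have "p <= length (?V p)"
  proof (induction p)
   case (Suc p)
   thus ?case using ne[of p] by (cases "it f p w") auto
  qed simp
  with p show ?thesis by simp
 qed
 thus "extend f y ~= [] & (ALL n :: nat. n <= n) | extend f y = [] & (ALL n. ALL p>=n. n <= length (?V p))"
  by (cases "extend f y = []") simp_all
qed

lemma (in normalized) quadratic_upper: "EX C. ALL n>=2. card (factors x n) <= C * n * n"
proof -
 have "D_ok (%n. n)" "mirror.D_ok (%n. n)"
  using D_ok_id[OF idem] mirror.D_ok_id idem_mir unfolding mirror_G by blast+
 from upper_bound[OF this] obtain C where
  C: "!!n. n >= 2 ==> card (factors x n) <= C * n * Suc (card {p. p < n + 2 & (EX d:R. n <= length (it f (Suc p) [d]))})"
  by blast
 have "card (factors x n) <= (C * 3) * n * n" if "n >= 2" for n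
 proof -
  have "card {p. p < n + 2 & (EX d:R. n <= length (it f (Suc p) [d]))} <= card {..<n + 2}" by (intro card_mono) auto
  hence "C * n * Suc (card {p. p < n + 2 & (EX d:R. n <= length (it f (Suc p) [d]))}) <= C * n * (3 * n)"
   using that by (intro mult_le_mono) auto
  thus ?thesis using C[OF that] by (simp add: algebra_simps)
 qed
 thus ?thesis by blast
qed

section \<open>Lower bounds\<close>

lemma first_outside_unique:
 assumes "y @ c # w = y' @ c' # w'" "c ~: S" "c' ~: S" "set y <= S" "set y' <= S"
 shows "y = y' & c = c' & w = w'"
 using assms
proof (induction y arbitrary: y')
 case Nil
 thus ?case by (cases y') auto
next
 case (Cons d y)
 thus ?case by (cases y') auto
qed

text \<open>A maximal run over \<open>S\<close> delimited by other letters cannot be shifted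
  slightly. Two such runs in the same word coincide, or the one starting earlier ends before the
  delimiter \<open>e'\<close> in front of the other.\<close>

lemma compare_runs:
 assumes eq: "L @ z @ r # R = L' @ z' @ r' # R'" and len: "length L <= length L'"
  and S: "set z <= S" "set z' <= S" "r ~: S" "r' ~: S" and L': "L' = l' @ [e']" "e' ~: S"
 shows "L = L' & z = z' | (EX m. L' = L @ z @ m & r # R = m @ z' @ r' # R')"
proof -
 have "L = take (length L) L'" using arg_cong[OF eq, of "take (length L)"] len by simp
 then obtain m where m1: "L' = L @ m" by (metis append_take_drop_id)
 hence m: "L' = L @ m" "z @ r # R = m @ z' @ r' # R'" using eq by simp_all
 show ?thesis
 proof (cases "m = []")
  case True
  hence "z @ r # R = z' @ r' # R'" using m(2) by simp
  hence "z = z'" using first_outside_unique[OF _ S(3,4,1,2)] by blast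
  thus ?thesis using m True by simp
 next
  case False
  hence e': "e' : set m" using m(1) L'(1) by (metis append_is_Nil_conv last_append last_in_set last_snoc)
  from m(2) obtain us where "z = m @ us | m = z @ us & r # R = us @ z' @ r' # R'"
   by (auto simp: append_eq_append_conv2)
  moreover have "z ~= m @ us" using e' L'(2) S(1) by auto
  ultimately have "m = z @ us & r # R = us @ z' @ r' # R'" by blast
  thus ?thesis using m(1) by blast
 qed
qed

lemma concat_map_Nil [simp]: "concat (map (%i. []) xs) = []"
 by (induction xs) auto

lemma card_windows:
 fixes w :: "'p \<times> nat => 'b"
 assumes "finite I" "inj_on w (I \<times> {..<K})" "!!p k. p : I ==> k < K ==> w (p, k) : A" "finite A"
 shows "card I * K <= card A"
proof -
 have "card I * K = card (I \<times> {..<K})" by (simp add: card_cartesian_product)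
 also have "... = card (w ` (I \<times> {..<K}))" using assms(2) by (simp add: card_image)
 also have "... <= card A" using assms(3,4) by (intro card_mono) auto
 finally show ?thesis .
qed

lemma surrounded:
 assumes "EX b:set w1. P b" "EX c:set w2. P c" "~ P s"
 shows "EX l b y c q. w1 @ s # w2 = l @ b # y @ c # q & P b & P c & (ALL d:set y. ~ P d) & s : set y"
proof -
 from split_list_last_prop[OF assms(1)] obtain l b y1 where b: "w1 = l @ b # y1" "P b" "ALL d:set y1. ~ P d" by blast
 from split_list_first_prop[OF assms(2)] obtain y2 c q where c: "w2 = y2 @ c # q" "P c" "ALL d:set y2. ~ P d" by blast
 have "w1 @ s # w2 = l @ b # (y1 @ s # y2) @ c # q" using b c by simp
 moreover have "ALL d:set (y1 @ s # y2). ~ P d" using b c assms(3) by auto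
 ultimately show ?thesis using b(2) c(2) by (metis in_set_conv_decomp)
qed

section \<open>Runs of slow letters inside images of fast letters\<close>

context morphism
begin

text \<open>A slow run at the beginning of the image of a fast letter cannot pass the image of a
  fast child. Descending to the first child not fully covered, every level adds fewer than
  \<open>W\<close> slow images.\<close>

lemma run_bound_prefix:
 assumes S: "!!s. s : S ==> set (f s) <= S" "S <= R" "!!b. b : R - S ==> EX c:set (f b). c ~: S"
  and M: "!!s p. s : S ==> length (it f p [s]) <= M p" and W: "!!b. b : R ==> length (f b) <= W"
  and b: "b : R - S" and z: "it f p [b] = z @ r" "set z <= S"
 shows "length z <= (SUM i<p. W * M i)"
 using b z
proof (induction p arbitrary: b z r)
 case 0
 thus ?case by (cases z) auto
next
 case (Suc p)
 have F: "EX c:set (it f n [d]). c ~: S" if "d : R - S" for d n using S(3) that by (rule fast_descendant)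
 show ?case
 proof (cases "z = []")
  case False
  have "concat (map (%d. it f p [d]) (f b)) = z @ r" using Suc.prems(2) unfolding it_Suc_letter
   by (subst (asm) it_concat)
  from prefix_of_concat[OF False this] obtain mid c v t z' where
   sp: "f b = mid @ c # v" "z = concat (map (%d. it f p [d]) mid) @ t" "t ~= []" "it f p [c] = t @ z'" by blast
  have z_eq: "z = it f p mid @ t" using sp(2) it_concat[of p f mid] by simp
  have R: "set mid <= R" "c : R" using closed[of b] Suc.prems(1) sp(1) by auto
  have mid: "d : S" if dm: "d : set mid" for d
  proof (rule ccontr)
   assume "d ~: S"
   then obtain e where "e : set (it f p [d])" "e ~: S" using F[of d p] dm R(1) by blast
   moreover have "set (it f p [d]) <= set z" unfolding z_eq using dm set_it[of p f mid] by auto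
   ultimately show False using Suc.prems(3) by blast
  qed
  have "length (it f p mid) <= length mid * M p" using M mid by (intro length_it_le) auto
  moreover have "length t <= (SUM i<p. W * M i) + M p"
  proof (cases "c : S")
   case True
   hence "length (it f p [c]) <= M p" by (rule M)
   thus ?thesis using sp(4) by simp
  next
   case False
   thus ?thesis using Suc.IH[of c t z'] sp(4) R(2) z_eq Suc.prems(3) by simp
  qed
  ultimately have "length z <= (SUM i<p. W * M i) + (length mid + 1) * M p" unfolding z_eq by simp
  also have "(length mid + 1) * M p <= W * M p"
   using W[of b] Suc.prems(1) sp(1) by (intro mult_le_mono1) simp
  finally show ?thesis by simp
 qed simp
qed

lemma run_bound_suffix:
 assumes S: "!!s. s : S ==> set (f s) <= S" "S <= R" "!!b. b : R - S ==> EX c:set (f b). c ~: S"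
  and M: "!!s p. s : S ==> length (it f p [s]) <= M p" and W: "!!b. b : R ==> length (f b) <= W"
  and b: "b : R - S" and z: "it f p [b] = r @ z" "set z <= S"
 shows "length z <= (SUM i<p. W * M i)"
proof -
 interpret m: morphism "mir f" R by (rule morphism_mir)
 have "it (mir f) p [b] = rev z @ rev r" using z(1) by (simp add: it_mir_letter)
 hence "length (rev z) <= (SUM i<p. W * M i)"
  using S(2) M W b z(2) by (intro m.run_bound_prefix[of S M W b p "rev z" "rev r"])
   (auto simp: mir_def it_mir_letter dest: S(1) S(3)[OF DiffI] subsetD)
 thus ?thesis by simp
qed

text \<open>Descend until the run no longer fits into the image of one letter. There it splits into
  a suffix, some slow images and a prefix; both ends are bounded as before, which explains the
  factor 2.\<close>

lemma run_bound:
 assumes S: "!!s. s : S ==> set (f s) <= S" "S <= R" "!!b. b : R - S ==> EX c:set (f b). c ~: S"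
  and M: "!!s p. s : S ==> length (it f p [s]) <= M p" and W: "!!b. b : R ==> length (f b) <= W"
  and W0: "1 <= W"
  and b: "b : R - S" and z: "it f p [b] = l @ z @ r" "set z <= S"
 shows "length z <= 2 * (SUM i<p. W * M i)"
 using b z
proof (induction p arbitrary: b l z r)
 case 0
 hence "length z = 0 | z = [b]" by (cases l; cases z) auto
 thus ?case using 0 by auto
next
 case (Suc p)
 let ?E = "SUM i<p. W * M i"
 have F: "EX c:set (it f n [d]). c ~: S" if "d : R - S" for d n using S(3) that by (rule fast_descendant)
 have WM: "M p <= W * M p" using W0 by (cases W) auto
 show ?case
 proof (cases "EX d:set (f b). EX y v. it f p [d] = y @ z @ v")
  case True
  then obtain d y v where d: "d : set (f b)" "it f p [d] = y @ z @ v" by blast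
  show ?thesis
  proof (cases "d : S")
   case True
   hence "length (it f p [d]) <= M p" by (rule M)
   hence "length z <= M p" using d(2) by simp
   hence "length z <= W * M p" using WM by (rule le_trans)
   thus ?thesis by simp
  next
   case False
   hence "d : R - S" using closed[of b] Suc.prems(1) d(1) by auto
   hence "length z <= 2 * ?E" using d(2) Suc.prems(3) by (rule Suc.IH)
   thus ?thesis by simp
  qed
 next
  case False
  show ?thesis
  proof (cases "z = []")
   case z: False
   have "concat (map (%d. it f p [d]) (f b)) = l @ z @ r" using Suc.prems(2) unfolding it_Suc_letter
    by (subst (asm) it_concat)
   from infix_of_concat[OF z this] False obtain u d mid c v s t y' z' where
    sp: "f b = u @ d # mid @ c # v" "z = s @ concat (map (%d. it f p [d]) mid) @ t"
    "s ~= []" "t ~= []" "it f p [d] = y' @ s" "it f p [c] = t @ z'" by blast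
   have z_eq: "z = s @ it f p mid @ t" using sp(2) it_concat[of p f mid] by simp
   have R: "d : R" "set mid <= R" "c : R" using closed[of b] Suc.prems(1) sp(1) by auto
   have mid: "d : S" if dm: "d : set mid" for d
   proof (rule ccontr)
    assume "d ~: S"
    then obtain e where "e : set (it f p [d])" "e ~: S" using F[of d p] dm R(2) by blast
    moreover have "set (it f p [d]) <= set z" unfolding z_eq using dm set_it[of p f mid] by auto
    ultimately show False using Suc.prems(3) by blast
   qed
   have sub: "set s <= S" "set t <= S" using Suc.prems(3) z_eq by auto
   have "length (it f p mid) <= length mid * M p" using M mid by (intro length_it_le) auto
   moreover have "length s <= ?E + M p"
   proof (cases "d : S")
    case True
    hence "length (it f p [d]) <= M p" by (rule M)
    thus ?thesis using sp(5) by simp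
   next
    case False
    hence "length s <= ?E" using run_bound_suffix[OF S M W _ sp(5) sub(1)] R(1) by blast
    thus ?thesis by simp
   qed
   moreover have "length t <= ?E + M p"
   proof (cases "c : S")
    case True
    hence "length (it f p [c]) <= M p" by (rule M)
    thus ?thesis using sp(6) by simp
   next
    case False
    hence "length t <= ?E" using run_bound_prefix[OF S M W _ sp(6) sub(2)] R(3) by blast
    thus ?thesis by simp
   qed
   ultimately have "length z <= 2 * ?E + (length mid + 2) * M p" unfolding z_eq by simp
   also have "(length mid + 2) * M p <= W * M p"
    using W[of b] Suc.prems(1) sp(1) by (intro mult_le_mono1) simp
   finally show ?thesis by simp
  qed simp
 qed
qed

end

context pure_morphic
begin

lemma F_occurrences:
 assumes "!!b. P b ==> b : R ==> EX c:set (f b). P c" "f a = a # u" "EX c:set u. P c" "P a"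
 shows "Suc n <= length (filter P (it f n [a]))" and "n < length (it f n [a])"
proof -
 have "it f n [a] = a # concat (map (%i. it f i u) [0..<n])" for n
  using it_self_reproducing[of f a "[]" u n] assms(2) by simp
 moreover have uR: "set u <= R" using closed[OF a_in_R] assms(2) by auto
 have "EX c:set (it f i u). P c" for i
 proof (induction i)
  case (Suc i)
  then obtain c where c: "c : set (it f i u)" "P c" by blast
  thus ?case using assms(1)[of c] it_in_R[OF uR, of i] by (auto simp: set_extend)
 qed (use assms(3) in simp)
 hence one: "1 <= length (filter P (it f i u))" for i
  by (cases "filter P (it f i u)") (auto simp: filter_empty_conv)
 have "n <= length (filter P (concat (map (%i. it f i u) [0..<n])))"
 proof (induction n)
  case (Suc n)
  thus ?case using one[of n] by simp
 qed simp
 ultimately show *: "Suc n <= length (filter P (it f n [a]))" using assms(4) by simp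
 show "n < length (it f n [a])" using * length_filter_le[of P "it f n [a]"] by linarith
qed

text \<open>The word begins with a letter satisfying \<open>P\<close>, and such letters never run
  out, so every occurrence of \<open>s\<close> is enclosed between two of them.\<close>

lemma block_exists:
 assumes P: "!!b. P b ==> b : R ==> EX c:set (f b). P c" "EX u. f a = a # u & (EX c:set u. P c)" "P a"
  and s: "s : R" "~ P s"
 shows "EX l b y c. pre (l @ b # y @ [c]) & P b & P c & (ALL d:set y. ~ P d) & s : set y"
proof -
 obtain u where u: "f a = a # u" "EX c:set u. P c" using P(2) by blast
 note occ = F_occurrences[OF P(1) u P(3)]
 obtain n where "s : set (it f n [a])" using reachable[OF s(1)] by blast
 then obtain w1 w2 where w: "it f n [a] = w1 @ s # w2" by (auto simp: in_set_conv_decomp)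
 have hd: "EX v. it f n [a] = a # v" for n
  using it_self_reproducing[of f a "[]" u n] u(1) by auto
 obtain w1' where w1: "w1 = a # w1'" using hd[of n] w s(2) P(3) by (cases w1) auto
 \<comment> \<open>After that many iterations there are more letters with \<open>P\<close> than the
   prefix up to \<open>s\<close> has letters, so one of them follows \<open>s\<close>.\<close>
 let ?m = "n + length (it f n [a])"
 obtain v where v: "it f ?m [a] = it f n [a] @ v" using it_a_mono[of n ?m] by auto
 have "length (filter P (it f ?m [a])) <= length (filter P (w1 @ [s])) + length (filter P (w2 @ v))" using v w by simp
 moreover have "length (filter P (w1 @ [s])) <= length (it f n [a])"
  using length_filter_le[of P "w1 @ [s]"] w by simp
 ultimately have "filter P (w2 @ v) ~= []" using occ(1)[of ?m] by (auto simp del: filter_append)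
 hence "EX c:set (w2 @ v). P c" by (auto simp: filter_empty_conv)
 from surrounded[OF _ this s(2), of w1] w1 P(3) obtain l b y c q where
  sur: "w1 @ s # w2 @ v = l @ b # y @ c # q" "P b" "P c" "ALL d:set y. ~ P d" "s : set y" by auto
 have "pre (w1 @ s # w2 @ v)" using pre_iter[of ?m] v w by simp
 hence "pre ((l @ b # y @ [c]) @ q)" using sur(1) by simp
 hence "pre (l @ b # y @ [c])" by (rule pre_appendD)
 with sur show ?thesis by blast
qed

text \<open>Slow letters \<open>S\<close>, fast letters \<open>R - S\<close>: the runs of slow letters inside the image of a fast letter
 are shorter than the run around \<open>f\<^sup>p(y)\<close>, which therefore determines its window's coordinates.\<close>

lemma slow_block_windows:
 assumes S: "!!s. s : S ==> set (f s) <= S" "S <= R" "!!b. b : R - S ==> EX c:set (f b). c ~: S"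
  and M: "!!s p. s : S ==> length (it f p [s]) <= M p" and W: "!!b. b : R ==> length (f b) <= W" "1 <= W"
  and block: "fac (b # y @ [c])" "b ~: S" "c ~: S" "set y <= S"
  and E: "!!p. E p = (SUM i<p. W * M i)"
  and I: "finite I" "!!p. p : I ==> 2 * E p < length (it f p y)"
   "!!p. p : I ==> 2 * (2 * E p + length y * M p) + 2 <= N"
   "!!p. p : I ==> N + E p <= length (it f p [b])" "!!p. p : I ==> N + E p <= length (it f p [c])"
   "!!p p'. p : I ==> p' : I ==> p < p' ==> 2 * E p + length y * M p < length (it f p' y)"
 shows "card I * (N div 2) <= card (factors x N)"
proof -
 have R: "b : R - S" "c : R - S" using fac_R[OF block(1)] block(2,3) by auto
 have F: "EX c:set (it f n [d]). c ~: S" if "d : R - S" for d n using S(3) that by (rule fast_descendant)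
 \<comment> \<open>In this proof \<open>rate p\<close> and \<open>ga p\<close> are letters: the last
   fast letter of the image of \<open>b\<close> and the first one of the image of \<open>c\<close>.
   They delimit the slow run \<open>z p\<close>.\<close>
 have "EX Y rate T. it f p [b] = Y @ rate # T & rate ~: S & set T <= S" for p
  using split_list_last_prop[OF F[OF R(1), of p]] by blast
 then obtain Y rate T where bT: "!!p. it f p [b] = Y p @ rate p # T p" "!!p. rate p ~: S" "!!p. set (T p) <= S" by metis
 have "EX J ga Z. it f p [c] = J @ ga # Z & ga ~: S & set J <= S" for p
  using split_list_first_prop[OF F[OF R(2), of p]] by blast
 then obtain J ga Z where cJ: "!!p. it f p [c] = J p @ ga p # Z p" "!!p. ga p ~: S" "!!p. set (J p) <= S" by metis
 define z where "z p = T p @ it f p y @ J p" for p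
 have zS: "set (z p) <= S" for p
  unfolding z_def using bT(3) cJ(3) it_closed[of S f y p] S(1) block(4) by auto
 have lenT: "length (T p) <= E p" for p
  unfolding E using run_bound_suffix[OF S M W(1) R(1), of p "Y p @ [rate p]" "T p"] bT by simp
 have lenJ: "length (J p) <= E p" for p
  unfolding E using run_bound_prefix[OF S M W(1) R(2), of p "J p" "ga p # Z p"] cJ by simp
 have run: "length v <= 2 * E p" if "d : {b, c}" "it f p [d] = l @ v @ r" "set v <= S" for d l v r p
  unfolding E using run_bound[OF S M W, of d p l v r] R that by blast
 have z_le: "length (z p) <= 2 * E p + length y * M p" for p
 proof -
  have "length (it f p y) <= length y * M p" using M block(4) by (intro length_it_le) auto
  thus ?thesis using lenT[of p] lenJ[of p] by (simp add: z_def)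
 qed
 have z_ge: "length (it f p y) <= length (z p)" for p by (simp add: z_def)
 \<comment> \<open>The window with coordinates \<open>(p, k)\<close> begins \<open>k\<close> letters
   before the delimiter \<open>rate p\<close> and contains the run \<open>z p\<close> together with
   both delimiters.\<close>
 define L where "L p k = drop (length (Y p) - k) (Y p) @ [rate p]" for p k
 define Q where "Q p k = take (N - Suc k - length (z p) - 1) (Z p)" for p k
 define w where "w = (%(p, k). L p k @ z p @ ga p # Q p k)"
 have lens: "length (L p k) = Suc k" "length (w (p, k)) = N" if p: "p : I" and k: "k < N div 2" for p k
 proof -
  have "N + E p <= length (Y p) + 1 + length (T p)" using I(4)[OF p] bT(1)[of p] by simp
  hence "k <= length (Y p)" using lenT[of p] k by linarith
  thus L: "length (L p k) = Suc k" by (simp add: L_def)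
  have "N + E p <= length (J p) + 1 + length (Z p)" using I(5)[OF p] cJ(1)[of p] by simp
  hence "N <= Suc (length (Z p))" using lenJ[of p] by linarith
  moreover have "Suc k + length (z p) + 1 <= N"
  proof -
   have "2 * Suc k <= N" using k by presburger
   hence "Suc k + X + 1 <= N" if "X <= Y" "2 * Y + 2 <= N" for X Y using that by presburger
   from this[OF z_le I(3)[OF p]] show ?thesis .
  qed
  ultimately have "length (Q p k) = N - Suc k - length (z p) - 1" "Suc k + length (z p) + 1 <= N" by (auto simp: Q_def)
  thus "length (w (p, k)) = N" using L by (simp add: w_def)
 qed
 have facw: "fac (w (p, k))" for p k
 proof -
  have "it f p (b # y @ [c]) = Y p @ rate p # z p @ ga p # Z p"
   using it_Cons[of p f b "y @ [c]"] bT(1) cJ(1) by (simp add: it_append z_def)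
  hence "fac (Y p @ rate p # z p @ ga p # Z p)" using fac_it[OF block(1), of p] by simp
  moreover have "Y p @ rate p # z p @ ga p # Z p = take (length (Y p) - k) (Y p) @ w (p, k) @
    drop (N - Suc k - length (z p) - 1) (Z p)"
   by (simp add: w_def L_def Q_def)
  ultimately show ?thesis using fac_appendD by metis
 qed
 have inL: "length v <= 2 * E p" if "L p k = u @ v @ m" "set v <= S" for p k u v m
 proof (rule run[of b _ _ _ "m @ T p"])
  show "it f p [b] = (take (length (Y p) - k) (Y p) @ u) @ v @ m @ T p"
  proof -
   have "it f p [b] = take (length (Y p) - k) (Y p) @ L p k @ T p" by (simp add: bT(1) L_def)
   thus ?thesis by (simp add: that(1))
  qed
 qed (use that in auto)
 have inQ: "length v <= 2 * E p" if "ga p # Q p k = u @ v @ m" "set v <= S" for p k u v m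
 proof (rule run[of c _ "J p @ u" _ "m @ drop (N - Suc k - length (z p) - 1) (Z p)"])
  have "it f p [c] = J p @ (ga p # Q p k) @ drop (N - Suc k - length (z p) - 1) (Z p)"
   by (simp add: cJ(1) Q_def)
  thus "it f p [c] = (J p @ u) @ v @ m @ drop (N - Suc k - length (z p) - 1) (Z p)" by (simp only: that(1) append.assoc)
 qed (use that in auto)
 have same: "p = p' & k = k'" if p: "p : I" "k < N div 2" "p' : I" "k' < N div 2"
  and eq: "w (p, k) = w (p', k')" and le: "length (L p k) <= length (L p' k')" for p k p' k'
 proof -
  have "L p k @ z p @ ga p # Q p k = L p' k' @ z p' @ ga p' # Q p' k'" using eq by (simp add: w_def)
  from compare_runs[OF this le zS zS cJ(2) cJ(2) L_def bT(2)]
  show ?thesis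
  proof
   assume *: "L p k = L p' k' & z p = z p'"
   hence "k = k'" using lens(1) p by (metis Suc_inject)
   moreover have "p = p'"
   proof (rule ccontr)
    assume "p ~= p'"
    then consider "p < p'" | "p' < p" by linarith
    thus False
    proof cases
     case 1
     thus False using I(6)[OF p(1,3) 1] z_le[of p] z_ge[of p'] * by simp
    next
     case 2
     thus False using I(6)[OF p(3,1) 2] z_le[of p'] z_ge[of p] * by simp
    qed
   qed
   ultimately show ?thesis by simp
  next
   assume "EX m. L p' k' = L p k @ z p @ m & ga p # Q p k = m @ z p' @ ga p' # Q p' k'"
   then obtain m where m: "L p' k' = L p k @ z p @ m" "ga p # Q p k = m @ z p' @ ga p' # Q p' k'" by blast
   \<comment> \<open>Disjoint runs would place \<open>z p\<close> inside the \<open>p'\<close>-th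
     image of \<open>b\<close> and \<open>z p'\<close> inside the \<open>p\<close>-th image of
     \<open>c\<close>, making each shorter than the other.\<close>
   have "length (z p) <= 2 * E p'" using inL[OF m(1) zS] .
   also have "... < length (z p')" using I(2)[OF p(3)] z_ge[of p'] by linarith
   also have "... <= 2 * E p" using inQ[OF m(2) zS] .
   also have "... < length (z p)" using I(2)[OF p(1)] z_ge[of p] by linarith
   finally show ?thesis .
  qed
 qed
 have "inj_on w (I \<times> {..<N div 2})"
 proof (rule inj_onI)
  fix q q' assume q: "q : I \<times> {..<N div 2}" "q' : I \<times> {..<N div 2}" "w q = w q'"
  obtain p k p' k' where qq: "q = (p, k)" "q' = (p', k')" by (cases q; cases q')
  have *: "p : I" "p' : I" "k < N div 2" "k' < N div 2" "w (p, k) = w (p', k')" using q qq by auto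
  show "q = q'"
  proof (cases "length (L p k) <= length (L p' k')")
   case True
   from same[OF *(1,3,2,4,5) this] show ?thesis using qq by simp
  next
   case False
   hence "length (L p' k') <= length (L p k)" by simp
   from same[OF *(2,4,1,3) *(5)[symmetric] this] show ?thesis using qq by simp
  qed
 qed
 from card_windows[OF I(1) this _ finite_factors]
 show ?thesis using facw lens(2) unfolding factors_eq by blast
qed

end

section \<open>Quadratic complexity from accumulating bounded words\<close>

context normalized
begin

text \<open>With \<open>t\<close> and \<open>i\<close> the bounded words produced next to \<open>b\<close> and \<open>c\<close>, the bounded block between \<open>b\<close> and \<open>c\<close>
 has length affine in the number of iterations.\<close>

lemma quadratic_windows:
 assumes block: "pre (l @ b # y @ [c])" "l ~= []" "b : G" "c : G" "set y <= B"
  and fb: "f b = u @ b # t" "set t <= B" and fc: "f c = i @ c # v" "set i <= B"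
  and acc: "extend f (t @ i) ~= []"
  and long: "!!n. n < length (it f n [a])"
 shows "EX K. ALL N>=K. N * N <= K * card (factors x N)"
proof -
 define T J z where "T n = concat (map (%j. it f j t) [0..<n])"
  and "J n = concat (map (%j. it f j i) (rev [0..<n]))" and "z n = T n @ it f n y @ J n" for n
 define U V where "U n = concat (map (%j. it f j u) (rev [0..<n]))"
  and "V n = concat (map (%j. it f j v) [0..<n])" for n
 have itb: "it f n [b] = U n @ b # T n" for n using it_self_reproducing[where f = f, OF fb(1)] by (simp add: U_def T_def)
 have itc: "it f n [c] = J n @ c # V n" for n using it_self_reproducing[where f = f, OF fc(1)] by (simp add: J_def V_def)
 define d where "d = length (extend f (t @ i))"
 have d: "1 <= d" using acc by (auto simp: d_def Suc_le_eq)
 have lenT: "length (T (Suc n)) = length t + n * length (extend f t)" for n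
 proof (induction n)
  case (Suc n)
  have "T (Suc (Suc n)) = T (Suc n) @ it f (Suc n) t" by (simp add: T_def)
  thus ?case using Suc idem_word[OF fb(2), of "Suc n"] by simp
 qed (simp add: T_def)
 have lenJ: "length (J (Suc n)) = length i + n * length (extend f i)" for n
 proof (induction n)
  case (Suc n)
  have "J (Suc (Suc n)) = it f (Suc n) i @ J (Suc n)" by (simp add: J_def)
  thus ?case using Suc idem_word[OF fc(2), of "Suc n"] by simp
 qed (simp add: J_def)
 define A where "A = length t + length i + length (extend f y)"
 \<comment> \<open>After the first iteration every bounded word has a constant image, so the run
   gains exactly \<open>d\<close> letters per iteration and its length determines
   \<open>n\<close>.\<close>
 have lenz: "length (z (Suc n)) = A + n * d" for n
  using lenT[of n] lenJ[of n] idem_word[OF block(5), of "Suc n"]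
  by (simp add: z_def A_def d_def extend_append algebra_simps)
 have zB: "set (z n) <= - G" for n
 proof -
  have B: "set (it f j w) <= - G" if "set w <= B" for j w
   using that growing_if_child[where f = f and n = j] set_it[of j f w] by fastforce
  show ?thesis
   using subsetD[OF B[OF block(5)]] subsetD[OF B[OF fb(2)]] subsetD[OF B[OF fc(2)]]
   unfolding z_def T_def J_def set_append set_concat set_map by blast
 qed
 define \<Lambda> where "\<Lambda> n = it f n l @ U n" for n
 have pre_n: "pre (\<Lambda> n @ b # z n @ c # V n)" for n
 proof -
  have "it f n (l @ b # y @ [c]) = \<Lambda> n @ b # z n @ c # V n"
   using it_Cons[of n f b "y @ [c]"] by (simp add: it_append itb itc \<Lambda>_def z_def)
  thus ?thesis using pre_it[OF block(1), of n] by simp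
 qed
 have len\<Lambda>: "n < length (\<Lambda> n)" for n
 proof -
  obtain q where "l = [a] @ q"
   using pre_comparable[OF pre_iter[of 0] block(1)] block(2) by (cases l) auto
  hence "it f n l = it f n [a] @ it f n q" by (metis it_append)
  hence "length (it f n [a]) <= length (it f n l)" by simp
  thus ?thesis using long[of n] by (simp add: \<Lambda>_def)
 qed
 \<comment> \<open>With \<open>K N <= n < 2 * K N\<close> and \<open>k < K N\<close>, a run of
   length \<open>A + n * d\<close> with delimiters fits into a window of length \<open>N\<close>,
   and the run is longer than every offset \<open>k\<close>.\<close>
 define K where "K N = N div (2 * (d + d + 2))" for N
 define w where "w N = (%(n, k). (drop (length (\<Lambda> (Suc n)) - k) (\<Lambda> (Suc n)) @ [b]) @ z (Suc n) @
   c # x [length (\<Lambda> (Suc n) @ b # z (Suc n) @ [c]) \<rightarrow> length (\<Lambda> (Suc n) @ b # z (Suc n) @ [c]) + (N - k - length (z (Suc n)) - 2)])" for N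
 have bound: "K N * K N <= card (factors x N)" if N: "2 * A + 4 <= N" for N
 proof -
  let ?K = "K N"
  let ?I = "{?K..<2 * ?K}"
  have KN: "?K * (2 * (d + d + 2)) <= N" unfolding K_def by (rule div_times_less_eq_dividend)
  have arith: "2 * (k + (A + X) + 2) <= 2 * (Q + A + 2 * Y + 2)" if "X <= 2 * Y" "k < Q" for k X Y Q :: nat
   using that by presburger
  have fits: "k + length (z (Suc n)) + 2 <= N" if "n < 2 * ?K" "k < ?K" for n k
  proof -
   have "n * d <= (2 * ?K) * d" by (rule mult_le_mono1) (use that in simp)
   hence "n * d <= 2 * (?K * d)" by (simp only: mult.assoc)
   hence "2 * (k + length (z (Suc n)) + 2) <= 2 * (?K + A + 2 * (?K * d) + 2)"
    using arith that(2) unfolding lenz by blast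
   also have "... <= ?K * (2 * (d + d + 2)) + 2 * A + 4" by (simp add: algebra_simps)
   also have "... <= N + N" using KN N by linarith
   finally show ?thesis by simp
  qed
  have fw: "w N (n, k) : factors x N" if "n : ?I" "k < ?K" for n k
  proof -
   let ?P = "\<Lambda> (Suc n) @ b # z (Suc n) @ [c]"
   have preP: "pre ?P" using pre_n[of "Suc n"] pre_appendD[of ?P "V (Suc n)"] by simp
   have "prefix (length ?P + q) x = ?P @ x [length ?P \<rightarrow> length ?P + q]" for q
    using subsequence_append[where i = "length ?P" and j = q and w = x] preP unfolding pre_def by simp
   hence preq: "pre (?P @ x [length ?P \<rightarrow> length ?P + q])" for q using pre_subsequence by metis
   have k: "k < length (\<Lambda> (Suc n))" using that len\<Lambda>[of "Suc n"] by auto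
   let ?r = "N - k - length (z (Suc n)) - 2"
   have "?P @ x [length ?P \<rightarrow> length ?P + ?r] = take (length (\<Lambda> (Suc n)) - k) (\<Lambda> (Suc n)) @ w N (n, k)"
    by (simp add: w_def)
   hence "fac (w N (n, k))" using preq[of ?r] unfolding fac_def by metis
   moreover have "length (w N (n, k)) = N" using k fits[of n k] that by (simp add: w_def)
   ultimately show ?thesis by (simp add: factors_eq)
  qed
  have same: "n = n' & k = k'" if n: "n : ?I" "k < ?K" "n' : ?I" "k' < ?K" and eq: "w N (n, k) = w N (n', k')"
   and le: "k <= k'" for n k n' k'
  proof -
   let ?L = "%n k. drop (length (\<Lambda> (Suc n)) - k) (\<Lambda> (Suc n)) @ [b]"
   have lenL: "length (?L n k) = Suc k" if "n : ?I" "k < ?K" for n k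
    using that len\<Lambda>[of "Suc n"] by auto
   have cG: "c ~: - G" "b ~: - G" using block(3,4) by auto
   from eq have "?L n k @ z (Suc n) @ c # x [length (\<Lambda> (Suc n) @ b # z (Suc n) @ [c]) \<rightarrow>
      length (\<Lambda> (Suc n) @ b # z (Suc n) @ [c]) + (N - k - length (z (Suc n)) - 2)] =
     ?L n' k' @ z (Suc n') @ c # x [length (\<Lambda> (Suc n') @ b # z (Suc n') @ [c]) \<rightarrow>
      length (\<Lambda> (Suc n') @ b # z (Suc n') @ [c]) + (N - k' - length (z (Suc n')) - 2)]"
    by (simp only: w_def prod.case)
   from compare_runs[OF this _ zB zB cG(1) cG(1) refl cG(2)] lenL[OF n(1,2)] lenL[OF n(3,4)] le
   consider "?L n k = ?L n' k'" "z (Suc n) = z (Suc n')" | m where "?L n' k' = ?L n k @ z (Suc n) @ m"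
    by fastforce
   thus ?thesis
   proof cases
    case 1
    hence "Suc k = Suc k'" using lenL[OF n(1,2)] lenL[OF n(3,4)] by metis
    moreover have "A + n * d = A + n' * d" using 1(2) lenz by metis
    ultimately show ?thesis using d by simp
   next
    case 2
    \<comment> \<open>The first run would lie within the left part of the second window, which is
      too short, since \<open>k' < K N <= n * d\<close>.\<close>
    have "Suc k' = Suc k + length (z (Suc n)) + length m"
     using arg_cong[OF 2, of length] lenL[OF n(1,2)] lenL[OF n(3,4)] by simp
    moreover have "?K * 1 <= n * d" using n(1) d by (intro mult_le_mono) auto
    ultimately show ?thesis using n(4) lenz[of n] by linarith
   qed
  qed
  have "inj_on (w N) (?I \<times> {..<?K})"
  proof (rule inj_onI)
   fix q q' assume q: "q : ?I \<times> {..<?K}" "q' : ?I \<times> {..<?K}" "w N q = w N q'"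
   obtain n k n' k' where qq: "q = (n, k)" "q' = (n', k')" by (cases q; cases q')
   have *: "n : ?I" "n' : ?I" "k < ?K" "k' < ?K" "w N (n, k) = w N (n', k')" using q qq by auto
   show "q = q'"
   proof (cases "k <= k'")
    case True
    from same[OF *(1,3,2,4,5) this] show ?thesis using qq by simp
   next
    case False
    hence "k' <= k" by simp
    from same[OF *(2,4,1,3) *(5)[symmetric] this] show ?thesis using qq by simp
   qed
  qed
  from card_windows[OF _ this fw finite_factors] show ?thesis by simp
 qed
 define m where "m = 2 * (d + d + 2)"
 have "N * N <= (2 * A + 4 + 4 * m * m) * card (factors x N)" if N: "2 * A + 4 + 4 * m * m <= N" for N
 proof -
  have m: "1 <= m" by (simp add: m_def)
  have "m * 1 <= m * m" using m by (intro mult_le_mono) auto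
  hence mN: "m <= N" using N by linarith
  have Nm: "N = K N * m + N mod m" unfolding K_def m_def by (rule div_mult_mod_eq[symmetric])
  have "N mod m < m" using m by simp
  moreover have "m <= K N * m"
  proof -
   have "K N ~= 0" using mN m unfolding K_def m_def[symmetric] by (simp add: div_eq_0_iff)
   thus ?thesis by (cases "K N") auto
  qed
  ultimately have "N <= K N * m + K N * m" using Nm by linarith
  hence "N <= 2 * m * K N" by (simp add: algebra_simps)
  hence "N * N <= (2 * m * K N) * (2 * m * K N)" by (intro mult_le_mono)
  also have "... = 4 * m * m * (K N * K N)" by (simp add: algebra_simps)
  also have "... <= 4 * m * m * card (factors x N)" using bound[of N] N by (intro mult_le_mono2) linarith
  also have "... <= (2 * A + 4 + 4 * m * m) * card (factors x N)" by (intro mult_le_mono1) simp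
  finally show ?thesis .
 qed
 thus ?thesis by blast
qed

lemma first_split: "c : G ==> EX y0 c1 w0 y w. f c = y0 @ c1 # w0 & f c1 = y @ c1 # w & c1 : G & set y0 <= B & set y <= B"
 using nf unfolding normal_def by blast

lemma last_split: "c : G ==> EX y0 c1 w0 y w. f c = w0 @ c1 # y0 & f c1 = w @ c1 # y & c1 : G & set y0 <= B & set y <= B"
proof -
 assume "c : G"
 then obtain y0 c1 w0 y w where *: "mir f c = y0 @ c1 # w0" "mir f c1 = y @ c1 # w" "c1 : G" "set y0 <= B" "set y <= B"
  using nf_mir unfolding normal_def by blast
 hence "f c = rev w0 @ c1 # rev y0" "f c1 = rev w @ c1 # rev y"
  unfolding mir_def by (metis rev.simps(2) rev_append rev_rev_ident append.assoc append_Cons append_Nil)+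
 moreover have "set (rev y0) <= B" "set (rev y) <= B" using *(4,5) by simp_all
 ultimately show ?thesis using *(3) by blast
qed

definition bd_imm :: "'a list => bool" where
 "bd_imm v \<longleftrightarrow> set v <= B & extend f v ~= []"

text \<open>The windows require self-reproducing letters on both sides of the bounded block.
  \<open>b\<close> is one; its growing neighbour on the side where the bounded word accumulates
  becomes one after a further application of \<open>f\<close>, by the normal form.\<close>

lemma quadratic_lower:
 assumes b: "b : G" "f b = u @ b # v" "bd_imm v | bd_imm u" and occ: "pre (l @ [b])" "l ~= []"
 shows "EX K. ALL N>=K. N * N <= K * card (factors x N)"
proof -
 have P: "EX c:set (f b). growing f c" if "growing f b" "b : R" for b
  by (rule growing_child[OF that(1)])
 obtain ua where ua: "f a = a # ua" using prolongable by blast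
 have ua_G: "EX c:set ua. growing f c"
 proof (rule ccontr)
  assume no: "~ ?thesis"
  have "set ua <= R" using closed[OF a_in_R] ua by auto
  hence uaB: "set ua <= B" using no by auto
  obtain n q where n: "it f n [a] = (l @ [b]) @ q" using pre_imp_iter[OF occ(1)] by blast
  have "it f n [a] = a # concat (map (%i. it f i ua) [0..<n])" using it_self_reproducing[of f a "[]" ua n] ua by simp
  then obtain l' where "concat (map (%i. it f i ua) [0..<n]) = l' @ [b] @ q" using n occ(2) by (cases l) (auto dest: sym)
  moreover have "b : set (l' @ [b] @ q)" by simp
  ultimately have "b : set (concat (map (%i. it f i ua) [0..<n]))" by (simp only:)
  then obtain i where "b : set (it f i ua)" by auto
  hence "EX d:set ua. growing f d" using b(1) set_it[of i f ua] growing_if_child[where f = f and n = i] by auto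
  with no show False by blast
 qed
 note occs = F_occurrences[OF P ua ua_G growing_a]
 \<comment> \<open>The left delimiter must not be the initial letter of the word, because the
   windows extend beyond it to the left.\<close>
 have not_a: "l' ~= []" if "pre (l' @ d # e)" "d : G" "f d = w0 @ d' # y0" "set y0 <= B" "w0 = []" for l' d e w0 d' y0
 proof
  assume "l' = []"
  hence "d = a" using pre_nth[OF that(1), of 0] pre_nth[OF pre_iter[of 0], of 0] by simp
  hence "ua = y0" using that(3,5) ua by simp
  with that(4) ua_G show False by auto
 qed
 from b(3) show ?thesis
 proof
  assume v: "bd_imm v"
  obtain n q where n: "it f n [a] = (l @ [b]) @ q" using pre_imp_iter[OF occ(1)] by blast
  let ?m = "n + length (it f n [a])"
  obtain r where r: "it f ?m [a] = it f n [a] @ r" using it_a_mono[of n ?m] by auto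
  have "length (filter (growing f) (it f ?m [a])) <= length (l @ [b]) + length (filter (growing f) (q @ r))"
   using r n length_filter_le[of "growing f" "l @ [b]"] by simp
  moreover have "length (l @ [b]) <= length (it f n [a])" using n by simp
  ultimately have "filter (growing f) (q @ r) ~= []" using occs(1)[of ?m] by (auto simp del: filter_append)
  hence "EX c:set (q @ r). growing f c" by (auto simp: filter_empty_conv)
  from split_list_first_prop[OF this] obtain y c z where c: "q @ r = y @ c # z" "growing f c" "ALL d:set y. ~ growing f d" by blast
  have "it f ?m [a] = (l @ b # y @ [c]) @ z" using r n c(1) by simp
  hence pre: "pre (l @ b # y @ [c])" using pre_iter[of ?m] pre_appendD by metis
  have "fac (l @ b # y @ [c])" using pre unfolding fac_def by (metis append_Nil)
  hence R: "set y <= R" "c : R" using fac_R[of "l @ b # y @ [c]"] by auto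
  then obtain y0 c1 w0 i w where sp: "f c = y0 @ c1 # w0" "f c1 = i @ c1 # w" "c1 : G" "set y0 <= B" "set i <= B"
   using first_split[of c] c(2) by blast
  have "pre (extend f (l @ b # y @ [c]))" using pre_it[OF pre, of 1] by simp
  hence "pre ((extend f l @ u) @ b # (v @ extend f y @ y0) @ [c1] @ w0)" by (simp add: extend_append b(2) sp(1))
  hence pre': "pre ((extend f l @ u) @ b # (v @ extend f y @ y0) @ [c1])"
   using pre_appendD[of "(extend f l @ u) @ b # (v @ extend f y @ y0) @ [c1]" w0] by simp
  have "set (extend f y) <= B" using R(1) c(3) closed growing_if_child[where f = f and n = 1] by (fastforce simp: set_extend)
  hence "set (v @ extend f y @ y0) <= B" using v sp(4) by (auto simp: bd_imm_def)
  moreover have "extend f l ~= []"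
  proof -
   have "l = a # tl l" using pre_nth[OF occ(1), of 0] pre_nth[OF pre_iter[of 0], of 0] occ(2) by (cases l) auto
   hence "extend f l = f a @ extend f (tl l)" by (metis extend_Cons)
   thus ?thesis using ua by simp
  qed
  ultimately show ?thesis
   using v by (intro quadratic_windows[OF pre' _ b(1) sp(3) _ b(2) _ sp(2,5) _ occs(2)]) (auto simp: bd_imm_def extend_append)
 next
  assume u: "bd_imm u"
  have la: "l = a # tl l" using pre_nth[OF occ(1), of 0] pre_nth[OF pre_iter[of 0], of 0] occ(2) by (cases l) auto
  hence "EX d:set l. growing f d" using growing_a by (metis list.set_intros(1))
  from split_list_last_prop[OF this] obtain l0 b0 y where b0: "l = l0 @ b0 # y" "growing f b0" "ALL d:set y. ~ growing f d" by blast
  have pre: "pre (l0 @ b0 # y @ [b])" using occ(1) b0(1) by simp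
  hence "fac (l0 @ b0 # y @ [b])" unfolding fac_def by (metis append_Nil)
  hence R: "set y <= R" "b0 : R" using fac_R[of "l0 @ b0 # y @ [b]"] by auto
  then obtain y0 c1 w0 t w where sp: "f b0 = w0 @ c1 # y0" "f c1 = w @ c1 # t" "c1 : G" "set y0 <= B" "set t <= B"
   using last_split[of b0] b0(2) by blast
  have "pre (extend f (l0 @ b0 # y @ [b]))" using pre_it[OF pre, of 1] by simp
  hence "pre ((extend f l0 @ w0) @ c1 # (y0 @ extend f y @ u) @ [b] @ v)" by (simp add: extend_append b(2) sp(1))
  hence pre': "pre ((extend f l0 @ w0) @ c1 # (y0 @ extend f y @ u) @ [b])"
   using pre_appendD[of "(extend f l0 @ w0) @ c1 # (y0 @ extend f y @ u) @ [b]" v] by simp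
  have "set (extend f y) <= B" using R(1) b0(3) closed growing_if_child[where f = f and n = 1] by (fastforce simp: set_extend)
  hence "set (y0 @ extend f y @ u) <= B" using u sp(4) by (auto simp: bd_imm_def)
  moreover have "extend f l0 @ w0 ~= []"
  proof
   assume e: "extend f l0 @ w0 = []"
   have "l0 = []"
   proof (rule ccontr)
    assume "l0 ~= []"
    hence "l0 = a # tl l0" using la b0(1) by (cases l0) auto
    hence "extend f l0 = f a @ extend f (tl l0)" by (metis extend_Cons)
    thus False using e ua by simp
   qed
   moreover have "l0 ~= []" using not_a[of l0 b0 "y @ [b]" w0 c1 y0] pre R(2) b0(2) sp(1,4) e by simp
   ultimately show False by simp
  qed
  ultimately show ?thesis
   using u by (intro quadratic_windows[OF pre' _ sp(3) b(1) _ sp(2,5) b(2) _ _ occs(2)]) (auto simp: bd_imm_def extend_append)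
 qed
qed

end

section \<open>Growth classes of the letters\<close>

lemma growsE:
 assumes "grows u deg rate"
 obtains c C where "0 < rate" "0 < c" "0 < C" "EV n. c * (real n ^ deg * rate ^ n) <= u n"
  "EV n. u n <= C * (real n ^ deg * rate ^ n)"
proof -
 from assms obtain c C where "0 < rate" "0 < c" "0 < C"
  and ev: "EV n. c * (real n ^ deg * rate ^ n) <= u n & u n <= C * (real n ^ deg * rate ^ n)"
  unfolding grows_def by blast
 show thesis
 proof (rule that)
  show "0 < rate" "0 < c" "0 < C" by fact+
  show "EV n. c * (real n ^ deg * rate ^ n) <= u n" using ev by eventually_elim simp
  show "EV n. u n <= C * (real n ^ deg * rate ^ n)" using ev by eventually_elim simp
 qed
qed

text \<open>Letters outside \<open>E\<close> are deleted at every step. Thus only lines of descent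
  that stay in \<open>E\<close> survive, as for a diagonal block of the incidence matrix.\<close>

definition gf :: "('a => 'a list) => ('a => bool) => 'a => 'a list" where
 "gf f E b = filter E (f b)"

lemma it_gf_closed:
 assumes "!!b c. ~ E b ==> c : set (f b) ==> ~ E c" "b : S" "!!b. b : S ==> set (f b) <= S"
 shows "it (gf f E) n (filter E w) = filter E (it f n w)"
proof (induction n)
 case (Suc n)
 have "extend (gf f E) (filter E v) = filter E (extend f v)" for v
 proof (induction v)
  case (Cons b v)
  have "filter E (f b) = []" if "~ E b" using assms(1)[OF that] by (simp add: filter_empty_conv)
  with Cons show ?case by (simp add: gf_def)
 qed simp
 with Suc show ?case by simp
qed simp

lemma it_gf_growing: "it (gf f (growing f)) n (filter (growing f) w) = filter (growing f) (it f n w)"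
 by (rule it_gf_closed[where S = UNIV]) (use growing_if_child[where f = f and n = 1] in auto)

lemma (in morphism) morphism_gf: "morphism (gf f E) R"
 using finite_R closed by unfold_locales (auto simp: gf_def)

text \<open>The situation in which no bounded word accumulates next to a growing letter (not quadratic).\<close>

locale nq = normalized +
 assumes nq_first: "c : G ==> f c = y @ c # w ==> set y <= B ==> extend f y = [] & (EX d:set w. growing f d)"
  and nq_last: "c : G ==> f c = w @ c # y ==> set y <= B ==> extend f y = [] & (EX d:set w. growing f d)"
begin

abbreviation "L b n \<equiv> real (length (it f n [b]))"

lemma growing_R_closed: "c : G ==> d : set (it f n [c]) ==> growing f d ==> d : G"
 using it_letter_in_R[of c n] by auto

text \<open>Counting only growing letters removes the contribution of bounded letters from all
  recursions; the order is that of the full length, by \<open>length_le_gl\<close>.\<close>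

definition gl :: "'a => nat => nat" where
 "gl b n = length (filter (growing f) (it f n [b]))"

lemma gl_add_le: "gl b n * K <= gl b (m + n)" if "!!c. c : G ==> K <= gl c m" "b : R" for b K m n
proof -
 have "length (filter (growing f) w) * K <= length (filter (growing f) (it f m w))" if "set w <= R" for w
  using that
 proof (induction w)
  case (Cons c w)
  have "growing f c ==> K <= gl c m" using Cons.prems \<open>!!c. c : G ==> K <= gl c m\<close> by simp
  thus ?case using Cons it_Cons[of m f c w] by (auto simp: gl_def)
 qed simp
 from this[OF it_letter_in_R[OF that(2), of n]] show ?thesis unfolding gl_def it_add .
qed

lemma gl_ge_1: "growing f b ==> 1 <= gl b n"
 using growing_descendant[of f b n] unfolding gl_def
 by (cases "filter (growing f) (it f n [b])") (auto simp: filter_empty_conv)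

lemma gl_mono_Suc: "b : R ==> gl b n <= gl b (Suc n)"
 using gl_add_le[of 1 1 b n] gl_ge_1 by simp

text \<open>The first growing letter of the image reproduces itself and is accompanied by a second
  growing letter. Hence the number of growing letters doubles every two steps, and all rates exceed
  1.\<close>

lemma gl_2: "c : G ==> 2 <= gl c 2"
proof -
 assume c: "c : G"
 then obtain y0 c1 w0 y w where sp: "f c = y0 @ c1 # w0" "f c1 = y @ c1 # w" "c1 : G" "set y0 <= B" "set y <= B"
  using first_split by blast
 hence "EX d:set w. growing f d" using nq_first by blast
 hence "1 <= length (filter (growing f) w)" by (cases "filter (growing f) w") (auto simp: filter_empty_conv)
 hence "2 <= length (filter (growing f) (f c1))" using sp(2,3) by simp
 also have "... <= gl c 2" by (simp add: gl_def numeral_2_eq_2 sp(1) extend_append)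
 finally show ?thesis .
qed

lemma gl_double: "b : R ==> 2 * gl b n <= gl b (n + 2)"
 using gl_add_le[of 2 2 b n] gl_2 by (simp add: mult.commute add.commute)

lemma sum_gl_le: "b : R ==> (SUM k<n. gl b k) <= 4 * gl b n"
proof (induction n rule: less_induct)
 case (less n)
 consider "n = 0" | "n = 1" | m where "n = m + 2" by (metis One_nat_def add_2_eq_Suc' not0_implies_Suc)
 thus ?case
 proof cases
  case 2
  thus ?thesis using gl_mono_Suc[OF less.prems, of 0] by simp
 next
  case 3
  have "(SUM k<m. gl b k) <= 4 * gl b m" using less 3 by simp
  moreover have "2 * gl b m <= gl b n" "gl b (m + 1) <= gl b n"
   using gl_double[OF less.prems, of m] gl_mono_Suc[OF less.prems, of "m + 1"] 3 by simp_all
  moreover have "(SUM k<n. gl b k) = (SUM k<m. gl b k) + gl b m + gl b (m + 1)" using 3 by simp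
  ultimately show ?thesis by linarith
 qed simp
qed

text \<open>The weight \<open>\<bar>f b\<bar>\<close> of a bounded letter \<open>b\<close> is preserved by \<open>f\<close>, so the bounded letters in \<open>f\<^sup>n(b)\<close> are
 accounted for by the growing letters of the earlier words.\<close>

lemma length_le_gl: "EX C. ALL b:R. ALL n. growing f b --> length (it f n [b]) <= C * gl b n"
proof -
 obtain W where W: "W >= 1" "!!b. b : R ==> length (f b) <= W" by (rule width) blast
 define om where "om w = length (extend f (filter (%b. ~ growing f b) w))" for w
 have om_app: "om (u @ v) = om u + om v" for u v by (simp add: om_def extend_append)
 have le_W: "length (extend f w) <= length w * W" if "set w <= R" for w
  using length_it_le[of w 1 f W] W(2) that by auto
 have step: "om (extend f w) <= om w + W * W * length (filter (growing f) w)" if "set w <= R" for w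
  using that
 proof (induction w)
  case (Cons b w)
  have "om (f b) <= om [b] + W * W * length (filter (growing f) [b])"
  proof (cases "growing f b")
   case True
   have "set (filter (%b. ~ growing f b) (f b)) <= R" using closed[of b] Cons.prems by auto
   hence "om (f b) <= length (filter (%b. ~ growing f b) (f b)) * W" unfolding om_def by (rule le_W)
   also have "... <= W * W"
    using W(2)[of b] Cons.prems by (intro mult_le_mono1 le_trans[OF length_filter_le]) simp
   finally show ?thesis using True by simp
  next
   case False
   hence b: "b : B" using Cons.prems by simp
   have "filter (%b. ~ growing f b) (f b) = f b"
    using False growing_if_child[where f = f and n = 1 and b = b] by (auto simp: filter_id_conv)
   hence "om (f b) = length (f b)" using idem[OF b] by (simp add: om_def)
   thus ?thesis using False by (simp add: om_def)
  qed
  moreover have "om (extend f w) <= om w + W * W * length (filter (growing f) w)" using Cons by simp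
  ultimately show ?case using om_app[of "f b" "extend f w"] om_app[of "[b]" w] by (auto simp: distrib_left split: if_splits)
 qed (simp add: om_def)
 have om_n: "om (it f n [b]) <= W * W * (SUM k<n. gl b k)" if "b : R" "growing f b" for b n
 proof (induction n)
  case 0 thus ?case using that by (simp add: om_def)
 next
  case (Suc n)
  thus ?case using step[OF it_letter_in_R[OF that(1)], of n] by (simp add: gl_def distrib_left)
 qed
 have len: "length (extend f w) <= om w + W * length (filter (growing f) w)" if "set w <= R" for w
  using that
 proof (induction w)
  case (Cons b w)
  thus ?case using W(2)[of b] by (auto simp: om_def distrib_left)
 qed (simp add: om_def)
 have "length (it f n [b]) <= (4 * W * W + W + 1) * gl b n" if b: "b : R" "growing f b" for b n
 proof (cases n)
  case 0
  thus ?thesis using b by (simp add: gl_def)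
 next
  case (Suc m)
  have "length (it f n [b]) <= W * W * (SUM k<m. gl b k) + W * gl b m"
   using len[OF it_letter_in_R[OF b(1)], of m] om_n[OF b, of m] unfolding Suc gl_def by simp
  also have "... <= W * W * (4 * gl b m) + W * gl b m" using sum_gl_le[OF b(1)] by (intro add_mono mult_le_mono2) auto
  also have "... = (4 * W * W + W) * gl b m" by (simp add: algebra_simps)
  also have "... <= (4 * W * W + W + 1) * gl b n" using gl_mono_Suc[OF b(1), of m] Suc by (intro mult_le_mono) auto
  finally show ?thesis .
 qed
 thus ?thesis by blast
qed

lemma L_ge_exp: "c : G ==> 2 ^ (n div 2) <= gl c n"
proof (induction n rule: less_induct)
 case (less n)
 consider "n = 0" | "n = 1" | m where "n = m + 2" by (metis One_nat_def add_2_eq_Suc' not0_implies_Suc)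
 thus ?case
 proof cases
  case 3
  have "2 ^ (m div 2) <= gl c m" using less 3 by simp
  moreover have "2 * gl c m <= gl c n" using gl_double[of c m] less.prems 3 by simp
  moreover have "n div 2 = Suc (m div 2)" using 3 by simp
  ultimately show ?thesis by simp
 qed (use gl_ge_1[of c] less.prems in simp_all)
qed

lemma grows_base_gt_1:
 assumes g: "grows u deg rate" and u: "!!n :: nat. 2 ^ (n div 2) <= u n" shows "1 < rate"
proof (rule ccontr)
 assume "~ 1 < rate"
 from g obtain C where rate: "0 < rate" and C: "0 < C" "EV n. u n <= C * (real n ^ deg * rate ^ n)"
  by (rule growsE)
 have "EV n. sqrt 2 ^ n <= 2 * C * real n ^ deg"
  using C(2)
 proof eventually_elim
  case (elim n)
  have "sqrt 2 ^ n <= sqrt 2 ^ (2 * (n div 2) + 1)" by (intro power_increasing) auto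
  also have "... <= 2 * 2 ^ (n div 2)" using real_sqrt_le_iff[of 2 4] by (simp add: power_mult)
  also have "... <= 2 * u n" using u by simp
  also have "... <= 2 * (C * (real n ^ deg * rate ^ n))" using elim by simp
  also have "... <= 2 * (C * (real n ^ deg * 1))" using rate \<open>~ 1 < rate\<close> C
   by (intro mult_left_mono power_le_one) auto
  finally show ?case by simp
 qed
 moreover have "EV n. 2 * C * real n ^ deg < sqrt 2 ^ n"
 proof -
  have "(%n. real n ^ deg * (1 / sqrt 2) ^ n) \<longlonglongrightarrow> 0" by real_asymp
  hence "EV n. real n ^ deg * (1 / sqrt 2) ^ n < 1 / (2 * C)"
   by (rule order_tendstoD) (use C in simp)
  thus ?thesis by eventually_elim (use C in \<open>simp add: power_divide field_simps\<close>)
 qed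
 ultimately have "EV n :: nat. False" by eventually_elim simp
 thus False by simp
qed

text \<open>The general theorem on orders applies to the morphism restricted to growing letters, and
  the length differs from their number by bounded factors only.\<close>

lemma growth_exists: "c : G ==> EX deg rate. 1 < rate & grows (%n. real (gl c n)) deg rate & grows (L c) deg rate"
proof -
 assume c: "c : G"
 interpret h: morphism "gf f (growing f)" R by (rule morphism_gf)
 have "it (gf f (growing f)) n [c] = filter (growing f) (it f n [c])" for n
  using it_gf_growing[where f = f and n = n and w = "[c]"] c by simp
 hence "tame (%n. real (gl c n))" using h.tame_length[of c] c by (simp add: gl_def)
 moreover have "~ (EV n. real (gl c n) = 0)"
 proof
  assume "EV n. real (gl c n) = 0"
  then obtain n where "real (gl c n) = 0" by (auto simp: eventually_sequentially)
  thus False using gl_ge_1[of c n] c by simp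
 qed
 ultimately obtain deg rate where g: "grows (%n. real (gl c n)) deg rate" unfolding tame_def by blast
 have "2 ^ (n div 2) <= real (gl c n)" for n
 proof -
  have "real (2 ^ (n div 2)) <= real (gl c n)" using L_ge_exp[OF c] by (intro of_nat_mono)
  thus ?thesis by simp
 qed
 hence "1 < rate" by (rule grows_base_gt_1[OF g])
 moreover have "grows (L c) deg rate"
 proof -
  obtain C where C: "!!n. length (it f n [c]) <= C * gl c n" using length_le_gl c by blast
  have "1 * real (gl c n) <= L c n & L c n <= real (Suc C) * real (gl c n)" for n
  proof
   show "1 * real (gl c n) <= L c n" unfolding gl_def by simp
   have "length (it f n [c]) <= Suc C * gl c n" using C[of n] by simp
   thus "L c n <= real (Suc C) * real (gl c n)" by (metis of_nat_le_iff of_nat_mult)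
  qed
  thus ?thesis by (intro grows_sandwich[OF g zero_less_one]) (auto intro: always_eventually)
 qed
 ultimately show ?thesis using g by blast
qed

definition deg :: "'a => nat" where "deg c = fst (SOME ab. 1 < snd ab & grows (%n. real (gl c n)) (fst ab) (snd ab) & grows (L c) (fst ab) (snd ab))"
definition rate :: "'a => real" where "rate c = snd (SOME ab. 1 < snd ab & grows (%n. real (gl c n)) (fst ab) (snd ab) & grows (L c) (fst ab) (snd ab))"

lemma growth:
 assumes "c : G"
 shows rate_gt_1: "1 < rate c" and grows_gl: "grows (%n. real (gl c n)) (deg c) (rate c)" and grows_L: "grows (L c) (deg c) (rate c)"
proof -
 obtain A D where "1 < D & grows (%n. real (gl c n)) A D & grows (L c) A D" using growth_exists[OF assms] by blast
 hence "EX ab. 1 < snd ab & grows (%n. real (gl c n)) (fst ab) (snd ab) & grows (L c) (fst ab) (snd ab)"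
  by (intro exI[of _ "(A, D)"]) simp
 from someI_ex[OF this] show "1 < rate c" "grows (%n. real (gl c n)) (deg c) (rate c)" "grows (L c) (deg c) (rate c)"
  unfolding deg_def rate_def by blast+
qed

section \<open>Counting the effective levels\<close>

text \<open>The word \<open>w\<close> beside a self-reproducing letter contains a growing letter.
  Once all growing letters have images of length \<open>n\<close>, the next summand alone provides
  \<open>n\<close> letters, whence the \<open>Suc\<close>.\<close>

lemma D_ok_nq:
 assumes m: "!!n p d. m n <= p ==> d : G ==> n <= length (it f p [d])"
 shows "D_ok (%n. Suc (m n))" "mirror.D_ok (%n. Suc (m n))"
proof -
 have len: "n <= length (concat (map (%i. it f i w) [0..<p]))" if pd: "Suc (m n) <= p" "d : set w" "d : G" for n p w d
 proof -
  obtain q where q: "p = Suc q" "m n <= q" using pd(1) by (cases p) auto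
  have "n <= length (it f q [d])" using m[OF q(2) pd(3)] .
  also have "... <= length (it f q w)" using pd(2) by (simp add: length_it_subset)
  finally show ?thesis using q by simp
 qed
 show "D_ok (%n. Suc (m n))"
  unfolding D_ok_def
 proof (intro ballI allI impI disjI2 conjI)
  fix c y w assume c: "c : G" "f c = y @ c # w" "set y <= B"
  show "extend f y = []" using nq_first[OF c] by blast
  fix n p assume p: "Suc (m n) <= p"
  obtain d where d: "d : set w" "growing f d" using nq_first[OF c] by blast
  hence "d : G" using closed[of c] c(1,2) by auto
  thus "n <= length (concat (map (%i. it f i w) [0..<p]))" using len p d(1) by blast
 qed
 show "mirror.D_ok (%n. Suc (m n))"
  unfolding mirror.D_ok_def mirror_G
 proof (intro ballI allI impI disjI2 conjI)
  fix c y w assume c: "c : G" "mir f c = y @ c # w" "set y <= B"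
  have fc: "f c = rev w @ c # rev y" using arg_cong[OF c(2), of rev] by (simp add: mir_def)
  have yB: "set (rev y) <= B" using c(3) by simp
  have e: "extend f (rev y) = []" using nq_last[OF c(1) fc yB] by blast
  thus "extend (mir f) y = []" using it_mir[of 1 f "rev y"] by simp
  fix n p assume p: "Suc (m n) <= p"
  obtain d where d: "d : set w" "growing f d" using nq_last[OF c(1) fc yB] by auto
  hence "d : G" using closed[of c] c(1) fc by auto
  hence "n <= length (concat (map (%i. it f i (rev w)) [0..<p]))" using len p d(1) by simp
  moreover have "length (concat (map (%i. it (mir f) i w) [0..<p])) = length (concat (map (%i. it f i (rev w)) [0..<p]))"
   using it_mir[of _ f "rev w"] by (simp add: length_concat comp_def)
  ultimately show "n <= length (concat (map (%i. it (mir f) i w) [0..<p]))" by simp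
 qed
qed

lemma bounded_letters: "EX K. ALL b:B. ALL p. length (it f p [b]) <= K"
proof -
 have "finite B" using finite_R by simp
 moreover have "ALL b:B. EX K. ALL p. length (it f p [b]) <= K"
  by (intro ballI not_growing_bound) simp
 ultimately obtain K where K: "!!b p. b : B ==> length (it f p [b]) <= K b" by metis
 have "length (it f p [b]) <= Max (K ` B)" if "b : B" for b p
  using K[OF that, of p] \<open>finite B\<close> that by (meson Max_ge finite_imageI imageI le_trans)
 thus ?thesis by blast
qed

text \<open>With \<open>p\<^sub>0\<close> the first level reaching length \<open>n\<close>, only the levels from \<open>p\<^sub>0\<close> to \<open>p\<^sub>0 + J\<close> contribute.\<close>

lemma upper_levels:
 assumes J: "!!n p d. n >= n0 ==> d : R ==> n <= length (it f (Suc p) [d]) ==>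
   (!!q e. q < p ==> e : R ==> length (it f (Suc q) [e]) < n) ==>
   (ALL q>=p + J n. ALL e:G. n <= length (it f q [e]))"
 shows "EX C. ALL n>=max 2 n0. card (factors x n) <= C * n * (J n + 4)"
proof -
 define P where "P n p \<longleftrightarrow> (EX d:R. n <= length (it f (Suc p) [d]))" for n p
 have exP: "EX p. P n p" for n
 proof -
  obtain k where "n <= length (it f k [a])" "1 <= k" using unbounded_from by blast
  thus ?thesis unfolding P_def using a_in_R by (intro exI[of _ "k - 1"] bexI[of _ a]) auto
 qed
 define p0 where "p0 n = (LEAST p. P n p)" for n
 have p0: "P n (p0 n)" "!!q. q < p0 n ==> ~ P n q" for n
  unfolding p0_def using exP by (auto intro: LeastI_ex dest: not_less_Least)
 have ex_m: "EX m. ALL p>=m. ALL d:G. n <= length (it f p [d])" for n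
 proof (intro exI allI impI ballI)
  fix p d assume p: "2 * n <= p" and d: "d : G"
  have "n <= p div 2" using p by linarith
  also have "... <= 2 ^ (p div 2)" by (rule less_imp_le[OF less_exp])
  also have "... <= gl d p" by (rule L_ge_exp[OF d])
  also have "... <= length (it f p [d])" unfolding gl_def by simp
  finally show "n <= length (it f p [d])" .
 qed
 \<comment> \<open>\<open>D_ok\<close> speaks of all \<open>n\<close>; below \<open>n0\<close>,
   where \<open>J\<close> says nothing, some value obtained from exponential growth is
   taken.\<close>
 define m where "m n = (if n >= n0 then p0 n + J n else (SOME m. ALL p>=m. ALL d:G. n <= length (it f p [d])))" for n
 have m: "n <= length (it f p [d])" if "m n <= p" "d : G" for n p d
 proof (cases "n >= n0")
  case True
  obtain e where "e : R" "n <= length (it f (Suc (p0 n)) [e])" using p0(1)[of n] unfolding P_def by blast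
  moreover have "length (it f (Suc q) [e]) < n" if "q < p0 n" "e : R" for q e
   using p0(2)[OF that(1)] that(2) unfolding P_def by (meson not_le)
  ultimately show ?thesis using J[OF True, of e "p0 n"] that True by (simp add: m_def)
 next
  case False
  thus ?thesis using someI_ex[OF ex_m[of n]] that by (simp add: m_def)
 qed
 from upper_bound[OF D_ok_nq[of m, OF m]] obtain C where
  C: "!!n. n >= 2 ==> card (factors x n) <= C * n * Suc (card {p. p < Suc (m n) + 2 & P n p})"
  unfolding P_def by auto
 have "card (factors x n) <= C * n * (J n + 4)" if n: "max 2 n0 <= n" for n
 proof -
  have "{p. p < Suc (m n) + 2 & P n p} <= {p0 n..<p0 n + J n + 3}"
   using p0(2)[of _ n] n by (auto simp: m_def not_less[symmetric])
  hence "card {p. p < Suc (m n) + 2 & P n p} <= card {p0 n..<p0 n + J n + 3}" by (intro card_mono) auto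
  hence "Suc (card {p. p < Suc (m n) + 2 & P n p}) <= J n + 4" by simp
  hence "C * n * Suc (card {p. p < Suc (m n) + 2 & P n p}) <= C * n * (J n + 4)" by (rule mult_le_mono2)
  thus ?thesis using C[of n] n by simp
 qed
 thus ?thesis by blast
qed

end

section \<open>Lower bounds from slow and fast letters\<close>

lemma geometric_sum_le:
 fixes ph :: "nat => real"
 assumes "1 < ga" "!!p. ga * ph p <= ph (Suc p)" "0 <= ph 0"
 shows "(SUM i<p. ph i) <= ph p / (ga - 1)"
proof (induction p)
 case (Suc p)
 have "(SUM i<Suc p. ph i) <= ph p / (ga - 1) + ph p" using Suc by simp
 also have "... = ga * ph p / (ga - 1)" using assms(1) by (simp add: field_simps)
 also have "... <= ph (Suc p) / (ga - 1)" using assms by (intro divide_right_mono) auto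
 finally show ?case .
qed (use assms in simp)

lemma geometric_power_le:
 fixes ph :: "nat => real"
 assumes "1 < ga" "!!p. ga * ph p <= ph (Suc p)"
 shows "ga ^ k * ph p <= ph (p + k)"
proof (induction k)
 case (Suc k)
 have "ga ^ Suc k * ph p = ga * (ga ^ k * ph p)" by simp
 also have "... <= ga * ph (p + k)" using Suc assms(1) by (intro mult_left_mono) auto
 also have "... <= ph (p + Suc k)" using assms(2) by simp
 finally show ?case .
qed simp

text \<open>Since \<open>ph\<close> is at least 1, a larger constant also absorbs the finitely many
  exceptional \<open>p\<close>.\<close>

lemma uniform_bound:
 fixes u :: "'b => nat => real"
 assumes "finite S" "!!s. s : S ==> EX C. EV p. u s p <= C * ph p" "!!p. 1 <= ph p"
 shows "EX C>0. ALL s:S. ALL p. u s p <= C * ph p"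
 using assms(1,2)
proof (induction S)
 case empty
 show ?case by (auto intro: exI[of _ 1])
next
 case (insert s S)
 then obtain C where C: "0 < C" "ALL s:S. ALL p. u s p <= C * ph p" by blast
 obtain D P where D: "!!p. p >= P ==> u s p <= D * ph p"
  using insert.prems[of s] by (auto simp: eventually_sequentially)
 define K where "K = C + \<bar>D\<bar> + (SUM p<P. \<bar>u s p\<bar>)"
 have nn: "0 <= (SUM p<P. \<bar>u s p\<bar>)" by (simp add: sum_nonneg)
 have K: "0 < K" "C <= K" "D <= K" unfolding K_def using C nn by linarith+
 have "u t p <= K * ph p" if t: "t : insert s S" for t p
 proof -
  have ph: "0 <= ph p" using assms(3)[of p] by simp
  consider "t : S" | "t = s" "p >= P" | "t = s" "p < P" using t by force
  thus ?thesis
  proof cases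
   case 1
   hence "u t p <= C * ph p" using C by blast
   also have "... <= K * ph p" using K ph by (intro mult_right_mono)
   finally show ?thesis .
  next
   case 2
   hence "u t p <= D * ph p" using D by blast
   also have "... <= K * ph p" using K ph by (intro mult_right_mono)
   finally show ?thesis .
  next
   case 3
   have "u t p <= \<bar>u s p\<bar>" using 3 by simp
   also have "... <= (SUM p<P. \<bar>u s p\<bar>)" using 3 by (intro member_le_sum) auto
   also have "... <= K" unfolding K_def using C by simp
   also have "... <= K * ph p" using K assms(3)[of p] by (simp add: mult_le_cancel_left1)
   finally show ?thesis .
  qed
 qed
 with K(1) show ?case by blast
qed

context nq
begin

text \<open>At a level \<open>p\<close> with the order \<open>ph p\<close> of slow images well below
  \<open>N\<close> and that of fast images above it, every window of length \<open>N\<close> across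
  an enlarged slow block shows exactly its slow run. Each such level therefore contributes about
  \<open>N / 2\<close> new factors. The divisor \<open>ka\<close> spaces the levels so that their
  runs differ clearly in length.\<close>

lemma slow_fast_lower:
 fixes ph ps :: "nat => real"
 assumes S: "!!s. s : S ==> set (f s) <= S" "S <= R" "S ~= R"
  and ph: "1 < ga" "!!p. ga * ph p <= ph (Suc p)" "!!p. 1 <= ph p"
  and slow: "!!s. s : S ==> EX C. EV p. L s p <= C * ph p"
  and si: "si : S" "0 < c0" "EV p. c0 * ph p <= L si p"
  and fast: "!!d. d : R - S ==> EV p. ps p <= L d p"
  and ratio: "filterlim (%p. ps p / ph p) at_top sequentially"
 shows "EX K>0. EX ka>=1. EX P. ALL N I. finite I --> (ALL p:I. ka dvd p & P <= p & K * ph p <= real N & 2 * real N <= ps p) -->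
   card I * (N div 2) <= card (factors x N)"
proof -
 obtain W where W: "!!b. b : R ==> length (f b) <= W" "1 <= W" by (rule width) blast
 have "finite S" using S(2) finite_R finite_subset by blast
 hence "EX C>0. ALL s:S. ALL p. L s p <= C * ph p" by (rule uniform_bound) (use slow ph(3) in auto)
 then obtain C where C: "0 < C" "!!s p. s : S ==> L s p <= C * ph p" by blast
 define M where "M p = nat \<lfloor>C * ph p\<rfloor>" for p
 have M: "length (it f p [s]) <= M p" if "s : S" for s p
  using C(2)[OF that, of p] unfolding M_def by (simp add: le_nat_floor)
 have ph_pos: "0 < ph p" for p using ph(3)[of p] by simp
 have M_le: "real (M p) <= C * ph p" for p
  unfolding M_def using C(1) ph_pos[of p] by (intro of_nat_floor) simp
 have len_w: "real (length (it f p w)) <= real (length w) * C * ph p" if "set w <= S" for w p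
 proof -
  have "length (it f p w) <= length w * M p" by (rule length_it_le) (use M that in auto)
  hence "real (length (it f p w)) <= real (length w) * real (M p)" by (metis of_nat_le_iff of_nat_mult)
  also have "... <= real (length w) * (C * ph p)" using M_le by (intro mult_left_mono) auto
  finally show ?thesis by (simp add: mult.assoc)
 qed
 have ph_mono: "ph p <= ph (Suc p)" for p
 proof -
  have "1 * ph p <= ga * ph p" using ph(1) ph_pos[of p] by (intro mult_right_mono) auto
  thus ?thesis using ph(2)[of p] by linarith
 qed
 \<comment> \<open>As \<open>ps / ph\<close> is unbounded, no fast letter has images of order
   \<open>ph\<close>. A fast letter with slow children only, or an initial letter followed only by
   slow letters in its image, would be such a letter.\<close>
 have not_slow: False if "d : R - S" "EV p. L d p <= D * ph p" for d D
 proof -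
  have "EV p. D < ps p / ph p" using ratio by (simp add: filterlim_at_top_dense)
  with that(2) fast[OF that(1)] have "EV p :: nat. False"
  proof eventually_elim
   case (elim p)
   hence "D * ph p < ps p" using ph_pos[of p] by (simp add: field_simps)
   thus ?case using elim by simp
  qed
  thus False by simp
 qed
 have child: "EX c:set (f b). c ~: S" if b: "b : R - S" for b
 proof (rule ccontr)
  assume "~ ?thesis"
  hence fb: "set (f b) <= S" by blast
  have "L b (Suc p) <= real (length (f b)) * C * ph (Suc p)" for p
  proof -
   have "L b (Suc p) <= real (length (f b)) * C * ph p" using len_w[OF fb, of p] by (simp only: it_Suc_letter)
   also have "... <= real (length (f b)) * C * ph (Suc p)" using ph_mono C(1) by (intro mult_left_mono) auto
   finally show ?thesis .
  qed
  hence "L b p <= real (length (f b)) * C * ph p" if "1 <= p" for p using that by (cases p) auto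
  hence "EV p. L b p <= real (length (f b)) * C * ph p"
   by (auto simp: eventually_sequentially)
  thus False by (rule not_slow[OF b])
 qed
 have aS: "a ~: S"
 proof
  assume "a : S"
  hence "set (it f n [a]) <= S" for n using it_closed[of S f "[a]" n] S(1) by simp
  hence "R <= S" using reachable by blast
  thus False using S by blast
 qed
 obtain u where u: "f a = a # u" using prolongable by blast
 have uS: "EX c:set u. c ~: S"
 proof (rule ccontr)
  assume "~ ?thesis"
  hence uS: "set u <= S" by blast
  have "L a p <= (1 + real (length u) * C / (ga - 1)) * ph p" for p
  proof -
   have "it f p [a] = a # concat (map (%i. it f i u) [0..<p])"
    using it_self_reproducing[of f a "[]" u p] u by simp
   hence "L a p = 1 + (SUM i<p. real (length (it f i u)))"
    by (simp add: length_concat comp_def interv_sum_list_conv_sum_set_nat atLeast0LessThan)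
   also have "... <= 1 + (SUM i<p. real (length u) * C * ph i)" using len_w[OF uS] by (intro add_left_mono sum_mono)
   also have "... = 1 + real (length u) * C * (SUM i<p. ph i)" by (simp add: sum_distrib_left)
   also have "... <= ph p + real (length u) * C * (ph p / (ga - 1))"
    using geometric_sum_le[of ga ph p] ph ph_pos[of 0] C(1) by (intro add_mono mult_left_mono) auto
   finally show ?thesis by (simp add: algebra_simps)
  qed
  hence "EV p. L a p <= (1 + real (length u) * C / (ga - 1)) * ph p"
   by (intro always_eventually allI)
  thus False by (rule not_slow[rotated]) (use aS a_in_R in simp)
 qed
 obtain l b0 y0 c1 where blk0: "pre (l @ b0 # y0 @ [c1])" "b0 ~: S" "c1 ~: S" "set y0 <= S" "si : set y0"
 proof -
  have "EX l b y c. pre (l @ b # y @ [c]) & b ~: S & c ~: S & (ALL d:set y. ~ d ~: S) & si : set y"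
   by (rule block_exists) (use child aS u uS si(1) S(2) in auto)
  thus thesis using that by blast
 qed
 have fac0: "fac (b0 # y0 @ [c1])" unfolding fac_def using blk0(1) by blast
 have R0: "b0 : R - S" "c1 : R - S" using fac_R[OF fac0] blk0(2,3) by auto
 have F: "EX c:set (it f n [d]). c ~: S" if "d : R - S" for d n using child that by (rule fast_descendant)
 define A where "A = W * C / (ga - 1)"
 have A: "0 < A" unfolding A_def using W(2) C(1) ph(1) by simp
 define E where "E p = (SUM i<p. W * M i)" for p
 have E_le: "real (E p) <= A * ph p" for p
 proof -
  have "real (E p) <= (SUM i<p. W * (C * ph i))"
   unfolding E_def of_nat_sum of_nat_mult using M_le by (intro sum_mono mult_left_mono) auto
  also have "... = W * C * (SUM i<p. ph i)" by (simp add: sum_distrib_left mult.assoc)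
  also have "... <= W * C * (ph p / (ga - 1))"
   using geometric_sum_le[of ga ph p] ph ph_pos[of 0] C(1) by (intro mult_left_mono) auto
  finally show ?thesis by (simp add: A_def)
 qed
 \<comment> \<open>The block found first may yield runs no longer than those inside images of fast
   letters. Its image under \<open>ka\<close> iterations contains a slow word that is larger by
   \<open>ga ^ ka\<close>, enough to exceed the bound \<open>2 * E p\<close>.\<close>
 obtain ka where ka: "2 * A / c0 < ga ^ ka" using real_arch_pow[OF ph(1)] by blast
 obtain Y b Z where Y: "it f ka [b0] = Y @ b # Z" "b ~: S" "set Z <= S"
  using split_list_last_prop[OF F[OF R0(1), of ka]] by blast
 obtain Y' c Z' where Y': "it f ka [c1] = Y' @ c # Z'" "c ~: S" "set Y' <= S"
  using split_list_first_prop[OF F[OF R0(2), of ka]] by blast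
 define y where "y = Z @ it f ka y0 @ Y'"
 have fac: "fac (b # y @ [c])"
 proof -
  have "fac (it f ka (b0 # y0 @ [c1]))" using fac0 by (rule fac_it)
  moreover have "it f ka (b0 # y0 @ [c1]) = Y @ (b # y @ [c]) @ Z'"
   using it_append[of ka f "[b0]" "y0 @ [c1]"] by (simp add: y_def it_append Y(1) Y'(1))
  ultimately show ?thesis using fac_appendD by metis
 qed
 have yS: "set y <= S" using Y Y' it_closed[of S f y0 ka] S(1) blk0(4) by (auto simp: y_def)
 have bcR: "b : R - S" "c : R - S" using fac_R[OF fac] Y(2) Y'(2) by auto
 have y_ge: "length (it f (p + ka) [si]) <= length (it f p y)" for p
 proof -
  have "length (it f (p + ka) [si]) <= length (it f (p + ka) y0)" by (rule length_it_subset[OF blk0(5)])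
  also have "... <= length (it f p y)" by (simp add: y_def it_append it_add)
  finally show ?thesis .
 qed
 \<comment> \<open>The terms pay for twice the longest possible run, at most \<open>2 * E p\<close>
   plus the image of \<open>y\<close>, and for the two delimiters.\<close>
 define K where "K = 4 * A + 2 * real (length y) * C + 2"
 have K: "0 < K" "A <= K" using A C(1) by (simp_all add: K_def add_pos_nonneg)
 \<comment> \<open>Levels at distance \<open>ka0\<close> are so far apart that the shortest run of
   the higher level exceeds the longest one of the lower level.\<close>
 obtain ka0' where ka0': "K / c0 < ga ^ ka0'" using real_arch_pow[OF ph(1)] by blast
 define ka0 where "ka0 = Suc ka0'"
 have ka0: "K / c0 < ga ^ ka0"
 proof -
  have "ga ^ ka0' <= ga ^ ka0" unfolding ka0_def using ph(1) by (intro power_increasing) auto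
  with ka0' show ?thesis by linarith
 qed
 have "EV p. c0 * ph p <= L si p & ps p <= L b p & ps p <= L c p"
  using si(3) fast[OF bcR(1)] fast[OF bcR(2)] by eventually_elim simp
 then obtain P where P: "!!p. p >= P ==> c0 * ph p <= L si p & ps p <= L b p & ps p <= L c p"
  by (auto simp: eventually_sequentially)
 have y_big: "c0 * (ga ^ k * ph p) <= real (length (it f q y))" if "q + ka = p + k" "q >= P" for p q k
 proof -
  have "c0 * (ga ^ k * ph p) <= c0 * ph (p + k)"
   using geometric_power_le[of ga ph k p] ph si(2) by (intro mult_left_mono) auto
  also have "... <= L si (q + ka)" using P[of "q + ka"] that by simp
  also have "... <= real (length (it f q y))" using y_ge[of q] by simp
  finally show ?thesis .
 qed
 have main: "card I * (N div 2) <= card (factors x N)"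
  if I: "finite I" "!!p. p : I ==> ka0 dvd p & P <= p & K * ph p <= real N & 2 * real N <= ps p" for N I
 proof (rule slow_block_windows[where S = S and M = M and W = W and E = E, OF S(1,2) child M W fac Y(2) Y'(2) yS E_def I(1)])
  fix p assume p: "p : I"
  have "2 * real (E p) <= 2 * (A * ph p)" using E_le[of p] by simp
  also have "... < c0 * ga ^ ka * ph p" using ka si(2) ph_pos[of p] by (simp add: field_simps)
  also have "... <= real (length (it f p y))" using y_big[of p p ka] I(2)[OF p] by (simp add: mult.assoc)
  finally show "2 * E p < length (it f p y)" by simp
  have "real (2 * (2 * E p + length y * M p) + 2) = 4 * real (E p) + 2 * real (length y) * real (M p) + 2" by simp
  also have "... <= 4 * (A * ph p) + 2 * real (length y) * (C * ph p) + 2 * ph p"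
   using E_le[of p] M_le[of p] ph(3)[of p] by (intro add_mono mult_left_mono) auto
  also have "... = K * ph p" by (simp add: K_def algebra_simps)
  also have "... <= real N" using I(2)[OF p] by simp
  finally show N: "2 * (2 * E p + length y * M p) + 2 <= N" by linarith
  have "E p <= N" by (rule order_trans[OF _ N]) simp
  moreover have "2 * real N <= L b p" "2 * real N <= L c p" using I(2)[OF p] P[of p] by linarith+
  ultimately show "N + E p <= length (it f p [b])" "N + E p <= length (it f p [c])" by linarith+
 next
  fix p p' assume p: "p : I" "p' : I" "p < p'"
  obtain q q' where "p = ka0 * q" "p' = ka0 * q'" using I(2)[OF p(1)] I(2)[OF p(2)] by (auto elim!: dvdE)
  hence "q < q'" using p(3) by simp
  then obtain r where "q' = Suc q + r" using less_imp_Suc_add[of q q'] by auto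
  hence "p' = p + ka0 + ka0 * r" using \<open>p = ka0 * q\<close> \<open>p' = ka0 * q'\<close> by (simp add: algebra_simps)
  then obtain k where k: "p' = p + (ka0 + k)" by simp
  have "real (2 * E p + length y * M p) = 2 * real (E p) + real (length y) * real (M p)" by simp
  also have "... <= 2 * (A * ph p) + real (length y) * (C * ph p)"
   using E_le[of p] M_le[of p] by (intro add_mono mult_left_mono) auto
  also have "... <= K * ph p"
  proof -
   have "0 <= (2 * A + real (length y) * C + 2) * ph p" using A C(1) ph_pos[of p] by simp
   thus ?thesis by (simp add: K_def algebra_simps)
  qed
  also have "... < c0 * (ga ^ ka0 * ph p)" using ka0 si(2) ph_pos[of p] by (simp add: field_simps)
  also have "... <= c0 * (ga ^ (ka0 + k + ka) * ph p)"
   using ph(1) si(2) ph_pos[of p] by (intro mult_left_mono mult_right_mono power_increasing) auto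
  also have "... <= real (length (it f p' y))" using y_big[of p' p "ka0 + k + ka"] I(2)[OF p(2)] k by simp
  finally show "2 * E p + length y * M p < length (it f p' y)" by linarith
 qed
 show ?thesis
 proof (rule exI[of _ K], rule conjI[OF K(1)], rule exI[of _ ka0], rule conjI, goal_cases)
  case 2
  show ?case
  proof (rule exI[of _ P], intro allI impI)
   fix N I assume "finite I" and I: "ALL p:I. ka0 dvd p & P <= p & K * ph p <= real N & 2 * real N <= ps p"
   show "card I * (N div 2) <= card (factors x N)" by (rule main[OF \<open>finite I\<close> bspec[OF I]])
  qed
 qed (simp add: ka0_def)
qed

end

section \<open>Levels between the slow and the fast order of growth\<close>

lemma multiples_between:
 assumes "1 <= (ka::nat)"
 shows "EX I. finite I & (ALL p:I. ka dvd p & l < p & p <= h) & (real h - real l) / real ka - 1 <= real (card I)"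
proof (intro exI conjI ballI)
 let ?I = "(%i. ka * i) ` {l div ka<..h div ka}"
 show "finite ?I" by simp
 show "ka dvd p" if "p : ?I" for p using that by auto
 show "l < p" if "p : ?I" for p using that assms by (auto simp: div_less_iff_less_mult mult.commute)
 show "p <= h" if "p : ?I" for p using that assms by (auto simp: less_eq_div_iff_mult_less_eq mult.commute)
 have "card ?I = h div ka - l div ka" using assms by (subst card_image) (auto simp: inj_on_def)
 hence "real (h div ka) - real (l div ka) <= real (card ?I)" by simp
 moreover have "real h / real ka - real (h div ka) <= 1"
 proof -
  have "real h = real ka * real (h div ka) + real (h mod ka)" by (simp flip: of_nat_mult of_nat_add)
  moreover have "real (h mod ka) <= real ka" using assms by (intro of_nat_mono less_imp_le mod_less_divisor) simp
  ultimately have "real h <= real ka * (real (h div ka) + 1)" by (simp add: algebra_simps)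
  thus ?thesis using assms by (simp add: field_simps)
 qed
 moreover have "real (l div ka) <= real l / real ka"
 proof -
  have "real (l div ka * ka) <= real l" by (rule of_nat_mono) simp
  thus ?thesis using assms by (simp add: field_simps)
 qed
 ultimately show "(real h - real l) / real ka - 1 <= real (card ?I)" by (simp add: diff_divide_distrib)
qed

lemma poly_exp_bound:
 fixes b et :: real
 assumes "0 < b" "b < et"
 shows "EX D>0. ALL p. (real p + 1) ^ k * b ^ p <= D * et ^ p"
proof -
 define r where "r = b / et"
 have r: "0 < r" "r < 1" using assms by (simp_all add: r_def)
 have "EV p. (real p + 1) ^ k * r ^ p <= 1 * 1"
 proof -
  have "((%p. (real p + 1) ^ k * r ^ p) \<longlongrightarrow> 0) sequentially" using r by real_asymp
  hence "EV p. (real p + 1) ^ k * r ^ p < 1" by (rule order_tendstoD) simp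
  thus ?thesis by eventually_elim simp
 qed
 hence "EX C>0. ALL s:{()}. ALL p. (real p + 1) ^ k * r ^ p <= C * 1"
  by (intro uniform_bound) auto
 then obtain D where D: "0 < D" "!!p. (real p + 1) ^ k * r ^ p <= D" by auto
 have "(real p + 1) ^ k * b ^ p <= D * et ^ p" for p
 proof -
  have "b ^ p = r ^ p * et ^ p" using assms by (simp add: r_def power_divide)
  thus ?thesis using mult_right_mono[OF D(2)[of p], of "et ^ p"] assms by (simp add: mult.assoc)
 qed
 with D(1) show ?thesis by blast
qed

text \<open>For different rates the admissible levels lie between the logarithms of \<open>N\<close>
  to the bases \<open>dl\<close> and \<open>b\<close>. A base \<open>et\<close> between them absorbs
  the polynomial factor, and the remaining interval still has a length proportional to
  \<open>ln N\<close>.\<close>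

lemma exp_window:
 fixes b dl K c :: real
 assumes "1 < b" "b < dl" "0 < K" "0 < c" "1 <= (ka::nat)"
 shows "EX e>0. EV N :: nat. EX I. finite I &
  (ALL p:I. ka dvd p & P <= p & K * ((real p + 1) ^ k * b ^ p) <= real N & 2 * real N <= c * dl ^ p) &
  e * ln (real N) <= real (card I)"
proof -
 obtain et where et: "b < et" "et < dl" using dense assms(2) by blast
 obtain D where D: "0 < D" "!!p. (real p + 1) ^ k * b ^ p <= D * et ^ p"
  using poly_exp_bound[of b et] assms(1) et by auto
 define h where "h N = nat \<lfloor>log et (real N / (K * D))\<rfloor>" for N :: nat
 define l where "l N = P + nat \<lceil>log dl (2 * real N / c)\<rceil>" for N :: nat
 \<comment> \<open>Half the density of the admissible multiples of \<open>ka\<close>; the other half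
   absorbs the constants collected in \<open>q\<close>.\<close>
 define e where "e = (1 / ln et - 1 / ln dl) / (2 * real ka)"
 have ln: "0 < ln et" "ln et < ln dl" using et assms(1) by auto
 hence e: "0 < e" using assms(5) by (simp add: e_def field_simps)
 define q where "q = (ln (K * D) / ln et + ln (2 / c) / ln dl + 2 + real P) / ka + 1"
 have "EV N :: nat. q / e <= ln (real N)"
  by (rule filterlim_at_top[THEN iffD1, rule_format]) real_asymp
 moreover have "EV N :: nat. 1 <= 2 * real N / c"
  by (rule filterlim_at_top[THEN iffD1, rule_format]) (use assms(4) in real_asymp)
 moreover have "EV N :: nat. 1 <= real N / (K * D)"
  by (rule filterlim_at_top[THEN iffD1, rule_format]) (use assms(3) D(1) in real_asymp)
 moreover have "EV N :: nat. 0 < N" by (rule eventually_gt_at_top)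
 ultimately have "EV N :: nat. EX I. finite I &
  (ALL p:I. ka dvd p & P <= p & K * ((real p + 1) ^ k * b ^ p) <= real N & 2 * real N <= c * dl ^ p) &
  e * ln (real N) <= real (card I)"
 proof eventually_elim
  case (elim N)
  obtain I where I: "finite I" "!!p. p : I ==> ka dvd p & l N < p & p <= h N"
   "(real (h N) - real (l N)) / real ka - 1 <= real (card I)"
   using multiples_between[OF assms(5), of "l N" "h N"] by blast
  have lh: "real (h N) > log et (real N / (K * D)) - 1" unfolding h_def by linarith
  have h_le: "real (h N) <= log et (real N / (K * D))"
   unfolding h_def using elim(3) et assms(1) by (intro of_nat_floor) simp
  have ll: "real (l N) < real P + log dl (2 * real N / c) + 1"
  proof -
   have "0 <= log dl (2 * real N / c)" using elim(2) et assms(1) by simp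
   thus ?thesis unfolding l_def by simp linarith
  qed
  have l_ge: "log dl (2 * real N / c) <= real (l N)" unfolding l_def by simp linarith
  have "log et (real N / (K * D)) = ln (real N) / ln et - ln (K * D) / ln et"
   using elim(4) assms(3) D(1) by (simp add: log_def ln_div diff_divide_distrib)
  moreover have "log dl (2 * real N / c) = ln (real N) / ln dl + ln (2 / c) / ln dl"
   using elim(4) assms(4) by (simp add: log_def ln_div ln_mult add_divide_distrib diff_divide_distrib)
  ultimately have "ln (real N) / ln et - ln (K * D) / ln et - ln (real N) / ln dl - ln (2 / c) / ln dl - 2 - real P
   <= real (h N) - real (l N)" using lh ll by linarith
  hence "(ln (real N) / ln et - ln (K * D) / ln et - ln (real N) / ln dl - ln (2 / c) / ln dl - 2 - real P) / ka
   <= (real (h N) - real (l N)) / ka" by (rule divide_right_mono) simp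
  with I(3) have "(ln (real N) / ln et - ln (K * D) / ln et - ln (real N) / ln dl - ln (2 / c) / ln dl - 2 - real P) / ka - 1
   <= real (card I)" by (rule order_trans[OF diff_right_mono, rotated])
  moreover have "(ln (real N) / ln et - ln (K * D) / ln et - ln (real N) / ln dl - ln (2 / c) / ln dl - 2 - real P) / ka - 1
    = 2 * e * ln (real N) - q"
   unfolding q_def e_def using assms(5) by (simp add: diff_divide_distrib add_divide_distrib algebra_simps)
  moreover have "q <= e * ln (real N)" using elim(1) e by (simp add: field_simps)
  ultimately have card: "e * ln (real N) <= real (card I)" by linarith
  have "ka dvd p & P <= p & K * ((real p + 1) ^ k * b ^ p) <= real N & 2 * real N <= c * dl ^ p" if "p : I" for p
  proof (intro conjI)
   show "ka dvd p" "P <= p" using I(2)[OF that] by (auto simp: l_def)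
   have "real p <= log et (real N / (K * D))" using I(2)[OF that] h_le by linarith
   hence "et powr real p <= real N / (K * D)" using et assms(1) elim(3) by (subst (asm) le_log_iff) auto
   hence "K * (D * et ^ p) <= real N" using et assms(1,3) D(1) by (simp add: powr_realpow field_simps)
   moreover have "K * ((real p + 1) ^ k * b ^ p) <= K * (D * et ^ p)" using D(2) assms(3) by (intro mult_left_mono) auto
   ultimately show "K * ((real p + 1) ^ k * b ^ p) <= real N" by linarith
   have "log dl (2 * real N / c) <= real p" using I(2)[OF that] l_ge by linarith
   hence "2 * real N / c <= dl powr real p" using et assms(1) elim(2) by (subst (asm) log_le_iff) auto
   thus "2 * real N <= c * dl ^ p" using et assms(1,4) by (simp add: powr_realpow field_simps)
  qed
  with I(1) card show ?case by blast
 qed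
 with e show ?thesis by blast
qed

text \<open>For equal rates the two orders differ by the factor \<open>p + 1\<close>. Let
  \<open>p1\<close> be the last level at which the slow order is below \<open>N\<close>. One may
  then go back while the power of \<open>b\<close> lost is at most of order \<open>p1\<close>, that
  is, by about \<open>ln p1\<close> levels, which is of order \<open>ln (ln N)\<close>.\<close>

lemma loglog_window:
 fixes b K c :: real
 assumes "1 < b" "0 < K" "0 < c" "1 <= (ka::nat)"
 shows "EX e>0. EV N :: nat. EX I. finite I &
  (ALL p:I. ka dvd p & P <= p & K * ((real p + 1) ^ k * b ^ p) <= real N & 2 * real N <= c * ((real p + 1) ^ Suc k * b ^ p)) &
  e * ln (ln (real N)) <= real (card I)"
proof -
 define ph where "ph p = (real p + 1) ^ k * b ^ p" for p :: nat
 have ph_ge: "real p <= ph p * (1 / (b - 1))" for p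
 proof -
  have "real p * (b - 1) <= b ^ p" using Bernoulli_inequality[of "b - 1" p] assms(1) by simp
  also have "... <= ph p" unfolding ph_def using assms(1) by (simp add: one_le_power mult_le_cancel_right1)
  finally show ?thesis using assms(1) by (simp add: field_simps)
 qed
 obtain D where D: "0 < D" "!!p. ph p <= D * (2 * b) ^ p"
  using poly_exp_bound[of b "2 * b" k] assms(1) by (auto simp: ph_def)
 \<comment> \<open>The denominator collects the losses of the estimate at the end: \<open>b\<close>
   for the step to \<open>Suc p1\<close>, \<open>4 ^ k\<close> for replacing \<open>p1 + 2\<close>
   by \<open>4 * (p + 1)\<close>, and 4 for the factor in \<open>2 * N\<close> and for
   \<open>p1 + 1\<close> against \<open>p + 1\<close>.\<close>
 define c2 where "c2 = c / (4 * 2 ^ k * K * 2 ^ k * b)"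
 have c2: "0 < c2" unfolding c2_def using assms by simp
 define j where "j p = nat \<lfloor>log b (c2 * (real p + 1))\<rfloor>" for p :: nat
 have lnb: "0 < ln b" using assms(1) by simp
 have "EV p. P <= p div 2 & j p <= p div 2 & ln (real p + 1) / (2 * ln b * real ka) <= real (j p) / real ka - 1"
 proof -
  have "EV p :: nat. 2 * P <= p" by (rule eventually_ge_at_top)
  moreover have "EV p :: nat. (ln c2 + ln (real p + 1)) / ln b + 1 <= real p / 2 & 0 <= (ln c2 + ln (real p + 1)) / ln b"
   using lnb by (intro eventually_conj; real_asymp)
  moreover have "EV p :: nat. ln (real p + 1) / 2 <= ln c2 + ln (real p + 1) - ln b - real ka * ln b"
   by real_asymp
  ultimately show ?thesis
  proof eventually_elim
   case (elim p)
   have lg: "log b (c2 * (real p + 1)) = (ln c2 + ln (real p + 1)) / ln b" using c2 by (simp add: log_def ln_mult)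
   have j: "real (j p) <= log b (c2 * (real p + 1))" "log b (c2 * (real p + 1)) - 1 <= real (j p)"
    using elim(2) unfolding j_def lg by linarith+
   have "2 * real (j p) + 2 <= real p" using j(1) elim(2) unfolding lg by linarith
   hence "2 * j p + 2 <= p" by linarith
   hence "j p <= p div 2" by linarith
   moreover have "P <= p div 2" using elim(1) by linarith
   moreover have "ln (real p + 1) / (2 * ln b * real ka) <= real (j p) / real ka - 1"
   proof -
    have "ln (real p + 1) / 2 / ln b <= (ln c2 + ln (real p + 1) - ln b - real ka * ln b) / ln b"
     using elim(3) lnb by (intro divide_right_mono) auto
    also have "... = log b (c2 * (real p + 1)) - 1 - real ka" using lnb lg by (simp add: diff_divide_distrib)
    also have "... <= real (j p) - real ka" using j(2) by simp
    finally have "ln (real p + 1) / 2 / ln b / real ka <= (real (j p) - real ka) / real ka" by (intro divide_right_mono) auto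
    thus ?thesis using assms(4) by (simp add: diff_divide_distrib)
   qed
   ultimately show ?case by blast
  qed
 qed
 then obtain p0 where p0: "!!p. p >= p0 ==> P <= p div 2 & j p <= p div 2 & ln (real p + 1) / (2 * ln b * real ka) <= real (j p) / real ka - 1"
  by (auto simp: eventually_sequentially)
 define e where "e = 1 / (4 * ln b * real ka)"
 have e: "0 < e" unfolding e_def using lnb assms(4) by simp
 define rk where "rk = ln (2 * b)"
 have rk: "0 < rk" unfolding rk_def using assms(1) by simp
 have "EV N :: nat. K * ph p0 <= real N"
  by (rule filterlim_at_top[THEN iffD1, rule_format]) real_asymp
 moreover have "EV N :: nat. sqrt (ln (real N)) <= (ln (real N) - ln (K * D)) / rk & 1 <= ln (real N)"
  using rk by (intro eventually_conj; real_asymp)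
 moreover have "EV N :: nat. 0 < N" by (rule eventually_gt_at_top)
 ultimately have "EV N :: nat. EX I. finite I &
  (ALL p:I. ka dvd p & P <= p & K * ph p <= real N & 2 * real N <= c * ((real p + 1) * ph p)) &
  e * ln (ln (real N)) <= real (card I)"
 proof eventually_elim
  case (elim N)
  have bnd: "ALL p. K * ph p <= real N --> p <= nat \<lceil>real N / (K * (b - 1))\<rceil>"
  proof (intro allI impI)
   fix p assume "K * ph p <= real N"
   hence "ph p <= real N / K" using assms(2) by (simp add: field_simps)
   hence "ph p * (1 / (b - 1)) <= real N / K * (1 / (b - 1))" using assms(1) by (intro mult_right_mono) auto
   hence "real p <= real N / (K * (b - 1))" using ph_ge[of p] by simp
   thus "p <= nat \<lceil>real N / (K * (b - 1))\<rceil>" by linarith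
  qed
  define p1 where "p1 = (GREATEST p. K * ph p <= real N)"
  have p1: "K * ph p1 <= real N" "p0 <= p1"
   unfolding p1_def using GreatestI_nat[of "%p. K * ph p <= real N" p0] Greatest_le_nat[of "%p. K * ph p <= real N" p0] bnd elim(1)
   by blast+
  have up: "real N < K * ph (Suc p1)"
  proof (rule ccontr)
   assume "~ ?thesis"
   hence "Suc p1 <= p1" unfolding p1_def using Greatest_le_nat[of "%p. K * ph p <= real N"] bnd by (metis linorder_not_le)
   thus False by simp
  qed
  have p1': "P <= p1 div 2" "j p1 <= p1 div 2" "ln (real p1 + 1) / (2 * ln b * real ka) <= real (j p1) / real ka - 1"
   using p0[OF p1(2)] by blast+
  obtain I where I: "finite I" "!!p. p : I ==> ka dvd p & p1 - j p1 < p & p <= p1"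
   "(real p1 - real (p1 - j p1)) / real ka - 1 <= real (card I)"
   using multiples_between[OF assms(4), of "p1 - j p1" "p1"] by blast
  have "e * ln (ln (real N)) <= real (card I)"
  proof -
   have "ln (real N) < ln (K * ph (Suc p1))" using up elim(3) by (subst ln_less_cancel_iff) auto
   also have "... <= ln (K * (D * (2 * b) ^ Suc p1))"
   proof -
    have "K * ph (Suc p1) <= K * (D * (2 * b) ^ Suc p1)" by (rule mult_left_mono[OF D(2)]) (use assms(2) in simp)
    moreover have "0 < K * ph (Suc p1)" using up elim(3) by linarith
    ultimately show ?thesis by (subst ln_le_cancel_iff) (simp_all del: power_Suc)
   qed
   also have "... = ln (K * D) + (real p1 + 1) * rk"
    using D(1) assms by (simp add: ln_mult ln_realpow rk_def algebra_simps)
   finally have "(ln (real N) - ln (K * D)) / rk < real p1 + 1" using rk by (simp add: field_simps)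
   \<comment> \<open>A crude bound is enough: under the next logarithm the root becomes the factor
     1/2.\<close>
   hence "sqrt (ln (real N)) <= real p1 + 1" using elim(2) by linarith
   hence "ln (sqrt (ln (real N))) <= ln (real p1 + 1)" using elim(2) by (subst ln_le_cancel_iff) auto
   hence "ln (ln (real N)) / 2 <= ln (real p1 + 1)" using elim(2) by (simp add: ln_sqrt)
   hence "ln (ln (real N)) / 2 / (2 * ln b * real ka) <= ln (real p1 + 1) / (2 * ln b * real ka)"
    using lnb by (intro divide_right_mono) auto
   also have "... <= real (j p1) / real ka - 1" by (rule p1'(3))
   also have "... <= real (card I)" using I(3) p1'(2) by (simp add: of_nat_diff)
   finally show ?thesis by (simp add: e_def)
  qed
  moreover have "ka dvd p & P <= p & K * ph p <= real N & 2 * real N <= c * ((real p + 1) * ph p)" if "p : I" for p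
  proof (intro conjI)
   have p: "p1 - j p1 < p" "p <= p1" "ka dvd p" using I(2)[OF that] by auto
   show "ka dvd p" by fact
   show "P <= p" using p p1' by linarith
   have "ph p <= ph p1" unfolding ph_def using p assms(1) by (intro mult_mono power_mono power_increasing) auto
   hence "K * ph p <= K * ph p1" using assms(2) by simp
   thus "K * ph p <= real N" using p1(1) by linarith
   obtain i where i: "p1 = p + i" using p(2) le_Suc_ex by blast
   hence ij: "i <= j p1" using p by linarith
   have "p1 - p1 div 2 < p" using diff_le_mono2[OF p1'(2), of p1] p(1) by (rule le_less_trans)
   hence "p1 + 1 <= 2 * (p + 1)" by presburger
   hence half: "real p1 + 1 <= 2 * (real p + 1)" using of_nat_mono[where 'a = real] by fastforce
   have "b ^ i <= b ^ j p1" using ij assms(1) by (intro power_increasing) auto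
   also have "... <= c2 * (real p1 + 1)"
   proof -
    have "0 < j p1" using p by linarith
    hence "real (j p1) <= log b (c2 * (real p1 + 1))" unfolding j_def by linarith
    hence "b powr real (j p1) <= c2 * (real p1 + 1)" using assms(1) c2 by (subst (asm) le_log_iff) auto
    thus ?thesis using assms(1) by (simp add: powr_realpow)
   qed
   finally have bi: "b ^ i <= c2 * (real p1 + 1)" .
   have "real N <= K * ((real p1 + 2) ^ k * (b * b ^ p1))" using up by (simp add: ph_def add.commute)
   also have "... <= K * ((4 * (real p + 1)) ^ k * (b * b ^ p1))"
    using half assms by (intro mult_left_mono mult_right_mono power_mono) auto
   also have "... = K * 2 ^ k * 2 ^ k * b * b ^ i * ph p"
   proof -
    have "(4 * (real p + 1)) ^ k = 2 ^ k * (2 ^ k * (real p + 1) ^ k)"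
     by (simp only: power_mult_distrib[symmetric]) simp
    thus ?thesis unfolding i ph_def power_add by (simp only: mult_ac)
   qed
   also have "... <= K * 2 ^ k * 2 ^ k * b * (c2 * (real p1 + 1)) * ph p"
    using bi assms by (intro mult_right_mono mult_left_mono) (auto simp: ph_def)
   also have "... <= K * 2 ^ k * 2 ^ k * b * (c2 * (2 * (real p + 1))) * ph p"
    using half c2 assms by (intro mult_right_mono mult_left_mono) (auto simp: ph_def)
   also have "... = c / 2 * ((real p + 1) * ph p)" unfolding c2_def using assms by (simp add: field_simps)
   finally show "2 * real N <= c * ((real p + 1) * ph p)" by simp
  qed
  ultimately show ?case using I(1) by blast
 qed
 hence "EV N :: nat. EX I. finite I &
  (ALL p:I. ka dvd p & P <= p & K * ((real p + 1) ^ k * b ^ p) <= real N & 2 * real N <= c * ((real p + 1) ^ Suc k * b ^ p)) &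
  e * ln (ln (real N)) <= real (card I)" by (simp add: ph_def mult.assoc)
 with e show ?thesis by blast
qed

section \<open>Orders of complexity when no bounded words accumulate\<close>

lemma grows_le_compare:
 assumes "grows u k b" "grows v k' b'" "EV n. u n <= C * v n"
 shows "b < b' | b = b' & k <= k'"
proof (rule ccontr)
 assume not: "~ ?thesis"
 from assms(1) obtain c where c: "0 < b" "0 < c" "EV n. c * (real n ^ k * b ^ n) <= u n" by (rule growsE)
 from assms(2) obtain D where D: "0 < b'" "0 < D" "EV n. v n <= D * (real n ^ k' * b' ^ n)" by (rule growsE)
 obtain E where E: "0 < E" "EV n. real n ^ Suc k' * b' ^ n <= E * (real n ^ k * b ^ n)"
 proof -
  have "b' < b | b' = b & Suc k' <= k" using not by auto
  thus thesis using poly_exp_le[of b' b "Suc k'" k] D(1) that by blast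
 qed
 have "EV n. E * \<bar>C\<bar> * D / c < real n"
  using filterlim_real_sequentially by (simp add: filterlim_at_top_dense)
 with c(3) D(3) E(2) assms(3) grows_nonneg[OF assms(2)] eventually_gt_at_top[of 0]
 have "EV n :: nat. False"
 proof eventually_elim
  case (elim n)
  have pos: "0 < real n ^ k' * b' ^ n" using D(1) elim by simp
  have "c * (real n * (real n ^ k' * b' ^ n)) <= c * (E * (real n ^ k * b ^ n))" using elim c(2) by (simp add: mult.assoc)
  also have "... = E * (c * (real n ^ k * b ^ n))" by simp
  also have "... <= E * (C * v n)" using elim E(1) by (intro mult_left_mono) auto
  also have "... <= E * (\<bar>C\<bar> * (D * (real n ^ k' * b' ^ n)))"
   using elim E(1) by (intro mult_left_mono mult_mono) auto
  finally have "c * real n * (real n ^ k' * b' ^ n) <= E * \<bar>C\<bar> * D * (real n ^ k' * b' ^ n)" by (simp add: mult.assoc)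
  hence "c * real n <= E * \<bar>C\<bar> * D" using pos by (simp add: mult_le_cancel_right)
  thus ?case using elim c(2) by (simp add: field_simps)
 qed
 thus False by simp
qed

lemma has_growthI:
 assumes "0 < c" "EV n. 0 <= growth_fun g n"
  "EV n. c * growth_fun g n <= real (card (factors x n))"
  "EV n. real (card (factors x n)) <= C * growth_fun g n"
 shows "has_growth x g"
 unfolding has_growth_def factor_complexity_def
proof (rule bigthetaI)
 show "(%n. real (card (factors x n))) : O(growth_fun g)"
  by (rule bigoI[of _ C]) (use assms(2,4) in \<open>eventually_elim, simp\<close>)
 show "(%n. real (card (factors x n))) : \<Omega>(growth_fun g)"
  by (rule landau_omega.bigI[OF assms(1)]) (use assms(2,3) in \<open>eventually_elim, simp\<close>)
qed

lemma window_lower: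
 assumes w: "0 < e" "EV N. EX I. finite I & (ALL p:I. Q N p) & e * h N <= real (card I)"
  and lower: "!!N I. finite I ==> (ALL p:I. Q N p) ==> card I * (N div 2) <= P N"
 shows "EV N. (e / 3) * (real N * h N) <= real (P N)"
 using w(2) eventually_ge_at_top[of 2]
proof eventually_elim
 case (elim N)
 then obtain I where I: "finite I" "ALL p:I. Q N p" "e * h N <= real (card I)" by blast
 have "N <= 3 * (N div 2)" using elim(2) by presburger
 hence N: "real N <= 3 * real (N div 2)" using of_nat_mono[where 'a = real] by fastforce
 have "(e / 3) * (real N * h N) = (e * h N) * (real N / 3)" by simp
 also have "... <= real (card I) * (real N / 3)" using I(3) by (intro mult_right_mono) auto
 also have "... <= real (card I) * real (N div 2)" using N by (intro mult_left_mono) auto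
 also have "... <= real (P N)" using lower[OF I(1,2)] by (metis of_nat_le_iff of_nat_mult)
 finally show ?case .
qed

lemma grows_shift_upper:
 assumes "grows u k b" "k <= k'"
 shows "EX C. EV p. u p <= C * ((real p + 1) ^ k' * b ^ p)"
proof -
 from assms(1) obtain C where C: "0 < b" "0 < C" "EV n. u n <= C * (real n ^ k * b ^ n)" by (rule growsE)
 have "EV n. u n <= C * ((real n + 1) ^ k' * b ^ n)"
  using C(3)
 proof eventually_elim
  case (elim n)
  have "real n ^ k <= (real n + 1) ^ k" by (intro power_mono) auto
  also have "... <= (real n + 1) ^ k'" using assms(2) by (intro power_increasing) auto
  finally have "C * (real n ^ k * b ^ n) <= C * ((real n + 1) ^ k' * b ^ n)" using C by (intro mult_left_mono mult_right_mono) auto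
  with elim show ?case by linarith
 qed
 thus ?thesis by blast
qed

lemma grows_shift_lower:
 assumes "grows u k b" "k' <= k"
 shows "EX c>0. EV p. c * ((real p + 1) ^ k' * b ^ p) <= u p"
proof -
 from assms(1) obtain c where c: "0 < b" "0 < c" "EV n. c * (real n ^ k * b ^ n) <= u n" by (rule growsE)
 have "EV n. (c / 2 ^ k') * ((real n + 1) ^ k' * b ^ n) <= u n"
  using c(3) eventually_ge_at_top[of 1]
 proof eventually_elim
  case (elim n)
  have "(real n + 1) ^ k' <= (2 * real n) ^ k'" using elim by (intro power_mono) auto
  also have "... <= 2 ^ k' * real n ^ k" using assms(2) elim by (auto simp: power_mult_distrib intro!: power_increasing)
  finally have "(real n + 1) ^ k' / 2 ^ k' <= real n ^ k" by (simp add: field_simps)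
  hence "c * ((real n + 1) ^ k' / 2 ^ k' * b ^ n) <= c * (real n ^ k * b ^ n)" using c by (intro mult_left_mono mult_right_mono) auto
  with elim show ?case by simp
 qed
 moreover have "0 < c / 2 ^ k'" using c by simp
 ultimately show ?thesis by blast
qed

lemma shifted_poly_exp_step:
 "0 < b ==> b * ((real p + 1) ^ k * b ^ p) <= (real (Suc p) + 1) ^ k * b ^ Suc p"
proof -
 assume "0 < b"
 hence "(real p + 1) ^ k * b ^ Suc p <= (real (Suc p) + 1) ^ k * b ^ Suc p" by (intro mult_right_mono power_mono) auto
 thus ?thesis by (simp add: mult_ac)
qed

lemma shifted_poly_exp_ge_1: "1 <= b ==> 1 <= (real p + 1) ^ k * b ^ p"
 using mult_mono[of 1 "(real p + 1) ^ k" 1 "b ^ p"] by (simp add: one_le_power)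

lemma uniform_lower:
 fixes u :: "'b => nat => real"
 assumes "finite S" "!!s. s : S ==> EX c>0. EV p. c * ph p <= u s p"
 shows "EX c>0. EV p. 0 <= ph p --> (ALL s:S. c * ph p <= u s p)"
 using assms
proof (induction S)
 case empty
 show ?case by (intro exI[of _ 1]) simp
next
 case (insert s S)
 then obtain c where c: "0 < c" "EV p. 0 <= ph p --> (ALL s:S. c * ph p <= u s p)" by auto
 obtain d where d: "0 < d" "EV p. d * ph p <= u s p" using insert.prems[of s] by auto
 have "EV p. 0 <= ph p --> (ALL t:insert s S. min c d * ph p <= u t p)"
  using c(2) d(2)
 proof eventually_elim
  case (elim p)
  show ?case
  proof (intro impI ballI)
   fix t assume p: "0 <= ph p" and t: "t : insert s S"
   have "min c d * ph p <= c * ph p" "min c d * ph p <= d * ph p" using p by (intro mult_right_mono; simp)+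
   thus "min c d * ph p <= u t p" using t elim p by fastforce
  qed
 qed
 moreover have "0 < min c d" using c d by simp
 ultimately show ?case by blast
qed

context nq
begin

lemma length_ge_exp: "c : G ==> 2 ^ (p div 2) <= length (it f p [c])"
 using L_ge_exp[of c p] length_filter_le[of "growing f" "it f p [c]"] unfolding gl_def by linarith

lemma growth_child:
 assumes "c : G" "d : set (f c)" "growing f d"
 shows "d : G" "rate d < rate c | rate d = rate c & deg d <= deg c"
proof -
 show d: "d : G" using growing_R_closed[of c d 1] assms by simp
 obtain W where W: "!!b. b : R ==> length (f b) <= W" by (rule width) blast
 have "L d p <= real W * L c p" for p
 proof -
  have "length (it f p [d]) <= length (it f (Suc p) [c])" unfolding it_Suc_letter by (rule length_it_subset[OF assms(2)])
  also have "... = length (it f 1 (it f p [c]))" by simp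
  also have "... <= length (it f p [c]) * W"
   by (rule length_it_le) (use W it_letter_in_R[of c p] assms(1) in auto)
  finally have "real (length (it f p [d])) <= real (length (it f p [c]) * W)" by (rule of_nat_mono)
  thus ?thesis by (simp add: mult.commute)
 qed
 thus "rate d < rate c | rate d = rate c & deg d <= deg c"
  by (intro grows_le_compare[OF growth(3)[OF d] growth(3)[OF assms(1)], of "real W"] always_eventually) simp
qed

lemma bounded_letter_length: "b : B ==> (!!p. 1 <= ph p) ==> EX C. EV p. L b p <= C * ph p"
proof -
 assume b: "b : B" and ph: "!!p. 1 <= ph p"
 obtain K where "ALL p. length (it f p [b]) <= K" using bounded_letters b by blast
 hence "L b p <= real K * ph p" for p
  using mult_left_mono[OF ph[of p], of "real K"] by (smt (verit) of_nat_0_le_iff of_nat_mono mult_cancel_left2)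
 thus ?thesis by (intro exI[of _ "real K"] always_eventually) simp
qed

text \<open>When the first image reaches length \<open>n\<close>, all others lag behind at most by a
  polynomial factor in the level, hence by a power of \<open>ln n\<close>. At the common rate
  \<open>b\<close> this is made up within the logarithm of that factor.\<close>

lemma upper_same_base:
 assumes G: "!!c. c : G ==> rate c = b" "!!c. c : G ==> k <= deg c & deg c <= k + A"
 shows "EX C D. 0 < D & (EV n. real (card (factors x n)) <=
  real C * real n * (real (nat \<lceil>log b (D * (2 * log 2 (real n) + 3) ^ A)\<rceil>) + 5))"
proof -
 have b: "1 < b" using rate_gt_1[OF a_in_G] G(1)[OF a_in_G] by simp
 have finG: "finite G" using finite_R by simp
 obtain C1 where C1: "0 < C1" "!!d p. d : G ==> L d p <= C1 * ((real p + 1) ^ (k + A) * b ^ p)"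
 proof -
  have "EX C>0. ALL d:G. ALL p. L d p <= C * ((real p + 1) ^ (k + A) * b ^ p)"
  proof (rule uniform_bound[OF finG])
   show "EX C. EV p. L d p <= C * ((real p + 1) ^ (k + A) * b ^ p)" if "d : G" for d
    using grows_shift_upper[OF growth(3)[OF that]] G[OF that] by auto
  qed (rule shifted_poly_exp_ge_1, use b in simp)
  thus thesis using that by blast
 qed
 obtain C2 where C2: "0 < C2" "!!d p. d : G ==> (real p + 1) ^ k * b ^ p <= C2 * L d p"
 proof -
  have "EX C>0. ALL d:G. ALL p. (real p + 1) ^ k * b ^ p / L d p <= C * 1"
  proof (rule uniform_bound[OF finG])
   fix d assume d: "d : G"
   obtain c where c: "0 < c" "EV p. c * ((real p + 1) ^ k * b ^ p) <= L d p"
    using grows_shift_lower[OF growth(3)[OF d], of k] G[OF d] by auto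
   have "EV p. (real p + 1) ^ k * b ^ p / L d p <= (1 / c) * 1"
    using c(2)
   proof eventually_elim
    case (elim p)
    have "0 < (2::nat) ^ (p div 2)" by simp
    hence "0 < L d p" using length_ge_exp[OF d, of p] by linarith
    thus ?case using elim c(1) by (simp add: field_simps)
   qed
   thus "EX C. EV p. (real p + 1) ^ k * b ^ p / L d p <= C * 1" by blast
  qed simp
  then obtain C where C: "0 < C" "!!d p. d : G ==> (real p + 1) ^ k * b ^ p / L d p <= C" by auto
  have "(real p + 1) ^ k * b ^ p <= C * L d p" if d: "d : G" for d p
  proof -
   have "0 < (2::nat) ^ (p div 2)" by simp
   hence "0 < L d p" using length_ge_exp[OF d, of p] by linarith
   thus ?thesis using C(2)[OF d, of p] by (simp add: field_simps)
  qed
  with C(1) show thesis using that by blast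
 qed
 obtain K where K: "ALL b:B. ALL p. length (it f p [b]) <= K" using bounded_letters by blast
 define D where "D = C1 * C2"
 have D: "0 < D" using C1 C2 by (simp add: D_def)
 define J where "J n = nat \<lceil>log b (D * (2 * log 2 (real n) + 3) ^ A)\<rceil>" for n :: nat
 have "EX C. ALL n>=max 2 (Suc K). card (factors x n) <= C * n * (Suc (J n) + 4)"
 proof (rule upper_levels, intro allI impI ballI)
  fix n p d q e
  assume n: "Suc K <= n" and d: "d : R" "n <= length (it f (Suc p) [d])"
   and small: "!!q e. q < p ==> e : R ==> length (it f (Suc q) [e]) < n" and q: "p + Suc (J n) <= q" and e: "e : G"
  have dG: "d : G"
  proof (rule ccontr)
   assume "d ~: G"
   hence "length (it f (Suc p) [d]) <= K" using K d by blast
   thus False using n d by linarith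
  qed
  have n0: "0 < n" using n by simp
  have lg: "0 <= log 2 (real n)" using n0 by simp
  \<comment> \<open>By minimality of \<open>p\<close>, the \<open>p\<close>-th image of
    \<open>a\<close> is still shorter than \<open>n\<close>, yet its length is at least
    \<open>2 ^ (p div 2)\<close>.\<close>
  have p_le: "real p + 2 <= 2 * log 2 (real n) + 3"
  proof (cases p)
   case (Suc r)
   have "2 ^ (p div 2) <= length (it f p [a])" by (rule length_ge_exp[OF a_in_G])
   also have "... < n" using small[of r a] Suc a_in_R by simp
   finally have "real (2 ^ (p div 2)) <= real n" by linarith
   hence "2 powr real (p div 2) <= real n" by (simp add: powr_realpow)
   hence "real (p div 2) <= log 2 (real n)" using n0 by (simp add: le_log_iff)
   moreover have "real p <= 2 * real (p div 2) + 1"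
   proof -
    have "p <= 2 * (p div 2) + 1" by presburger
    thus ?thesis using of_nat_mono[where 'a = real] by fastforce
   qed
   ultimately show ?thesis by linarith
  qed (use lg in simp)
  have bJ: "D * (2 * log 2 (real n) + 3) ^ A <= b ^ J n"
  proof -
   have pos: "0 < D * (2 * log 2 (real n) + 3) ^ A" using D lg by simp
   have "log b (D * (2 * log 2 (real n) + 3) ^ A) <= real (J n)" unfolding J_def by linarith
   thus ?thesis using b pos by (simp add: log_le_iff powr_realpow)
  qed
  have "C2 * real n <= C2 * L d (Suc p)" using d C2(1) by (intro mult_left_mono) auto
  also have "... <= C2 * (C1 * ((real (Suc p) + 1) ^ (k + A) * b ^ Suc p))" using C1(2)[OF dG, of "Suc p"] C2(1) by (intro mult_left_mono) auto
  also have "... = (real p + 2) ^ k * b ^ Suc p * (D * (real p + 2) ^ A)" by (simp add: D_def power_add add.commute)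
  also have "... <= (real p + 2) ^ k * b ^ Suc p * (D * (2 * log 2 (real n) + 3) ^ A)"
   using p_le b D by (intro mult_left_mono power_mono) auto
  also have "... <= (real p + 2) ^ k * b ^ Suc p * b ^ J n" using bJ b by (intro mult_left_mono) auto
  also have "... = (real p + 2) ^ k * b ^ (p + Suc (J n))" by (simp add: power_add)
  also have "... <= (real q + 1) ^ k * b ^ q" using q b by (intro mult_mono power_mono power_increasing) auto
  also have "... <= C2 * L e q" by (rule C2(2)[OF e])
  finally show "n <= length (it f q [e])" using C2(1) by simp
 qed
 then obtain C where C: "!!n. max 2 (Suc K) <= n ==> card (factors x n) <= C * n * (Suc (J n) + 4)" by blast
 have "real (card (factors x n)) <= real C * real n * (real (J n) + 5)" if "max 2 (Suc K) <= n" for n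
 proof -
  have "real (card (factors x n)) <= real (C * n * (Suc (J n) + 4))" using C[OF that] by (rule of_nat_mono)
  thus ?thesis by (simp add: algebra_simps)
 qed
 hence "EV n. real (card (factors x n)) <= real C * real n * (real (J n) + 5)"
  unfolding eventually_sequentially by blast
 thus ?thesis unfolding J_def using D by blast
qed

text \<open>All growing images double every two steps, so \<open>2 * log 2 n\<close> levels are
  enough for each of them to reach length \<open>n\<close>.\<close>

lemma upper_log: "EX C. EV n. real (card (factors x n)) <= C * (real n * ln (real n))"
proof -
 define J where "J n = nat \<lceil>2 * log 2 (real n)\<rceil> + 2" for n :: nat
 have "EX C. ALL n>=max 2 1. card (factors x n) <= C * n * (J n + 4)"
 proof (rule upper_levels, intro allI impI ballI)
  fix n p d q e
  assume n: "1 <= n" and q: "p + J n <= q" and e: "e : G"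
  have "real (J n) <= real q" using q by linarith
  moreover have "2 * log 2 (real n) + 2 <= real (J n)" unfolding J_def by simp linarith
  moreover have "real q <= 2 * real (q div 2) + 1"
  proof -
   have "q <= 2 * (q div 2) + 1" by presburger
   thus ?thesis using of_nat_mono[where 'a = real] by fastforce
  qed
  ultimately have "log 2 (real n) <= real (q div 2)" by linarith
  hence "real n <= 2 ^ (q div 2)" using n by (simp add: log_le_iff powr_realpow)
  hence "n <= 2 ^ (q div 2)" by (metis of_nat_le_iff of_nat_numeral of_nat_power)
  thus "n <= length (it f q [e])" using length_ge_exp[OF e, of q] by linarith
 qed
 then obtain C where "ALL n>=max 2 1. card (factors x n) <= C * n * (J n + 4)" ..
 hence C: "card (factors x n) <= C * n * (J n + 4)" if "2 <= n" for n using that by simp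
 have "EV n :: nat. 1 <= ln (real n)" by real_asymp
 hence "EV n. real (card (factors x n)) <= real C * (2 / ln 2 + 7) * (real n * ln (real n))"
  using eventually_ge_at_top[of 2]
 proof eventually_elim
  case (elim n)
  have "0 <= log 2 (real n)" using elim by simp
  hence "real (J n) <= 2 * log 2 (real n) + 3" unfolding J_def by simp linarith
  moreover have "2 * log 2 (real n) = 2 / ln 2 * ln (real n)" by (simp add: log_def)
  ultimately have "real (J n) + 4 <= (2 / ln 2 + 7) * ln (real n)" using elim(1) unfolding distrib_right by linarith
  hence "real C * real n * (real (J n) + 4) <= real C * real n * ((2 / ln 2 + 7) * ln (real n))" by (intro mult_left_mono) auto
  moreover have "real (card (factors x n)) <= real (C * n * (J n + 4))" using C[OF elim(2)] by (rule of_nat_mono)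
  moreover have "real (C * n * (J n + 4)) = real C * real n * (real (J n) + 4)" by simp
  moreover have "real C * (2 / ln 2 + 7) * (real n * ln (real n)) = real C * real n * ((2 / ln 2 + 7) * ln (real n))"
   by (simp only: mult_ac)
  ultimately show ?case by linarith
 qed
 thus ?thesis by blast
qed

theorem linear_log:
 assumes "c1 : G" "c2 : G" "rate c1 ~= rate c2"
 shows "has_growth x Linear_log"
proof -
 have finG: "finite G" using finite_R by simp
 \<comment> \<open>Slow letters are those of the least rate and the bounded ones; all others count
   as fast, at least at the next larger rate \<open>dl\<close>.\<close>
 define b where "b = Min (rate ` G)"
 have b: "b : rate ` G" "!!c. c : G ==> b <= rate c" unfolding b_def using finG assms(1) by (auto intro: Min_in)
 hence b1: "1 < b" using rate_gt_1 by auto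
 define F where "F = {c : G. b < rate c}"
 have "b < rate c1 | b < rate c2" using b(2)[OF assms(1)] b(2)[OF assms(2)] assms(3) by linarith
 hence F: "finite F" "F ~= {}" unfolding F_def using finite_R assms(1,2) by auto
 define dl where "dl = Min (rate ` F)"
 have dl: "b < dl" "!!c. c : F ==> dl <= rate c" unfolding dl_def using F by (auto simp: F_def)
 define S where "S = R - F"
 define k where "k = Max (deg ` G)"
 have k: "!!c. c : G ==> deg c <= k" unfolding k_def using finG by simp
 define ph where "ph k p = (real p + 1) ^ k * b ^ p" for k p
 have ph1: "1 <= ph k p" for k p unfolding ph_def using shifted_poly_exp_ge_1[of b p k] b1 by simp
 have S_G: "s : B | s : G & rate s = b" if "s : S" for s using that b(2)[of s] by (auto simp: S_def F_def)
 have slow_closed: "set (f s) <= S" if s: "s : S" for s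
 proof
  fix t assume t: "t : set (f s)"
  have tR: "t : R" using s t closed[of s] by (auto simp: S_def)
  show "t : S"
  proof (rule ccontr)
   assume "t ~: S"
   hence tF: "t : G" "b < rate t" using tR by (auto simp: S_def F_def)
   hence "growing f s" using growing_if_child[where f = f and n = 1 and b = s and c = t] t by simp
   hence "s : G" "rate s = b" using S_G[OF s] by auto
   thus False using growth_child(2)[of s t] t tF by auto
  qed
 qed
 obtain si where si: "si : G" "rate si = b" using b(1) by auto
 \<comment> \<open>Among the slow letters the largest degree gives the common order, attained by
   \<open>s0\<close>.\<close>
 define ks where "ks = Max (deg ` {c : G. rate c = b})"
 have "ks : deg ` {c : G. rate c = b}" unfolding ks_def using si finite_R by (intro Max_in) auto
 then obtain s0 where s0: "s0 : G" "rate s0 = b" "deg s0 = ks" by auto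
 have ks: "deg c <= ks" if "c : G" "rate c = b" for c unfolding ks_def using that finite_R by (intro Max_ge) auto
 obtain c0 where c0: "0 < c0" "EV p. c0 * ph ks p <= L s0 p"
  using grows_shift_lower[OF growth(3)[OF s0(1)], of ks] s0 unfolding ph_def by auto
 obtain c where c: "0 < c" "EV p. 0 <= dl ^ p --> (ALL d:F. c * dl ^ p <= L d p)"
 proof -
  have "EX c>0. EV p. 0 <= dl ^ p --> (ALL d:F. c * dl ^ p <= L d p)"
  proof (rule uniform_lower[OF F(1)])
   fix d assume d: "d : F"
   hence dG: "d : G" by (simp add: F_def)
   obtain c where c: "0 < c" "EV p. c * ((real p + 1) ^ 0 * rate d ^ p) <= L d p"
    using grows_shift_lower[OF growth(3)[OF dG], of 0] by auto
   have "EV p. c * dl ^ p <= L d p"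
    using c(2)
   proof eventually_elim
    case (elim p)
    have "c * dl ^ p <= c * rate d ^ p" using c(1) dl b1 d by (intro mult_left_mono power_mono) auto
    with elim show ?case by simp
   qed
   with c(1) show "EX c>0. EV p. c * dl ^ p <= L d p" by blast
  qed
  thus thesis using that by blast
 qed
 have "EX K>0. EX ka>=1. EX P. ALL N I. finite I --> (ALL p:I. ka dvd p & P <= p & K * ph ks p <= real N & 2 * real N <= c * dl ^ p) -->
   card I * (N div 2) <= card (factors x N)"
 proof (rule slow_fast_lower[where S = S and ga = b and si = s0 and ?c0.0 = c0])
  show "S <= R" "S ~= R" using F by (auto simp: S_def F_def)
  show "b * ph ks p <= ph ks (Suc p)" for p unfolding ph_def using shifted_poly_exp_step[of b p ks] b1 by simp
  show "EX C. EV p. L s p <= C * ph ks p" if s: "s : S" for s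
  proof -
   consider "s : B" | "s : G" "rate s = b" using S_G[OF s] by blast
   thus ?thesis
   proof cases
    case 1 thus ?thesis using bounded_letter_length[where ph = "ph ks"] ph1 by blast
   next
    case 2
    thus ?thesis using grows_shift_upper[OF growth(3)[OF 2(1)] ks[OF 2]] unfolding ph_def by simp
   qed
  qed
  show "s0 : S" using s0 by (auto simp: S_def F_def)
  show "EV p. c * dl ^ p <= L d p" if "d : R - S" for d
   using c(2) by eventually_elim (use that dl(1) b1 in \<open>auto simp: S_def\<close>)
  show "filterlim (%p. c * dl ^ p / ph ks p) at_top sequentially"
   unfolding ph_def using c(1) dl(1) b1 by real_asymp
 qed (use slow_closed b1 ph1 c0 in auto)
 then obtain K ka P where K: "0 < K" "1 <= ka"
  and lower: "!!N I. finite I ==> (ALL p:I. ka dvd p & P <= p & K * ph ks p <= real N & 2 * real N <= c * dl ^ p) ==>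
   card I * (N div 2) <= card (factors x N)" by blast
 obtain e where e: "0 < e" "EV N :: nat. EX I. finite I &
  (ALL p:I. ka dvd p & P <= p & K * ph ks p <= real N & 2 * real N <= c * dl ^ p) & e * ln (real N) <= real (card I)"
  using exp_window[OF b1 dl(1) K(1) c(1) K(2), of P ks] unfolding ph_def by blast
 have lo: "EV n. e / 3 * (real n * ln (real n)) <= real (card (factors x n))"
  by (rule window_lower[OF e lower])
 obtain C where "EV n. real (card (factors x n)) <= C * (real n * ln (real n))" using upper_log by blast
 thus ?thesis using lo e(1) by (intro has_growthI[of "e / 3" _ _ C]) (auto intro: eventually_sequentiallyI[of 1])
qed

text \<open>At equal rates the letters of least degree take the role of the slow ones; every other
  letter is faster by at least one factor \<open>p\<close>.\<close>

theorem linear_loglog: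
 assumes eqb: "!!c. c : G ==> rate c = b" and "c1 : G" "c2 : G" "deg c1 ~= deg c2"
 shows "has_growth x Linear_loglog"
proof -
 have finG: "finite G" using finite_R by simp
 have b1: "1 < b" using rate_gt_1[OF a_in_G] eqb[OF a_in_G] by simp
 define k where "k = Min (deg ` G)"
 have k: "k : deg ` G" "!!c. c : G ==> k <= deg c" unfolding k_def using finG assms(2) by (auto intro: Min_in)
 define F where "F = {c : G. k < deg c}"
 have "k < deg c1 | k < deg c2" using k(2)[OF assms(2)] k(2)[OF assms(3)] assms(4) by linarith
 hence F: "finite F" "F ~= {}" unfolding F_def using finite_R assms(2,3) by auto
 define S where "S = R - F"
 define ph where "ph k p = (real p + 1) ^ k * b ^ p" for k p
 have ph1: "1 <= ph k p" for k p unfolding ph_def using shifted_poly_exp_ge_1[of b p k] b1 by simp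
 have S_G: "s : B | s : G & deg s = k" if "s : S" for s using that k(2)[of s] by (auto simp: S_def F_def)
 have slow_closed: "set (f s) <= S" if s: "s : S" for s
 proof
  fix t assume t: "t : set (f s)"
  have tR: "t : R" using s t closed[of s] by (auto simp: S_def)
  show "t : S"
  proof (rule ccontr)
   assume "t ~: S"
   hence tF: "t : G" "k < deg t" using tR by (auto simp: S_def F_def)
   hence "growing f s" using growing_if_child[where f = f and n = 1 and b = s and c = t] t by simp
   hence "s : G" "deg s = k" using S_G[OF s] by auto
   thus False using growth_child(2)[of s t] t tF eqb[of s] eqb[of t] by auto
  qed
 qed
 obtain s0 where s0: "s0 : G" "deg s0 = k" using k(1) by auto
 obtain c0 where c0: "0 < c0" "EV p. c0 * ph k p <= L s0 p"
  using grows_shift_lower[OF growth(3)[OF s0(1)], of k] s0 eqb[OF s0(1)] unfolding ph_def by auto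
 obtain c where c: "0 < c" "EV p. 0 <= ph (Suc k) p --> (ALL d:F. c * ph (Suc k) p <= L d p)"
 proof -
  have "EX c>0. EV p. 0 <= ph (Suc k) p --> (ALL d:F. c * ph (Suc k) p <= L d p)"
  proof (rule uniform_lower[OF F(1)])
   fix d assume d: "d : F"
   thus "EX c>0. EV p. c * ph (Suc k) p <= L d p"
    using grows_shift_lower[OF growth(3), of d "Suc k"] eqb[of d] unfolding ph_def F_def by auto
  qed
  thus thesis using that by blast
 qed
 have "EX K>0. EX ka>=1. EX P. ALL N I. finite I --> (ALL p:I. ka dvd p & P <= p & K * ph k p <= real N & 2 * real N <= c * ph (Suc k) p) -->
   card I * (N div 2) <= card (factors x N)"
 proof (rule slow_fast_lower[where S = S and ga = b and si = s0 and ?c0.0 = c0])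
  show "S <= R" "S ~= R" using F by (auto simp: S_def F_def)
  show "b * ph k p <= ph k (Suc p)" for p unfolding ph_def using shifted_poly_exp_step[of b p k] b1 by simp
  show "EX C. EV p. L s p <= C * ph k p" if s: "s : S" for s
  proof -
   consider "s : B" | "s : G" "deg s = k" using S_G[OF s] by blast
   thus ?thesis
   proof cases
    case 1 thus ?thesis using bounded_letter_length[where ph = "ph k"] ph1 by blast
   next
    case 2
    thus ?thesis using grows_shift_upper[OF growth(3)[OF 2(1)], of k] eqb[OF 2(1)] unfolding ph_def by simp
   qed
  qed
  show "s0 : S" using s0 by (auto simp: S_def F_def)
  show "EV p. c * ph (Suc k) p <= L d p" if d: "d : R - S" for d
   using c(2)
  proof eventually_elim
   case (elim p)
   have "0 <= ph (Suc k) p" using ph1[of "Suc k" p] by linarith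
   thus ?case using elim d by (auto simp: S_def)
  qed
  have "c * ph (Suc k) p / ph k p = c * (real p + 1)" for p
   using b1 unfolding ph_def by (simp add: field_simps)
  moreover have "filterlim (%p. c * (real p + 1)) at_top sequentially" using c(1) by real_asymp
  ultimately show "filterlim (%p. c * ph (Suc k) p / ph k p) at_top sequentially" by simp
 qed (use slow_closed b1 ph1 c0 in auto)
 then obtain K ka P where K: "0 < K" "1 <= ka"
  and lower: "!!N I. finite I ==> (ALL p:I. ka dvd p & P <= p & K * ph k p <= real N & 2 * real N <= c * ph (Suc k) p) ==>
   card I * (N div 2) <= card (factors x N)" by blast
 obtain e where e: "0 < e" "EV N :: nat. EX I. finite I &
  (ALL p:I. ka dvd p & P <= p & K * ph k p <= real N & 2 * real N <= c * ph (Suc k) p) & e * ln (ln (real N)) <= real (card I)"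
  using loglog_window[OF b1 K(1) c(1) K(2), of P k] unfolding ph_def by blast
 have lo: "EV n. e / 3 * (real n * ln (ln (real n))) <= real (card (factors x n))"
  by (rule window_lower[OF e lower])
 define A where "A = Max (deg ` G)"
 have A: "deg c <= k + A" if "c : G" for c
 proof -
  have "deg c <= A" unfolding A_def by (rule Max_ge) (use finG that in \<open>blast+\<close>)
  thus ?thesis by simp
 qed
 obtain C D where D: "0 < D" "EV n. real (card (factors x n)) <=
  real C * real n * (real (nat \<lceil>log b (D * (2 * log 2 (real n) + 3) ^ A)\<rceil>) + 5)"
  using upper_same_base[of b k A] eqb k(2) A by blast
 define C' where "C' = \<bar>ln D / ln b\<bar> + real A * 2 / ln b + 6"
 have lnb: "0 < ln b" using b1 by simp
 have "EV n :: nat. ln (2 * log 2 (real n) + 3) <= 2 * ln (ln (real n))" by real_asymp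
 moreover have "EV n :: nat. 1 <= ln (ln (real n))" by real_asymp
 ultimately have "EV n. real (card (factors x n)) <= real C * C' * (real n * ln (ln (real n)))"
  using D(2) eventually_ge_at_top[of 2]
 proof eventually_elim
  case (elim n)
  have lg: "0 <= log 2 (real n)" using elim by simp
  hence "log b (D * (2 * log 2 (real n) + 3) ^ A) = ln D / ln b + real A * ln (2 * log 2 (real n) + 3) / ln b"
   using D(1) by (simp add: log_def ln_mult ln_realpow add_divide_distrib)
  also have "... <= \<bar>ln D / ln b\<bar> * ln (ln (real n)) + real A * (2 * ln (ln (real n))) / ln b"
  proof (rule add_mono)
   have "ln D / ln b <= \<bar>ln D / ln b\<bar> * 1" using abs_ge_self[of "ln D / ln b"] by (simp only: mult_1_right)
   also have "... <= \<bar>ln D / ln b\<bar> * ln (ln (real n))" using elim(2) by (intro mult_left_mono) auto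
   finally show "ln D / ln b <= \<bar>ln D / ln b\<bar> * ln (ln (real n))" .
   show "real A * ln (2 * log 2 (real n) + 3) / ln b <= real A * (2 * ln (ln (real n))) / ln b"
    using elim(1) lnb by (intro divide_right_mono mult_left_mono) auto
  qed
  finally have le: "log b (D * (2 * log 2 (real n) + 3) ^ A) <= (\<bar>ln D / ln b\<bar> + real A * 2 / ln b) * ln (ln (real n))"
   by (simp add: algebra_simps)
  have nn: "0 <= (\<bar>ln D / ln b\<bar> + real A * 2 / ln b) * ln (ln (real n))" using elim(2) lnb by simp
  have "real (nat \<lceil>log b (D * (2 * log 2 (real n) + 3) ^ A)\<rceil>) <= (\<bar>ln D / ln b\<bar> + real A * 2 / ln b) * ln (ln (real n)) + 1"
   using le nn by linarith
  hence "real (nat \<lceil>log b (D * (2 * log 2 (real n) + 3) ^ A)\<rceil>) + 5 <= C' * ln (ln (real n))"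
   using elim(2) unfolding C'_def distrib_right by linarith
  hence "real C * real n * (real (nat \<lceil>log b (D * (2 * log 2 (real n) + 3) ^ A)\<rceil>) + 5) <= real C * real n * (C' * ln (ln (real n)))"
   by (intro mult_left_mono) auto
  with elim(3) show ?case by (simp add: mult_ac)
 qed
 moreover have "EV n :: nat. 0 <= real n * ln (ln (real n))" by real_asymp
 ultimately show ?thesis using lo e(1) by (intro has_growthI[of "e / 3" _ _ "real C * C'"]) auto
qed

text \<open>At equal orders the number of levels is bounded, which gives the upper bound; the lower
  bound is that of Morse and Hedlund.\<close>

theorem linear:
 assumes "!!c. c : G ==> rate c = b" "!!c. c : G ==> deg c = k" "~ uper x"
 shows "has_growth x Linear"
proof -
 obtain C D where D: "0 < D" "EV n. real (card (factors x n)) <=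
  real C * real n * (real (nat \<lceil>log b (D * (2 * log 2 (real n) + 3) ^ 0)\<rceil>) + 5)"
  using upper_same_base[of b k 0] assms(1,2) by auto
 have "EV n. real (card (factors x n)) <= real C * (real (nat \<lceil>log b D\<rceil>) + 5) * real n"
  using D(2) by eventually_elim (simp add: mult_ac)
 moreover have "EV n. 1 * real n <= real (card (factors x n))"
 proof (intro always_eventually allI)
  fix n
  have "Suc n <= card (factors x n)" by (rule not_uper_card_factors) (use assms(3) finite_factors in auto)
  thus "1 * real n <= real (card (factors x n))" by simp
 qed
 ultimately show ?thesis by (intro has_growthI[of 1 _ _ "real C * (real (nat \<lceil>log b D\<rceil>) + 5)"]) auto
qed

end

section \<open>Rounding real solutions, and layers of letters of equal degree\<close>

lemma simultaneous_approximation: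
 fixes v :: "'i => real"
 assumes "finite K" "0 < ep"
 shows "EX N::nat. 0 < N & (ALL i:K. EX z::int. \<bar>real N * v i - of_int z\<bar> < ep)"
proof -
 \<comment> \<open>The fractional parts converge along a subsequence, so the difference of two late
   indices is a common almost-denominator.\<close>
 have "EX r l. strict_mono r & (ALL i:K. (%n. frac (real (r n) * v i)) \<longlonglongrightarrow> l i)"
  by (rule finite_bounded_subsequence[OF assms(1), where C = 1 and v = "%n i. frac (real n * v i)"])
   (simp add: abs_le_iff frac_lt_1 less_imp_le order_trans[OF _ frac_ge_0])
 then obtain r l where r: "strict_mono r" "!!i. i : K ==> (%n. frac (real (r n) * v i)) \<longlonglongrightarrow> l i" by blast
 have "EV n. ALL i:K. \<bar>frac (real (r n) * v i) - l i\<bar> < ep / 2"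
 proof (rule eventually_ball_finite[OF assms(1)], rule ballI)
  fix i assume "i : K"
  thus "EV n. \<bar>frac (real (r n) * v i) - l i\<bar> < ep / 2"
   using tendstoD[OF r(2), of i "ep / 2"] assms(2) by (simp add: dist_real_def)
 qed
 then obtain n where n: "!!m i. m >= n ==> i : K ==> \<bar>frac (real (r m) * v i) - l i\<bar> < ep / 2"
  by (auto simp: eventually_sequentially)
 have lt: "r n < r (Suc n)" using r(1) by (simp add: strict_mono_Suc_iff)
 show ?thesis
 proof (intro exI[of _ "r (Suc n) - r n"] conjI ballI)
  show "0 < r (Suc n) - r n" using lt by simp
  fix i assume i: "i : K"
  have "real (r (Suc n) - r n) * v i - of_int (\<lfloor>real (r (Suc n)) * v i\<rfloor> - \<lfloor>real (r n) * v i\<rfloor>)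
   = frac (real (r (Suc n)) * v i) - frac (real (r n) * v i)"
   using lt by (simp add: frac_def of_nat_diff algebra_simps)
  moreover have "\<bar>frac (real (r (Suc n)) * v i) - frac (real (r n) * v i)\<bar> < ep"
   using n[of n i] n[of "Suc n" i] i by linarith
  ultimately show "EX z::int. \<bar>real (r (Suc n) - r n) * v i - of_int z\<bar> < ep" by metis
 qed
qed

text \<open>Multiplying by a common almost-denominator and rounding preserves the finitely many relations,
 since their errors are integers smaller than 1.\<close>

lemma natural_solution:
 fixes v :: "'i => real"
 assumes K: "finite K" "!!i. i : K ==> 0 < v i" and fin: "finite E"
  and E: "!!us ws. (us, ws) : E ==> set us <= K & set ws <= K & sum_list (map v us) = sum_list (map v ws)"
 shows "EX z :: 'i => nat. (ALL i:K. 0 < z i) & (ALL (us, ws):E. sum_list (map z us) = sum_list (map z ws))"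
proof -
 define M where "M = Suc (SUM (us, ws):E. length us + length ws)"
 have M: "length us + length ws < M" if "(us, ws) : E" for us ws
  using member_le_sum[OF that, of "%(us, ws). length us + length ws"] fin unfolding M_def by simp
 \<comment> \<open>The bound \<open>1 / M\<close> keeps the accumulated error of a relation below 1;
   the entries of \<open>v\<close> keep the rounded values positive.\<close>
 define ep where "ep = Min (insert (1 / real M) (v ` K))"
 have M0: "0 < M" unfolding M_def by simp
 have ep: "0 < ep" "ep <= 1 / real M" "!!i. i : K ==> ep <= v i"
  unfolding ep_def using K M0 by (auto simp: Min_gr_iff)
 obtain N :: nat where N: "0 < N" "ALL i:K. EX z::int. \<bar>real N * v i - of_int z\<bar> < ep"
  using simultaneous_approximation[OF K(1) ep(1)] by blast
 then obtain z :: "'i => int" where z: "!!i. i : K ==> \<bar>real N * v i - of_int (z i)\<bar> < ep" by metis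
 have pos: "0 < z i" if "i : K" for i
 proof -
  have "1 * v i <= real N * v i" using N(1) K(2)[OF that] by (intro mult_right_mono) auto
  hence "0 < real_of_int (z i)" using z[OF that] ep(3)[OF that] by linarith
  thus ?thesis by simp
 qed
 have err: "\<bar>real N * sum_list (map v us) - of_int (sum_list (map z us))\<bar> <= real (length us) * ep" if "set us <= K" for us
  using that
 proof (induction us)
  case (Cons i us)
  have "\<bar>real N * v i - of_int (z i)\<bar> <= ep" using z[of i] Cons.prems by simp
  moreover have "\<bar>real N * sum_list (map v us) - of_int (sum_list (map z us))\<bar> <= real (length us) * ep" using Cons by simp
  ultimately have "\<bar>(real N * v i - of_int (z i)) + (real N * sum_list (map v us) - of_int (sum_list (map z us)))\<bar> <= ep + real (length us) * ep"
   by linarith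
  thus ?case by (simp add: algebra_simps)
 qed simp
 have eq: "sum_list (map z us) = sum_list (map z ws)" if "(us, ws) : E" for us ws
 proof -
  have *: "set us <= K" "set ws <= K" "sum_list (map v us) = sum_list (map v ws)" using E[OF that] by auto
  have "\<bar>real_of_int (sum_list (map z us)) - real_of_int (sum_list (map z ws))\<bar> <= real (length us) * ep + real (length ws) * ep"
   using err[OF *(1)] err[OF *(2)] *(3) by simp
  also have "... = real (length us + length ws) * ep" by (simp add: distrib_right)
  also have "... <= real (length us + length ws) * (1 / real M)" using ep(2) by (rule mult_left_mono) simp
  also have "... < 1" using M[OF that] M0 by (simp add: divide_less_eq)
  finally have "\<bar>real_of_int (sum_list (map z us) - sum_list (map z ws))\<bar> < 1" by simp
  thus ?thesis by linarith
 qed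
 have nat_sum: "sum_list (map (%i. nat (z i)) us) = nat (sum_list (map z us)) & 0 <= sum_list (map z us)" if "set us <= K" for us
  using that
 proof (induction us)
  case (Cons i us)
  thus ?case using pos[of i] by (simp add: nat_add_distrib)
 qed simp
 show ?thesis
 proof (intro exI[of _ "%i. nat (z i)"] conjI ballI)
  show "0 < nat (z i)" if "i : K" for i using pos[OF that] by simp
  fix e assume e: "e : E"
  obtain us ws where uw: "e = (us, ws)" by (cases e)
  have "set us <= K" "set ws <= K" using E e uw by blast+
  thus "case e of (us, ws) => sum_list (map (%i. nat (z i)) us) = sum_list (map (%i. nat (z i)) ws)"
  proof -
   have "(us, ws) : E" using e uw by simp
   hence "sum_list (map z us) = sum_list (map z ws)" by (rule eq)
   thus ?thesis unfolding uw prod.case using nat_sum[OF \<open>set us <= K\<close>] nat_sum[OF \<open>set ws <= K\<close>] by (simp only:)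
  qed
 qed
qed

lemma sum_list_filter_split:
 fixes h :: "'a => 'b::comm_monoid_add"
 shows "sum_list (map h w) = sum_list (map h (filter P w)) + sum_list (map h (filter (%c. ~ P c) w))"
 by (induction w) (simp_all add: add_ac)

lemma eventually_at_double:
 assumes "EV n. P n" shows "EV n. P (n + n :: nat)"
proof -
 obtain N where "!!n. n >= N ==> P n" using assms by (auto simp: eventually_sequentially)
 thus ?thesis by (auto simp: eventually_sequentially intro!: exI[of _ N])
qed

context nq
begin

text \<open>The number of lines of descent from \<open>d\<close> that stay in \<open>E\<close> for
  \<open>n\<close> generations.\<close>

definition lay :: "('a => bool) => 'a => nat => nat" where
 "lay E d n = length (it (gf f E) n [d])"

lemma lay_0 [simp]: "lay E d 0 = 1"
 by (simp add: lay_def)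

lemma lay_Suc: "lay E d (Suc n) = sum_list (map (%c. lay E c n) (filter E (f d)))"
 unfolding lay_def it_Suc_letter by (subst length_it) (simp add: gf_def)

lemma it_gf_E: "E d ==> c : set (it (gf f E) n [d]) ==> E c"
 by (cases n) (auto simp: gf_def set_extend)

lemma it_gf_subset: "set (it (gf f E) n [d]) <= set (it f n [d])"
proof (induction n)
 case (Suc n)
 thus ?case by (auto simp: set_extend gf_def)
qed simp

lemma gl_word: "length (filter (growing f) (it f n w)) = sum_list (map (%b. gl b n) w)"
 by (subst it_concat) (simp add: filter_concat length_concat comp_def gl_def)

lemma gl_Suc: "gl d (Suc n) = sum_list (map (%c. gl c n) (f d))"
 unfolding gl_def[of d] it_Suc_letter gl_word ..

lemma gl_not_growing: "~ growing f b ==> gl b n = 0"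
 using growing_if_child[where f = f and n = n and b = b] by (auto simp: gl_def filter_empty_conv)

lemma gl_ge_lay_sum: "sum_list (map (%c. gl c m) (it (gf f E) n [d])) <= gl d (n + m)"
proof (induction n arbitrary: m)
 case (Suc n)
 have "sum_list (map (%c. gl c m) (extend (gf f E) w)) <= sum_list (map (%c. gl c (Suc m)) w)" for w
 proof (induction w)
  case (Cons c w)
  have "sum_list (map (%c. gl c m) (filter E (f c))) <= gl c (Suc m)"
   unfolding gl_Suc using sum_list_filter_split[of "%c. gl c m" "f c" E] by simp
  thus ?case using Cons by (simp add: gf_def)
 qed simp
 from order_trans[OF this Suc] show ?case by (simp del: gl_Suc)
qed (simp add: gl_def)

lemma gl_ge_lay: "(!!c. c : R ==> E c ==> K <= gl c m) ==> d : R ==> E d ==> lay E d n * K <= gl d (n + m)"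
proof -
 assume K: "!!c. c : R ==> E c ==> K <= gl c m" and d: "d : R" "E d"
 have "set w <= {c : R. E c} ==> length w * K <= sum_list (map (%c. gl c m) w)" for w
  by (induction w) (use K in \<open>auto simp: add_mono\<close>)
 moreover have "set (it (gf f E) n [d]) <= {c : R. E c}"
  using it_gf_E[where E = E and d = d] it_gf_subset[where E = E and n = n and d = d] it_letter_in_R[OF d(1), of n] d(2) by auto
 ultimately show ?thesis unfolding lay_def using gl_ge_lay_sum[where m = m and E = E and n = n and d = d] by (meson order_trans)
qed

text \<open>Lines of descent are sorted by the generation \<open>k\<close> of their last letter in
  \<open>E\<close>. They leave through at most \<open>W\<close> children, and each growing child has
  at most \<open>U (n - 1 - k)\<close> growing descendants in the end.\<close>

lemma exit_upper:
 fixes U :: "nat => real"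
 assumes W: "!!b. b : R ==> length (f b) <= W"
  and U: "!!c c' m. c : R ==> E c ==> c' : set (f c) ==> growing f c' ==> ~ E c' ==> real (gl c' m) <= U m"
  and nn: "!!m. 0 <= U m" and d: "d : R" "E d"
 shows "real (gl d n) <= real (lay E d n) + (SUM k<n. real (lay E d k) * (real W * U (n - 1 - k)))"
proof -
 define S where "S k m = real (sum_list (map (%c. gl c m) (it (gf f E) k [d])))" for k m
 have mem: "set (it (gf f E) k [d]) <= {c : R. E c}" for k
  using it_gf_E[where E = E and d = d] it_gf_subset[where E = E and n = k and d = d] it_letter_in_R[OF d(1), of k] d(2) by auto
 have exits: "real (sum_list (map (%c. gl c (Suc m)) w)) <=
   real (sum_list (map (%c. gl c m) (extend (gf f E) w))) + real (length w) * (real W * U m)"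
  if "set w <= {c : R. E c}" for w m
  using that
 proof (induction w)
  case (Cons c w)
  have c: "c : R" "E c" using Cons.prems by auto
  have "real (sum_list (map (%c. gl c m) v)) <= real (length v) * U m" if "set v <= {c' : set (f c). ~ E c'}" for v
   using that
  proof (induction v)
   case (Cons c' v)
   have "real (gl c' m) <= U m"
    using U[OF c, of c' m] Cons.prems gl_not_growing[of c' m] nn[of m] by (cases "growing f c'") auto
   thus ?case using Cons by (simp add: distrib_right)
  qed simp
  from this[of "filter (%c. ~ E c) (f c)"]
  have "real (sum_list (map (%c. gl c m) (filter (%c. ~ E c) (f c)))) <= real (length (filter (%c. ~ E c) (f c))) * U m" by auto
  also have "... <= real W * U m"
   using le_trans[OF length_filter_le W[OF c(1)]] nn by (intro mult_right_mono of_nat_mono) auto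
  finally have "real (gl c (Suc m)) <= real (sum_list (map (%c. gl c m) (filter E (f c)))) + real W * U m"
   unfolding gl_Suc using sum_list_filter_split[of "%c. gl c m" "f c" E] by simp
  thus ?case using Cons by (simp add: gf_def distrib_right)
 qed simp
 have "S k m <= real (lay E d (k + m)) + (SUM i<m. real (lay E d (k + i)) * (real W * U (m - 1 - i)))" for k m
 proof (induction m arbitrary: k)
  case 0
  have "set w <= {c : R. E c} ==> sum_list (map (%c. gl c 0) w) <= length w" for w
   by (induction w) (auto simp: gl_def)
  from this[OF mem[of k]] show ?case by (simp add: S_def lay_def)
 next
  case (Suc m)
  have "S k (Suc m) <= S (Suc k) m + real (lay E d k) * (real W * U m)"
   using exits[OF mem[of k], of m] by (simp add: S_def lay_def)
  also have "... <= real (lay E d (Suc k + m)) + (SUM i<m. real (lay E d (Suc k + i)) * (real W * U (m - 1 - i)))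
    + real (lay E d k) * (real W * U m)" using Suc.IH[of "Suc k"] by simp
  also have "... = real (lay E d (k + Suc m)) + (SUM i<Suc m. real (lay E d (k + i)) * (real W * U (Suc m - 1 - i)))"
   by (subst sum.lessThan_Suc_shift) simp
  finally show ?case .
 qed
 from this[of 0 n] show ?thesis by (simp add: S_def)
qed

lemma lay_closed:
 assumes "!!c c'. c : R ==> E c ==> c' : set (f c) ==> growing f c' ==> E c'" "d : R" "E d"
 shows "gl d n <= lay E d n"
proof -
 obtain W where W: "!!b. b : R ==> length (f b) <= W" by (rule width) blast
 have "real (gl d n) <= real (lay E d n) + (SUM k<n. real (lay E d k) * (real W * (%m. 0) (n - 1 - k)))"
 proof (rule exit_upper[where E = E and W = W and U = "%m. 0", OF W _ _ assms(2,3)])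
  fix c c' m assume "c : R" "E c" "c' : set (f c)" "growing f c'" "~ E c'"
  thus "real (gl c' m) <= 0" using assms(1) by blast
 qed auto
 thus ?thesis by simp
qed

lemma lay_le_gl: "growing f d ==> (!!c. E c ==> growing f c) ==> lay E d n <= gl d n"
proof -
 assume g: "growing f d" "!!c. E c ==> growing f c"
 have mem: "c : set (it (gf f E) n [d]) ==> growing f c" for c
  using g by (cases n) (auto simp: gf_def set_extend)
 have "set w <= {c. growing f c} ==> length w <= sum_list (map (%c. gl c 0) w)" for w
  by (induction w) (auto simp: gl_def)
 from this[of "it (gf f E) n [d]"] show ?thesis unfolding lay_def using mem gl_ge_lay_sum[where m = 0 and E = E and n = n and d = d] by fastforce
qed

text \<open>In a closed layer all descendants have the order of \<open>d\<close>, so the count after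
  \<open>2n\<close> steps has at least the order of the square of the count after \<open>n\<close>
  steps. For the order \<open>n ^ k * b ^ n\<close> this is possible only with
  \<open>k = 0\<close>.\<close>

lemma min_layer_zero:
 assumes E: "!!c c'. c : R ==> E c ==> c' : set (f c) ==> growing f c' ==> E c'" "!!c. E c ==> growing f c"
  and g: "!!c. c : R ==> E c ==> rate c = b & deg c = k" and d: "d : R" "E d"
 shows "k = 0"
proof -
 have b: "1 < b" using rate_gt_1[of d] g[OF d] d E(2)[OF d(2)] by simp
 define ph where "ph n = real n ^ k * b ^ n" for n
 have ph0: "0 <= ph n" for n unfolding ph_def using b by simp
 have "EX c>0. EV n. 0 <= ph n --> (ALL s:{c:R. E c}. c * ph n <= real (gl s n))"
 proof (rule uniform_lower)
  show "finite {c : R. E c}" using finite_R by simp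
  fix s assume "s : {c : R. E c}"
  hence "grows (%n. real (gl s n)) k b" using growth(2)[of s] g[of s] E(2)[of s] by auto
  thus "EX c>0. EV n. c * ph n <= real (gl s n)" unfolding ph_def by (rule growsE) blast
 qed
 then obtain c where c: "0 < c" "EV n. ALL s:{c:R. E c}. c * ph n <= real (gl s n)" using ph0 by auto
 have "grows (%n. real (gl d n)) k b" using growth(2)[of d] g[OF d] E(2)[OF d(2)] d by auto
 then obtain C where C: "0 < C" "EV n. real (gl d n) <= C * ph n" unfolding ph_def by (rule growsE)
 have "EV n. C * 2 ^ k / (c * c) < real n"
  using filterlim_real_sequentially by (simp add: filterlim_at_top_dense)
 hence "EV n :: nat. k = 0"
  using c(2) eventually_at_double[OF C(2)] eventually_gt_at_top[of 0]
 proof eventually_elim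
  case (elim n)
  define K where "K = nat \<lceil>c * ph n\<rceil>"
  have "K <= gl s n" if "s : R" "E s" for s using elim(2) that unfolding K_def by (simp add: nat_le_iff ceiling_le_iff)
  hence "lay E d n * K <= gl d (n + n)" by (rule gl_ge_lay) (use d in auto)
  moreover have "gl d n * K <= lay E d n * K" by (rule mult_le_mono1[OF lay_closed[where E = E, OF E(1) d]])
  ultimately have "gl d n * K <= gl d (n + n)" by linarith
  hence 1: "real (gl d n) * real K <= real (gl d (n + n))" by (metis of_nat_le_iff of_nat_mult)
  have dn: "c * ph n <= real (gl d n)" "c * ph n <= real K" using elim(2) d unfolding K_def by (auto simp: real_nat_ceiling_ge)
  have "(c * ph n) * (c * ph n) <= real (gl d n) * real K" using dn ph0[of n] c(1) by (intro mult_mono) auto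
  also have "... <= C * ph (n + n)" using 1 elim(3) by linarith
  also have "C * ph (n + n) = C * (2 ^ k * (real n ^ k * (b ^ n * b ^ n)))"
  proof -
   have "real (n + n) = 2 * real n" by simp
   hence "real (n + n) ^ k = 2 ^ k * real n ^ k" by (simp only: power_mult_distrib)
   thus ?thesis unfolding ph_def power_add by (simp only: mult.assoc)
  qed
  finally have "(c * c * real n ^ k) * (real n ^ k * (b ^ n * b ^ n)) <= (C * 2 ^ k) * (real n ^ k * (b ^ n * b ^ n))"
   unfolding ph_def by (simp only: mult_ac)
  moreover have "0 < real n ^ k * (b ^ n * b ^ n)" using b elim(4) by simp
  ultimately have le: "c * c * real n ^ k <= C * 2 ^ k" by (simp only: mult_le_cancel_right_pos)
  show ?case
  proof (rule ccontr)
   assume "k ~= 0"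
   hence "real n ^ 1 <= real n ^ k" using elim(4) by (intro power_increasing) auto
   hence "c * c * real n <= c * c * real n ^ k" using c(1) by (intro mult_left_mono) auto
   hence "c * c * real n <= C * 2 ^ k" using le by linarith
   thus False using elim(1) c(1) by (simp add: field_simps)
  qed
 qed
 thus ?thesis by simp
qed

end

text \<open>Intended are \<open>rk = deg\<close> and \<open>X d e = N u\<^sub>d v\<^sub>e\<close>, rounded, with positive left eigenvectors \<open>u\<close> and \<open>v\<close> of the layers
 of \<open>d\<close> and \<open>e\<close>. Conversely, the equation forces the layers of all ranks to have the growth rate of layer 0.\<close>

definition rank_cert :: "('a => 'a list) => 'a set => ('a => nat) => ('a => 'a => nat) => bool" where
 "rank_cert f G rk X \<longleftrightarrow>
   (ALL c:G. ALL d:set (f c). d : G --> rk d <= rk c) &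
   (ALL d:G. ALL e:G. rk e = 0 --> 0 < X d e &
    sum_list (map (%c. X c e) (filter (%c. c : G & rk c = rk d) (f d))) =
    sum_list (map (%e'. X d e') (filter (%c. c : G & rk c = 0) (f e)))) &
   (ALL d:G. EX n. EX e:set (it f n [d]). e : G & rk e = 0)"

lemma tendsto_sum_list:
 fixes l :: "'a => real"
 assumes "!!c. c : set w ==> (%n. g n c) \<longlonglongrightarrow> l c"
 shows "(%n. sum_list (map (g n) w)) \<longlonglongrightarrow> sum_list (map l w)"
 using assms by (induction w) (auto intro!: tendsto_add)

context nq
begin

lemma gl_pos: "d : G ==> 0 < real (gl d n)"
 using gl_ge_1[of d n] by simp

lemma gl_bounds:
 "EX C>0. ALL d:G. ALL n. (real n + 1) ^ deg d * rate d ^ n <= C * real (gl d n) & real (gl d n) <= C * ((real n + 1) ^ deg d * rate d ^ n)"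
proof -
 have finG: "finite G" using finite_R by simp
 have pos: "0 < (real n + 1) ^ deg d * rate d ^ n" if "d : G" for d n
  using rate_gt_1[OF that] by (intro mult_pos_pos zero_less_power) auto
 have "EX C>0. ALL d:G. ALL n. real (gl d n) / ((real n + 1) ^ deg d * rate d ^ n) <= C * 1"
 proof (rule uniform_bound[OF finG])
  fix d assume d: "d : G"
  obtain C where "EV n. real (gl d n) <= C * ((real n + 1) ^ deg d * rate d ^ n)"
   using grows_shift_upper[OF growth(2)[OF d] order_refl] by blast
  hence "EV n. real (gl d n) / ((real n + 1) ^ deg d * rate d ^ n) <= C * 1"
   by eventually_elim (use pos[OF d] in \<open>simp add: pos_divide_le_eq\<close>)
  thus "EX C. EV n. real (gl d n) / ((real n + 1) ^ deg d * rate d ^ n) <= C * 1" by blast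
 qed simp
 then obtain C1 where C1: "0 < C1" "!!d n. d : G ==> real (gl d n) / ((real n + 1) ^ deg d * rate d ^ n) <= C1" by auto
 have "EX C>0. ALL d:G. ALL n. ((real n + 1) ^ deg d * rate d ^ n) / real (gl d n) <= C * 1"
 proof (rule uniform_bound[OF finG])
  fix d assume d: "d : G"
  obtain c where c: "0 < c" "EV n. c * ((real n + 1) ^ deg d * rate d ^ n) <= real (gl d n)"
   using grows_shift_lower[OF growth(2)[OF d] order_refl] by blast
  have "EV n. ((real n + 1) ^ deg d * rate d ^ n) / real (gl d n) <= (1 / c) * 1"
   using c(2) by eventually_elim (use gl_pos[OF d] c(1) in \<open>simp add: field_simps\<close>)
  thus "EX C. EV n. ((real n + 1) ^ deg d * rate d ^ n) / real (gl d n) <= C * 1" by blast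
 qed simp
 then obtain C2 where C2: "0 < C2" "!!d n. d : G ==> ((real n + 1) ^ deg d * rate d ^ n) / real (gl d n) <= C2" by auto
 have "(real n + 1) ^ deg d * rate d ^ n <= max C1 C2 * real (gl d n) & real (gl d n) <= max C1 C2 * ((real n + 1) ^ deg d * rate d ^ n)"
  if d: "d : G" for d n
 proof
  have "(real n + 1) ^ deg d * rate d ^ n <= C2 * real (gl d n)"
   using C2(2)[OF d, of n] gl_pos[OF d, of n] by (simp add: pos_divide_le_eq)
  also have "... <= max C1 C2 * real (gl d n)" by (intro mult_right_mono) auto
  finally show "(real n + 1) ^ deg d * rate d ^ n <= max C1 C2 * real (gl d n)" .
  have "real (gl d n) <= C1 * ((real n + 1) ^ deg d * rate d ^ n)"
   using C1(2)[OF d, of n] pos[OF d, of n] by (simp add: pos_divide_le_eq)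
  also have "... <= max C1 C2 * ((real n + 1) ^ deg d * rate d ^ n)"
   using pos[OF d, of n] by (intro mult_right_mono) auto
  finally show "real (gl d n) <= max C1 C2 * ((real n + 1) ^ deg d * rate d ^ n)" .
 qed
 moreover have "0 < max C1 C2" using C1(1) by simp
 ultimately show ?thesis by blast
qed

text \<open>At equal rates degrees do not increase along descent, so the descendants of least degree
  form a closed layer, whose degree is 0.\<close>

lemma reaches_rank_zero:
 assumes eqb: "!!c. c : G ==> rate c = b" and d: "d : G"
 shows "EX n. EX e:set (it f n [d]). e : G & deg e = 0"
proof -
 define T where "T = {c : G. EX n. c : set (it f n [d])}"
 have T: "finite T" "d : T" unfolding T_def using finite_R d by (auto intro: exI[of _ 0])
 define k where "k = Min (deg ` T)"
 have k: "k : deg ` T" "!!c. c : T ==> k <= deg c" unfolding k_def using T by (auto intro: Min_in)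
 then obtain e where e: "e : T" "deg e = k" by auto
 have "k = 0"
 proof (rule min_layer_zero[where E = "%c. c : T & deg c = k" and b = b and d = e])
  fix c c' assume c: "c : R" "c : T & deg c = k" "c' : set (f c)" "growing f c'"
  hence cG: "c : G" by (simp add: T_def)
  note ch = growth_child[OF cG c(3,4)]
  obtain n where "c : set (it f n [d])" using c(2) by (auto simp: T_def)
  hence "c' : set (it f (Suc n) [d])" using c(3) by (auto simp: set_extend)
  hence "c' : T" using ch(1) unfolding T_def by blast
  moreover have "deg c' <= k" using ch(2) eqb[OF cG] eqb[OF ch(1)] c(2) by auto
  ultimately show "c' : T & deg c' = k" using k(2)[of c'] by simp
 qed (use e eqb in \<open>auto simp: T_def\<close>)
 with e show ?thesis by (auto simp: T_def)
qed

text \<open>After \<open>n\<close> steps each letter of the layer has descendants of order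
  \<open>n ^ j * b ^ n\<close> in \<open>n\<close> further steps, while the total after
  \<open>2n\<close> steps has the order \<open>n ^ j * b ^ (2n)\<close>. This leaves only the order
  \<open>b ^ n\<close> for the layer itself.\<close>

lemma layer_upper:
 assumes eqb: "!!c. c : G ==> rate c = b"
 shows "EX C>0. ALL d:G. ALL n. real (lay (%c. c : G & deg c = deg d) d n) <= C * b ^ n"
proof -
 have b: "1 < b" using rate_gt_1[OF a_in_G] eqb[OF a_in_G] by simp
 obtain C where C: "0 < C" "!!d n. d : G ==> (real n + 1) ^ deg d * rate d ^ n <= C * real (gl d n)"
  "!!d n. d : G ==> real (gl d n) <= C * ((real n + 1) ^ deg d * rate d ^ n)" using gl_bounds by blast
 define A where "A = Max (deg ` G)"
 have A: "deg d <= A" if "d : G" for d unfolding A_def by (rule Max_ge) (use finite_R that in auto)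
 have "real (lay (%c. c : G & deg c = deg d) d n) <= (C * C * 2 ^ A) * b ^ n" if d: "d : G" for d n
 proof -
  define j where "j = deg d"
  define K where "K = nat \<lceil>(real n + 1) ^ j * b ^ n / C\<rceil>"
  have "K <= gl c n" if "c : R" "c : G & deg c = j" for c
  proof -
   have "(real n + 1) ^ j * b ^ n <= C * real (gl c n)" using C(2)[of c n] eqb[of c] that by auto
   thus ?thesis unfolding K_def using C(1) by (simp add: nat_le_iff ceiling_le_iff pos_divide_le_eq mult.commute)
  qed
  hence "lay (%c. c : G & deg c = j) d n * K <= gl d (n + n)" by (rule gl_ge_lay) (use d j_def in auto)
  hence "real (lay (%c. c : G & deg c = j) d n) * real K <= real (gl d (n + n))" by (metis of_nat_le_iff of_nat_mult)
  also have "... <= C * ((real (n + n) + 1) ^ j * b ^ (n + n))" using C(3)[OF d, of "n + n"] eqb[OF d] by (simp add: j_def)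
  also have "... <= C * ((2 * (real n + 1)) ^ j * b ^ (n + n))"
   using C(1) b by (intro mult_left_mono mult_right_mono power_mono) auto
  also have "... = (C * 2 ^ j * b ^ n) * ((real n + 1) ^ j * b ^ n)"
   unfolding power_add power_mult_distrib by (simp only: mult_ac)
  finally have 1: "real (lay (%c. c : G & deg c = j) d n) * real K <= (C * 2 ^ j * b ^ n) * ((real n + 1) ^ j * b ^ n)" .
  have K: "(real n + 1) ^ j * b ^ n / C <= real K" unfolding K_def by (rule real_nat_ceiling_ge)
  have pos: "0 < (real n + 1) ^ j * b ^ n" using b by simp
  have "real (lay (%c. c : G & deg c = j) d n) * ((real n + 1) ^ j * b ^ n / C) <= (C * 2 ^ j * b ^ n) * ((real n + 1) ^ j * b ^ n)"
   using order_trans[OF mult_left_mono[OF K] 1] by simp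
  hence "real (lay (%c. c : G & deg c = j) d n) * ((real n + 1) ^ j * b ^ n) <= (C * (C * 2 ^ j * b ^ n)) * ((real n + 1) ^ j * b ^ n)"
   using C(1) by (simp add: field_simps)
  hence "real (lay (%c. c : G & deg c = j) d n) <= C * (C * 2 ^ j * b ^ n)" using pos by (simp only: mult_le_cancel_right_pos)
  also have "... <= C * (C * 2 ^ A * b ^ n)"
   using C(1) b A[OF d] unfolding j_def by (intro mult_left_mono mult_right_mono power_increasing) auto
  finally show ?thesis by (simp add: j_def mult.assoc)
 qed
 moreover have "0 < C * C * 2 ^ A" using C(1) by simp
 ultimately show ?thesis by blast
qed

text \<open>Lines that leave the layer continue with a degree smaller by at least 1. To reach the
  full degree of \<open>d\<close> in the end, about \<open>n\<close> generations must each
  contribute, so the normalized layer sizes cannot vanish on average.\<close>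

lemma layer_cesaro:
 assumes eqb: "!!c. c : G ==> rate c = b" and d: "d : G"
 shows "EX c>0. EV n. c * real n <= (SUM k<n. real (lay (%c. c : G & deg c = deg d) d k) / b ^ k)"
proof -
 have b: "1 < b" using rate_gt_1[OF a_in_G] eqb[OF a_in_G] by simp
 obtain C where C: "0 < C" "!!d n. d : G ==> (real n + 1) ^ deg d * rate d ^ n <= C * real (gl d n)"
  "!!d n. d : G ==> real (gl d n) <= C * ((real n + 1) ^ deg d * rate d ^ n)" using gl_bounds by blast
 define E where "E c \<longleftrightarrow> c : G & deg c = deg d" for c
 have EE: "(%c. c : G & deg c = deg d) = E" by (simp add: E_def fun_eq_iff)
 define A where "A k = real (lay E d k) / b ^ k" for k
 have exits: "c' : G & deg c' < deg d" if "c : R" "E c" "c' : set (f c)" "growing f c'" "~ E c'" for c c'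
 proof -
  have cG: "c : G" using that by (simp add: E_def)
  note ch = growth_child[OF cG that(3,4)]
  have "deg c' <= deg d" using ch(2) eqb[OF cG] eqb[OF ch(1)] that(2) by (auto simp: E_def)
  thus ?thesis using that(5) ch(1) by (auto simp: E_def)
 qed
 have Ed: "E d" using d by (simp add: E_def)
 have dR: "d : R" using d by simp
 show ?thesis
 proof (cases "deg d = 0")
  case True
  have "1 / C <= A k" for k
  proof -
   have "gl d k <= lay E d k" by (rule lay_closed[where E = E, OF _ dR Ed]) (use exits True in force)
   hence "C * real (gl d k) <= C * real (lay E d k)" using C(1) by simp
   moreover have "b ^ k <= C * real (gl d k)" using C(2)[OF d, of k] eqb[OF d] True by simp
   ultimately have "b ^ k <= C * real (lay E d k)" by linarith
   thus ?thesis using C(1) b by (simp add: A_def field_simps)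
  qed
  hence "(SUM k<n. 1 / C) <= (SUM k<n. A k)" for n by (intro sum_mono) auto
  hence "1 / C * real n <= (SUM k<n. A k)" for n by simp
  thus ?thesis unfolding EE using C(1) by (intro exI[of _ "1 / C"]) (simp add: A_def)
 next
  case False
  then obtain i where i: "deg d = Suc i" by (cases "deg d") auto
  obtain W where W: "W >= 1" "!!b. b : R ==> length (f b) <= W" by (rule width) blast
  obtain C' where C': "0 < C'" "!!k. real (lay E d k) <= C' * b ^ k"
   using layer_upper[OF eqb] d unfolding E_def by blast
  define U where "U m = C * ((real m + 1) ^ i * b ^ m)" for m :: nat
  have U: "real (gl c' m) <= U m" if "c : R" "E c" "c' : set (f c)" "growing f c'" "~ E c'" for c c' m
  proof -
   have c': "c' : G" "deg c' <= i" using exits[OF that] i by auto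
   have "real (gl c' m) <= C * ((real m + 1) ^ deg c' * b ^ m)" using C(3)[OF c'(1), of m] eqb[OF c'(1)] by simp
   also have "... <= U m" unfolding U_def using C(1) b c'(2) by (intro mult_left_mono mult_right_mono power_increasing) auto
   finally show ?thesis .
  qed
  have U0: "0 <= U m" for m unfolding U_def using C(1) b by simp
  define q where "q = real W * C / b"
  have q: "0 < q" unfolding q_def using W(1) C(1) b by simp
  \<comment> \<open>The lower bound for \<open>gl d n\<close> is divided by the order one degree
    below; what remains of the exits is the sum of the normalized layer sizes.\<close>
  have key: "(real n + 1) / C <= C' + q * (SUM k<n. A k)" for n
  proof -
   have summand: "real (lay E d k) * (real W * U (n - 1 - k)) <= b ^ n * (real n + 1) ^ i * (q * A k)" if k: "k < n" for k
   proof -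
    have "U (n - 1 - k) <= C * ((real n + 1) ^ i * b ^ (n - 1 - k))"
     unfolding U_def using C(1) b k by (intro mult_left_mono mult_right_mono power_mono) auto
    hence "real (lay E d k) * (real W * U (n - 1 - k)) <= real (lay E d k) * (real W * (C * ((real n + 1) ^ i * b ^ (n - 1 - k))))"
     by (intro mult_left_mono) auto
    also have "b ^ (n - 1 - k) = b ^ n / (b * b ^ k)"
    proof -
     have "n = (n - 1 - k) + Suc k" using k by simp
     hence "b ^ n = b ^ (n - 1 - k) * (b * b ^ k)" by (metis power_add power_Suc)
     thus ?thesis using b by simp
    qed
    finally show ?thesis by (simp add: A_def q_def mult_ac)
   qed
   have "b ^ n * (real n + 1) ^ i * ((real n + 1) / C) = (real n + 1) ^ deg d * rate d ^ n / C" using eqb[OF d] by (simp add: i)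
   also have "... <= real (gl d n)" using C(2)[OF d, of n] C(1) by (simp add: pos_divide_le_eq mult.commute)
   also have "... <= real (lay E d n) + (SUM k<n. real (lay E d k) * (real W * U (n - 1 - k)))"
    by (rule exit_upper[where E = E, OF W(2) U U0 dR Ed])
   also have "... <= C' * b ^ n + (SUM k<n. b ^ n * (real n + 1) ^ i * (q * A k))"
    using C'(2)[of n] summand by (intro add_mono sum_mono) auto
   also have "... = C' * b ^ n * 1 + b ^ n * (real n + 1) ^ i * (q * (SUM k<n. A k))" by (simp add: sum_distrib_left)
   also have "... <= C' * b ^ n * (real n + 1) ^ i + b ^ n * (real n + 1) ^ i * (q * (SUM k<n. A k))"
    using C'(1) b by (intro add_right_mono mult_left_mono) auto
   also have "... = b ^ n * (real n + 1) ^ i * (C' + q * (SUM k<n. A k))" by (simp add: algebra_simps)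
   finally have le: "b ^ n * (real n + 1) ^ i * ((real n + 1) / C) <= b ^ n * (real n + 1) ^ i * (C' + q * (SUM k<n. A k))" .
   have "0 < b ^ n * (real n + 1) ^ i" using b by simp
   with le show ?thesis by (simp only: mult_le_cancel_left_pos)
  qed
  have "EV n. 2 * C * C' <= real n"
   using filterlim_real_sequentially by (simp add: filterlim_at_top)
  hence "EV n. 1 / (2 * C * q) * real n <= (SUM k<n. A k)"
  proof eventually_elim
   case (elim n)
   have "C' <= real n / (2 * C)" using elim C(1) by (simp add: field_simps)
   moreover have "real n / C <= (real n + 1) / C" using C(1) by (intro divide_right_mono) auto
   moreover have "real n / C = real n / (2 * C) + real n / (2 * C)" using C(1) by (simp add: field_simps)
   ultimately have "real n / (2 * C) <= q * (SUM k<n. A k)" using key[of n] by linarith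
   thus ?case using q C(1) by (simp add: field_simps)
  qed
  moreover have "0 < 1 / (2 * C * q)" using C(1) q by simp
  ultimately show ?thesis unfolding EE A_def by blast
 qed
qed

text \<open>A layer may split into several strong components and may be periodic, so Perron's
  theorem does not apply to it directly. Averages of the normalized layer sizes are used instead:
  they are bounded, bounded away from zero, and invariant in the limit.\<close>

lemma layer_eigenvector:
 assumes eqb: "!!c. c : G ==> rate c = b"
 shows "EX l. ALL d:G. 0 < l d & sum_list (map l (filter (%c. c : G & deg c = deg d) (f d))) = b * l d"
proof -
 have b: "1 < b" using rate_gt_1[OF a_in_G] eqb[OF a_in_G] by simp
 have finG: "finite G" using finite_R by simp
 define A where "A d k = real (lay (%c. c : G & deg c = deg d) d k) / b ^ k" for d k
 obtain C where C: "0 < C" "!!d k. d : G ==> A d k <= C"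
 proof -
  obtain C where "0 < C" "ALL d:G. ALL n. real (lay (%c. c : G & deg c = deg d) d n) <= C * b ^ n" using layer_upper[OF eqb] by blast
  thus thesis using that[of C] b by (simp add: A_def pos_divide_le_eq)
 qed
 have A0: "0 <= A d k" for d k using b by (simp add: A_def)
 define v where "v n d = (SUM k<n. A d k) / real n" for n d
 have v: "\<bar>v n d\<bar> <= C" if "d : G" for n d
 proof -
  have "(SUM k<n. A d k) <= real n * C" using sum_bounded_above[of "{..<n}" "A d" C] C(2)[OF that] by simp
  moreover have "0 <= (SUM k<n. A d k)" by (intro sum_nonneg A0)
  ultimately show ?thesis unfolding v_def using C(1) by (cases "n = 0") (simp_all add: field_simps)
 qed
 have "EX r l. strict_mono r & (ALL d:G. (%n. v (r n) d) \<longlonglongrightarrow> l d)"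
  by (rule finite_bounded_subsequence[OF finG v])
 then obtain r l where r: "strict_mono r" "!!d. d : G ==> (%n. v (r n) d) \<longlonglongrightarrow> l d" by blast
 have r_top: "filterlim r at_top sequentially" by (rule filterlim_subseq[OF r(1)])
 have "0 < l d" if d: "d : G" for d
 proof -
  obtain c where c: "0 < c" "EV n. c * real n <= (SUM k<n. A d k)"
   using layer_cesaro[OF eqb d] unfolding A_def by blast
  have "EV n. c <= v n d"
   using c(2) eventually_gt_at_top[of 0] by eventually_elim (simp add: v_def field_simps)
  hence "EV n. c <= v (r n) d" by (rule eventually_compose_filterlim[OF _ r_top])
  hence "c <= l d" by (rule tendsto_lowerbound[OF r(2)[OF d]]) simp
  with c(1) show ?thesis by simp
 qed
 moreover have "sum_list (map l (filter (%c. c : G & deg c = deg d) (f d))) = b * l d" if d: "d : G" for d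
 proof -
  let ?w = "filter (%c. c : G & deg c = deg d) (f d)"
  have step: "sum_list (map (%c. A c k) ?w) = b * A d (Suc k)" for k
  proof -
   have "real (sum_list (map (%c. lay (%c. c : G & deg c = deg d) c k) w)) = sum_list (map (%c. A c k) w) * b ^ k"
    if "ALL c:set w. deg c = deg d" for w
    using that b by (induction w) (simp_all add: A_def distrib_right)
   from this[of ?w] have "real (lay (%c. c : G & deg c = deg d) d (Suc k)) = sum_list (map (%c. A c k) ?w) * b ^ k"
    unfolding lay_Suc by simp
   thus ?thesis using b by (simp add: A_def)
  qed
  \<comment> \<open>Shifting the average by one generation changes only the two boundary terms,
    which are negligible after division by \<open>n\<close>.\<close>
  have "sum_list (map (%c. v n c) ?w) = b * (v n d + (A d n - 1) / real n)" for n
  proof -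
   have "sum_list (map (%c. v n c) w) = (SUM k<n. sum_list (map (%c. A c k) w)) / real n" for w
    by (induction w) (simp_all add: v_def sum.distrib add_divide_distrib)
   from this[of ?w] have "sum_list (map (%c. v n c) ?w) = (SUM k<n. b * A d (Suc k)) / real n" by (simp only: step)
   also have "(SUM k<n. b * A d (Suc k)) = b * ((SUM k<n. A d k) + A d n - A d 0)"
    unfolding sum_distrib_left[symmetric] using sum.lessThan_Suc_shift[of "A d" n] by simp
   finally have "sum_list (map (%c. v n c) ?w) = b * ((SUM k<n. A d k) + A d n - A d 0) / real n" .
   moreover have "A d 0 = 1" by (simp add: A_def)
   ultimately show ?thesis by (simp only: v_def[of n d] add_diff_eq[symmetric] add_divide_distrib times_divide_eq_right[symmetric])
  qed
  hence "(%n. sum_list (map (v (r n)) ?w)) = (%n. b * (v (r n) d + (A d (r n) - 1) / real (r n)))" by simp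
  moreover have "(%n. b * (v (r n) d + (A d (r n) - 1) / real (r n))) \<longlonglongrightarrow> b * (l d + 0)"
  proof (intro tendsto_mult tendsto_add tendsto_const r(2)[OF d])
   have "(%n. (C + 1) / real n) \<longlonglongrightarrow> 0" by real_asymp
   hence "(%n. (A d n - 1) / real n) \<longlonglongrightarrow> 0"
   proof (rule tendsto_0_le[where K = 1], intro always_eventually allI)
    fix n
    have "\<bar>A d n - 1\<bar> <= C + 1" using A0[of d n] C(2)[OF d, of n] by linarith
    thus "norm ((A d n - 1) / real n) <= norm ((C + 1) / real n) * 1" using C(1) by (simp add: divide_right_mono)
   qed
   thus "(%n. (A d (r n) - 1) / real (r n)) \<longlonglongrightarrow> 0" by (rule filterlim_compose[OF _ r_top])
  qed
  moreover have "(%n. sum_list (map (v (r n)) ?w)) \<longlonglongrightarrow> sum_list (map l ?w)"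
   by (rule tendsto_sum_list) (use r(2) in auto)
  ultimately show ?thesis using LIMSEQ_unique by fastforce
 qed
 ultimately show ?thesis by blast
qed

theorem rank_cert_complete:
 assumes eqb: "!!c. c : G ==> rate c = b"
 shows "EX X. rank_cert f G deg X"
proof -
 obtain l where l: "!!d. d : G ==> 0 < l d"
  "!!d. d : G ==> sum_list (map l (filter (%c. c : G & deg c = deg d) (f d))) = b * l d"
  using layer_eigenvector[OF eqb] by blast
 define Z where "Z = {e : G. deg e = 0}"
 define us where "us d e = map (%c. (c, e)) (filter (%c. c : G & deg c = deg d) (f d))" for d e :: 'a
 define ws where "ws d e = map (%e'. (d, e')) (filter (%c. c : G & deg c = 0) (f e))" for d e :: 'a
 define E where "E = (%(d, e). (us d e, ws d e)) ` (G \<times> Z)"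
 have fin: "finite (G \<times> Z)" unfolding Z_def using finite_R by simp
 have "EX z :: 'a \<times> 'a => nat. (ALL i:G \<times> Z. 0 < z i) & (ALL (us, ws):E. sum_list (map z us) = sum_list (map z ws))"
 proof (rule natural_solution[where v = "%(d, e). l d * l e", OF fin])
  show "0 < (case i of (d, e) => l d * l e)" if "i : G \<times> Z" for i using that l(1) by (auto simp: Z_def)
  show "finite E" unfolding E_def using fin by (rule finite_imageI)
  fix u w assume "(u, w) : E"
  then obtain d e where de: "d : G" "e : Z" "u = us d e" "w = ws d e" by (auto simp: E_def)
  have eG: "e : G" "deg e = 0" using de(2) by (auto simp: Z_def)
  have "sum_list (map (%(d, e). l d * l e) u) = sum_list (map l (filter (%c. c : G & deg c = deg d) (f d))) * l e"
   unfolding de us_def by (simp add: comp_def sum_list_mult_const)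
  \<comment> \<open>The eigenvalue enters both sides in the same way and cancels, which leaves a
    relation with integer coefficients.\<close>
  also have "... = l d * (b * l e)" using l(2)[OF de(1)] by simp
  also have "... = l d * sum_list (map l (filter (%c. c : G & deg c = 0) (f e)))" using l(2)[OF eG(1)] eG(2) by simp
  also have "... = sum_list (map (%(d, e). l d * l e) w)" unfolding de ws_def by (simp add: comp_def sum_list_const_mult)
  finally show "set u <= G \<times> Z & set w <= G \<times> Z & sum_list (map (%(d, e). l d * l e) u) = sum_list (map (%(d, e). l d * l e) w)"
   using de by (auto simp: us_def ws_def Z_def)
 qed
 then obtain z :: "'a \<times> 'a => nat" where
  zz: "(ALL i:G \<times> Z. 0 < z i) & (ALL (us, ws):E. sum_list (map z us) = sum_list (map z ws))" ..
 have z1: "0 < z i" if "i : G \<times> Z" for i by (rule bspec[OF conjunct1[OF zz] that])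
 have z2: "sum_list (map z u) = sum_list (map z w)" if "(u, w) : E" for u w
  using bspec[OF conjunct2[OF zz] that] by (simp only: prod.case)
 have "rank_cert f G deg (%d e. z (d, e))"
  unfolding rank_cert_def
 proof (intro conjI ballI impI)
  fix c d assume "c : G" "d : set (f c)" "d : G"
  thus "deg d <= deg c" using growth_child(2)[of c d] eqb by auto
 next
  fix d e assume de: "d : G" "e : G" "deg e = 0"
  hence eZ: "e : Z" by (simp add: Z_def)
  show "0 < z (d, e)" using z1 de(1) eZ by simp
  have "(us d e, ws d e) : E" unfolding E_def using de(1) eZ by force
  hence "sum_list (map z (us d e)) = sum_list (map z (ws d e))" by (rule z2)
  thus "sum_list (map (%c. z (c, e)) (filter (%c. c : G & deg c = deg d) (f d))) =
    sum_list (map (%e'. z (d, e')) (filter (%c. c : G & deg c = 0) (f e)))"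
   by (simp add: us_def ws_def comp_def)
 next
  fix d assume "d : G"
  show "EX n. EX e:set (it f n [d]). e : G & deg e = 0" by (rule reaches_rank_zero[OF eqb \<open>d : G\<close>])
 qed
 thus ?thesis by blast
qed

end

section \<open>Certificates for different rates\<close>

text \<open>The inequality makes the letters outside \<open>S\<close> grow at a higher exponential rate than those in \<open>S\<close>.\<close>

definition gap_cert :: "('a => 'a list) => 'a set => 'a set => nat => bool" where
 "gap_cert f G S n \<longleftrightarrow> S <= G & (EX s. s : S) & (EX d:G. d ~: S) &
   (ALL s:S. ALL c:set (f s). c : G --> c : S) &
   (ALL s:S. ALL d:G. d ~: S -->
    length (filter (%c. c : G) (it f n [s])) < length (it (gf f (%c. c : G & c ~: S)) n [d]))"

lemma grows_poly_exp: "0 < b ==> grows (%n. real n ^ k * b ^ n) k b"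
 unfolding grows_def by (intro conjI exI[of _ 1] always_eventually) auto

lemma grows_base_le:
 assumes "grows u k b'" "0 < b" "!!n. u n <= C * ((real n + 1) ^ J * b ^ n)"
 shows "b' <= b"
proof -
 have "EV n. u n <= (\<bar>C\<bar> * 2 ^ J) * (real n ^ J * b ^ n)"
  using eventually_ge_at_top[of 1]
 proof eventually_elim
  case (elim n)
  have "u n <= C * ((real n + 1) ^ J * b ^ n)" by (rule assms(3))
  also have "... <= \<bar>C\<bar> * ((2 * real n) ^ J * b ^ n)"
   using elim assms(2) by (intro mult_mono power_mono) auto
  also have "... = (\<bar>C\<bar> * 2 ^ J) * (real n ^ J * b ^ n)" by (simp only: power_mult_distrib mult.assoc)
  finally show ?case .
 qed
 from grows_le_compare[OF assms(1) grows_poly_exp[OF assms(2)] this] show ?thesis by auto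
qed

lemma grows_less:
 assumes "grows u k b" "grows v k' b'" "b < b'"
 shows "EV n. u n < v n"
proof -
 from assms(1) obtain C where C: "0 < b" "0 < C" "EV n. u n <= C * (real n ^ k * b ^ n)" by (rule growsE)
 from assms(2) obtain c where c: "0 < c" "EV n. c * (real n ^ k' * b' ^ n) <= v n" by (rule growsE)
 obtain D where D: "0 < D" "EV n. real n ^ Suc k * b ^ n <= D * (real n ^ k' * b' ^ n)"
  using poly_exp_le[of b b' "Suc k" k'] C(1) assms(3) by blast
 have "EV n. C * D / c < real n"
  using filterlim_real_sequentially by (simp add: filterlim_at_top_dense)
 thus ?thesis
  using C(3) c(2) D(2) eventually_gt_at_top[of 0]
 proof eventually_elim
  case (elim n)
  have pos: "0 < real n ^ k' * b' ^ n" using elim C(1) assms(3) by simp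
  have "real n * u n <= real n * (C * (real n ^ k * b ^ n))" using elim by (intro mult_left_mono) auto
  also have "... = C * (real n ^ Suc k * b ^ n)" by simp
  also have "... <= C * (D * (real n ^ k' * b' ^ n))" using elim C(2) by (intro mult_left_mono) auto
  also have "... < real n * c * (real n ^ k' * b' ^ n)"
  proof -
   have "C * D < real n * c" using elim(1) c(1) by (simp add: field_simps)
   from mult_strict_right_mono[OF this pos] show ?thesis by (simp only: mult.assoc)
  qed
  also have "... <= real n * v n" using elim mult_left_mono[of "c * (real n ^ k' * b' ^ n)" "v n" "real n"] by (simp add: mult.assoc)
  finally show ?case using elim(5) by simp
 qed
qed

lemma eventually_at_multiple:
 assumes "EV n. P n" "1 <= (m::nat)" shows "EV j. P (j * m)"
proof -
 obtain N where N: "!!n. n >= N ==> P n" using assms(1) by (auto simp: eventually_sequentially)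
 have "P (j * m)" if "N <= j" for j
 proof (rule N)
  have "j * 1 <= j * m" using assms(2) by (intro mult_le_mono2)
  with that show "N <= j * m" by linarith
 qed
 thus ?thesis by (auto simp: eventually_sequentially)
qed

lemma geometric_compare:
 assumes "grows u k b" "1 <= (m::nat)" "0 <= M" "!!j. u (j * m) <= M ^ j"
 shows "b ^ m <= M"
proof (rule ccontr)
 assume not: "~ ?thesis"
 from assms(1) obtain c where c: "0 < b" "0 < c" "EV n. c * (real n ^ k * b ^ n) <= u n" by (rule growsE)
 have bm: "0 < b ^ m" using c(1) by simp
 have "(%j. (M / b ^ m) ^ j) \<longlonglongrightarrow> 0" using not assms(3) bm by (intro LIMSEQ_power_zero) (simp add: divide_less_eq)
 hence "EV j. (M / b ^ m) ^ j < c" by (rule order_tendstoD) (rule c(2))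
 hence "EV j :: nat. False"
  using eventually_at_multiple[OF c(3) assms(2)] eventually_ge_at_top[of 1]
 proof eventually_elim
  case (elim j)
  have "1 <= real (j * m) ^ k"
  proof (rule one_le_power)
   have "1 * 1 <= j * m" using elim(3) assms(2) by (intro mult_le_mono)
   thus "1 <= real (j * m)" by (simp del: of_nat_mult)
  qed
  hence "c * (1 * b ^ (j * m)) <= c * (real (j * m) ^ k * b ^ (j * m))" using c by (intro mult_left_mono mult_right_mono) auto
  also have "... <= M ^ j" using elim(2) assms(4)[of j] by linarith
  finally have "c * (b ^ m) ^ j <= M ^ j" by (simp add: mult.commute[of j m] power_mult)
  hence "c <= (M / b ^ m) ^ j" using bm by (simp add: power_divide field_simps)
  with elim(1) show ?case by simp
 qed
 thus False by simp
qed

lemma geometric_compare':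
 assumes "grows u k b" "1 <= (m::nat)" "0 < M" "!!j. M ^ j <= u (j * m)"
 shows "M <= b ^ m"
proof (rule ccontr)
 assume not: "~ ?thesis"
 from assms(1) obtain C where c: "0 < b" "0 < C" "EV n. u n <= C * (real n ^ k * b ^ n)" by (rule growsE)
 define r where "r = b ^ m / M"
 have r: "0 < r" "r < 1" using c(1) assms(3) not by (simp_all add: r_def)
 define q where "q = real m"
 have q: "0 < q" using assms(2) by (simp add: q_def)
 have "(%j. (real j * q) ^ k * r ^ j) \<longlonglongrightarrow> 0" using r q by real_asymp
 hence "EV j. (real j * q) ^ k * r ^ j < 1 / C" by (rule order_tendstoD) (use c(2) in simp)
 hence "EV j :: nat. False"
  using eventually_at_multiple[OF c(3) assms(2)]
 proof eventually_elim
  case (elim j)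
  have "M ^ j <= C * (real (j * m) ^ k * b ^ (j * m))" using elim(2) assms(4)[of j] by linarith
  also have "b ^ (j * m) = r ^ j * M ^ j" using assms(3) by (simp add: r_def power_divide mult.commute[of j m] power_mult)
  finally have "1 * M ^ j <= (C * ((real j * q) ^ k * r ^ j)) * M ^ j" by (simp add: q_def mult.assoc)
  moreover have "0 < M ^ j" using assms(3) by simp
  ultimately have "1 <= C * ((real j * q) ^ k * r ^ j)" by (simp only: mult_le_cancel_right_pos)
  with elim(1) c(2) show ?case by (simp add: field_simps)
 qed
 thus False by simp
qed

context nq
begin

lemma filter_G: "set w <= R ==> filter (%c. c : G) w = filter (growing f) w"
 by (rule filter_cong) auto

text \<open>Let \<open>M\<close> be the largest count in \<open>S\<close> at the single time
  \<open>n\<close>. By iteration in steps of \<open>n\<close>, counts in \<open>S\<close> grow at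
  most like \<open>M ^ j\<close> and those outside at least like \<open>Suc M ^ j\<close>. As the
  layer outside \<open>S\<close> is counted without its exits, all its letters obey the same bound
  and the induction closes.\<close>

theorem gap_cert_sound:
 assumes "gap_cert f G S n"
 shows "EX c1:G. EX c2:G. rate c1 ~= rate c2"
proof (rule ccontr)
 assume "~ ?thesis"
 hence eq: "rate c = rate a" if "c : G" for c using that a_in_G by metis
 obtain s d where sd: "s : S" "d : G" "d ~: S" and SG: "S <= G"
  and cl: "!!s c. s : S ==> c : set (f s) ==> c : G ==> c : S"
  and lt: "!!s d. s : S ==> d : G ==> d ~: S ==> gl s n < lay (%c. c : G & c ~: S) d n"
 proof -
  have "gl s n < lay (%c. c : G & c ~: S) d n" if "s : S" "d : G" "d ~: S" for s d
  proof -
   have "s : R" using that(1) assms by (auto simp: gap_cert_def)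
   have "length (filter (%c. c : G) (it f n [s])) < length (it (gf f (%c. c : G & c ~: S)) n [d])"
    using assms that unfolding gap_cert_def by blast
   thus ?thesis unfolding gl_def lay_def filter_G[OF it_letter_in_R[OF \<open>s : R\<close>]] .
  qed
  moreover obtain s where "s : S" using assms unfolding gap_cert_def by blast
  moreover obtain d where "d : G" "d ~: S" using assms unfolding gap_cert_def by blast
  ultimately show thesis using that assms unfolding gap_cert_def by blast
 qed
 define F where "F c \<longleftrightarrow> c : G & c ~: S" for c
 have F: "(%c. c : G & c ~: S) = F" by (simp add: F_def fun_eq_iff)
 have "finite S" using SG finite_R finite_subset by fastforce
 define M where "M = Max ((%s. gl s n) ` S)"
 have M: "gl t n <= M" if "t : S" for t unfolding M_def using that \<open>finite S\<close> by simp
 have "M : (%s. gl s n) ` S" unfolding M_def using sd(1) \<open>finite S\<close> by (intro Max_in) auto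
 then obtain s' where s': "s' : S" "M = gl s' n" by auto
 have M': "Suc M <= lay F t n" if "F t" for t
  using lt[OF s'(1), of t] that unfolding F s'(2) Suc_le_eq by (simp add: F_def)
 have n1: "1 <= n"
 proof (rule ccontr)
  assume "~ 1 <= n"
  hence "n = 0" by simp
  thus False using lt[OF sd] SG sd(1) by (auto simp: gl_def)
 qed
 have S_lay: "gl t k <= lay (%c. c : S) t k" "lay (%c. c : S) t k <= gl t k" if "t : S" for t k
 proof -
  have t: "t : R" "growing f t" using that SG by auto
  show "gl t k <= lay (%c. c : S) t k"
   by (rule lay_closed[where E = "%c. c : S"]) (use t that cl closed SG in blast)+
  show "lay (%c. c : S) t k <= gl t k" by (rule lay_le_gl[OF t(2)]) (use SG in blast)
 qed
 have lower: "length w * K <= length (it g k w)" if "!!c. c : set w ==> K <= length (it g k [c])" for w :: "'a list" and g K k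
  using that
 proof (induction w)
  case (Cons c w)
  thus ?case using it_Cons[of k g c w] by (simp add: add_mono)
 qed simp
 have "gl s (j * n) <= M ^ j" for j
 proof -
  have "lay (%c. c : S) s (j * n) <= M ^ j"
  proof (induction j)
   case (Suc j)
   have "lay (%c. c : S) s (Suc j * n) = length (it (gf f (%c. c : S)) n (it (gf f (%c. c : S)) (j * n) [s]))"
    unfolding lay_def by (simp add: it_add)
   also have "... <= lay (%c. c : S) s (j * n) * M"
    unfolding lay_def
   proof (rule length_it_le)
    fix c assume "c : set (it (gf f (%c. c : S)) (j * n) [s])"
    hence c: "c : S" using it_gf_E[where E = "%c. c : S", OF sd(1)] by blast
    show "length (it (gf f (%c. c : S)) n [c]) <= M"
     using S_lay(2)[OF c, of n] M[OF c] unfolding lay_def by linarith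
   qed
   also have "... <= M ^ Suc j" using Suc by simp
   finally show ?case .
  qed simp
  thus ?thesis using S_lay(1)[OF sd(1), of "j * n"] by linarith
 qed
 hence "real (gl s (j * n)) <= real M ^ j" for j by (metis of_nat_le_iff of_nat_power)
 moreover have sG: "s : G" using sd SG by blast
 ultimately have 1: "rate s ^ n <= real M" using geometric_compare[OF growth(2)[OF sG] n1, of "real M"] by simp
 have "Suc M ^ j <= gl d (j * n)" for j
 proof -
  have "Suc M ^ j <= lay F d (j * n)"
  proof (induction j)
   case (Suc j)
   have "Suc M ^ Suc j <= lay F d (j * n) * Suc M" using Suc by (metis mult.commute mult_le_mono1 power_Suc)
   also have "... <= length (it (gf f F) n (it (gf f F) (j * n) [d]))"
    unfolding lay_def
   proof (rule lower)
    fix c assume "c : set (it (gf f F) (j * n) [d])"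
    hence "F c" by (rule it_gf_E[where E = F and d = d, rotated]) (use sd in \<open>simp add: F_def\<close>)
    thus "Suc M <= length (it (gf f F) n [c])" using M' unfolding lay_def by blast
   qed
   also have "... = lay F d (Suc j * n)" unfolding lay_def by (simp add: it_add)
   finally show ?case .
  qed simp
  also have "... <= gl d (j * n)" by (rule lay_le_gl) (use sd in \<open>auto simp: F_def\<close>)
  finally show ?thesis .
 qed
 hence "real (Suc M) ^ j <= real (gl d (j * n))" for j by (metis of_nat_le_iff of_nat_power)
 hence "real (Suc M) <= rate d ^ n" using geometric_compare'[OF growth(2)[OF sd(2)] n1, of "real (Suc M)"] by simp
 with 1 show False using eq[OF sd(2)] eq[OF sG] by simp
qed

text \<open>The letters of least rate \<open>b\<close> form \<open>S\<close>. Since rates do not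
  increase along descent, \<open>S\<close> is closed.\<close>

theorem gap_cert_complete:
 assumes "c1 : G" "c2 : G" "rate c1 ~= rate c2"
 shows "EX S n. gap_cert f G S n"
proof -
 have finG: "finite G" using finite_R by simp
 define b where "b = Min (rate ` G)"
 have b: "b : rate ` G" "!!c. c : G ==> b <= rate c" unfolding b_def using finG assms(1) by (auto intro: Min_in)
 hence b1: "1 < b" using rate_gt_1 by auto
 define S where "S = {c : G. rate c = b}"
 define F where "F c \<longleftrightarrow> c : G & c ~: S" for c
 have F: "(%c. c : G & c ~: S) = F" by (simp add: F_def fun_eq_iff)
 have Fb: "b < rate c" if "F c" for c using that b(2)[of c] by (auto simp: F_def S_def)
 have S_closed: "c' : S" if "c : S" "c' : set (f c)" "c' : G" for c c'
  using growth_child(2)[of c c'] that b(2)[of c'] by (auto simp: S_def)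
 obtain C where C: "0 < C" "!!d n. d : G ==> real (gl d n) <= C * ((real n + 1) ^ deg d * rate d ^ n)" using gl_bounds by blast
 obtain W where W: "W >= 1" "!!b. b : R ==> length (f b) <= W" by (rule width) blast
 define A where "A = Max (deg ` G)"
 have A: "deg d <= A" if "d : G" for d unfolding A_def by (rule Max_ge) (use finG that in blast)+
 \<comment> \<open>The certificate counts only descent outside \<open>S\<close>. If this alone had
   rate at most \<open>b\<close>, then, as the exits lead into \<open>S\<close> and have rate
   \<open>b\<close> too, the letter itself would have rate \<open>b\<close>.\<close>
 have fast: "EX k b'. b < b' & grows (%n. real (lay F d n)) k b'" if Fd: "F d" for d
 proof -
  have dR: "d : R" and dG: "d : G" using Fd by (auto simp: F_def)
  interpret h: morphism "gf f F" R by (rule morphism_gf)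
  have tame: "tame (%n. real (lay F d n))" unfolding lay_def by (rule h.tame_length[OF dR])
  have no: False if "EV n. real (lay F d n) <= D * ((real n + 1) ^ k * b ^ n)" for D k
  proof -
   have "EX D>0. ALL t:{()}. ALL n. real (lay F d n) <= D * ((real n + 1) ^ k * b ^ n)"
    by (rule uniform_bound) (use that shifted_poly_exp_ge_1[of b] b1 in auto)
   then obtain D where D: "0 < D" "!!n. real (lay F d n) <= D * ((real n + 1) ^ k * b ^ n)" by auto
   define U where "U m = C * ((real m + 1) ^ A * b ^ m)" for m :: nat
   have U: "real (gl c' m) <= U m" if c: "c : R" "F c" "c' : set (f c)" "growing f c'" "~ F c'" for c c' m
   proof -
    have c': "c' : G" "rate c' = b" using growth_child(1)[of c c'] c by (auto simp: F_def S_def)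
    have "real (gl c' m) <= C * ((real m + 1) ^ deg c' * b ^ m)" using C(2)[OF c'(1), of m] c'(2) by simp
    also have "... <= U m" unfolding U_def using C(1) b1 A[OF c'(1)] by (intro mult_left_mono mult_right_mono power_increasing) auto
    finally show ?thesis .
   qed
   have U0: "0 <= U m" for m unfolding U_def using C(1) b1 by simp
   define J where "J = k + A + 1"
   have "real (gl d n) <= (D + D * real W * C) * ((real n + 1) ^ J * b ^ n)" for n
   proof -
    have summand: "real (lay F d i) * (real W * U (n - 1 - i)) <= D * real W * C * ((real n + 1) ^ (k + A) * b ^ n)" if i: "i < n" for i
    proof -
     have "real (lay F d i) <= D * ((real n + 1) ^ k * b ^ i)"
     proof (rule order_trans[OF D(2)])
      show "D * ((real i + 1) ^ k * b ^ i) <= D * ((real n + 1) ^ k * b ^ i)"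
       using D(1) b1 i by (intro mult_left_mono mult_right_mono power_mono) auto
     qed
     moreover have "real W * U (n - 1 - i) <= real W * (C * ((real n + 1) ^ A * b ^ (n - 1 - i)))"
      unfolding U_def using C(1) b1 i by (intro mult_left_mono mult_right_mono power_mono) auto
     ultimately have "real (lay F d i) * (real W * U (n - 1 - i)) <=
       D * ((real n + 1) ^ k * b ^ i) * (real W * (C * ((real n + 1) ^ A * b ^ (n - 1 - i))))"
      by (rule mult_mono) (use D(1) b1 U0 in simp_all)
     also have "... = D * real W * C * ((real n + 1) ^ (k + A) * (b ^ i * b ^ (n - 1 - i)))"
      by (simp only: power_add mult_ac)
     also have "... <= D * real W * C * ((real n + 1) ^ (k + A) * b ^ n)"
     proof -
      have "b ^ i * b ^ (n - 1 - i) <= b ^ n" unfolding power_add[symmetric] using b1 i by (intro power_increasing) auto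
      thus ?thesis using D(1) C(1) by (intro mult_left_mono) auto
     qed
     finally show ?thesis .
    qed
    have "real (gl d n) <= real (lay F d n) + (SUM i<n. real (lay F d i) * (real W * U (n - 1 - i)))"
     by (rule exit_upper[where E = F, OF W(2) U U0 dR Fd])
    also have "... <= D * ((real n + 1) ^ k * b ^ n) + (SUM i<n. D * real W * C * ((real n + 1) ^ (k + A) * b ^ n))"
     using D(2)[of n] summand by (intro add_mono sum_mono) auto
    also have "... = D * ((real n + 1) ^ k * b ^ n) + D * real W * C * (real n * (real n + 1) ^ (k + A) * b ^ n)" by simp
    also have "... <= D * ((real n + 1) ^ J * b ^ n) + D * real W * C * ((real n + 1) ^ J * b ^ n)"
    proof (intro add_mono mult_left_mono mult_right_mono)
     show "(real n + 1) ^ k <= (real n + 1) ^ J" unfolding J_def by (intro power_increasing) auto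
     have "real n * (real n + 1) ^ (k + A) <= (real n + 1) * (real n + 1) ^ (k + A)" by (intro mult_right_mono) auto
     thus "real n * (real n + 1) ^ (k + A) <= (real n + 1) ^ J" by (simp add: J_def)
    qed (use D(1) C(1) b1 in auto)
    finally show ?thesis by (simp only: distrib_right)
   qed
   hence "rate d <= b" using grows_base_le[OF growth(2)[OF dG]] b1 by (metis less_trans zero_less_one)
   thus False using Fb[OF Fd] by simp
  qed
  from tame consider "EV n. real (lay F d n) = 0" | k b' where "grows (%n. real (lay F d n)) k b'"
   unfolding tame_def by blast
  thus ?thesis
  proof cases
   case 1
   hence "EV n. real (lay F d n) <= 0 * ((real n + 1) ^ 0 * b ^ n)" by eventually_elim simp
   thus ?thesis using no by blast
  next
   case (2 k b')
   show ?thesis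
   proof (cases "b < b'")
    case False
    obtain D where D: "EV n. real (lay F d n) <= D * ((real n + 1) ^ k * b' ^ n)"
     using grows_shift_upper[OF 2 order_refl] by blast
    have b'0: "0 < b'" using 2 by (rule growsE)
    have "EV n. real (lay F d n) <= \<bar>D\<bar> * ((real n + 1) ^ k * b ^ n)"
     using D
    proof eventually_elim
     case (elim n)
     also have "D * ((real n + 1) ^ k * b' ^ n) <= \<bar>D\<bar> * ((real n + 1) ^ k * b ^ n)"
      using False b'0 by (intro mult_mono power_mono) auto
     finally show ?case .
    qed
    thus ?thesis using no by blast
   qed (use 2 in blast)
  qed
 qed
 have fin: "finite S" "finite {d : G. F d}" unfolding S_def using finite_R by simp_all
 have "EV n. ALL s:S. ALL d:{d : G. F d}. gl s n < lay F d n"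
 proof (rule eventually_ball_finite[OF fin(1)], rule ballI, rule eventually_ball_finite[OF fin(2)], rule ballI)
  fix s d assume sd: "s : S" "d : {d : G. F d}"
  hence s: "s : G" "rate s = b" by (auto simp: S_def)
  obtain k b' where "b < b'" "grows (%n. real (lay F d n)) k b'" using fast[of d] sd by blast
  hence "EV n. real (gl s n) < real (lay F d n)"
   using grows_less[OF growth(2)[OF s(1)]] s(2) by blast
  thus "EV n. gl s n < lay F d n" by simp
 qed
 then obtain n where n: "!!s d. s : S ==> d : G ==> F d ==> gl s n < lay F d n"
  unfolding eventually_sequentially by auto
 have SG: "S <= G" by (auto simp: S_def)
 have "gap_cert f G S n"
  unfolding gap_cert_def
 proof (intro conjI ballI impI)
  show "S <= G" by (rule SG)
  show "EX s. s : S" using b(1) by (auto simp: S_def)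
  have "rate c1 ~= b | rate c2 ~= b" using assms(3) by auto
  thus "EX d:G. d ~: S" using assms(1,2) unfolding S_def by blast
  show "c : S" if "s : S" "c : set (f s)" "c : G" for s c using S_closed that by blast
  fix s d assume sd: "s : S" "d : G" "d ~: S"
  hence "s : R" using SG by blast
  have "gl s n < lay F d n" using n sd by (simp add: F_def)
  thus "length (filter (%c. c : G) (it f n [s])) < length (it (gf f (%c. c : G & c ~: S)) n [d])"
   unfolding gl_def lay_def filter_G[OF it_letter_in_R[OF \<open>s : R\<close>]] F .
 qed
 thus ?thesis by blast
qed

end

section \<open>Soundness of the rank certificate\<close>

lemma sum_list_map_concat:
 "sum_list (map h (concat (map g v))) = sum_list (map (%c. sum_list (map h (g c))) v)"
 by (induction v) simp_all

context nq
begin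

text \<open>The word \<open>it (gf f E) r w\<close> is a subword of \<open>filter E (it f r w)\<close>.\<close>

lemma lay_sum_le:
 fixes h :: "'a => nat"
 assumes "!!c. c : set w ==> E c"
 shows "sum_list (map h (it (gf f E) r w)) <= sum_list (map h (filter E (it f r w)))"
proof (induction r arbitrary: h)
 case 0
 thus ?case using assms by (simp add: filter_id_conv)
next
 case (Suc r)
 define h1 where "h1 c = sum_list (map h (filter E (f c)))" for c
 have ext: "sum_list (map h (extend (gf f E) v)) = sum_list (map h1 v)" for v
  by (induction v) (simp_all add: h1_def gf_def)
 have "sum_list (map h (it (gf f E) (Suc r) w)) = sum_list (map h1 (it (gf f E) r w))" using ext by simp
 also have "... <= sum_list (map h1 (filter E (it f r w)))" by (rule Suc)
 also have "... <= sum_list (map h1 (it f r w))" using sum_list_filter_split[of h1 "it f r w" E] by simp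
 also have "... = sum_list (map h (filter E (extend f (it f r w))))"
 proof -
  have "sum_list (map h1 v) = sum_list (map h (filter E (extend f v)))" for v
   by (induction v) (simp_all add: h1_def)
  thus ?thesis by simp
 qed
 finally show ?case by simp
qed

lemma gl_descendant:
 assumes "d : G" "e : set (it f m [d])"
 shows "gl e n <= gl d (n + m)"
proof -
 have "gl d (n + m) = sum_list (map (%b. gl b n) (it f m [d]))" unfolding gl_def[of d] it_add gl_word ..
 moreover have "gl e n <= sum_list (map (%b. gl b n) (it f m [d]))" by (rule member_le_sum_list) (use assms(2) in auto)
 ultimately show ?thesis by simp
qed

text \<open>The exchange relation is iterated: letters of the layer of \<open>d\<close> weighted
  against \<open>e\<close> balance letters of layer 0 below \<open>e\<close> weighted against
  \<open>d\<close>. The weights lie between 1 and a constant, so every layer has the size of layer 0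
  up to that constant. Layer 0 is closed and its letters are comparable to each other, hence of
  degree 0.\<close>

lemma rank_cert_layers:
 assumes cert: "rank_cert f G rk X"
 shows "EX b C. 1 < b & 0 < C & (ALL e:G. rk e = 0 --> rate e = b & deg e = 0) &
  (ALL d:G. ALL n. b ^ n <= C * real (lay (%c. c : G & rk c = rk d) d n) & real (lay (%c. c : G & rk c = rk d) d n) <= C * b ^ n)"
proof -
 define E where "E j c \<longleftrightarrow> c : G & rk c = j" for j :: nat and c
 have E: "(%c. c : G & rk c = j) = E j" for j by (simp add: E_def fun_eq_iff)
 have mono: "rk d <= rk c" if "c : G" "d : set (f c)" "d : G" for c d
  using cert that unfolding rank_cert_def by blast
 have X_pos: "0 < X d e" if "d : G" "E 0 e" for d e
  using cert that unfolding rank_cert_def E_def by blast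
 have X_eq: "sum_list (map (%c. X c e) (filter (E (rk d)) (f d))) = sum_list (map (X d) (filter (E 0) (f e)))" if "d : G" "E 0 e" for d e
  using cert that unfolding rank_cert_def E by (simp add: E_def)
 have closed0: "E 0 c'" if "c : R" "E 0 c" "c' : set (f c)" "growing f c'" for c c'
 proof -
  have "c : G" "rk c = 0" using that(2) by (auto simp: E_def)
  moreover from this have "c' : G" using growth_child(1)[of c c'] that by blast
  ultimately show ?thesis using mono[of c c'] that by (simp add: E_def)
 qed
 have memE: "set (it (gf f (E (rk d))) n [d]) <= {c. E (rk d) c}" if "d : G" for d n
 proof (intro subsetI CollectI)
  fix c assume "c : set (it (gf f (E (rk d))) n [d])"
  thus "E (rk d) c" by (rule it_gf_E[rotated]) (use that in \<open>simp add: E_def\<close>)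
 qed
 \<comment> \<open>One generation on the side of \<open>d\<close> is traded for one on the side of
   \<open>e\<close>, and the induction hypothesis is applied to the children of
   \<open>e\<close>.\<close>
 have swap: "sum_list (map (%c. X c e) (it (gf f (E (rk d))) n [d])) = sum_list (map (X d) (it (gf f (E 0)) n [e]))"
  if "d : G" "E 0 e" for d e n
  using that(2)
 proof (induction n arbitrary: e)
  case (Suc n)
  note X_eq' = X_eq[OF _ \<open>E 0 e\<close>]
  have step: "sum_list (map (%c. X c e) (extend (gf f (E (rk d))) w)) = sum_list (map (%c. sum_list (map (X c) (filter (E 0) (f e)))) w)"
   if "set w <= {c. E (rk d) c}" for w
   using that
  proof (induction w)
   case (Cons c w)
   hence c: "c : G" "rk c = rk d" by (auto simp: E_def)
   have "sum_list (map (%c. X c e) (filter (E (rk d)) (f c))) = sum_list (map (X c) (filter (E 0) (f e)))"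
    using X_eq'[OF c(1)] c(2) by simp
   thus ?case using Cons by (simp add: gf_def)
  qed simp
  have exch: "sum_list (map (%c. sum_list (map (X c) v)) u) = sum_list (map (%e'. sum_list (map (%c. X c e') u)) v)" for u v
   by (induction u) (simp_all add: sum_list_addf)
  have "sum_list (map (%c. X c e) (it (gf f (E (rk d))) (Suc n) [d])) =
    sum_list (map (%c. sum_list (map (X c) (filter (E 0) (f e)))) (it (gf f (E (rk d))) n [d]))"
   using step[OF memE[OF that(1), of n]] by simp
  also have "... = sum_list (map (%e'. sum_list (map (%c. X c e') (it (gf f (E (rk d))) n [d]))) (filter (E 0) (f e)))"
   by (rule exch)
  also have "... = sum_list (map (%e'. sum_list (map (X d) (it (gf f (E 0)) n [e']))) (filter (E 0) (f e)))"
   by (rule arg_cong[where f = sum_list], rule map_cong[OF refl], rule Suc.IH) simp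
  also have "... = sum_list (map (X d) (it (gf f (E 0)) n (gf f (E 0) e)))"
   by (subst it_concat[of n "gf f (E 0)" "gf f (E 0) e"]) (simp only: gf_def sum_list_map_concat)
  also have "... = sum_list (map (X d) (it (gf f (E 0)) (Suc n) [e]))" by (simp only: it_Suc_letter)
  finally show ?case .
 qed simp
 obtain e0 where e0: "E 0 e0" using cert a_in_G unfolding rank_cert_def E_def by blast
 have finG: "finite G" using finite_R by simp
 define M where "M = Max ((%(d, e). X d e) ` (G \<times> G))"
 have M: "X d e <= M" if "d : G" "e : G" for d e
 proof -
  have "X d e : (%(d, e). X d e) ` (G \<times> G)" using that by force
  thus ?thesis unfolding M_def using finG by (intro Max_ge) blast+
 qed
 have bounds: "length w <= sum_list (map h w) & sum_list (map h w) <= M * length w" if "!!c. c : set w ==> 0 < h c & h c <= M" for w and h :: "'a => nat"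
  using that
 proof (induction w)
  case (Cons c w)
  have "0 < h c & h c <= M" by (rule Cons.prems) simp
  moreover have "length w <= sum_list (map h w) & sum_list (map h w) <= M * length w" by (rule Cons.IH) (use Cons.prems in simp)
  ultimately show ?case by simp
 qed simp
 have compare: "lay (E (rk d)) d n <= M * lay (E 0) e n" "lay (E 0) e n <= M * lay (E (rk d)) d n" if de: "d : G" "E 0 e" for d e n
 proof -
  have eG: "e : G" "rk e = 0" using de(2) by (auto simp: E_def)
  have 1: "0 < X c e & X c e <= M" if "c : set (it (gf f (E (rk d))) n [d])" for c
   using memE[OF de(1), of n] that X_pos[of c e] M[of c e] de(2) eG by (auto simp: E_def)
  have 2: "0 < X d c & X d c <= M" if "c : set (it (gf f (E 0)) n [e])" for c
   using memE[OF eG(1), of n] that X_pos[of d c] M[of d c] de(1) eG by (auto simp: E_def)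
  show "lay (E (rk d)) d n <= M * lay (E 0) e n" "lay (E 0) e n <= M * lay (E (rk d)) d n"
   unfolding lay_def
   using bounds[of "it (gf f (E (rk d))) n [d]" "%c. X c e", OF 1] bounds[of "it (gf f (E 0)) n [e]" "X d", OF 2] swap[OF de, of n]
   by linarith+
 qed
 have gl_lay: "gl e n = lay (E 0) e n" if "E 0 e" for e n
 proof (rule antisym)
  have e: "e : R" "growing f e" using that by (auto simp: E_def)
  show "gl e n <= lay (E 0) e n" by (rule lay_closed[where E = "E 0", OF closed0 e(1) that])
  have "growing f c" if "E 0 c" for c using that by (simp add: E_def)
  thus "lay (E 0) e n <= gl e n" by (rule lay_le_gl[OF e(2)])
 qed
 have le: "gl e n <= M * gl e' n" if "E 0 e" "E 0 e'" for e e' n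
  using compare(1)[of e e' n] that gl_lay by (simp add: E_def)
 have lex: "rate e < rate e' | rate e = rate e' & deg e <= deg e'" if "E 0 e" "E 0 e'" for e e'
 proof -
  have eG: "e : G" "e' : G" using that by (auto simp: E_def)
  have "real (gl e n) <= real M * real (gl e' n)" for n using le[OF that, of n] by (metis of_nat_le_iff of_nat_mult)
  thus ?thesis by (intro grows_le_compare[OF growth(2)[OF eG(1)] growth(2)[OF eG(2)]] always_eventually allI)
 qed
 have same: "rate e = rate e0 & deg e = deg e0" if "E 0 e" for e using lex[OF that e0] lex[OF e0 that] by auto
 have e0G: "e0 : G" "e0 : R" using e0 by (auto simp: E_def)
 have deg0: "deg e0 = 0"
 proof (rule min_layer_zero[where E = "E 0" and b = "rate e0" and d = e0, OF closed0 _ same e0G(2) e0])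
  show "growing f c" if "E 0 c" for c using that by (simp add: E_def)
 qed
 obtain C where C: "0 < C" "!!d n. d : G ==> (real n + 1) ^ deg d * rate d ^ n <= C * real (gl d n)"
  "!!d n. d : G ==> real (gl d n) <= C * ((real n + 1) ^ deg d * rate d ^ n)" using gl_bounds by blast
 define b where "b = rate e0"
 have b: "1 < b" unfolding b_def by (rule rate_gt_1[OF e0G(1)])
 have M0: "0 < M" using X_pos[OF a_in_G e0] M[OF a_in_G e0G(1)] by linarith
 have "b ^ n <= (C * real M) * real (lay (E (rk d)) d n) & real (lay (E (rk d)) d n) <= (C * real M) * b ^ n" if d: "d : G" for d n
 proof
  have "b ^ n <= C * real (gl e0 n)" using C(2)[OF e0G(1), of n] deg0 by (simp add: b_def)
  also have "real (gl e0 n) <= real (M * lay (E (rk d)) d n)"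
   unfolding gl_lay[OF e0] using compare(2)[OF d e0] by (rule of_nat_mono)
  finally show "b ^ n <= (C * real M) * real (lay (E (rk d)) d n)" using C(1) by (simp add: mult.assoc)
  have "real (lay (E (rk d)) d n) <= real (M * gl e0 n)"
   unfolding gl_lay[OF e0] using compare(1)[OF d e0] by (rule of_nat_mono)
  also have "... = real M * real (gl e0 n)" by simp
  also have "... <= real M * (C * b ^ n)" using C(3)[OF e0G(1), of n] deg0 by (intro mult_left_mono) (auto simp: b_def)
  finally show "real (lay (E (rk d)) d n) <= (C * real M) * b ^ n" by (simp add: mult_ac)
 qed
 moreover have "ALL e:G. rk e = 0 --> rate e = b & deg e = 0" using same deg0 by (auto simp: E_def b_def)
 moreover have "0 < C * real M" using C(1) M0 by simp
 ultimately show ?thesis unfolding E using b by blast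
qed

theorem rank_cert_sound:
 assumes cert: "rank_cert f G rk X"
 shows "EX b. (ALL c:G. rate c = b) & ((ALL c:G. rk c = 0) --> (ALL c:G. deg c = 0)) &
  ((EX c:G. 0 < rk c) --> (EX c1:G. EX c2:G. deg c1 ~= deg c2))"
proof -
 define E where "E j c \<longleftrightarrow> c : G & rk c = j" for j :: nat and c
 have E: "(%c. c : G & rk c = j) = E j" for j by (simp add: E_def fun_eq_iff)
 have mono: "rk d <= rk c" if "c : G" "d : set (f c)" "d : G" for c d
  using cert that unfolding rank_cert_def by blast
 have reach: "EX n. EX e:set (it f n [d]). e : G & rk e = 0" if "d : G" for d
  using cert that unfolding rank_cert_def by blast
 obtain b C where b: "1 < b" and C: "0 < C" and zero: "!!e. e : G ==> rk e = 0 ==> rate e = b & deg e = 0"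
  and lay: "!!d n. d : G ==> b ^ n <= C * real (lay (E (rk d)) d n)" "!!d n. d : G ==> real (lay (E (rk d)) d n) <= C * b ^ n"
  using rank_cert_layers[OF cert] unfolding E by blast
 obtain D where D: "0 < D" "!!d n. d : G ==> (real n + 1) ^ deg d * rate d ^ n <= D * real (gl d n)"
  "!!d n. d : G ==> real (gl d n) <= D * ((real n + 1) ^ deg d * rate d ^ n)" using gl_bounds by blast
 obtain W where W: "W >= 1" "!!b. b : R ==> length (f b) <= W" by (rule width) blast
 have exits: "c' : G & rk c' < j" if c: "c : R" "E j c" "c' : set (f c)" "growing f c'" "~ E j c'" for c c' j
 proof -
  have cG: "c : G" "rk c = j" using c(2) by (auto simp: E_def)
  have "c' : G" by (rule growth_child(1)[OF cG(1) c(3,4)])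
  moreover from this have "rk c' <= j" using mono[OF cG(1) c(3)] cG(2) by simp
  ultimately show ?thesis using c(5) by (auto simp: E_def)
 qed
 \<comment> \<open>Every layer has size of order \<open>b ^ n\<close>, and exits lead to smaller
   ranks; each rank thus adds at most one power of \<open>n\<close> and leaves the rate
   unchanged.\<close>
 have upper: "EX K>0. EX J. ALL d:G. rk d <= j --> (ALL n. real (gl d n) <= K * ((real n + 1) ^ J * b ^ n))" for j
 proof (induction j)
  case 0
  have "real (gl d n) <= D * ((real n + 1) ^ 0 * b ^ n)" if "d : G" "rk d <= 0" for d n
   using D(3)[OF that(1), of n] zero[OF that(1)] that(2) by simp
  thus ?case using D(1) by blast
 next
  case (Suc j)
  then obtain K J where K: "0 < K" "!!d n. d : G ==> rk d <= j ==> real (gl d n) <= K * ((real n + 1) ^ J * b ^ n)" by blast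
  define U where "U m = K * ((real m + 1) ^ J * b ^ m)" for m :: nat
  have U0: "0 <= U m" for m unfolding U_def using K(1) b by simp
  have U: "real (gl c' m) <= U m" if "c : R" "E (Suc j) c" "c' : set (f c)" "growing f c'" "~ E (Suc j) c'" for c c' m
   using exits[OF that] K(2)[of c' m] by (simp add: U_def less_Suc_eq_le)
  define K' where "K' = K + C + C * real W * K"
  have K': "0 < K'" "K <= K'" "C + C * real W * K <= K'" unfolding K'_def using K(1) C by (simp_all add: add_pos_nonneg)
  have "real (gl d n) <= K' * ((real n + 1) ^ Suc J * b ^ n)" if d: "d : G" "rk d <= Suc j" for d n
  proof (cases "rk d <= j")
   case True
   have "real (gl d n) <= K * ((real n + 1) ^ J * b ^ n)" by (rule K(2)[OF d(1) True])
   also have "... <= K' * ((real n + 1) ^ Suc J * b ^ n)"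
   proof (rule mult_mono[OF K'(2)])
    show "(real n + 1) ^ J * b ^ n <= (real n + 1) ^ Suc J * b ^ n"
     using b by (intro mult_right_mono power_increasing) auto
   qed (use K' b in auto)
   finally show ?thesis .
  next
   case False
   hence rkd: "rk d = Suc j" using d(2) by simp
   have dR: "d : R" and Ed: "E (Suc j) d" using d(1) rkd by (auto simp: E_def)
   have summand: "real (lay (E (Suc j)) d i) * (real W * U (n - 1 - i)) <= C * real W * K * ((real n + 1) ^ J * b ^ n)" if i: "i < n" for i
   proof -
    have l: "real (lay (E (Suc j)) d i) <= C * b ^ i" using lay(2)[OF d(1), of i] rkd by simp
    have u: "real W * U (n - 1 - i) <= real W * (K * ((real n + 1) ^ J * b ^ (n - 1 - i)))"
     unfolding U_def using K(1) b i by (intro mult_left_mono mult_right_mono power_mono) auto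
    have "real (lay (E (Suc j)) d i) * (real W * U (n - 1 - i)) <= (C * b ^ i) * (real W * (K * ((real n + 1) ^ J * b ^ (n - 1 - i))))"
     by (rule mult_mono[OF l u]) (use C b U0 in simp_all)
    also have "... = C * real W * K * ((real n + 1) ^ J * (b ^ i * b ^ (n - 1 - i)))" by (simp only: mult_ac)
    also have "... <= C * real W * K * ((real n + 1) ^ J * b ^ n)"
    proof -
     have "b ^ i * b ^ (n - 1 - i) <= b ^ n" unfolding power_add[symmetric] using b i by (intro power_increasing) auto
     thus ?thesis using C K(1) by (intro mult_left_mono) auto
    qed
    finally show ?thesis .
   qed
   have "real (gl d n) <= real (lay (E (Suc j)) d n) + (SUM i<n. real (lay (E (Suc j)) d i) * (real W * U (n - 1 - i)))"
    by (rule exit_upper[where E = "E (Suc j)", OF W(2) U U0 dR Ed])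
   also have "... <= C * b ^ n + (SUM i<n. C * real W * K * ((real n + 1) ^ J * b ^ n))"
    using lay(2)[OF d(1), of n] rkd summand by (intro add_mono sum_mono) auto
   also have "... = C * (1 * b ^ n) + C * real W * K * (real n * (real n + 1) ^ J * b ^ n)" by simp
   also have "... <= C * ((real n + 1) ^ Suc J * b ^ n) + C * real W * K * ((real n + 1) ^ Suc J * b ^ n)"
   proof (intro add_mono mult_left_mono mult_right_mono)
    show "1 <= (real n + 1) ^ Suc J" by (rule one_le_power) simp
    have "real n * (real n + 1) ^ J <= (real n + 1) * (real n + 1) ^ J" by (intro mult_right_mono) auto
    thus "real n * (real n + 1) ^ J <= (real n + 1) ^ Suc J" by simp
   qed (use C K(1) b in auto)
   also have "... = (C + C * real W * K) * ((real n + 1) ^ Suc J * b ^ n)" by (simp only: distrib_right)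
   also have "... <= K' * ((real n + 1) ^ Suc J * b ^ n)" using K'(3) b by (intro mult_right_mono) auto
   finally show ?thesis .
  qed
  with K'(1) show ?case by blast
 qed
 have eqb: "rate d = b" if d: "d : G" for d
 proof (rule antisym)
  obtain K J where "ALL d':G. rk d' <= rk d --> (ALL n. real (gl d' n) <= K * ((real n + 1) ^ J * b ^ n))" using upper[of "rk d"] by blast
  hence "!!n. real (gl d n) <= K * ((real n + 1) ^ J * b ^ n)" using d by blast
  thus "rate d <= b" using grows_base_le[OF growth(2)[OF d], of b K J] b by simp
  \<comment> \<open>Some descendant has rank 0 and rate \<open>b\<close>, so the rate of
    \<open>d\<close> is not smaller.\<close>
  obtain m e where e: "e : set (it f m [d])" "e : G" "rk e = 0" using reach[OF d] by blast
  have rate0: "0 < rate d" using rate_gt_1[OF d] by simp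
  have bnd: "real n ^ 0 * b ^ n <= (D * (D * ((real m + 1) ^ deg d * rate d ^ m))) * ((real n + 1) ^ deg d * rate d ^ n)" for n
  proof -
   have "real n ^ 0 * b ^ n <= D * real (gl e n)" using D(2)[OF e(2), of n] zero[OF e(2,3)] by simp
   also have "... <= D * real (gl d (n + m))" using gl_descendant[OF d e(1), of n] D(1) by simp
   also have "... <= D * (D * ((real (n + m) + 1) ^ deg d * rate d ^ (n + m)))" using D(3)[OF d, of "n + m"] D(1) by simp
   also have "... <= D * (D * (((real m + 1) * (real n + 1)) ^ deg d * rate d ^ (n + m)))"
    using D(1) rate0 by (intro mult_left_mono mult_right_mono power_mono) (auto simp: algebra_simps)
   also have "... = (D * (D * ((real m + 1) ^ deg d * rate d ^ m))) * ((real n + 1) ^ deg d * rate d ^ n)"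
    by (simp only: power_mult_distrib power_add mult_ac)
   finally show ?thesis .
  qed
  have b0: "0 < b" using b by simp
  show "b <= rate d" by (rule grows_base_le[OF grows_poly_exp[OF b0, of 0] rate0 bnd])
 qed
 have pos: "EX c1:G. EX c2:G. deg c1 ~= deg c2" if ex: "EX c:G. 0 < rk c"
 proof -
  \<comment> \<open>A letter of least positive rank has a positive degree: all along its layer
    letters of rank 0 split off, and about \<open>n\<close> generations of them add up to the order
    \<open>n * b ^ n\<close>.\<close>
  define j where "j = (LEAST j. 0 < j & (EX c:G. rk c = j))"
  have "EX j. 0 < j & (EX c:G. rk c = j)" using ex by blast
  hence j: "0 < j & (EX c:G. rk c = j)" unfolding j_def by (rule LeastI_ex)
  have j_least: "rk c = 0" if "c : G" "rk c < j" for c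
  proof -
   have "~ (0 < rk c & (EX c':G. rk c' = rk c))" by (rule not_less_Least[OF that(2)[unfolded j_def]])
   thus ?thesis using that(1) by auto
  qed
  obtain d where d: "d : G" "rk d = j" using j by blast
  have ex_r: "EX r. ALL n>=r. EX e:set (it f n [c]). e : G & rk e = 0" if c: "c : G" for c
  proof -
   obtain r e where r: "e : set (it f r [c])" "e : G" "rk e = 0" using reach[OF c] by blast
   have "EX e:set (it f (r + k) [c]). e : G & rk e = 0" for k
   proof (induction k)
    case (Suc k)
    then obtain e where e: "e : set (it f (r + k) [c])" "e : G" "rk e = 0" by blast
    then obtain e' where e': "e' : set (f e)" "growing f e'" using growing_child[of f e] by blast
    have "e' : G" by (rule growth_child(1)[OF e(2) e'])
    moreover from this have "rk e' = 0" using mono[OF e(2) e'(1)] e(3) by simp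
    moreover have "e' : set (it f (r + Suc k) [c])" using e(1) e'(1) by (auto simp: set_extend)
    ultimately show ?case by blast
   qed (use r in auto)
   thus ?thesis by (intro exI[of _ r] allI impI) (metis le_Suc_ex)
  qed
  \<comment> \<open>A common number of steps for all letters; it exists because a letter of rank 0
    always has a child of rank 0.\<close>
  obtain r where r: "!!c. c : G ==> EX e:set (it f r [c]). e : G & rk e = 0"
  proof -
   obtain rr where rr: "!!c. c : G ==> ALL n>=rr c. EX e:set (it f n [c]). e : G & rk e = 0" using ex_r by metis
   have "rr c <= Max (rr ` G)" if "c : G" for c by (rule Max_ge) (use finite_R that in auto)
   thus thesis using that[of "Max (rr ` G)"] rr by blast
  qed
  define S where "S i m = sum_list (map (%c. gl c m) (it (gf f (E j)) i [d]))" for i m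
  have Ed: "E j d" using d by (simp add: E_def)
  have mem: "E j c" if "c : set (it (gf f (E j)) i [d])" for c i by (rule it_gf_E[where E = "E j", OF Ed that])
  \<comment> \<open>Among the descendants after \<open>r\<close> steps, those in the layer and one
    letter of rank 0 for each ancestor are counted separately.\<close>
  have step: "real (S (i + r) m) + real (lay (E j) d i) * (b ^ m / D) <= real (S i (r + m))" for i m
  proof -
   have letter: "real (sum_list (map (%c. gl c m) (it (gf f (E j)) r [c]))) + b ^ m / D <= real (gl c (m + r))" if c: "E j c" for c
   proof -
    have cG: "c : G" "rk c = j" using c by (auto simp: E_def)
    obtain e where e: "e : set (it f r [c])" "e : G" "rk e = 0" using r[OF cG(1)] by blast
    have nE: "~ E j e" using e j by (auto simp: E_def)
    have "sum_list (map (%c. gl c m) (it (gf f (E j)) r [c])) <= sum_list (map (%c. gl c m) (filter (E j) (it f r [c])))"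
     by (rule lay_sum_le) (use c in simp)
    moreover have "gl e m <= sum_list (map (%c. gl c m) (filter (%c. ~ E j c) (it f r [c])))"
     by (rule member_le_sum_list) (use e(1) nE in auto)
    moreover have "gl c (m + r) = sum_list (map (%b. gl b m) (it f r [c]))" unfolding gl_def[of c] it_add gl_word ..
    ultimately have "sum_list (map (%c. gl c m) (it (gf f (E j)) r [c])) + gl e m <= gl c (m + r)"
     using sum_list_filter_split[of "%c. gl c m" "it f r [c]" "E j"] by linarith
    hence "real (sum_list (map (%c. gl c m) (it (gf f (E j)) r [c]))) + real (gl e m) <= real (gl c (m + r))"
     by (metis of_nat_add of_nat_le_iff)
    moreover have "b ^ m / D <= real (gl e m)"
     using D(2)[OF e(2), of m] zero[OF e(2,3)] D(1) by (simp add: pos_divide_le_eq mult.commute)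
    ultimately show ?thesis by linarith
   qed
   have word: "real (sum_list (map (%c. gl c m) (it (gf f (E j)) r w))) + real (length w) * (b ^ m / D) <= real (sum_list (map (%c. gl c (m + r)) w))"
    if "!!c. c : set w ==> E j c" for w
    using that
   proof (induction w)
    case (Cons c w)
    have "real (sum_list (map (%c. gl c m) (it (gf f (E j)) r w))) + real (length w) * (b ^ m / D) <= real (sum_list (map (%c. gl c (m + r)) w))"
     by (rule Cons.IH) (use Cons.prems in simp)
    moreover have "real (sum_list (map (%c. gl c m) (it (gf f (E j)) r [c]))) + b ^ m / D <= real (gl c (m + r))"
     by (rule letter) (use Cons.prems in simp)
    moreover have "sum_list (map (%c. gl c m) (it (gf f (E j)) r (c # w))) =
      sum_list (map (%c. gl c m) (it (gf f (E j)) r [c])) + sum_list (map (%c. gl c m) (it (gf f (E j)) r w))"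
     by (subst it_Cons) simp
    moreover have "real (length (c # w)) * (b ^ m / D) = b ^ m / D + real (length w) * (b ^ m / D)" by (simp add: algebra_simps add_divide_distrib)
    ultimately show ?case by (simp only: list.map sum_list.Cons of_nat_add)
   qed simp
   have "it (gf f (E j)) (i + r) [d] = it (gf f (E j)) r (it (gf f (E j)) i [d])" by (metis it_add add.commute)
   thus ?thesis using word[of "it (gf f (E j)) i [d]", OF mem] by (simp add: S_def lay_def add.commute)
  qed
  have low: "b ^ i <= C * real (lay (E j) d i)" for i using lay(1)[OF d(1), of i] d(2) by simp
  have S_ge: "real k * (b ^ (i + k * r) / (C * D * b ^ r)) <= real (S i (k * r))" for i k
  proof (induction k arbitrary: i)
   case (Suc k)
   have "b ^ (i + Suc k * r) / (C * D * b ^ r) = b ^ i / C * (b ^ (k * r) / D)" using b by (simp add: power_add)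
   also have "... <= real (lay (E j) d i) * (b ^ (k * r) / D)"
    using low[of i] C D(1) b by (intro mult_right_mono) (auto simp: pos_divide_le_eq mult.commute)
   finally have 1: "b ^ (i + Suc k * r) / (C * D * b ^ r) <= real (lay (E j) d i) * (b ^ (k * r) / D)" .
   have "real k * (b ^ (i + Suc k * r) / (C * D * b ^ r)) <= real (S (i + r) (k * r))"
    using Suc[of "i + r"] by (simp add: add.assoc)
   moreover have "real (S (i + r) (k * r)) + real (lay (E j) d i) * (b ^ (k * r) / D) <= real (S i (Suc k * r))"
    using step[of i "k * r"] by simp
   moreover have "real (Suc k) * (b ^ (i + Suc k * r) / (C * D * b ^ r)) =
     real k * (b ^ (i + Suc k * r) / (C * D * b ^ r)) + b ^ (i + Suc k * r) / (C * D * b ^ r)" by (simp add: algebra_simps add_divide_distrib)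
   ultimately show ?case using 1 by linarith
  qed simp
  have "deg d ~= 0"
  proof
   assume "deg d = 0"
   obtain k :: nat where k: "D * (C * D * b ^ r) < real k" using reals_Archimedean2 by blast
   have "real k * (b ^ (k * r) / (C * D * b ^ r)) <= real (S 0 (k * r))" using S_ge[of k 0] by simp
   also have "... = real (gl d (k * r))" by (simp add: S_def)
   also have "... <= D * b ^ (k * r)" using D(3)[OF d(1), of "k * r"] eqb[OF d(1)] \<open>deg d = 0\<close> by simp
   finally have "real k * b ^ (k * r) <= (D * (C * D * b ^ r)) * b ^ (k * r)" using C D(1) b by (simp add: field_simps)
   moreover have "0 < b ^ (k * r)" using b by simp
   ultimately have "real k <= D * (C * D * b ^ r)" by (simp only: mult_le_cancel_right_pos)
   with k show False by simp
  qed
  moreover obtain m e where "e : G" "rk e = 0" using reach[OF d(1)] by blast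
  ultimately show ?thesis using zero d(1) by metis
 qed
 show ?thesis using eqb zero pos by blast
qed

end

section \<open>Certificates\<close>

text \<open>A decidable condition that makes all letters of \<open>v\<close> bounded and keeps the
  word from vanishing under iteration.\<close>

definition stable_image :: "('a => 'a list) => 'a list => bool" where
 "stable_image g v \<longleftrightarrow> extend g v ~= [] & extend g (extend g v) = extend g v"

text \<open>No normal form is part of this certificate; the soundness proof passes to a suitable
  power itself. The condition on \<open>l\<close> excludes the occurrence of \<open>b\<close> at the
  very beginning, where nothing precedes it.\<close>

definition quad_cert :: "('a => 'a list) => 'a => bool" where
 "quad_cert g a \<longleftrightarrow> (EX N l b r u v. it g N [a] = l @ b # r & l ~= [] & g b = u @ b # v & (stable_image g u | stable_image g v))"

definition split_cert :: "('a => 'a list) => 'a list => 'a list => 'a => bool" where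
 "split_cert g Gs Bs c \<longleftrightarrow> (EX y0 c1 w0 y w. g c = y0 @ c1 # w0 & g c1 = y @ c1 # w & c1 : set Gs &
   (ALL d:set y0. d : set Bs) & (ALL d:set y. d : set Bs) & extend g y = [] & (EX d:set w. d : set Gs))"

text \<open>\<open>Gs\<close> and \<open>Bs\<close> enumerate the growing and the bounded letters.\<close>

definition nq_cert :: "('a => 'a list) => 'a => 'a list => 'a list => bool" where
 "nq_cert g a Gs Bs \<longleftrightarrow> a : set Gs &
   (ALL c:set (Gs @ Bs). (ALL d:set (g c). d : set (Gs @ Bs)) & (EX n. c : set (it g n [a]))) &
   (ALL b:set Bs. extend g (g b) = g b) &
   (ALL c:set Gs. split_cert g Gs Bs c & split_cert (mir g) Gs Bs c)"

lemma not_growingI: "(!!n. length (it f n [b]) <= K) ==> ~ growing f b"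
 unfolding growing_def by (metis Suc_n_not_le_n le_trans)

context pure_morphic
begin

text \<open>The lists are only claimed to separate growing from bounded letters. Idempotence
  confirms the claim for \<open>Bs\<close>; for \<open>Gs\<close>, a self-reproducing letter in the
  image gains a surviving letter at every step.\<close>

lemma nq_cert_sets:
 assumes cert: "nq_cert f a Gs Bs"
 shows "G = set Gs" and "B = set Bs" and "R = set Gs \<union> set Bs"
proof -
 have cl: "set (f c) <= set Gs \<union> set Bs" if "c : set Gs \<union> set Bs" for c
  using cert that unfolding nq_cert_def by auto
 have "set (it f n [a]) <= set Gs \<union> set Bs" for n
  by (rule it_closed) (use cl cert in \<open>auto simp: nq_cert_def\<close>)
 hence "R <= set Gs \<union> set Bs" using reachable by blast
 moreover have "set Gs \<union> set Bs <= R"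
 proof
  fix c assume "c : set Gs \<union> set Bs"
  hence "EX n. c : set (it f n [a])" using cert unfolding nq_cert_def by simp
  then obtain n where "c : set (it f n [a])" ..
  thus "c : R" using it_letter_in_R[OF a_in_R] by blast
 qed
 ultimately show R: "R = set Gs \<union> set Bs" by blast
 have bd: "~ growing f b" if "b : set Bs" for b
 proof -
  have id: "extend f (f b) = f b" using cert that unfolding nq_cert_def by blast
  have "length (it f n [b]) <= max 1 (length (f b))" for n
   using it_idem_on[of "[b]" f "n - 1"] id by (cases n) auto
  thus ?thesis by (rule not_growingI)
 qed
 have child: "EX d:set (f c). d : set Gs" if "c : set Gs" for c
  using cert that unfolding nq_cert_def split_cert_def by (metis in_set_conv_decomp)
 have persist: "EX d:set (it f n w). d : set Gs" if "EX d:set w. d : set Gs" for n w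
  using child that by (rule it_persist)
 have gr: "growing f c" if "c : set Gs" for c
 proof -
  have "split_cert f Gs Bs c" using cert that unfolding nq_cert_def by blast
  then obtain y0 c1 w0 y w d where s: "f c = y0 @ c1 # w0" "f c1 = y @ c1 # w" "d : set w" "d : set Gs"
   unfolding split_cert_def by blast
  have "n <= length (it f n [c1])" for n
  proof -
   have "EX d:set w. d : set Gs" using s(3,4) by blast
   hence "it f i w ~= []" for i using persist[of w i] by auto
   hence "1 <= length (it f i w)" for i by (cases "it f i w") auto
   hence "(SUM i<n. 1) <= (SUM i<n. length (it f i w))" by (intro sum_mono) auto
   also have "... <= length (it f n [c1])"
    using it_self_reproducing[where f = f, OF s(2), of n]
    by (simp add: length_concat comp_def interv_sum_list_conv_sum_set_nat atLeast0LessThan)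
   finally show ?thesis by simp
  qed
  hence "growing f c1" unfolding growing_def by blast
  moreover have "c1 : set (it f 1 [c])" using s(1) by simp
  ultimately show ?thesis using growing_if_child by metis
 qed
 show "G = set Gs" "B = set Bs" using R bd gr by blast+
qed

lemma nq_cert_nq:
 assumes cert: "nq_cert f a Gs Bs"
 shows "nq f R a x"
proof -
 note sets = nq_cert_sets[OF cert]
 have split: "split_cert f Gs Bs c" "split_cert (mir f) Gs Bs c" if "c : set Gs" for c
  using cert that unfolding nq_cert_def by blast+
 have split_nf: "EX y0 c1 w0 y w. g c = y0 @ c1 # w0 & g c1 = y @ c1 # w & c1 : G & set y0 <= B & set y <= B" if sc: "split_cert g Gs Bs c" for g c
 proof -
  obtain y0 c1 w0 y w where s: "g c = y0 @ c1 # w0" "g c1 = y @ c1 # w" "c1 : set Gs" "set y0 <= set Bs" "set y <= set Bs"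
   using sc unfolding split_cert_def by blast
  have "c1 : G" "set y0 <= B" "set y <= B" using s(3-5) sets(1,2) by simp_all
  with s(1,2) show ?thesis by blast
 qed
 have first: "extend g y = [] & (EX d:set w. growing f d)"
  if sc: "split_cert g Gs Bs c" and c: "c : G" "g c = y @ c # w" "set y <= B" for g c y w
 proof -
  obtain y0 c1 w0 y1 w1 where s: "g c = y0 @ c1 # w0" "g c1 = y1 @ c1 # w1" "c1 : set Gs" "set y0 <= set Bs" "set y1 <= set Bs"
   "extend g y1 = []" "EX d:set w1. d : set Gs" using sc unfolding split_cert_def by blast
  have notB: "c ~: set Bs" "c1 ~: set Bs" using c(1) s(3) sets(1,2) by blast+
  have "y = y0 & c = c1 & w = w0"
   by (rule first_outside_unique[OF _ notB]) (use c s sets in auto)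
  hence "y @ c # w = y1 @ c # w1" using s(2) c(2) by simp
  hence "y = y1 & c = c & w = w1"
   by (rule first_outside_unique[OF _ notB(1) notB(1)]) (use c s sets in auto)
  thus ?thesis using s(6,7) sets(1) by blast
 qed
 show ?thesis
 proof (unfold_locales)
  show "extend f (f b) = f b" if "b : B" for b using cert that sets(2) unfolding nq_cert_def by blast
  show "normal f G B" "normal (mir f) G B" unfolding normal_def using split_nf split sets(1) by blast+
  show "extend f y = [] & (EX d:set w. growing f d)" if "c : G" "f c = y @ c # w" "set y <= B" for c y w
   using first[of f c y w] split(1) sets(1) that by blast
  fix c w y assume c: "c : G" "f c = w @ c # y" "set y <= B"
  have "mir f c = rev y @ c # rev w" using c(2) by (simp add: mir_def)
  hence "extend (mir f) (rev y) = [] & (EX d:set (rev w). growing f d)"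
   using first[of "mir f" c "rev y" "rev w"] split(2) sets(1) c by auto
  thus "extend f y = [] & (EX d:set w. growing f d)" using it_mir[of 1 f y] by simp
 qed
qed

lemma stable_image_bounded:
 assumes "stable_image f v" "c : set v" shows "~ growing f c"
proof
 assume g: "growing f c"
 have "it f (Suc n) v = extend f v" for n
  using assms(1) by (induction n) (auto simp: stable_image_def)
 hence "length (it f n v) <= max (length v) (length (extend f v))" for n by (cases n) auto
 hence "length (it f n [c]) <= max (length v) (length (extend f v))" for n
  using length_it_subset[OF assms(2), of n f] order_trans by blast
 hence "~ growing f c" by (rule not_growingI)
 with g show False by simp
qed

theorem quad_cert_sound:
 assumes "quad_cert f a"
 shows "has_growth x Quadratic"
proof -
 obtain N l b r u v where q: "it f N [a] = l @ b # r" "l ~= []" "f b = u @ b # v" "stable_image f u | stable_image f v"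
  using assms unfolding quad_cert_def by blast
 obtain e where e: "e >= 1" "!!b. b : B ==> extend (mpow f e) (mpow f e b) = mpow f e b"
  "normal (mpow f e) G B" "normal (mir (mpow f e)) G B" by (rule normal_power) blast
 have gr: "growing (mpow f e) b = growing f b" if "b : R" for b by (rule growing_mpow[OF e(1) that])
 have GB: "{b : R. growing (mpow f e) b} = G" "{b : R. ~ growing (mpow f e) b} = B" using gr by auto
 interpret e: pure_morphic "mpow f e" R a x by (rule pure_morphic_mpow[OF e(1)])
 interpret e: normalized "mpow f e" R a x
  by unfold_locales (unfold GB, use e in auto)
 have bR: "b : R" using it_letter_in_R[OF a_in_R, of N] q(1) by auto
 have uvR: "set u <= R" "set v <= R" using closed[OF bR] q(3) by auto
 \<comment> \<open>For the power \<open>e\<close> the neighbours of \<open>b\<close> become products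
   of iterates of \<open>u\<close> and of \<open>v\<close>; a stable one among them yields a bounded
   neighbour that survives.\<close>
 define U V where "U = concat (map (%i. it f i u) (rev [0..<e]))" and "V = concat (map (%i. it f i v) [0..<e])"
 have self: "it f n [b] = concat (map (%i. it f i u) (rev [0..<n])) @ b # concat (map (%i. it f i v) [0..<n])" for n
  by (rule it_self_reproducing) (rule q(3))
 have fe: "mpow f e b = U @ b # V" unfolding U_def V_def mpow_def by (rule self)
 have it_y: "it f n y ~= []" if "stable_image f y" for n y
 proof (cases n)
  case 0
  thus ?thesis using that by (auto simp: stable_image_def)
 next
  case (Suc m)
  have "it f (Suc m) y = extend f y" using that by (induction m) (auto simp: stable_image_def)
  thus ?thesis using that Suc by (auto simp: stable_image_def)
 qed
 have "n <= length (it f n [b])" for n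
 proof -
  obtain y where y: "stable_image f y" "y = u | y = v" using q(4) by blast
  have "1 <= length (it f i y)" for i using it_y[OF y(1), of i] by (cases "it f i y") auto
  hence "(SUM i<n. 1) <= (SUM i<n. length (it f i y))" by (intro sum_mono) auto
  also have "... <= length (it f n [b])"
   using y(2) unfolding self[of n]
   by (auto simp: length_concat comp_def interv_sum_list_conv_sum_set_nat atLeast0LessThan rev_map[symmetric])
  finally show ?thesis by simp
 qed
 hence bG: "b : G" using bR unfolding growing_def by blast
 have imm: "e.bd_imm Y" if Y: "set Y = (UN i<e. set (it f i y))" and y: "stable_image f y" "y = u | y = v" for Y y
 proof -
  have "d : B" if d: "d : set Y" for d
  proof -
   obtain i where "d : set (it f i y)" using d unfolding Y by blast
   hence "d : (UN b:set y. set (it f i [b]))" using set_it[of i f y] by simp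
   then obtain c where i: "c : set y" "d : set (it f i [c])" by blast
   have "c : R" using i(1) y(2) uvR by blast
   hence "d : R" using it_letter_in_R i(2) by blast
   moreover have "~ growing f d" using growing_if_child[OF i(2)] stable_image_bounded[OF y(1) i(1)] by blast
   ultimately show ?thesis by simp
  qed
  hence 1: "set Y <= {b : R. ~ growing (mpow f e) b}" unfolding GB by blast
  have "set y <= set Y" unfolding Y using e(1) by (auto intro!: bexI[of _ 0])
  moreover obtain z where "z : set (it f e y)" using it_y[OF y(1), of e] by (cases "it f e y") auto
  ultimately have "z : set (it f e Y)" by (auto simp: set_it[of e f y] set_it[of e f Y])
  hence "extend (mpow f e) Y ~= []" unfolding extend_mpow by auto
  with 1 show ?thesis unfolding e.bd_imm_def by blast
 qed
 have bd: "e.bd_imm V | e.bd_imm U"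
  using q(4)
 proof
  assume "stable_image f u"
  hence "e.bd_imm U" by (intro imm[of U u]) (auto simp: U_def)
  thus ?thesis ..
 next
  assume "stable_image f v"
  hence "e.bd_imm V" by (intro imm[of V v]) (auto simp: V_def)
  thus ?thesis ..
 qed
 have "pre (l @ [b])" using pre_iter[of N] pre_appendD[of "l @ [b]" r] q(1) by simp
 hence pre: "e.pre (l @ [b])" by (simp add: e.pre_def pre_def)
 obtain K where K: "!!N. K <= N ==> N * N <= K * card (factors x N)"
  using e.quadratic_lower[OF _ fe bd pre q(2)] bG unfolding GB by blast
 obtain C where C: "!!n. 2 <= n ==> card (factors x n) <= C * n * n" using e.quadratic_upper by blast
 show ?thesis
 proof (rule has_growthI[where c = "1 / real (Suc K)" and C = "real C"])
  show "EV n. 0 <= growth_fun Quadratic n" by simp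
  show "EV n. 1 / real (Suc K) * growth_fun Quadratic n <= real (card (factors x n))"
   using eventually_ge_at_top[of K]
  proof eventually_elim
   case (elim n)
   have "n * n <= Suc K * card (factors x n)" using K[OF elim] by simp
   hence "real n * real n <= real (Suc K) * real (card (factors x n))" by (metis of_nat_le_iff of_nat_mult)
   thus ?case by (simp add: power2_eq_square pos_divide_le_eq mult.commute)
  qed
  show "EV n. real (card (factors x n)) <= real C * growth_fun Quadratic n"
   using eventually_ge_at_top[of 2]
  proof eventually_elim
   case (elim n)
   have "real (card (factors x n)) <= real (C * n * n)" using C[OF elim] by (rule of_nat_mono)
   thus ?case by (simp add: power2_eq_square mult.assoc)
  qed
 qed simp
qed

theorem const_cert_sound:
 assumes "const_cert f a n ka v k l"
 shows "has_growth x Const"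
proof -
 obtain K where K: "!!n. card (factors x n) <= K" using uper_bounded[OF const_cert_uper[OF assms]] by blast
 have "1 <= card (factors x n)" for n
 proof -
  have "factors x n ~= {}" by (auto simp: factors_def)
  thus ?thesis using finite_factors[of n] by (simp add: Suc_le_eq card_gt_0_iff)
 qed
 hence "1 <= real (card (factors x n))" for n by (metis of_nat_1 of_nat_le_iff)
 moreover have "real (card (factors x n)) <= real K" for n using K[of n] by (rule of_nat_mono)
 ultimately show ?thesis
  by (intro has_growthI[where c = 1 and C = "real K"] always_eventually allI) simp_all
qed

theorem linear_sound:
 assumes nq: "nq_cert f a Gs Bs" and "rank_cert f (set Gs) rk X" "!!c. c : set Gs ==> rk c = 0"
  and m: "mismatch f a (length (Gs @ Bs)) (set Gs) n i j"
 shows "has_growth x Linear"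
proof -
 note G = nq_cert_sets(1)[OF nq]
 interpret nq f R a x by (rule nq_cert_nq[OF nq])
 obtain b where b: "ALL c:G. rate c = b" "ALL c:G. deg c = 0"
  using rank_cert_sound[OF assms(2)[folded G]] assms(3) unfolding G by blast
 have "card R <= length (Gs @ Bs)" unfolding nq_cert_sets(3)[OF nq] set_append[symmetric] by (rule card_length)
 hence "~ uper x" by (rule mismatch_not_uper[OF m]) (use G in auto)
 thus ?thesis by (rule linear[of b 0, rotated -1]) (use b in blast)+
qed

theorem loglog_sound:
 assumes "nq_cert f a Gs Bs" "rank_cert f (set Gs) rk X" "EX c:set Gs. 0 < rk c"
 shows "has_growth x Linear_loglog"
proof -
 note G = nq_cert_sets(1)[OF assms(1)]
 interpret nq f R a x by (rule nq_cert_nq[OF assms(1)])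
 obtain b c1 c2 where b: "ALL c:G. rate c = b" "c1 : G" "c2 : G" "deg c1 ~= deg c2"
  using rank_cert_sound[OF assms(2)[folded G]] assms(3) unfolding G by blast
 show ?thesis by (rule linear_loglog[of b c1 c2]) (use b in blast)+
qed

theorem log_sound:
 assumes "nq_cert f a Gs Bs" "gap_cert f (set Gs) S n"
 shows "has_growth x Linear_log"
proof -
 note G = nq_cert_sets(1)[OF assms(1)]
 interpret nq f R a x by (rule nq_cert_nq[OF assms(1)])
 obtain c1 c2 where "c1 : G" "c2 : G" "rate c1 ~= rate c2"
  using gap_cert_sound[OF assms(2)[folded G]] by blast
 thus ?thesis by (rule linear_log)
qed

end

context normalized
begin

text \<open>A surviving bounded word next to a self-reproducing letter is a certificate for the
  quadratic class as soon as that letter occurs away from the beginning. The occurrence of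
  \<open>a\<close> at the beginning requires separate arguments.\<close>

lemma nq_if_not_quad:
 assumes "~ uper x" "~ quad_cert f a"
 shows "nq f R a x"
proof -
 obtain ua where ua: "f a = a # ua" using prolongable by blast
 \<comment> \<open>If only bounded letters followed \<open>a\<close> in its image, the word would
   end in the powers of one bounded word and be ultimately periodic.\<close>
 have a_last: "~ set ua <= B"
 proof
  assume uB: "set ua <= B"
  have e: "it f 1 (extend f ua) = extend f ua" using it_idem_on[of ua f 1] idem uB by auto
  have it: "it f (Suc n) [a] = a # ua @ concat (replicate n (extend f ua))" for n
  proof (induction n)
   case (Suc n)
   thus ?case using e by (simp add: ua extend_append it_replicate[where n = 1, simplified] del: it_Suc)
  qed (simp add: ua)
  have "extend f ua ~= []"
  proof
   assume z: "extend f ua = []"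
   obtain n where n: "length (a # ua) + 1 <= length (it f n [a])" using unbounded by blast
   thus False using it[of "n - 1"] z by (cases n) auto
  qed
  hence "const_cert f a 1 1 (extend f ua) 1 1" unfolding const_cert_def
   using it[of 0] it[of 1] e by (simp add: numeral_2_eq_2)
  hence "uper x" by (rule const_cert_uper)
  with assms(1) show False ..
 qed
 have stable: "stable_image f y" if "set y <= B" "extend f y ~= []" for y
  using it_idem_on[of y f 1] idem that unfolding stable_image_def by (auto simp: numeral_2_eq_2)
 have occ: "EX N l r. it f N [a] = l @ c # r & l ~= []" if c: "c : R" "c ~= a" for c
 proof -
  obtain n where "c : set (it f n [a])" using reachable[OF c(1)] by blast
  then obtain l r where lr: "it f n [a] = l @ c # r" by (auto simp: in_set_conv_decomp)
  have "EX v. it f n [a] = a # v" using it_self_reproducing[where f = f and c = a and y = "[]" and w = ua and p = n] ua by simp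
  hence "l ~= []" using lr c(2) by (cases l) auto
  with lr show ?thesis by blast
 qed
 have no: False if "c : R" "c ~= a" "f c = u @ c # v" "stable_image f u | stable_image f v" for c u v
  using occ[OF that(1,2)] that(3,4) assms(2) unfolding quad_cert_def by blast
 have a_notB: "a ~: B" using growing_a by simp
 have head: "y = []" if "f a = y @ c # w" "set y <= B" for y c w
  using that ua a_notB by (cases y) auto
 \<comment> \<open>A self-reproducing letter whose neighbours on both sides vanish has a constant
   image, so it is bounded.\<close>
 have not_both: False if c: "c : G" "f c = y @ c # w" "extend f y = []" "extend f w = []" for c y w
 proof -
  have "length (it f n [c]) <= max 1 (length (f c))" for n
  proof -
   have "it f (Suc n) [c] = f c" for n
    using c by (induction n) (simp_all add: extend_append)
   thus ?thesis by (cases n) auto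
  qed
  hence "~ growing f c" by (rule not_growingI)
  thus False using c(1) by simp
 qed
 show ?thesis
 proof (unfold_locales)
  fix c y w assume c: "c : G" "f c = y @ c # w" "set y <= B"
  have wR: "set w <= R" using closed[of c] c(1,2) by auto
  have y: "extend f y = []"
  proof (rule ccontr)
   assume ne: "extend f y ~= []"
   have "c ~= a" using head[of y c w] c(2,3) ne by auto
   thus False using no[of c y w] c stable[OF c(3) ne] by blast
  qed
  moreover have "EX d:set w. growing f d"
  proof (rule ccontr)
   assume "~ ?thesis"
   hence wB: "set w <= B" using wR by blast
   show False
   proof (cases "c = a")
    case True
    hence "y = []" using head[of y c w] c(2,3) by simp
    thus False using True c(2) ua a_last wB by simp
   next
    case False
    hence "extend f w = []" using no[of c y w] c(1,2) stable[OF wB] by blast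
    thus False by (rule not_both[OF c(1,2) y])
   qed
  qed
  ultimately show "extend f y = [] & (EX d:set w. growing f d)" ..
 next
  fix c w y assume c: "c : G" "f c = w @ c # y" "set y <= B"
  have wR: "set w <= R" using closed[of c] c(1,2) by auto
  \<comment> \<open>Here \<open>a\<close> occurs in its own image with only bounded letters to its
    right; this cannot be the first occurrence, so the certificate may use it.\<close>
  have w_ne: "w ~= []" if "c = a"
   using c(2,3) ua a_last that by auto
  have w_hd: "a : set w" if "c = a"
   using w_ne[OF that] c(2) ua that by (cases w) auto
  have no': False if st: "stable_image f y | stable_image f w"
  proof (cases "c = a")
   case True
   have "it f 1 [a] = w @ a # y" using c(2) True by simp
   thus False using w_ne[OF True] c(2) True st assms(2) unfolding quad_cert_def by blast
  next
   case False
   thus False using no[of c w y] c(1,2) st by blast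
  qed
  have y: "extend f y = []"
  proof (rule ccontr)
   assume "extend f y ~= []"
   thus False using no' stable[OF c(3)] by blast
  qed
  moreover have "EX d:set w. growing f d"
  proof (rule ccontr)
   assume "~ ?thesis"
   hence wB: "set w <= B" using wR by blast
   hence "extend f w = []" using no' stable[OF wB] by blast
   thus False by (rule not_both[OF c(1,2) _ y])
  qed
  ultimately show "extend f y = [] & (EX d:set w. growing f d)" ..
 qed
qed

end

lemma (in nq) nq_cert_complete:
 assumes "set Gs = G" "set Bs = B"
 shows "nq_cert f a Gs Bs"
proof -
 have RGB: "R = G \<union> B" by auto
 have split: "split_cert g Gs Bs c" if ng: "normal g G B" "c : G"
  and g: "!!c y w. c : G ==> g c = y @ c # w ==> set y <= B ==> extend g y = [] & (EX d:set w. growing f d) & set w <= R" for g c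
 proof -
  obtain y0 c1 w0 y w where s: "g c = y0 @ c1 # w0" "g c1 = y @ c1 # w" "c1 : G" "set y0 <= B" "set y <= B"
   using ng unfolding normal_def by blast
  have e: "extend g y = []" "EX d:set w. growing f d" "set w <= R" using g[OF s(3,2,5)] by blast+
  have w: "EX d:set w. d : set Gs" using e(2,3) assms(1) by blast
  show ?thesis unfolding split_cert_def
   by (rule exI[of _ y0], rule exI[of _ c1], rule exI[of _ w0], rule exI[of _ y], rule exI[of _ w])
    (use s e(1) w assms in blast)
 qed
 have "split_cert f Gs Bs c" if c: "c : G" for c
 proof (rule split[OF nf c])
  fix c y w assume c: "c : G" "f c = y @ c # w" "set y <= B"
  thus "extend f y = [] & (EX d:set w. growing f d) & set w <= R" using nq_first[OF c] closed[of c] by auto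
 qed
 moreover have "split_cert (mir f) Gs Bs c" if c: "c : G" for c
 proof (rule split[OF nf_mir c])
  fix c y w assume c: "c : G" "mir f c = y @ c # w" "set y <= B"
  have fc: "f c = rev w @ c # rev y" using arg_cong[OF c(2), of rev] by (simp add: mir_def)
  have "extend f (rev y) = [] & (EX d:set (rev w). growing f d)" by (rule nq_last[OF c(1) fc]) (use c(3) in simp)
  moreover have "set w <= R" using closed[of c] c(1) fc by auto
  ultimately show "extend (mir f) y = [] & (EX d:set w. growing f d) & set w <= R"
   using it_mir[of 1 f "rev y"] by simp
 qed
 moreover have "EX n. c : set (it f n [a])" if "c : set (Gs @ Bs)" for c using that assms by (intro reachable) auto
 moreover have "ALL d:set (f c). d : set (Gs @ Bs)" if "c : set (Gs @ Bs)" for c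
  using that assms closed[of c] RGB by auto
 ultimately show ?thesis unfolding nq_cert_def using a_in_G assms idem by blast
qed

lemma (in nq) infinite_growing: "infinite {i. x i : G}"
 unfolding infinite_nat_iff_unbounded_le
proof
 fix N
 obtain ua where ua: "f a = a # ua" using prolongable by blast
 then obtain d where d: "d : set ua" "growing f d" using nq_first[OF a_in_G, of "[]" ua] by auto
 obtain n where n: "N <= length (it f n [a])" using unbounded by blast
 obtain c where c: "c : set (it f n ua)" "growing f c" using growing_descendant[OF d(2)] set_it[of n f ua] d(1) by blast
 then obtain k where k: "k < length (it f n ua)" "it f n ua ! k = c" by (auto simp: in_set_conv_nth)
 have w: "it f (Suc n) [a] = it f n [a] @ it f n ua" unfolding it_Suc_letter ua using it_append[of n f "[a]" ua] by simp
 have "x (length (it f n [a]) + k) = c"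
  using pre_nth[OF pre_iter[of "Suc n"], of "length (it f n [a]) + k"] k unfolding w by simp
 moreover have "c : R" using it_letter_in_R[OF a_in_R, of "Suc n"] c(1) unfolding w by auto
 ultimately show "EX i>=N. i : {i. x i : G}" using n c(2) by (intro exI[of _ "length (it f n [a]) + k"]) simp
qed

text \<open>Completeness holds for the power in normal form. Equal rates give a rank certificate
  with the true degrees as ranks, so the last alternative is decided by whether all degrees
  vanish.\<close>

theorem (in pure_morphic) some_cert:
 "EX ka>=1. (EX n p v k l. const_cert (mpow f ka) a n p v k l) | quad_cert (mpow f ka) a |
   (EX Gs Bs. nq_cert (mpow f ka) a Gs Bs & ((EX S n. gap_cert (mpow f ka) (set Gs) (set S) n) |
    (EX rk X. rank_cert (mpow f ka) (set Gs) rk X & ((EX c:set Gs. 0 < rk c) |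
     (ALL c:set Gs. rk c = 0) & (EX n i j. mismatch (mpow f ka) a (length (Gs @ Bs)) (set Gs) n i j)))))" (is "EX ka>=1. ?Q ka")
proof -
 obtain e where e: "e >= 1" "!!b. b : B ==> extend (mpow f e) (mpow f e b) = mpow f e b"
  "normal (mpow f e) G B" "normal (mir (mpow f e)) G B" by (rule normal_power) blast
 have gr: "growing (mpow f e) b = growing f b" if "b : R" for b by (rule growing_mpow[OF e(1) that])
 have GB: "{b : R. growing (mpow f e) b} = G" "{b : R. ~ growing (mpow f e) b} = B" using gr by auto
 interpret e: pure_morphic "mpow f e" R a x by (rule pure_morphic_mpow[OF e(1)])
 interpret e: normalized "mpow f e" R a x
  by unfold_locales (unfold GB, use e in auto)
 show ?thesis
 proof (rule exI[of _ e], rule conjI[OF e(1)], cases "uper x")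
  case True
  thus "?Q e" by (intro disjI1 e.uper_const_cert)
 next
  case aper: False
  show "?Q e"
  proof (cases "quad_cert (mpow f e) a")
   case False
   interpret e: nq "mpow f e" R a x by (rule e.nq_if_not_quad[OF aper False])
   have "finite G" "finite B" using finite_R by simp_all
   then obtain Gs Bs where Gs: "set Gs = {b : R. growing (mpow f e) b}" and Bs: "set Bs = {b : R. ~ growing (mpow f e) b}"
    unfolding GB using finite_list by metis
   have "(EX S n. gap_cert (mpow f e) (set Gs) (set S) n) | (EX rk X. rank_cert (mpow f e) (set Gs) rk X & ((EX c:set Gs. 0 < rk c) |
     (ALL c:set Gs. rk c = 0) & (EX n i j. mismatch (mpow f e) a (length (Gs @ Bs)) (set Gs) n i j)))"
   proof (cases "EX c1:set Gs. EX c2:set Gs. e.rate c1 ~= e.rate c2")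
    case True
    then obtain S n where S: "gap_cert (mpow f e) (set Gs) S n" unfolding Gs using e.gap_cert_complete by blast
    hence "S <= set Gs" unfolding gap_cert_def by blast
    then obtain S' where "set S' = S" using finite_list[of S] finite_subset[OF _ finite_set] by blast
    thus ?thesis using S by blast
   next
    case False
    hence eqb: "e.rate c = e.rate a" if "c : set Gs" for c using that e.a_in_G unfolding Gs by blast
    obtain X where X: "rank_cert (mpow f e) (set Gs) e.deg X" using e.rank_cert_complete[OF eqb[unfolded Gs]] unfolding Gs by blast
    have "EX n i j. mismatch (mpow f e) a (length (Gs @ Bs)) (set Gs) n i j"
     by (rule e.not_uper_mismatch[OF aper]) (use e.infinite_growing in \<open>simp_all add: Gs\<close>)
    thus ?thesis using X by (metis gr_zeroI)
   qed
   thus ?thesis using e.nq_cert_complete[OF Gs Bs]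
    by - (rule disjI2, rule disjI2, rule exI[of _ Gs], rule exI[of _ Bs], rule conjI)
  qed simp
 qed
qed

section \<open>Semidecidability of the certificates\<close>

lemma computable_extend [comp_intros]:
 fixes H :: "'e :: enc => 'a :: enc => 'a list"
 assumes "computable (%z. H (fst z) (snd z))" "computable w"
 shows "computable (%e. extend (H e) (w e))"
 unfolding extend_def by (intro comp_intros assms)

lemma computable_it [comp_intros]:
 fixes H :: "'e :: enc => 'a :: enc => 'a list"
 assumes H: "computable (%z. H (fst z) (snd z))" and "computable n" "computable w"
 shows "computable (%e. it (H e) (n e) (w e))"
 by (intro comp_intros computable_arg[OF H] assms)

lemma decidable_pc [comp_intros]:
 assumes "computable u" "computable v" shows "decidable (%e. pc (u e) (v e))"
 unfolding pc_iff_take by (intro comp_intros assms)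

lemma decidable_stable_image [comp_intros]:
 fixes H :: "'e :: enc => 'a :: enc => 'a list"
 assumes H: "computable (%z. H (fst z) (snd z))" and w: "computable w"
 shows "decidable (%e. stable_image (H e) (w e))"
 unfolding stable_image_def by (intro comp_intros computable_arg[OF H] computable_o[OF w])

lemma semidec_quad_cert:
 fixes H :: "'e :: enc => 'a :: enc => 'a list"
 assumes H: "computable (%z. H (fst z) (snd z))" and a: "computable a"
 shows "semidec (%e. quad_cert (H e) (a e))"
 unfolding quad_cert_def
 by (intro semidec_intros; rule semidec_decidable; intro comp_intros computable_arg[OF H] computable_o[OF a])

lemma decidable_const_cert [comp_intros]:
 fixes H :: "'e :: enc => 'a :: enc => 'a list"
 assumes H: "computable (%z. H (fst z) (snd z))"
  and "computable a" "computable n" "computable p" "computable v" "computable k" "computable l"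
 shows "decidable (%e. const_cert (H e) (a e) (n e) (p e) (v e) (k e) (l e))"
 unfolding const_cert_def by (intro comp_intros computable_arg[OF H] assms)

lemma semidec_split_cert:
 fixes H :: "'e :: enc => 'a :: enc => 'a list"
 assumes H: "computable (%z. H (fst z) (snd z))" and c: "computable Gs" "computable Bs" "computable c"
 shows "semidec (%e. split_cert (H e) (Gs e) (Bs e) (c e))"
 unfolding split_cert_def
 by (intro semidec_intros; (rule semidec_decidable)?;
   intro comp_intros computable_arg[OF H] computable_o[OF c(1)] computable_o[OF c(2)] computable_o[OF c(3)])

lemma semidec_nq_cert:
 fixes H :: "'e :: enc => 'a :: enc => 'a list"
 assumes H: "computable (%z. H (fst z) (snd z))" and c: "computable a" "computable Gs" "computable Bs"
 shows "semidec (%e. nq_cert (H e) (a e) (Gs e) (Bs e))"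
 unfolding nq_cert_def mir_def[abs_def]
 by (intro semidec_intros semidec_split_cert; (rule semidec_decidable)?;
   intro comp_intros computable_arg[OF H] computable_o[OF c(1)] computable_o[OF c(2)] computable_o[OF c(3)])

lemma decidable_mismatch [comp_intros]:
 fixes H :: "'e :: enc => 'a :: enc => 'a list"
 assumes H: "computable (%z. H (fst z) (snd z))" and c: "computable a" "computable m" "computable Gs" "computable n"
  "computable i" "computable j"
 shows "decidable (%e. mismatch (H e) (a e) (m e) (set (Gs e)) (n e) (i e) (j e))"
 unfolding mismatch_def Let_def by (intro comp_intros computable_arg[OF H] c computable_o[OF c(1)] computable_o[OF c(4)]
  computable_o[OF c(5)] computable_o[OF c(6)])

lemma semidec_rank_cert:
 fixes H :: "'e :: enc => 'a :: enc => 'a list" and rk :: "'e => 'a => nat" and X :: "'e => 'a \<times> 'a => nat"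
 assumes H: "computable (%z. H (fst z) (snd z))" and G: "computable Gs"
  and rk: "computable (%z. rk (fst z) (snd z))" and X: "computable (%z. X (fst z) (snd z))"
 shows "semidec (%e. rank_cert (H e) (set (Gs e)) (rk e) (%c d. X e (c, d)))"
 unfolding rank_cert_def
 by (intro semidec_intros; (rule semidec_decidable)?;
   intro comp_intros computable_arg[OF H] computable_arg[OF rk] computable_arg[OF X] computable_o[OF G])

lemma semidec_gap_cert:
 fixes H :: "'e :: enc => 'a :: enc => 'a list"
 assumes H: "computable (%z. H (fst z) (snd z))" and c: "computable Gs" "computable S" "computable n"
 shows "semidec (%e. gap_cert (H e) (set (Gs e)) (set (S e)) (n e))"
 unfolding gap_cert_def gf_def[abs_def] subset_eq
 by (intro semidec_intros; (rule semidec_decidable)?;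
   intro comp_intros computable_arg[OF H] computable_o[OF c(1)] computable_o[OF c(2)] computable_o[OF c(3)])

text \<open>The functions in a rank certificate matter only on the finitely many growing letters, so that
 they can be searched for as lists.\<close>

definition lookup2 :: "nat list list => nat \<times> nat => nat" where
 "lookup2 xs = (%(d, e). lookup 0 (lookup [] xs d) e)"

lemma computable_lookup2:
 assumes "computable L" "computable i"
 shows "computable (%e. lookup2 (L e) (i e))"
 unfolding lookup2_def case_prod_unfold by (intro comp_intros assms)

lemma rank_cert_cong:
 assumes "rank_cert f G rk X" "!!c. c : G ==> rk' c = rk c" "!!c d. c : G ==> d : G ==> X' c d = X c d"
 shows "rank_cert f G rk' X'"
proof -
 have fil: "filter (%c. c : G & rk' c = j) w = filter (%c. c : G & rk c = j) w" for j w
  by (rule filter_cong) (use assms(2) in auto)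
 have m1: "map (%c. X' c e) (filter (%c. c : G & rk c = j) w) = map (%c. X c e) (filter (%c. c : G & rk c = j) w)" if "e : G" for e j w
  by (rule map_cong) (use assms(3) that in auto)
 have m2: "map (%c. X' d c) (filter (%c. c : G & rk c = j) w) = map (%c. X d c) (filter (%c. c : G & rk c = j) w)" if "d : G" for d j w
  by (rule map_cong) (use assms(3) that in auto)
 show ?thesis
  unfolding rank_cert_def
 proof (intro conjI ballI impI)
  fix c d assume "c : G" "d : set (f c)" "d : G"
  thus "rk' d <= rk' c" using assms(1,2) unfolding rank_cert_def by simp
 next
  fix d e assume de: "d : G" "e : G" "rk' e = 0"
  hence "rk e = 0" using assms(2) by simp
  hence "0 < X d e & sum_list (map (%c. X c e) (filter (%c. c : G & rk c = rk d) (f d))) =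
    sum_list (map (%e'. X d e') (filter (%c. c : G & rk c = 0) (f e)))"
   using assms(1) de(1,2) unfolding rank_cert_def by blast
  thus "0 < X' d e" "sum_list (map (%c. X' c e) (filter (%c. c : G & rk' c = rk' d) (f d))) =
    sum_list (map (%e'. X' d e') (filter (%c. c : G & rk' c = 0) (f e)))"
   unfolding fil m1[OF de(2)] m2[OF de(1)] using assms(2,3) de by simp_all
 next
  fix d assume d: "d : G"
  obtain n e where "e : set (it f n [d])" "e : G" "rk e = 0" using assms(1) d unfolding rank_cert_def by blast
  thus "EX n. EX e:set (it f n [d]). e : G & rk' e = 0" using assms(2) by force
 qed
qed

lemma rank_cert_lists:
 assumes "rank_cert f (set Gs) rk X"
 shows "EX rs xs. rank_cert f (set Gs) (lookup 0 rs) (%d e. lookup2 xs (d, e)) & (ALL c:set Gs. lookup 0 rs c = rk c)"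
proof -
 define m where "m = Suc (Max (set Gs))"
 have m: "c < m" if "c : set Gs" for c unfolding m_def using that by (simp add: less_Suc_eq_le)
 define rs where "rs = map rk [0..<m]"
 define xs where "xs = map (%d. map (X d) [0..<m]) [0..<m]"
 have rs: "lookup 0 rs c = rk c" if "c : set Gs" for c using m[OF that] by (simp add: rs_def lookup_def)
 have "lookup2 xs (d, e) = X d e" if "d : set Gs" "e : set Gs" for d e
  using m[OF that(1)] m[OF that(2)] by (simp add: xs_def lookup2_def lookup_def)
 hence "rank_cert f (set Gs) (lookup 0 rs) (%d e. lookup2 xs (d, e))" using rs by (intro rank_cert_cong[OF assms])
 with rs show ?thesis by blast
qed

text \<open>The index is the code of the class, so that the index returned by the parallel search is
  already the answer.\<close>

definition cert :: "nat => (nat => nat list) => nat => bool" where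
 "cert i g a \<longleftrightarrow> (if i = 0 then EX n p v k l. const_cert g a n p v k l else if i = 4 then quad_cert g a
   else EX Gs Bs. nq_cert g a Gs Bs & (if i = 3 then EX S n. gap_cert g (set Gs) (set S) n
    else EX rs xs. rank_cert g (set Gs) (lookup 0 rs) (%d e. lookup2 xs (d, e)) &
     (if i = 2 then EX c:set Gs. 0 < lookup 0 rs c else (ALL c:set Gs. lookup 0 rs c = 0) &
      (EX n i j. mismatch g a (length (Gs @ Bs)) (set Gs) n i j))))"

lemma semidec_cert:
 fixes H :: "'e :: enc => nat => nat list"
 assumes H: "computable (%z. H (fst z) (snd z))" and a: "computable a"
 shows "semidec (%e. cert i (H e) (a e))"
proof -
 have if_const: "semidec (%e. if c then P e else Q e)" if "semidec P" "semidec Q" for c and P Q :: "'f :: enc => bool"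
  using that by (cases c) simp_all
 show ?thesis
  unfolding cert_def
  by (intro if_const semidec_intros semidec_quad_cert semidec_nq_cert semidec_rank_cert semidec_gap_cert H a;
   (rule semidec_decidable)?; intro comp_intros computable_lookup2 computable_arg[OF H] computable_o[OF a])
qed

section \<open>The classes exclude each other\<close>

lemma growth_fun_smallo:
 assumes "encode_growth c < encode_growth c'"
 shows "growth_fun c : o(growth_fun c')"
proof -
 \<comment> \<open>Arranged along their codes, the five functions form a chain in which only
   consecutive members have to be compared.\<close>
 define G :: "nat => nat => real" where "G i = (case i of 0 => %n. 1 | Suc 0 => %n. real n | Suc (Suc 0) => %n. real n * ln (ln (real n))
   | Suc (Suc (Suc 0)) => %n. real n * ln (real n) | _ => %n. (real n)\<^sup>2)" for i
 have eq: "growth_fun c = G (encode_growth c)" for c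
  by (cases c) (simp_all add: G_def fun_eq_iff numeral_eq_Suc)
 have step: "G i : o(G (Suc i))" if "i < 4" for i
 proof -
  have "(%n. 1 :: real) : o(%n. real n)" "(%n. real n) : o(%n. real n * ln (ln (real n)))"
   "(%n. real n * ln (ln (real n))) : o(%n. real n * ln (real n))" "(%n. real n * ln (real n)) : o(%n. (real n)\<^sup>2)"
   by real_asymp+
  moreover have "i = 0 | i = 1 | i = 2 | i = 3" using that by auto
  ultimately show ?thesis by (auto simp: G_def numeral_eq_Suc)
 qed
 have "G i : o(G j)" if "i < j" "j <= 4" for i j
  using that
 proof (induction j)
  case (Suc j)
  have "G j : o(G (Suc j))" using step Suc.prems by simp
  moreover have "i = j | G i : o(G j)"
  proof (cases "i = j")
   case False
   thus ?thesis using Suc.IH Suc.prems by simp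
  qed simp
  ultimately show ?case using landau_o.small_trans by blast
 qed simp
 moreover have "encode_growth c' <= 4" by (cases c') simp_all
 ultimately show ?thesis unfolding eq using assms by blast
qed

lemma has_growth_unique:
 assumes "has_growth x c" "has_growth x c'" shows "c = c'"
proof -
 have not_less: False if "has_growth x c" "has_growth x c'" "encode_growth c < encode_growth c'" for c c'
 proof -
  let ?P = "%n. real (factor_complexity x n)"
  have "?P : O(growth_fun c)" using that(1) unfolding has_growth_def by (rule bigthetaD1)
  hence "?P : o(growth_fun c')" using growth_fun_smallo[OF that(3)] by (rule landau_o.big_small_trans)
  moreover have "growth_fun c' : O(?P)"
   using that(2) unfolding has_growth_def by (intro bigthetaD1) (simp add: bigtheta_sym)
  ultimately have "growth_fun c' : o(growth_fun c')" by (rule landau_o.big_small_trans[rotated])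
  hence zero: "EV n. growth_fun c' n = 0" by (simp add: landau_o.small_refl_iff)
  have "EV n :: nat. 0 < ln (ln (real n))" by real_asymp
  with zero eventually_ge_at_top[of 2] have "EV n :: nat. False"
  proof eventually_elim
   case (elim n)
   thus ?case by (cases c') auto
  qed
  thus False by simp
 qed
 have "encode_growth c = encode_growth c'"
  using not_less[OF assms] not_less[OF assms(2,1)] by (meson linorder_neqE_nat)
 thus ?thesis by (cases c; cases c') simp_all
qed

section \<open>Decidability\<close>

lemma pure_morphic_cong:
 assumes "pure_morphic f R a x" "!!b. b : R ==> f b = g b"
 shows "pure_morphic g R a x"
proof -
 interpret pure_morphic f R a x by fact
 have it: "it f n [a] = it g n [a]" for n
  by (rule it_cong[where S = R]) (use assms(2) closed a_in_R in auto)
 show ?thesis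
 proof (unfold_locales)
  show "finite R" by (rule finite_R)
  show "set (g b) <= R" if "b : R" for b using closed[OF that] assms(2)[OF that] by simp
  show "a : R" by (rule a_in_R)
  show "EX u. g a = a # u" using prolongable assms(2)[OF a_in_R] by simp
  show "prefix (length (it g n [a])) x = it g n [a]" for n using word[of n] it[of n] by simp
  show "EX n. N <= length (it g n [a])" for N using unbounded[of N] it by simp
  show "EX n. b : set (it g n [a])" if "b : R" for b using reachable[OF that] it by simp
 qed
qed

text \<open>\<open>morphism_of\<close> is unspecified beyond the table, whereas the computable
  \<open>lookup\<close> returns the empty word there. They agree on the letters that occur.\<close>

lemma PMClass_instance_pure_morphic:
 assumes "PMClass_instance (ws, a)"
 shows "EX R. pure_morphic (lookup [] ws) R a (PMClass_word (ws, a))"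
proof -
 have ws: "!!b. b < length ws ==> set (morphism_of ws b) <= {..<length ws}" "a < length ws" "converges_on (morphism_of ws) a"
  using assms by (auto simp: PMClass_instance_def morphism_of_def)
 let ?R = "{b. EX n. b : set (it (morphism_of ws) n [a])}"
 have "pure_morphic (morphism_of ws) ?R a (limit_word (morphism_of ws) a)"
  by (rule pure_morphic_limit_word[where R = "{..<length ws}"]) (use ws in auto)
 moreover have "morphism_of ws b = lookup [] ws b" if b: "b : ?R" for b
 proof -
  obtain n where n: "b : set (it (morphism_of ws) n [a])" using b by blast
  have "set (it (morphism_of ws) n [a]) <= {..<length ws}" by (rule it_closed) (use ws in auto)
  hence "b < length ws" using n by auto
  thus ?thesis by (simp add: morphism_of_def lookup_def)
 qed
 ultimately have "pure_morphic (lookup [] ws) ?R a (limit_word (morphism_of ws) a)" by (rule pure_morphic_cong)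
 thus ?thesis by (auto simp: PMClass_word_def)
qed

lemma enc_instance: "enc p = encode_instance p"
proof -
 have "map enc w = w" for w :: "nat list" by (induction w) simp_all
 hence "(enc :: nat list => nat) = list_encode" by (simp add: fun_eq_iff enc_list_def)
 hence "enc ws = list_encode (map list_encode ws)" for ws :: "nat list list" by (simp add: enc_list_def)
 thus ?thesis by (cases p) (simp add: encode_instance_def)
qed

lemma cert_sound:
 assumes "pure_morphic f R a x" "cert (encode_growth c) f a"
 shows "has_growth x c"
proof -
 interpret pure_morphic f R a x by fact
 show ?thesis
  by (cases c; insert assms(2); simp add: cert_def del: length_append; (elim exE conjE)?;
   (rule const_cert_sound quad_cert_sound linear_sound loglog_sound log_sound, (assumption | erule (1) bspec)+)[1])
qed

lemma some_cert_nat: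
 assumes "pure_morphic f R a x"
 shows "EX ka c. 1 <= ka & cert (encode_growth c) (mpow f ka) a"
proof -
 interpret pure_morphic f R a x by fact
 show ?thesis
  using some_cert
 proof (elim disjE exE conjE)
  fix ka n p v k l assume ka: "1 <= ka" and "const_cert (mpow f ka) a n p v k l"
  hence "cert (encode_growth Const) (mpow f ka) a" by (simp add: cert_def del: length_append) blast
  with ka show ?thesis by blast
 next
  fix ka :: nat assume ka: "1 <= ka" and "quad_cert (mpow f ka) a"
  hence "cert (encode_growth Quadratic) (mpow f ka) a" by (simp add: cert_def)
  with ka show ?thesis by blast
 next
  fix ka Gs Bs S n assume ka: "1 <= ka" and "nq_cert (mpow f ka) a Gs Bs" "gap_cert (mpow f ka) (set Gs) (set S) n"
  hence "cert (encode_growth Linear_log) (mpow f ka) a" by (simp add: cert_def del: length_append) blast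
  with ka show ?thesis by blast
 next
  fix ka Gs Bs rk X assume ka: "1 <= ka" and nq: "nq_cert (mpow f ka) a Gs Bs" and X: "rank_cert (mpow f ka) (set Gs) rk X" and r: "EX c:set Gs. 0 < rk c"
  obtain rs xs where rs: "rank_cert (mpow f ka) (set Gs) (lookup 0 rs) (%d e. lookup2 xs (d, e))" "ALL c:set Gs. lookup 0 rs c = rk c"
   using rank_cert_lists[OF X] by blast
  have "EX c:set Gs. 0 < lookup 0 rs c" using r rs(2) by simp
  with nq rs(1) have "cert (encode_growth Linear_loglog) (mpow f ka) a" by (simp add: cert_def del: length_append) blast
  with ka show ?thesis by blast
 next
  fix ka Gs Bs rk X n i j assume ka: "1 <= ka" and nq: "nq_cert (mpow f ka) a Gs Bs" and X: "rank_cert (mpow f ka) (set Gs) rk X"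
   and r: "ALL c:set Gs. rk c = 0" "mismatch (mpow f ka) a (length (Gs @ Bs)) (set Gs) n i j"
  obtain rs xs where rs: "rank_cert (mpow f ka) (set Gs) (lookup 0 rs) (%d e. lookup2 xs (d, e))" "ALL c:set Gs. lookup 0 rs c = rk c"
   using rank_cert_lists[OF X] by blast
  have "ALL c:set Gs. lookup 0 rs c = 0" using r rs(2) by simp
  with nq rs(1) r(2) have "cert (encode_growth Linear) (mpow f ka) a" by (simp add: cert_def del: length_append) blast
  with ka show ?thesis by blast
 qed
qed

theorem theorem2p1:
  shows "\<exists>f :: recf. \<forall>p :: instance_data. PMClass_instance p \<longrightarrow>
    (\<exists>c :: growth. evaluates f [encode_instance p] (encode_growth c) \<and>
       (\<forall>c'. has_growth (PMClass_word p) c' \<longleftrightarrow> c' = c))"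
proof -
 \<comment> \<open>The exponent of a suitable power is not computed but searched for together with
   the certificate.\<close>
 define P :: "nat => instance_data => bool" where
  "P i p \<longleftrightarrow> (EX ka. 1 <= ka & cert i (mpow (lookup [] (fst p)) ka) (snd p))" for i p
 have semi: "semidec (P i)" for i
  unfolding P_def[abs_def] mpow_def
  by (intro semidec_intros semidec_cert; (rule semidec_decidable)?; intro comp_intros)
 obtain r where r: "!!p. (EX i<5. P i p) ==> EX i<5. P i p & evaluates r [enc p] i"
  using computable_select[of 5 P] semi by blast
 have "EX c. evaluates r [encode_instance p] (encode_growth c) & (ALL c'. has_growth (PMClass_word p) c' \<longleftrightarrow> c' = c)"
  if p: "PMClass_instance p" for p
 proof -
  obtain R where pm: "pure_morphic (lookup [] (fst p)) R (snd p) (PMClass_word p)"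
   using PMClass_instance_pure_morphic[of "fst p" "snd p"] p by auto
  have lt: "encode_growth c < 5" for c by (cases c) simp_all
  have "EX i<5. P i p" using some_cert_nat[OF pm] lt unfolding P_def by blast
  then obtain i where i: "i < 5" "P i p" "evaluates r [encode_instance p] i" using r enc_instance by metis
  have "i = 0 | i = 1 | i = 2 | i = 3 | i = 4" using i(1) by linarith
  then obtain c where c: "i = encode_growth c" by (metis encode_growth.simps)
  obtain ka where ka: "1 <= ka" "cert i (mpow (lookup [] (fst p)) ka) (snd p)" using i(2) unfolding P_def by blast
  \<comment> \<open>The search may stop at a power other than the one supplied by completeness;
    soundness holds for every power, since all of them have the same fixed point.\<close>
  have "has_growth (PMClass_word p) c"
   by (rule cert_sound[OF pure_morphic.pure_morphic_mpow[OF pm ka(1)]]) (use ka(2) c in simp)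
  hence "has_growth (PMClass_word p) c' \<longleftrightarrow> c' = c" for c' using has_growth_unique by blast
  with i(3) c show ?thesis by blast
 qed
 thus ?thesis by blast
qed

end
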